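(* Let $K$ be an imaginary quadratic number field with discriminant $D_K$, let $\alpha\in\,]0,\frac12[$, and let $\phi$ be a function from the positive integers to $]0,+\infty[$ with $\phi(N)\to+\infty$ as $N\to+\infty$. Assume that the limits $$\lambda_\phi=\lim_{N\to+\infty}\frac{\phi(N)}{N^{1-\alpha}},\quad \lambda'_\phi=\lim_{N\to+\infty}\frac{\phi(N)}{N^{1-\frac\alpha2}},\quad \lambda''_\phi=\lim_{N\to+\infty}\frac{\phi(N)}{N},\quad \lambda'''_\phi=\lim_{N\to+\infty}\frac{\phi(N)}{N^{1+\frac\alpha2}}$$ exist in $[0,+\infty]$, and let $\gamma\in\,]0,\frac{1-2\alpha}{2}[$ be such that $\lim_{N\to+\infty}\frac{\phi(N)}{N^{2-2\alpha-2\gamma}}=0$ (such a $\gamma$ is assumed to exist). Let $$\mathcal R_N=\frac1{\psi(N)}\sum_{a,b\in\mathbb N:\ a\ne b,\ 0<a,b\le N^2} r_{K,\alpha}(a,b,N)\,\Delta_{\phi(N)(\ln a-\ln b)},$$ where $\psi$ is specified in each case below. Then for every $A\ge1$ and every $C^1$ function $f$ on $\mathbb R$ with compact support contained in $[-A,A]$, as $N\to+\infty$, $$\mathcal R_N(f)=\int_{\mathbb R} f(t)\,dm_\phi(t)+E_N,$$ where: (1) if $\lambda_\phi=0$ and $\psi(N)=N^2S_{N,1}$, then $$E_N=O\Big(\Big(\tfrac{\phi(N)}{N^{1-\alpha}}\Big)^{\frac12}\|f'\|_\infty\Big)+O\Big(\max\Big\{\tfrac{\phi(N)}{N^{1-\alpha}},\tfrac1{N^{2\gamma}}\Big\}\|f\|_\infty\Big);$$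 (2) if $\lambda_\phi\in\,]0,+\infty[$, $D_K\equiv0\bmod 4$ and $\psi(N)=\frac{N^{3+\alpha}}{\phi(N)}$, then $$E_N=O\big(N^{-\alpha}\|f'\|_\infty\big)+O\Big(\max\Big\{\tfrac{A}{N^{\alpha/4}},\tfrac1{N^{2\gamma}}\Big\}\|f\|_\infty\Big)+O\Big(A\,\Big|\tfrac{N^{1-\alpha}}{\phi(N)}-\tfrac1{\lambda_\phi}\Big|^{\frac12}\Big|\ln\Big|\tfrac{N^{1-\alpha}}{\phi(N)}-\tfrac1{\lambda_\phi}\Big|\Big|\,\|f\|_\infty\Big);$$ (3) if $\lambda_\phi=+\infty$, $\lambda'_\phi<+\infty$, $\alpha<\frac25$ and $\psi(N)=\frac{N^3S_{N,0}}{\phi(N)}$, then $$E_N=O\big(N^{\frac{5\alpha-2}{4}}\|f'\|_\infty\big)+O\Big(\max\Big\{A^3\Big(\tfrac{N^{1-\alpha}}{\phi(N)}\Big)^{\frac23},N^{\frac{5\alpha-2}{4}}\Big\}\|f\|_\infty\Big);$$ (4) if $\lambda'_\phi=+\infty$, $\lambda''_\phi=0$, $\alpha\le\frac2{11}$ and $\psi(N)=\frac{N^3S_{N,0}}{\phi(N)}$, then $$E_N=O\Big(\tfrac{\phi(N)}{N^{1+\frac\alpha2}}\|f'\|_\infty+\tfrac{N^{1-\frac\alpha2}}{\phi(N)}\|f\|_\infty\Big);$$ (5) if $\lambda''_\phi>0$, $\lambda'''_\phi=0$, $\alpha\le\frac2{11}$ and $\psi(N)=\frac{N^3S_{N,0}}{\phi(N)}$,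 then $$E_N=O\Big(\tfrac{\phi(N)}{N^{1+\frac\alpha2}}\big(\|f'\|_\infty+A^3\|f\|_\infty\big)\Big).$$
   Context: $\mathcal O_K$ is the ring of integers of $K\subset\mathbb C$; $\mathtt n(z)=z\overline z$ and $\mathtt{tr}(z)=z+\overline z$ are the norm and trace. For nonzero $a,b,N\in\mathbb N$, $$r_{K,\alpha}(a,b,N)=\mathrm{Card}\{(w,z)\in\mathcal O_K\times\mathcal O_K:\ \mathtt n(w)=a,\ \mathtt n(z)=b,\ \mathtt n(z-w)\le N^{2\alpha}\}.$$ $\Delta_x$ is the unit Dirac mass at $x$, $\mathrm{Leb}_{\mathbb R}$ is Lebesgue measure, and $\mathcal R_N(f)=\int f\,d\mathcal R_N$. $]x,y[$ denotes an open interval. The $\mathbb Z$-basis $(1,\omega_K)$ of $\mathcal O_K$: $\omega_K=\frac{i\sqrt{|D_K|}}2$ if $D_K\equiv0\bmod4$ and $\omega_K=\frac{1+i\sqrt{|D_K|}}2$ otherwise. For $p=x_p+\omega_K y_p\in\mathcal O_K\setminus\{0\}$ with $x_p,y_p\in\mathbb Z$, set $x'_p=2x_p+y_p\,\mathtt{tr}(\omega_K)$ and $y'_p=x_p\,\mathtt{tr}(\omega_K)+2\,\mathtt n(\omega_K)\,y_p$ (integers, not both zero), $c'_p=\gcd(x'_p,y'_p)>0$, and $v_p=\frac1{c'_p}(y'_p-\omega_Kx'_p)\in\mathcal O_K\setminus\{0\}$. For $k\in\mathbb N$ (including $0$) and $N\ge1$, $$S_{N,k}=\frac{|D_K|\,(k+1)}{4\pi}\sum_{p\in\mathcal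 O_K:\ 0<|p|\le N^\alpha}\frac{|p|^k}{c'_p\,|v_p|}.$$ The limit measure $m_\phi$ is: $\frac{4\pi^2}{|D_K|}\Delta_0$ if $\lambda_\phi=0$; $\rho_{1-\alpha}\,\mathrm{Leb}_{\mathbb R}$ if $\lambda_\phi\in\,]0,+\infty[$; $\frac{8\pi}{3|D_K|}\mathrm{Leb}_{\mathbb R}$ if $\lambda_\phi=+\infty$. Here, when $\lambda_\phi\in\,]0,+\infty[$, $\rho_{1-\alpha}:\mathbb R\to[0,+\infty[$ is the even function with $$\rho_{1-\alpha}(t)=\begin{cases}\dfrac{8\pi}{3|D_K|}&\text{if }t=0,\\[2mm] \dfrac{8\pi\lambda_\phi^3}{|D_K|t^3}\Big(\arcsin\big(\tfrac t{2\lambda_\phi}\big)-\tfrac t{2\lambda_\phi}\big(1-\tfrac{t^2}{2\lambda_\phi^2}\big)\big(1-\tfrac{t^2}{4\lambda_\phi^2}\big)^{1/2}\Big)&\text{if }0<t\le2\lambda_\phi,\\[2mm] \dfrac{4\pi^2\lambda_\phi^3}{|D_K|t^3}&\text{if }t>2\lambda_\phi.\end{cases}$$ Conventions: $\|\cdot\|_\infty$ is the supremum norm. The implicit constants in the $O(\cdot)$ depend only on $K,\alpha,\phi,\gamma$ and not on $A$ or $f$; the estimates hold for all $N$ large enough, where the threshold may depend on $A$ and $f$. The expression $x^{1/2}|\ln x|$ is taken to be $0$ when $x=0$. *)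

theory Defs
  imports "HOL-Probability.Probability" "HOL-Computational_Algebra.Polynomial"
begin

definition imaginary_quadratic_field :: "complex set \<Rightarrow> bool" where
  "imaginary_quadratic_field K \<longleftrightarrow>
     1 \<in> K \<and> (\<forall>x\<in>K. \<forall>y\<in>K. x - y \<in> K \<and> x * y \<in> K) \<and> (\<forall>x\<in>K. inverse x \<in> K) \<and>
     vector_space.dim (\<lambda>(q::rat) (z::complex). of_rat q * z) K = 2 \<and> \<not> K \<subseteq> \<real>"

definition ring_of_integers :: "complex set \<Rightarrow> complex set" where
  "ring_of_integers K = {z \<in> K. algebraic_int z}"

definition integral_basis :: "complex set \<Rightarrow> complex \<Rightarrow> complex \<Rightarrow> bool" where
  "integral_basis K b1 b2 \<longleftrightarrow>
     b1 \<in> ring_of_integers K \<and> b2 \<in> ring_of_integers K \<and>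
     (\<forall>z\<in>ring_of_integers K. \<exists>!xy::int \<times> int. z = of_int (fst xy) * b1 + of_int (snd xy) * b2)"

(* The two embeddings of an imaginary quadratic K are the inclusion and complex conjugation;
   the discriminant is the squared determinant of the embeddings on an integral basis. *)
definition disc :: "complex set \<Rightarrow> int" where
  "disc K = (THE d. \<exists>b1 b2. integral_basis K b1 b2 \<and> of_int d = (b1 * cnj b2 - b2 * cnj b1)\<^sup>2)"

definition qnorm :: "complex \<Rightarrow> real" where
  "qnorm z = Re (z * cnj z)"

definition qtrace :: "complex \<Rightarrow> real" where
  "qtrace z = Re (z + cnj z)"

definition r_count :: "complex set \<Rightarrow> real \<Rightarrow> nat \<Rightarrow> nat \<Rightarrow> nat \<Rightarrow> nat" where
  "r_count K \<alpha> a b N =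
     card {(w, z). w \<in> ring_of_integers K \<and> z \<in> ring_of_integers K \<and>
                   qnorm w = real a \<and> qnorm z = real b \<and> qnorm (z - w) \<le> real N powr (2 * \<alpha>)}"

definition omega :: "complex set \<Rightarrow> complex" where
  "omega K = (if disc K mod 4 = 0
              then \<i> * of_real (sqrt \<bar>real_of_int (disc K)\<bar>) / 2
              else (1 + \<i> * of_real (sqrt \<bar>real_of_int (disc K)\<bar>)) / 2)"

definition coords :: "complex set \<Rightarrow> complex \<Rightarrow> int \<times> int" where
  "coords K p = (THE xy. p = of_int (fst xy) + omega K * of_int (snd xy))"

(* The trace and norm of omega K are integers; the floors below only convert their type. *)
definition x_coeff :: "complex set \<Rightarrow> complex \<Rightarrow> int" where
  "x_coeff K p = (case coords K p of (x, y) \<Rightarrow> 2 * x + y * \<lfloor>qtrace (omega K)\<rfloor>)"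

definition y_coeff :: "complex set \<Rightarrow> complex \<Rightarrow> int" where
  "y_coeff K p = (case coords K p of (x, y) \<Rightarrow>
     x * \<lfloor>qtrace (omega K)\<rfloor> + 2 * \<lfloor>qnorm (omega K)\<rfloor> * y)"

definition c_gcd :: "complex set \<Rightarrow> complex \<Rightarrow> int" where
  "c_gcd K p = gcd (x_coeff K p) (y_coeff K p)"

definition v_vec :: "complex set \<Rightarrow> complex \<Rightarrow> complex" where
  "v_vec K p = (of_int (y_coeff K p) - omega K * of_int (x_coeff K p)) / of_int (c_gcd K p)"

definition S_sum :: "complex set \<Rightarrow> real \<Rightarrow> nat \<Rightarrow> nat \<Rightarrow> real" where
  "S_sum K \<alpha> k N = \<bar>real_of_int (disc K)\<bar> * real (k + 1) / (4 * pi) *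
     (\<Sum>p | p \<in> ring_of_integers K \<and> 0 < cmod p \<and> cmod p \<le> real N powr \<alpha>.
        cmod p ^ k / (real_of_int (c_gcd K p) * cmod (v_vec K p)))"

definition index_pairs :: "nat \<Rightarrow> (nat \<times> nat) set" where
  "index_pairs N = {(a, b). a \<noteq> b \<and> 0 < a \<and> a \<le> N\<^sup>2 \<and> 0 < b \<and> b \<le> N\<^sup>2}"

(* The finite sum of Dirac masses with weights r_count / \<psi> is encoded as the image of the
   corresponding point measure on the index set; see integral_R_meas. *)
definition R_meas ::
  "complex set \<Rightarrow> real \<Rightarrow> (nat \<Rightarrow> real) \<Rightarrow> (nat \<Rightarrow> real) \<Rightarrow> nat \<Rightarrow> real measure" where
  "R_meas K \<alpha> \<phi> \<psi> N =
     distr (point_measure (index_pairs N) (\<lambda>(a, b). ennreal (real (r_count K \<alpha> a b N) / \<psi> N)))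
       borel (\<lambda>(a, b). \<phi> N * (ln (real a) - ln (real b)))"

lemma integral_R_meas:
  fixes f :: "real \<Rightarrow> real"
  assumes "f \<in> borel_measurable borel" "0 \<le> \<psi> N"
  shows "(\<integral>t. f t \<partial>R_meas K \<alpha> \<phi> \<psi> N) =
    1 / \<psi> N * (\<Sum>(a, b)\<in>index_pairs N. real (r_count K \<alpha> a b N) * f (\<phi> N * (ln (real a) - ln (real b))))"
proof -
  let ?h = "\<lambda>(a, b). \<phi> N * (ln (real a) - ln (real b))"
  let ?w = "\<lambda>(a, b). real (r_count K \<alpha> a b N) / \<psi> N"
  have fin: "finite (index_pairs N)"
    by (rule finite_subset[of _ "{..N\<^sup>2} \<times> {..N\<^sup>2}"]) (auto simp: index_pairs_def)
  have weight: "(\<lambda>(a, b). ennreal (real (r_count K \<alpha> a b N) / \<psi> N)) = (\<lambda>p. ennreal (?w p))"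
    by auto
  have "(\<integral>t. f t \<partial>R_meas K \<alpha> \<phi> \<psi> N) =
      (\<integral>p. f (?h p) \<partial>point_measure (index_pairs N) (\<lambda>p. ennreal (?w p)))"
    unfolding R_meas_def weight by (subst integral_distr) (auto simp: assms)
  also have "\<dots> = (\<Sum>p\<in>index_pairs N. ?w p * f (?h p))"
    using assms(2) by (subst lebesgue_integral_point_measure_finite[OF fin]) auto
  also have "\<dots> = 1 / \<psi> N * (\<Sum>(a, b)\<in>index_pairs N. real (r_count K \<alpha> a b N) * f (?h (a, b)))"
    by (simp add: sum_distrib_left case_prod_unfold)
  finally show ?thesis by simp
qed

(* The limit density, extended evenly to the negative half-line. *)
definition rho :: "complex set \<Rightarrow> real \<Rightarrow> real \<Rightarrow> real" where
  "rho K lam t =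
     (let s = \<bar>t\<bar>; D = \<bar>real_of_int (disc K)\<bar> in
      if s = 0 then 8 * pi / (3 * D)
      else if s \<le> 2 * lam then
        8 * pi * lam ^ 3 / (D * s ^ 3) *
          (arcsin (s / (2 * lam)) -
           s / (2 * lam) * (1 - s\<^sup>2 / (2 * lam\<^sup>2)) * sqrt (1 - s\<^sup>2 / (4 * lam\<^sup>2)))
      else 4 * pi\<^sup>2 * lam ^ 3 / (D * s ^ 3))"

definition limit_measure :: "complex set \<Rightarrow> ereal \<Rightarrow> real measure" where
  "limit_measure K lam =
     (if lam = 0 then
        scale_measure (ennreal (4 * pi\<^sup>2 / \<bar>real_of_int (disc K)\<bar>)) (return borel 0)
      else if lam = \<infinity> then
        scale_measure (ennreal (8 * pi / (3 * \<bar>real_of_int (disc K)\<bar>))) lborel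
      else density lborel (\<lambda>t. ennreal (rho K (real_of_ereal lam) t)))"

definition sup_norm :: "(real \<Rightarrow> real) \<Rightarrow> real" where
  "sup_norm g = (SUP t. \<bar>g t\<bar>)"

(* A sum of nonnegative O-terms is one O-term of their sum, so every error estimate has the form
   O(err N A \<parallel>f\<parallel> \<parallel>f'\<parallel>). The constant is chosen before A and f; the threshold for N after them. *)
definition converges_with_error ::
  "(nat \<Rightarrow> real measure) \<Rightarrow> real measure \<Rightarrow> (nat \<Rightarrow> real \<Rightarrow> real \<Rightarrow> real \<Rightarrow> real) \<Rightarrow> bool" where
  "converges_with_error R m err \<longleftrightarrow>
     (\<exists>C\<ge>0. \<forall>A\<ge>1. \<forall>f::real \<Rightarrow> real.
        f C1_differentiable_on UNIV \<longrightarrow> closure {t. f t \<noteq> 0} \<subseteq> {-A..A} \<longrightarrow>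
        (\<forall>\<^sub>F N in sequentially.
           \<bar>(\<integral>t. f t \<partial>R N) - (\<integral>t. f t \<partial>m)\<bar> \<le> C * err N A (sup_norm f) (sup_norm (deriv f))))"

end

theory Submission
  imports Defs "HOL-Real_Asymp.Real_Asymp"
begin

text \<open>
Write \<open>R = N\<^sup>\<alpha>\<close>, let \<open>\<omega> = omega K\<close> and regard \<open>\<O>\<^sub>K = \<int> + \<int> \<omega>\<close> as a lattice of covolume \<open>Im \<omega>\<close>, where \<open>|D\<^sub>K| = 4 (Im \<omega>)\<^sup>2\<close>.
The substitution \<open>p = w - z\<close> turns \<open>\<psi>(N) \<R>\<^sub>N(f)\<close> into a sum over the differences \<open>0 < |p| \<le> R\<close> of the inner sums
of \<open>f (\<phi> (ln |w|\<^sup>2 - ln |w - p|\<^sup>2))\<close> over lattice points \<open>w\<close> (\<open>sum_r_count_eq\<close>).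

For fixed \<open>p\<close> the logarithmic difference is \<open>2 Re (p / w)\<close> up to \<open>O(|p|\<^sup>2 / |w|\<^sup>2)\<close>, and the sum over \<open>w\<close> is close to an integral
over the disc of radius \<open>N\<close>.  Rotating and rescaling that disc, the inner sum is \<open>(N\<^sup>2 / Im \<omega>) G(2 \<phi> |p| / N)\<close> up to
a small error, with \<open>G(X)\<close> the integral of \<open>f (X Re (1/z))\<close> over the unit disc (\<open>disc_avg\<close>, \<open>sum_shifts_compare\<close>).
Everything thus depends on the size of \<open>X = 2 \<phi> |p| / N\<close>, which is at most \<open>2 \<phi> / N\<^bsup>1-\<alpha>\<^esup>\<close>:

  \<^item> If \<open>\<lambda>\<^sub>\<phi> = 0\<close>, then \<open>X\<close> tends to \<open>0\<close> and \<open>G(X)\<close> to \<open>G(0) = \<pi> f(0)\<close>, because \<open>G\<close> is Lipschitz.  This gives the point mass.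
  \<^item> If \<open>\<lambda>\<^sub>\<phi> = \<infinity>\<close>, the explicit density \<open>k\<close> of \<open>Re (1/z)\<close> on the unit disc (\<open>disc_kernel\<close>) gives
    \<open>G(X) = X\<^sup>-\<^sup>1 \<integral> f(t) k(t/X) dt\<close>, and \<open>k(0) = 2/3\<close> yields \<open>G(X) = (2/(3X)) \<integral> f + O(X\<^bsup>-7/4\<^esup>)\<close>.  The main terms sum to
    \<open>\<Sum> 1/|p|\<close>, which is what \<open>S\<^bsub>N,0\<^esub>\<close> normalizes.  This gives a multiple of Lebesgue measure.
  \<^item> If \<open>\<lambda>\<^sub>\<phi>\<close> is positive and finite, the sum over \<open>p\<close> is a Riemann sum for the integral of \<open>G(2 \<lambda>\<^sub>\<phi> |q|)\<close> over \<open>|q| \<le> 1\<close>.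
    In polar coordinates the density of that integral against \<open>f\<close> is a radial average of \<open>k\<close>, and this is \<open>\<rho>\<^bsub>1-\<alpha>\<^esub>\<close>.

The sums \<open>S\<^bsub>N,k\<^esub>\<close> are power sums in disguise, since \<open>c'\<^sub>p |v\<^sub>p| = 2 Im \<omega> |p|\<close> (\<open>c_gcd_times_v_vec\<close>).

The resulting errors \<open>C\<^sub>f e(N)\<close> have a constant depending on \<open>f\<close>, but the functions \<open>e(N)\<close> are of smaller order than the
rates of the theorem.  As the threshold for \<open>N\<close> may depend on \<open>f\<close> while \<open>\<parallel>f\<parallel>\<close> and \<open>\<parallel>f'\<parallel>\<close> are positive for
\<open>f \<noteq> 0\<close>, the constant \<open>C\<^sub>f\<close> is absorbed (\<open>converges_with_error_if_little_o\<close>); what remains is to compare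
powers of \<open>N\<close> and \<open>\<phi>(N)\<close> in each of the five regimes.
\<close>

section \<open>The ring of integers as a lattice\<close>

lemma poly_of_int_add:
  "poly (map_poly of_int (p + q)) (z::complex) = poly (map_poly of_int p) z + poly (map_poly of_int q) z"
proof -
  have "map_poly of_int (p + q) = (map_poly of_int p + map_poly of_int q :: complex poly)"
    by (rule poly_eqI) (simp add: coeff_map_poly)
  then show ?thesis by simp
qed

lemma poly_of_int_smult:
  "poly (map_poly of_int (smult c p)) (z::complex) = of_int c * poly (map_poly of_int p) z"
  by (induction p) (simp_all add: map_poly_pCons algebra_simps)

lemma poly_of_int_mult:
  "poly (map_poly of_int (p * q)) (z::complex) = poly (map_poly of_int p) z * poly (map_poly of_int q) z"
  by (induction p) (simp_all add: map_poly_pCons poly_of_int_add poly_of_int_smult algebra_simps)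

lemma complex_of_rat_eq: "(of_rat r :: complex) = of_real (of_rat r)"
  by (cases r) (simp add: of_rat_rat)

text \<open>
  The elements \<open>1\<close> and \<open>z\<close> are independent over the rationals because \<open>z\<close> is not real; a third independent element would
  contradict dimension two.
\<close>
lemma rational_quadratic_field_basis:
  assumes K: "imaginary_quadratic_field K" and z: "z \<in> K" "Im z \<noteq> 0" and w: "w \<in> K"
  obtains r s :: rat where "w = of_rat r + of_rat s * z"
proof -
  interpret Q: vector_space "\<lambda>(q::rat) (z::complex). of_rat q * z"
    by unfold_locales (auto simp: algebra_simps of_rat_add of_rat_mult)
  have one: "1 \<in> K" and dim: "Q.dim K = 2"
    using K by (auto simp: imaginary_quadratic_field_def)
  obtain B where B: "Q.independent B" "K \<subseteq> Q.span B" "card B = Q.dim K"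
    using Q.basis_exists by blast
  have finB: "finite B"
    using B(3) dim by (metis card.infinite zero_neq_numeral)
  have span1: "Q.span {1} = range of_rat"
    unfolding Q.span_singleton by auto
  have z_notin: "z \<notin> Q.span {1}"
    unfolding span1 using z(2) by (auto simp: complex_of_rat_eq)
  show thesis
  proof (cases "w \<in> Q.span {z, 1}")
    case True
    then obtain k where "w - of_rat k * z \<in> Q.span {1}"
      unfolding Q.span_insert[of z] by blast
    then obtain r where "w - of_rat k * z = of_rat r"
      unfolding span1 by blast
    then show thesis
      by (intro that[of r k]) (simp add: algebra_simps)
  next
    case False
    have "Q.independent {1}"
      by simp
    with z_notin have ind2: "Q.independent {z, 1}"
      unfolding Q.independent_insert[of z] by (auto dest: Q.span_base)
    with False have ind3: "Q.independent {w, z, 1}"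
      unfolding Q.independent_insert[of w] by auto
    have "card {w, z, 1} = 3"
      using False z_notin Q.span_base[of _ "{z, 1}"] Q.span_base[of _ "{1}"]
      by (auto simp: card_insert_if)
    moreover have "card {w, z, 1} \<le> card B"
      using Q.independent_span_bound[OF finB ind3] B(2) z(1) w one by auto
    ultimately show thesis
      using B(3) dim by simp
  qed
qed

text \<open>
  This is Gauss's lemma for quadratics.  The primitive integer polynomial \<open>q\<close> of degree two vanishing at \<open>z\<close> divides
  a monic integer polynomial up to a nonzero integer factor; comparing contents removes the factor, so the leading coefficient
  of \<open>q\<close> is a unit, and its other coefficients are the trace and the norm up to sign.
\<close>
lemma quadratic_algebraic_int_trace_norm:
  fixes z :: complex and r s :: rat
  assumes alg: "algebraic_int z" and im: "Im z \<noteq> 0" and rs: "z\<^sup>2 = of_rat r + of_rat s * z"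
  obtains a b :: int where "2 * Re z = of_int a" "(cmod z)\<^sup>2 = of_int b"
proof -
  obtain P :: "int poly" where P: "poly (map_poly of_int P) z = 0" "lead_coeff P = 1"
    using alg unfolding algebraic_int_altdef_ipoly by blast
  obtain r1 r2 where r: "r2 > 0" "r = of_int r1 / of_int r2"
    using quotient_of_div quotient_of_denom_pos by (metis surj_pair)
  obtain s1 s2 where s: "s2 > 0" "s = of_int s1 / of_int s2"
    using quotient_of_div quotient_of_denom_pos by (metis surj_pair)
  define Q where "Q = [: -r1 * s2, -s1 * r2, s2 * r2 :]"
  have Q0: "Q \<noteq> 0" using r s by (simp add: Q_def)
  have rr: "(of_rat r :: complex) * of_int r2 = of_int r1" and ss: "(of_rat s :: complex) * of_int s2 = of_int s1"
    using r s by (simp_all add: of_rat_divide)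
  have "poly (map_poly of_int Q) z = of_int s2 * of_int r2 * z\<^sup>2 - of_int s1 * of_int r2 * z - of_int r1 * of_int s2"
    by (simp add: Q_def map_poly_pCons algebra_simps power2_eq_square)
  also have "\<dots> = of_int s2 * of_int r2 * (z\<^sup>2 - (of_rat r + of_rat s * z))"
    unfolding rr[symmetric] ss[symmetric] by (simp add: algebra_simps)
  also have "\<dots> = 0" using rs by simp
  finally have Qz: "poly (map_poly of_int Q) z = 0" .
  define q where "q = primitive_part Q"
  have Qq: "Q = smult (content Q) q"
    by (simp add: q_def)
  have q0: "q \<noteq> 0" using Q0 by (simp add: q_def)
  have cq: "content q = 1" using Q0 by (simp add: q_def)
  have "degree Q = 2"
    using r s by (simp add: Q_def)
  then have degq: "degree q = 2"
    by (simp add: q_def)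
  have qz: "poly (map_poly of_int q) z = 0"
    using Qz Q0 poly_of_int_smult[of "content Q" q z] Qq by simp
  obtain a S where a: "a \<noteq> 0" "smult a P = q * S + pseudo_mod P q"
    using pseudo_mod(1)[OF q0, of P] by auto
  define T where "T = pseudo_mod P q"
  have degT: "T = 0 \<or> degree T < 2"
    using pseudo_mod(2)[OF q0, of P] degq by (auto simp: T_def)
  have Tz: "poly (map_poly of_int T) z = 0"
    using arg_cong[OF a(2), of "\<lambda>p. poly (map_poly of_int p) z"] P qz
    by (simp add: poly_of_int_add poly_of_int_mult poly_of_int_smult T_def)
  \<comment> \<open>A nonzero polynomial of degree at most one with integer coefficients has no nonreal root.\<close>
  have T0: "T = 0"
  proof -
    define u v where "u = coeff T 0" and "v = coeff T 1"
    have T: "T = [:u, v:]"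
      using degT by (auto simp: u_def v_def poly_eq_iff coeff_pCons coeff_eq_0 split: nat.splits)
    from Tz have "of_int u + of_int v * z = 0"
      by (simp add: T map_poly_pCons algebra_simps)
    then have "of_int v * Im z = 0" "of_int u + of_int v * Re z = 0"
      by (simp_all add: complex_eq_iff)
    with im show ?thesis by (simp add: T)
  qed
  have qS: "smult a P = q * S"
    using a(2) T0 by (simp add: T_def)
  have "content P = 1"
    using P(2) content_dvd_coeff[of P "degree P"] by (metis is_unit_content_iff)
  then have "content S = \<bar>a\<bar>"
    using arg_cong[OF qS, of content] cq by (simp add: content_mult)
  then obtain S' where S': "S = smult a S'"
    using const_poly_dvd_iff_dvd_content[of a S] by (auto elim: dvdE)
  with qS a(1) have "P = q * S'"
    by (simp add: poly_eq_iff)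
  then have "lead_coeff q * lead_coeff S' = 1"
    using P(2) by (simp add: lead_coeff_mult)
  then have lq: "lead_coeff q = 1 \<or> lead_coeff q = -1"
    using zmult_eq_1_iff by blast
  define e where "e = coeff q 2"
  have e: "e = 1 \<or> e = -1" "e * e = 1"
    using lq degq by (auto simp: e_def)
  have "q = [:coeff q 0, coeff q 1, e:]"
    using degq by (auto simp: poly_eq_iff coeff_pCons coeff_eq_0 e_def numeral_2_eq_2 split: nat.splits)
  then have "poly (map_poly of_int [:coeff q 0, coeff q 1, e:]) z = 0"
    using qz by simp
  then have "of_int (coeff q 0) + of_int (coeff q 1) * z + of_int e * z\<^sup>2 = 0"
    by (simp add: map_poly_pCons algebra_simps power2_eq_square)
  then have im0: "of_int (coeff q 1) * Im z + of_int e * (2 * Re z * Im z) = 0"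
    and re0: "of_int (coeff q 0) + of_int (coeff q 1) * Re z + of_int e * ((Re z)\<^sup>2 - (Im z)\<^sup>2) = 0"
    by (simp_all add: complex_eq_iff power2_eq_square algebra_simps)
  from im0 have "Im z * (of_int (coeff q 1) + of_int e * (2 * Re z)) = 0"
    by (simp add: distrib_left mult_ac)
  with im have "of_int (coeff q 1) + of_int e * (2 * Re z) = 0"
    by (simp only: mult_eq_0_iff) simp
  then have tr: "of_int (coeff q 1) = - of_int e * (2 * Re z)"
    by linarith
  have "2 * Re z = of_int (- e * coeff q 1)"
    using tr e by auto
  moreover have "(cmod z)\<^sup>2 = of_int (e * coeff q 0)"
    using re0 e unfolding tr cmod_power2 by (auto simp: power2_eq_square algebra_simps)
  ultimately show thesis by (rule that)
qed

lemma four_Im_square: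
  fixes a b :: int
  assumes "2 * Re z = of_int a" "(cmod z)\<^sup>2 = of_int b"
  shows "4 * (Im z)\<^sup>2 = of_int (4 * b - a\<^sup>2)"
proof -
  have "of_int (4 * b - a\<^sup>2) = 4 * (cmod z)\<^sup>2 - (2 * Re z)\<^sup>2"
    by (simp add: assms)
  then show ?thesis
    unfolding cmod_power2 by (simp add: power_mult_distrib)
qed

context
  fixes K :: "complex set"
  assumes K: "imaginary_quadratic_field K"
begin

lemma field_diff: "x \<in> K \<Longrightarrow> y \<in> K \<Longrightarrow> x - y \<in> K"
  and field_mult: "x \<in> K \<Longrightarrow> y \<in> K \<Longrightarrow> x * y \<in> K"
  and field_one: "1 \<in> K"
  using K by (auto simp: imaginary_quadratic_field_def)

lemma field_zero: "0 \<in> K"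
  using field_diff[OF field_one field_one] by simp

lemma field_add: "x \<in> K \<Longrightarrow> y \<in> K \<Longrightarrow> x + y \<in> K"
  using field_diff[of x "0 - y"] field_diff[OF field_zero, of y] by simp

lemma field_of_nat: "of_nat n \<in> K"
  by (induction n) (auto intro: field_zero field_one field_add)

lemma field_of_int: "of_int n \<in> K"
  using field_of_nat field_diff[OF field_zero field_of_nat] by (cases n) (auto simp del: of_nat_Suc)

lemma field_real_imp_rat:
  assumes "z \<in> K" "Im z = 0"
  shows "z \<in> \<rat>"
proof -
  obtain z0 where z0: "z0 \<in> K" "Im z0 \<noteq> 0"
    using K complex_is_Real_iff by (auto simp: imaginary_quadratic_field_def)
  obtain r s where z: "z = of_rat r + of_rat s * z0"
    using rational_quadratic_field_basis[OF K z0 assms(1)] .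
  have "s = 0"
    using assms(2) z0(2) arg_cong[OF z, of Im] by (simp add: complex_of_rat_eq)
  then show ?thesis using z by simp
qed

text \<open>
  Integrality in terms of trace and norm; this is the form in which closure properties are proved.
\<close>
lemma ring_of_integers_iff:
  "z \<in> ring_of_integers K \<longleftrightarrow>
     z \<in> K \<and> (\<exists>a b::int. 2 * Re z = of_int a \<and> (cmod z)\<^sup>2 = of_int b)"
proof
  assume z: "z \<in> ring_of_integers K"
  then have zK: "z \<in> K" and alg: "algebraic_int z"
    by (auto simp: ring_of_integers_def)
  show "z \<in> K \<and> (\<exists>a b::int. 2 * Re z = of_int a \<and> (cmod z)\<^sup>2 = of_int b)"
  proof (cases "Im z = 0")
    case True
    then obtain m where m: "z = of_int m"
      using rational_algebraic_int_is_int[OF alg field_real_imp_rat[OF zK]] by (auto elim: Ints_cases)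
    have "2 * Re z = of_int (2 * m)" "(cmod z)\<^sup>2 = of_int (m * m)"
      by (simp_all add: m power2_eq_square flip: of_int_mult)
    then show ?thesis using zK by blast
  next
    case False
    obtain r s where "z * z = of_rat r + of_rat s * z"
      using rational_quadratic_field_basis[OF K zK False field_mult[OF zK zK]] .
    then show ?thesis
      using quadratic_algebraic_int_trace_norm[OF alg False] zK
      by (metis power2_eq_square)
  qed
next
  assume *: "z \<in> K \<and> (\<exists>a b::int. 2 * Re z = of_int a \<and> (cmod z)\<^sup>2 = of_int b)"
  then obtain a b :: int where ab: "2 * Re z = of_int a" "(cmod z)\<^sup>2 = of_int b" by blast
  have ab': "of_int a = z + cnj z" "of_int b = z * cnj z"
    using ab by (simp_all add: complex_add_cnj flip: complex_norm_square)
  have "algebraic_int z"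
    unfolding algebraic_int_altdef_ipoly
    by (rule exI[of _ "[:b, -a, 1:]"])
       (simp add: map_poly_pCons ab' algebra_simps)
  then show "z \<in> ring_of_integers K"
    using * by (simp add: ring_of_integers_def)
qed

text \<open>
  Closure under subtraction is a parity argument.  With traces \<open>a\<close>, \<open>c\<close> and norms \<open>b\<close>, \<open>d\<close>, the rational number
  \<open>4 Im z Im w\<close> squares to the integer \<open>(4 b - a\<^sup>2) (4 d - c\<^sup>2)\<close>, hence is an integer \<open>n\<close> of the same parity as \<open>a c\<close>.  Therefore
  \<open>2 Re (z cnj w) = (a c + n) / 2\<close> is an integer, and so is the norm of \<open>z - w\<close>.
\<close>
lemma ring_of_integers_diff:
  assumes z: "z \<in> ring_of_integers K" and w: "w \<in> ring_of_integers K"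
  shows "z - w \<in> ring_of_integers K"
proof -
  obtain a b :: int where ab: "2 * Re z = of_int a" "(cmod z)\<^sup>2 = of_int b" and zK: "z \<in> K"
    using z by (auto simp: ring_of_integers_iff)
  obtain c d :: int where cd: "2 * Re w = of_int c" "(cmod w)\<^sup>2 = of_int d" and wK: "w \<in> K"
    using w by (auto simp: ring_of_integers_iff)
  have iz: "4 * (Im z)\<^sup>2 = of_int (4 * b - a\<^sup>2)"
    using four_Im_square[OF ab] .
  have iw: "4 * (Im w)\<^sup>2 = of_int (4 * d - c\<^sup>2)"
    using four_Im_square[OF cd] .
  define x where "x = 4 * (Im z * Im w)"
  have "x \<in> \<rat>"
  proof (cases "Im w = 0")
    case False
    obtain r s where zr: "z = of_rat r + of_rat s * w"
      using rational_quadratic_field_basis[OF K wK False zK] .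
    have "Im z = of_rat s * Im w"
      using arg_cong[OF zr, of Im] by (simp add: complex_of_rat_eq)
    then have "x = of_rat s * (4 * (Im w)\<^sup>2)"
      by (simp add: x_def power2_eq_square)
    then show ?thesis unfolding iw by simp
  qed (simp add: x_def)
  moreover have x2: "x\<^sup>2 = of_int ((4 * b - a\<^sup>2) * (4 * d - c\<^sup>2))"
    unfolding of_int_mult iz[symmetric] iw[symmetric] by (simp add: x_def power_mult_distrib)
  have "algebraic_int x"
    unfolding algebraic_int_altdef_ipoly
    using x2 by (intro exI[of _ "[: - ((4 * b - a\<^sup>2) * (4 * d - c\<^sup>2)), 0, 1:]"])
       (simp add: map_poly_pCons power2_eq_square)
  ultimately obtain n where n: "x = of_int n"
    using rational_algebraic_int_is_int by (auto elim: Ints_cases)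
  have "n\<^sup>2 = (4 * b - a\<^sup>2) * (4 * d - c\<^sup>2)"
    using x2 unfolding n by (metis of_int_eq_iff of_int_power)
  then have "even (n\<^sup>2) \<longleftrightarrow> even ((4 * b - a\<^sup>2) * (4 * d - c\<^sup>2))" by simp
  then have "even (a * c + n)"
    by auto
  then obtain k where k: "a * c + n = 2 * k" by (elim evenE)
  have "4 * (Re z * Re w) = of_int (a * c)"
    using ab cd by (simp flip: ab cd)
  then have "4 * (Re z * Re w + Im z * Im w) = of_int (2 * k)"
    using n unfolding x_def k[symmetric] by simp
  then have "2 * (Re z * Re w + Im z * Im w) = of_int k" by simp
  then have "(cmod (z - w))\<^sup>2 = of_int (b + d - k)"
    using ab(2) cd(2) unfolding cmod_power2 by (simp add: power2_eq_square algebra_simps)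
  moreover have "2 * Re (z - w) = of_int (a - c)"
    using ab cd by simp
  ultimately show ?thesis
    unfolding ring_of_integers_iff using field_diff[OF zK wK] by blast
qed

lemma ring_of_integers_of_int: "of_int n \<in> ring_of_integers K"
  by (auto simp: ring_of_integers_def field_of_int)

lemma ring_of_integers_add:
  assumes "z \<in> ring_of_integers K" "w \<in> ring_of_integers K"
  shows "z + w \<in> ring_of_integers K"
  using ring_of_integers_diff[OF assms(1) ring_of_integers_diff[OF ring_of_integers_of_int[of 0] assms(2)]]
  by simp

lemma ring_of_integers_times_int:
  assumes "z \<in> ring_of_integers K"
  shows "of_int n * z \<in> ring_of_integers K"
proof -
  have nat: "of_nat k * z \<in> ring_of_integers K" for k
    by (induction k) (use assms ring_of_integers_of_int[of 0] in \<open>auto simp: algebra_simps intro: ring_of_integers_add\<close>)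
  show ?thesis
  proof (cases "n \<ge> 0")
    case True
    then show ?thesis using nat[of "nat n"] by simp
  next
    case False
    then show ?thesis
      using ring_of_integers_diff[OF ring_of_integers_of_int[of 0] nat[of "nat (-n)"]] by simp
  qed
qed

text \<open>
  Clearing the denominators of trace and norm of a nonreal field element makes it integral.
\<close>
lemma ring_of_integers_not_real:
  obtains z where "z \<in> ring_of_integers K" "Im z > 0"
proof -
  obtain z0 where z0: "z0 \<in> K" "Im z0 \<noteq> 0"
    using K complex_is_Real_iff by (auto simp: imaginary_quadratic_field_def)
  obtain r s where z: "z0 * z0 = of_rat r + of_rat s * z0"
    using rational_quadratic_field_basis[OF K z0 field_mult[OF z0(1) z0(1)]] .
  have tr: "2 * Re z0 = of_rat s" and nm: "(cmod z0)\<^sup>2 = - of_rat r"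
  proof -
    have "2 * Re z0 * Im z0 = of_rat s * Im z0"
      using arg_cong[OF z, of Im] by (simp add: complex_of_rat_eq)
    with z0(2) show tr: "2 * Re z0 = of_rat s" by simp
    have "(Re z0)\<^sup>2 - (Im z0)\<^sup>2 = of_rat r + of_rat s * Re z0"
      using arg_cong[OF z, of Re] by (simp add: complex_of_rat_eq power2_eq_square)
    then show "(cmod z0)\<^sup>2 = - of_rat r"
      unfolding cmod_power2 by (simp add: power2_eq_square flip: tr)
  qed
  obtain r1 r2 where r: "r2 > 0" "r = of_int r1 / of_int r2"
    using quotient_of_div quotient_of_denom_pos by (metis surj_pair)
  obtain s1 s2 where s: "s2 > 0" "s = of_int s1 / of_int s2"
    using quotient_of_div quotient_of_denom_pos by (metis surj_pair)
  define y where "y = of_int (r2 * s2) * z0"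
  have "2 * Re y = of_int (r2 * s2) * of_rat s"
    by (simp add: y_def flip: tr)
  also have "\<dots> = of_int (r2 * s1)"
    using s by (simp add: of_rat_divide)
  finally have 1: "2 * Re y = of_int (r2 * s1)" .
  have "(cmod y)\<^sup>2 = (of_int (r2 * s2))\<^sup>2 * (cmod z0)\<^sup>2"
    by (simp add: y_def norm_mult power_mult_distrib)
  also have "\<dots> = of_int (- r1 * r2 * s2 * s2)"
    using r(1) unfolding nm r(2) by (simp add: of_rat_divide power2_eq_square)
  finally have 2: "(cmod y)\<^sup>2 = of_int (- r1 * r2 * s2 * s2)" .
  have "y \<in> K"
    unfolding y_def by (intro field_mult field_of_int z0)
  with 1 2 have y: "y \<in> ring_of_integers K"
    unfolding ring_of_integers_iff by blast
  have "Im y \<noteq> 0"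
    using r s z0(2) by (simp add: y_def)
  then show thesis
    using that[of y] that[of "0 - y"] y ring_of_integers_diff[OF ring_of_integers_of_int[of 0] y]
    by (cases "Im y > 0") auto
qed

text \<open>
  Four times the squared imaginary part of an integer of \<open>K\<close> is an integer, so there is a nonreal one with least positive imaginary part.
  Division with remainder by it leaves a real, hence rational, integer.  Subtracting a rational integer normalizes its real part.
\<close>
lemma ring_of_integers_lattice:
  obtains \<tau> where "\<tau> \<in> ring_of_integers K" "Im \<tau> > 0" "Re \<tau> = 0 \<or> Re \<tau> = 1 / 2"
    "\<And>z. z \<in> ring_of_integers K \<Longrightarrow> \<exists>m n::int. z = of_int m + of_int n * \<tau>"
proof -
  define P where "P z \<longleftrightarrow> z \<in> ring_of_integers K \<and> Im z > 0" for z
  have ex: "\<exists>z. P z"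
    using ring_of_integers_not_real by (auto simp: P_def)
  obtain \<sigma> where \<sigma>: "P \<sigma>" and min: "\<And>z. P z \<Longrightarrow> nat \<lfloor>4 * (Im \<sigma>)\<^sup>2\<rfloor> \<le> nat \<lfloor>4 * (Im z)\<^sup>2\<rfloor>"
    using ex_has_least_nat[of P _ "\<lambda>z. nat \<lfloor>4 * (Im z)\<^sup>2\<rfloor>"] ex by auto
  have int4: "\<exists>n::int. 4 * (Im z)\<^sup>2 = of_int n" if z: "z \<in> ring_of_integers K" for z
  proof -
    obtain a b :: int where ab: "2 * Re z = of_int a" "(cmod z)\<^sup>2 = of_int b"
      using iffD1[OF ring_of_integers_iff z] by blast
    have "4 * (Im z)\<^sup>2 = of_int (4 * b - a\<^sup>2)"
      using four_Im_square[OF ab] .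
    then show ?thesis ..
  qed
  have min': "Im \<sigma> \<le> Im z" if "P z" for z
  proof -
    obtain m n :: int where mn: "4 * (Im \<sigma>)\<^sup>2 = of_int m" "4 * (Im z)\<^sup>2 = of_int n"
      using int4[of \<sigma>] int4[of z] \<sigma> \<open>P z\<close> unfolding P_def by blast
    have "0 \<le> n"
      using mn(2) by (metis of_int_0_le_iff zero_le_mult_iff zero_le_numeral zero_le_power2)
    moreover have "nat m \<le> nat n"
      using min[OF that] unfolding mn by simp
    ultimately have "m \<le> n" by simp
    then have "(of_int m::real) \<le> of_int n" by simp
    then have "(Im \<sigma>)\<^sup>2 \<le> (Im z)\<^sup>2"
      unfolding mn[symmetric] by simp
    moreover have "0 \<le> Im z"
      using that by (simp add: P_def)
    ultimately show ?thesis
      by (rule power2_le_imp_le)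
  qed
  obtain a :: int where a: "2 * Re \<sigma> = of_int a"
    using \<sigma> by (auto simp: ring_of_integers_iff P_def)
  define \<tau> where "\<tau> = \<sigma> - of_int (a div 2)"
  have \<tau>: "\<tau> \<in> ring_of_integers K" "Im \<tau> = Im \<sigma>" "Im \<tau> > 0"
    using \<sigma> by (auto simp: \<tau>_def P_def intro: ring_of_integers_diff ring_of_integers_of_int)
  have "2 * Re \<tau> = of_int (a - 2 * (a div 2))"
    using a by (simp add: \<tau>_def)
  also have "a - 2 * (a div 2) = a mod 2"
    by (simp add: minus_mult_div_eq_mod)
  finally have re: "Re \<tau> = 0 \<or> Re \<tau> = 1 / 2"
    by (cases "even a") (auto simp: odd_iff_mod_2_eq_one)
  have "\<exists>m n::int. z = of_int m + of_int n * \<tau>" if z: "z \<in> ring_of_integers K" for z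
  proof -
    define n where "n = \<lfloor>Im z / Im \<tau>\<rfloor>"
    define w where "w = z - of_int n * \<tau>"
    have w: "w \<in> ring_of_integers K"
      unfolding w_def using z \<tau>(1) by (intro ring_of_integers_diff ring_of_integers_times_int)
    have "of_int n \<le> Im z / Im \<tau>" "Im z / Im \<tau> < of_int n + 1"
      by (simp_all add: n_def)
    then have "0 \<le> Im w" "Im w < Im \<sigma>"
      using \<tau>(3) unfolding \<tau>(2)[symmetric] by (simp_all add: w_def field_simps)
    moreover have "\<not> 0 < Im w"
      using min'[of w] w \<open>Im w < Im \<sigma>\<close> by (auto simp: P_def)
    ultimately have "Im w = 0" by simp
    then have "w \<in> \<int>"
      using w field_real_imp_rat[of w] rational_algebraic_int_is_int[of w]
      by (auto simp: ring_of_integers_def)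
    then obtain m where "w = of_int m" by (elim Ints_cases)
    then have "z = of_int m + of_int n * \<tau>" by (simp add: w_def algebra_simps)
    then show ?thesis by blast
  qed
  then show thesis
    using \<tau> re that by blast
qed

end

lemma int_combination_unique:
  fixes m n m' n' :: int
  assumes "Im \<tau> \<noteq> 0" "of_int m + of_int n * \<tau> = of_int m' + of_int n' * \<tau>"
  shows "m = m' \<and> n = n'"
proof -
  have "of_int n * Im \<tau> = of_int n' * Im \<tau>"
    using arg_cong[OF assms(2), of Im] by simp
  then have "n = n'" using assms(1) by simp
  with assms(2) show ?thesis by simp
qed

text \<open>
  Two integral bases differ by an integer matrix of determinant \<open>\<plusminus>1\<close>, so the defining property of the discriminant has a unique
  solution and may be evaluated on the basis \<open>1, \<tau>\<close> found in \<open>ring_of_integers_lattice\<close>: it is \<open>- d = a\<^sup>2 - 4 b\<close>, where \<open>a\<close> is \<open>0\<close> or \<open>1\<close>.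
  Its residue modulo four then tells the two possible real parts of \<open>\<tau>\<close> apart, which identifies \<open>\<tau>\<close> with \<open>omega K\<close>.
\<close>
theorem ring_of_integers_omega:
  assumes K: "imaginary_quadratic_field K"
  shows "ring_of_integers K = (\<lambda>(m, n). of_int m + of_int n * omega K) ` (UNIV :: (int \<times> int) set)"
    and "Im (omega K) > 0"
    and "\<bar>real_of_int (disc K)\<bar> = 4 * (Im (omega K))\<^sup>2"
    and "Re (omega K) = 0 \<or> Re (omega K) = 1 / 2"
proof -
  obtain \<tau> where \<tau>: "\<tau> \<in> ring_of_integers K" "Im \<tau> > 0" "Re \<tau> = 0 \<or> Re \<tau> = 1 / 2"
    and lat: "\<And>z. z \<in> ring_of_integers K \<Longrightarrow> \<exists>m n::int. z = of_int m + of_int n * \<tau>"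
    using ring_of_integers_lattice[OF K] by metis
  obtain a b :: int where ab: "2 * Re \<tau> = of_int a" "(cmod \<tau>)\<^sup>2 = of_int b"
    using \<tau>(1) by (auto simp: ring_of_integers_iff[OF K])
  define d where "d = 4 * b - a\<^sup>2"
  have d: "4 * (Im \<tau>)\<^sup>2 = of_int d"
    using four_Im_square[OF ab] by (simp add: d_def)
  have dpos: "d > 0"
    using \<tau>(2) d by (metis mult_pos_pos of_int_0_less_iff zero_less_numeral zero_less_power)
  have sq: "(1 * cnj \<tau> - \<tau> * cnj 1)\<^sup>2 = of_int (- d)"
  proof -
    have "1 * cnj \<tau> - \<tau> * cnj 1 = - (2 * \<i> * of_real (Im \<tau>))"
      by (simp add: complex_eq_iff)
    then have "(1 * cnj \<tau> - \<tau> * cnj 1)\<^sup>2 = - of_real (4 * (Im \<tau>)\<^sup>2)"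
      by (simp add: power2_eq_square)
    then show ?thesis by (simp add: d)
  qed
  have basis: "integral_basis K 1 \<tau>"
    unfolding integral_basis_def
  proof (intro conjI ballI)
    show "1 \<in> ring_of_integers K" "\<tau> \<in> ring_of_integers K"
      using \<tau> ring_of_integers_of_int[OF K, of 1] by simp_all
  next
    fix z assume "z \<in> ring_of_integers K"
    then obtain m n :: int where z: "z = of_int m + of_int n * \<tau>"
      using lat by blast
    show "\<exists>!xy::int \<times> int. z = of_int (fst xy) * 1 + of_int (snd xy) * \<tau>"
    proof (rule ex1I[of _ "(m, n)"])
      fix xy :: "int \<times> int" assume "z = of_int (fst xy) * 1 + of_int (snd xy) * \<tau>"
      then have "of_int (fst xy) + of_int (snd xy) * \<tau> = of_int m + of_int n * \<tau>"
        using z by (simp only: mult_1_right)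
      then have "fst xy = m \<and> snd xy = n"
        by (rule int_combination_unique[rotated]) (use \<tau>(2) in simp)
      then show "xy = (m, n)" by (simp add: prod_eq_iff)
    qed (simp add: z)
  qed
  have disc: "disc K = - d"
    unfolding disc_def
  proof (rule the_equality)
    show "\<exists>b1 b2. integral_basis K b1 b2 \<and> of_int (- d) = (b1 * cnj b2 - b2 * cnj b1)\<^sup>2"
      using basis sq by metis
  next
    fix d' :: int
    assume "\<exists>b1 b2. integral_basis K b1 b2 \<and> of_int d' = (b1 * cnj b2 - b2 * cnj b1)\<^sup>2"
    then obtain b1 b2 where b: "integral_basis K b1 b2" "of_int d' = (b1 * cnj b2 - b2 * cnj b1)\<^sup>2"
      by blast
    from b(1) have b12: "b1 \<in> ring_of_integers K" "b2 \<in> ring_of_integers K"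
      and bz: "\<And>z. z \<in> ring_of_integers K \<Longrightarrow>
        \<exists>!xy::int \<times> int. z = of_int (fst xy) * b1 + of_int (snd xy) * b2"
      by (simp_all add: integral_basis_def)
    obtain p q :: int where p: "b1 = of_int p + of_int q * \<tau>"
      using lat[OF b12(1)] by blast
    obtain r s :: int where r: "b2 = of_int r + of_int s * \<tau>"
      using lat[OF b12(2)] by blast
    have "1 \<in> ring_of_integers K"
      using ring_of_integers_of_int[OF K, of 1] by simp
    then obtain x y :: int where x: "1 = of_int x * b1 + of_int y * b2"
      using ex1_implies_ex[OF bz] by (metis surj_pair)
    obtain u v :: int where u: "\<tau> = of_int u * b1 + of_int v * b2"
      using ex1_implies_ex[OF bz[OF \<tau>(1)]] by (metis surj_pair)
    define \<delta> where "\<delta> = 1 * cnj \<tau> - \<tau> * cnj 1"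
    define \<epsilon> where "\<epsilon> = b1 * cnj b2 - b2 * cnj b1"
    have "\<delta> \<noteq> 0"
      using \<tau>(2) by (simp add: \<delta>_def complex_eq_iff)
    have e: "\<epsilon> = of_int (p * s - q * r) * \<delta>"
      unfolding \<epsilon>_def \<delta>_def p r by (simp add: algebra_simps)
    have "\<delta> = (of_int x * b1 + of_int y * b2) * cnj (of_int u * b1 + of_int v * b2)
        - (of_int u * b1 + of_int v * b2) * cnj (of_int x * b1 + of_int y * b2)"
      unfolding \<delta>_def x[symmetric] u[symmetric] ..
    also have "\<dots> = of_int (x * v - y * u) * \<epsilon>"
      unfolding \<epsilon>_def by (simp add: algebra_simps)
    finally have "\<delta> = of_int ((x * v - y * u) * (p * s - q * r)) * \<delta>"
      by (simp add: e)
    then have "(of_int ((x * v - y * u) * (p * s - q * r)) :: complex) = of_int 1"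
      using \<open>\<delta> \<noteq> 0\<close> by simp
    then have "(x * v - y * u) * (p * s - q * r) = 1"
      by (subst (asm) of_int_eq_iff)
    then have "(p * s - q * r)\<^sup>2 = 1"
      unfolding zmult_eq_1_iff by auto
    then have "\<epsilon>\<^sup>2 = \<delta>\<^sup>2"
      unfolding e power_mult_distrib of_int_power[symmetric] by simp
    then have "(of_int d' :: complex) = of_int (- d)"
      using b(2) sq by (simp add: \<epsilon>_def \<delta>_def)
    then show "d' = - d" by (subst (asm) of_int_eq_iff)
  qed
  have sqrtd: "sqrt \<bar>real_of_int (disc K)\<bar> = 2 * Im \<tau>"
  proof -
    have "\<bar>real_of_int (disc K)\<bar> = (2 * Im \<tau>)\<^sup>2"
      using dpos by (simp add: disc power_mult_distrib d)
    then show ?thesis using \<tau>(2) by (simp only: real_sqrt_abs)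
  qed
  have om: "omega K = \<tau>"
    using \<tau>(3)
  proof
    assume re: "Re \<tau> = 0"
    then have "a = 0" using ab(1) by simp
    then have "disc K mod 4 = 0"
      by (simp add: disc d_def)
    then show ?thesis
      unfolding omega_def sqrtd using re by (simp add: complex_eq_iff)
  next
    assume re: "Re \<tau> = 1 / 2"
    then have "a = 1" using ab(1) by simp
    then have "disc K = 1 + 4 * (- b)"
      by (simp add: disc d_def)
    then have "disc K mod 4 \<noteq> 0"
      by presburger
    then show ?thesis
      unfolding omega_def sqrtd using re by (simp add: complex_eq_iff)
  qed
  show "Im (omega K) > 0" "Re (omega K) = 0 \<or> Re (omega K) = 1 / 2"
    using \<tau> by (simp_all add: om)
  show "\<bar>real_of_int (disc K)\<bar> = 4 * (Im (omega K))\<^sup>2"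
    unfolding om d disc using dpos by simp
  show "ring_of_integers K = (\<lambda>(m, n). of_int m + of_int n * omega K) ` UNIV"
    unfolding om
  proof (intro equalityI subsetI)
    fix z assume "z \<in> ring_of_integers K"
    then obtain m n :: int where "z = of_int m + of_int n * \<tau>"
      using lat by blast
    then show "z \<in> (\<lambda>(m, n). of_int m + of_int n * \<tau>) ` UNIV"
      by (intro image_eqI[of _ _ "(m, n)"]) auto
  next
    fix z assume "z \<in> (\<lambda>(m, n). of_int m + of_int n * \<tau>) ` (UNIV :: (int \<times> int) set)"
    then obtain m n :: int where z: "z = of_int m + of_int n * \<tau>"
      by auto
    show "z \<in> ring_of_integers K"
      unfolding z using \<tau>(1)
      by (intro ring_of_integers_add[OF K] ring_of_integers_times_int[OF K] ring_of_integers_of_int[OF K])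
  qed
qed

text \<open>
  Geometrically, the lattice points lie on lines orthogonal to \<open>p\<close> at distance \<open>c'\<^sub>p / (2 |p|)\<close> from each other, and \<open>v\<^sub>p\<close> generates the
  lattice points of the line through the origin; the product of the two spacings is the covolume \<open>Im \<omega>\<close>.
  The proof evaluates \<open>|c'\<^sub>p v\<^sub>p|\<^sup>2\<close> in coordinates.
\<close>
lemma c_gcd_times_v_vec:
  assumes K: "imaginary_quadratic_field K" and p: "p \<in> ring_of_integers K" "p \<noteq> 0"
  shows "real_of_int (c_gcd K p) * cmod (v_vec K p) = 2 * Im (omega K) * cmod p"
proof -
  note om = ring_of_integers_omega[OF K]
  define I where "I = Im (omega K)"
  have I: "I > 0" using om(2) by (simp add: I_def)
  obtain m n :: int where pm: "p = of_int m + of_int n * omega K"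
    using p(1) unfolding om(1) by auto
  have co: "coords K p = (m, n)"
    unfolding coords_def
  proof (rule the_equality)
    fix xy :: "int \<times> int" assume "p = of_int (fst xy) + omega K * of_int (snd xy)"
    then have "of_int (fst xy) + of_int (snd xy) * omega K = of_int m + of_int n * omega K"
      using pm by (simp only: mult.commute)
    then have "fst xy = m \<and> snd xy = n"
      by (rule int_combination_unique[rotated]) (use om(2) in simp)
    then show "xy = (m, n)" by (simp add: prod_eq_iff)
  qed (simp add: pm)
  have "omega K \<in> ring_of_integers K"
    unfolding om(1) by (intro image_eqI[of _ _ "(0, 1)"]) auto
  then obtain a b :: int where ab: "2 * Re (omega K) = of_int a" "(cmod (omega K))\<^sup>2 = of_int b"
    using ring_of_integers_iff[OF K] by blast
  have tr: "qtrace (omega K) = of_int a"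
    unfolding qtrace_def using ab(1) by simp
  have nm: "qnorm (omega K) = of_int b"
    unfolding qnorm_def using ab(2) by (simp add: complex_mult_cnj cmod_power2)
  define x where "x = 2 * m + n * a"
  define y where "y = m * a + 2 * b * n"
  have xy: "x_coeff K p = x" "y_coeff K p = y"
    by (simp_all add: x_coeff_def y_coeff_def co tr nm x_def y_def)
  have I2: "2 * (of_int b - of_int a * of_int a / 4) = 2 * I\<^sup>2"
    using four_Im_square[OF ab] by (simp add: I_def power2_eq_square)
  have re: "Re (omega K) = of_int a / 2" using ab(1) by simp
  have ry: "real_of_int y - of_int a / 2 * of_int x = of_int n * (2 * I\<^sup>2)"
    unfolding I2[symmetric] by (simp add: x_def y_def field_simps)
  have rx: "real_of_int x = 2 * Re p"
    by (simp add: x_def pm re)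
  have ip: "Im p = of_int n * I"
    by (simp add: pm I_def)
  have "(cmod (of_int y - omega K * of_int x))\<^sup>2
      = (real_of_int y - of_int a / 2 * of_int x)\<^sup>2 + (I * of_int x)\<^sup>2"
    by (simp add: cmod_power2 re I_def)
  also have "\<dots> = (2 * I * cmod p)\<^sup>2"
    unfolding ry unfolding rx power_mult_distrib cmod_power2 ip by (simp add: power2_eq_square algebra_simps)
  finally have eq: "cmod (of_int y - omega K * of_int x) = 2 * I * cmod p"
    by (rule power2_eq_imp_eq) (use I in auto)
  have "c_gcd K p \<noteq> 0"
  proof
    assume "c_gcd K p = 0"
    then have "x = 0" "y = 0" by (simp_all add: c_gcd_def xy)
    then have "2 * I * cmod p = 0" using eq by simp
    then show False using I p(2) by simp
  qed
  then have "c_gcd K p > 0"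
    by (simp add: c_gcd_def)
  then show ?thesis
    unfolding v_vec_def norm_divide xy eq by (simp add: I_def)
qed

lemma S_sum_eq_power_sum:
  assumes K: "imaginary_quadratic_field K"
  shows "S_sum K \<alpha> k N = Im (omega K) * real (k + 1) / (2 * pi) *
    (\<Sum>p | p \<in> ring_of_integers K \<and> 0 < cmod p \<and> cmod p \<le> real N powr \<alpha>. cmod p ^ k / cmod p)"
proof -
  note om = ring_of_integers_omega[OF K]
  have "(\<Sum>p | p \<in> ring_of_integers K \<and> 0 < cmod p \<and> cmod p \<le> real N powr \<alpha>.
          cmod p ^ k / (real_of_int (c_gcd K p) * cmod (v_vec K p)))
      = (\<Sum>p | p \<in> ring_of_integers K \<and> 0 < cmod p \<and> cmod p \<le> real N powr \<alpha>.
          1 / (2 * Im (omega K)) * (cmod p ^ k / cmod p))"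
    by (rule sum.cong) (auto simp: c_gcd_times_v_vec[OF K])
  then show ?thesis
    unfolding S_sum_def om(3) sum_distrib_left[symmetric] mult.assoc
    using om(2) by (simp add: power2_eq_square)
qed

section \<open>Changes of variables in the plane\<close>

abbreviation plane :: "(real \<times> real) measure" where
  "plane \<equiv> lborel \<Otimes>\<^sub>M lborel"

abbreviation unit_disc :: "(real \<times> real) set" where
  "unit_disc \<equiv> {z. (fst z)\<^sup>2 + (snd z)\<^sup>2 \<le> 1}"

text \<open>
  For \<open>a \<noteq> 0\<close> the linear map is a composition of affine substitutions in one coordinate at a time.
\<close>
lemma nn_integral_linear_plane_aux:
  fixes H :: "real \<times> real \<Rightarrow> ennreal"
  assumes [measurable]: "H \<in> borel_measurable plane"
    and D: "a * d - b * c \<noteq> 0" and a: "a \<noteq> 0"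
  shows "(\<integral>\<^sup>+z. H z \<partial>plane) = ennreal \<bar>a * d - b * c\<bar> *
    (\<integral>\<^sup>+z. H (a * fst z + b * snd z, c * fst z + d * snd z) \<partial>plane)"
proof -
  define e where "e = (a * d - b * c) / a"
  have e: "e \<noteq> 0" "\<bar>e\<bar> * \<bar>a\<bar> = \<bar>a * d - b * c\<bar>"
    using a D by (simp_all add: e_def abs_divide)
  have "(\<integral>\<^sup>+z. H z \<partial>plane) = (\<integral>\<^sup>+x. \<integral>\<^sup>+y. H (x, y) \<partial>lborel \<partial>lborel)"
    by (simp add: lborel.nn_integral_fst)
  also have "\<dots> = (\<integral>\<^sup>+x. ennreal \<bar>e\<bar> * (\<integral>\<^sup>+y. H (x, c / a * x + e * y) \<partial>lborel) \<partial>lborel)"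
    by (intro nn_integral_cong nn_integral_real_affine) (use e in auto)
  also have "\<dots> = ennreal \<bar>e\<bar> * (\<integral>\<^sup>+x. \<integral>\<^sup>+y. H (x, c / a * x + e * y) \<partial>lborel \<partial>lborel)"
    by (rule nn_integral_cmult) measurable
  also have "(\<integral>\<^sup>+x. \<integral>\<^sup>+y. H (x, c / a * x + e * y) \<partial>lborel \<partial>lborel)
      = (\<integral>\<^sup>+y. \<integral>\<^sup>+x. H (x, c / a * x + e * y) \<partial>lborel \<partial>lborel)"
    by (rule lborel_pair.Fubini'[symmetric]) measurable
  also have "\<dots> = (\<integral>\<^sup>+y. ennreal \<bar>a\<bar> * (\<integral>\<^sup>+x. H (b * y + a * x, c / a * (b * y + a * x) + e * y) \<partial>lborel) \<partial>lborel)"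
    by (intro nn_integral_cong nn_integral_real_affine) (use a in auto)
  also have "\<dots> = ennreal \<bar>a\<bar> * (\<integral>\<^sup>+y. \<integral>\<^sup>+x. H (b * y + a * x, c / a * (b * y + a * x) + e * y) \<partial>lborel \<partial>lborel)"
    by (rule nn_integral_cmult) measurable
  also have "(\<integral>\<^sup>+y. \<integral>\<^sup>+x. H (b * y + a * x, c / a * (b * y + a * x) + e * y) \<partial>lborel \<partial>lborel)
     = (\<integral>\<^sup>+y. \<integral>\<^sup>+x. H (a * x + b * y, c * x + d * y) \<partial>lborel \<partial>lborel)"
  proof (intro nn_integral_cong arg_cong[of _ _ H])
    fix x y :: real
    have "c / a * (b * y + a * x) + e * y = c * x + d * y"
      using a by (simp add: e_def field_simps)
    then show "(b * y + a * x, c / a * (b * y + a * x) + e * y) = (a * x + b * y, c * x + d * y)"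
      by simp
  qed
  also have "\<dots> = (\<integral>\<^sup>+z. H (a * fst z + b * snd z, c * fst z + d * snd z) \<partial>plane)"
    by (subst lborel_pair.nn_integral_snd[symmetric]) simp_all
  finally show ?thesis
    using e(2) by (simp add: mult.assoc[symmetric] ennreal_mult''[symmetric])
qed

lemma nn_integral_plane_swap:
  assumes [measurable]: "H \<in> borel_measurable plane"
  shows "(\<integral>\<^sup>+z. H (snd z, fst z) \<partial>plane) = (\<integral>\<^sup>+z. H z \<partial>plane)"
  by (subst lborel_pair.nn_integral_snd[symmetric], simp)
     (simp add: lborel.nn_integral_fst)

text \<open>
  When the upper left entry vanishes, exchanging the two coordinates makes it nonzero.
\<close>
lemma nn_integral_linear_plane:
  fixes H :: "real \<times> real \<Rightarrow> ennreal"
  assumes [measurable]: "H \<in> borel_measurable plane" and D: "a * d - b * c \<noteq> 0"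
  shows "(\<integral>\<^sup>+z. H z \<partial>plane) = ennreal \<bar>a * d - b * c\<bar> *
    (\<integral>\<^sup>+z. H (a * fst z + b * snd z, c * fst z + d * snd z) \<partial>plane)"
proof (cases "a = 0")
  case False
  then show ?thesis using nn_integral_linear_plane_aux[OF assms] by blast
next
  case True
  have b: "b \<noteq> 0" "b * c - a * d \<noteq> 0" "\<bar>b * c - a * d\<bar> = \<bar>a * d - b * c\<bar>"
    using D True by auto
  have "(\<integral>\<^sup>+z. H (a * fst z + b * snd z, c * fst z + d * snd z) \<partial>plane)
     = (\<integral>\<^sup>+z. H (b * fst z + a * snd z, d * fst z + c * snd z) \<partial>plane)"
    using nn_integral_plane_swap[of "\<lambda>z. H (b * fst z + a * snd z, d * fst z + c * snd z)"]
    by (simp add: add.commute)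
  then show ?thesis
    using nn_integral_linear_plane_aux[OF assms(1) b(2) b(1)] b(3) by simp
qed

lemma distr_linear_plane:
  assumes D: "a * d - b * c \<noteq> 0"
  shows "distr plane (borel \<Otimes>\<^sub>M borel) (\<lambda>z. (a * fst z + b * snd z, c * fst z + d * snd z)) =
    density plane (\<lambda>_. ennreal (1 / \<bar>a * d - b * c\<bar>))" (is "?L = ?R")
proof (rule measure_eqI)
  show "sets ?L = sets ?R"
    by (simp add: sets_pair_measure_cong[OF sets_lborel sets_lborel])
next
  fix A assume "A \<in> sets ?L"
  then have A: "A \<in> sets (borel \<Otimes>\<^sub>M borel)" by simp
  then have [measurable]: "A \<in> sets plane"
    by (simp add: sets_pair_measure_cong[OF sets_lborel sets_lborel])
  let ?T = "\<lambda>z::real\<times>real. (a * fst z + b * snd z, c * fst z + d * snd z)"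
  have D': "ennreal (1 / \<bar>a * d - b * c\<bar>) * ennreal \<bar>a * d - b * c\<bar> = 1"
    using D by (simp add: ennreal_mult''[symmetric] flip: ennreal_1)
  have "emeasure ?L A = (\<integral>\<^sup>+z. indicator A (?T z) \<partial>plane)"
    using A by (subst nn_integral_indicator[symmetric]) (auto simp: nn_integral_distr simp del: nn_integral_indicator)
  also have "\<dots> = ennreal (1 / \<bar>a * d - b * c\<bar>) * (\<integral>\<^sup>+z. indicator A z \<partial>plane)"
    by (subst nn_integral_linear_plane[OF _ D]) (simp_all add: mult.assoc[symmetric] D')
  also have "\<dots> = (\<integral>\<^sup>+z. ennreal (1 / \<bar>a * d - b * c\<bar>) * indicator A z \<partial>plane)"
    by (rule nn_integral_cmult[symmetric]) measurable
  also have "\<dots> = emeasure ?R A"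
    by (rule emeasure_density[symmetric]) measurable
  finally show "emeasure ?L A = emeasure ?R A" .
qed

lemma integral_linear_plane:
  fixes h :: "real \<times> real \<Rightarrow> real"
  assumes [measurable]: "h \<in> borel_measurable plane" and D: "a * d - b * c \<noteq> 0"
  shows "(\<integral>z. h (a * fst z + b * snd z, c * fst z + d * snd z) \<partial>plane) =
    (\<integral>z. h z \<partial>plane) / \<bar>a * d - b * c\<bar>"
proof -
  have "(\<integral>z. h (a * fst z + b * snd z, c * fst z + d * snd z) \<partial>plane)
     = (\<integral>z. h z \<partial>distr plane (borel \<Otimes>\<^sub>M borel) (\<lambda>z. (a * fst z + b * snd z, c * fst z + d * snd z)))"
    by (subst integral_distr) simp_all
  also have "\<dots> = (\<integral>z. (1 / \<bar>a * d - b * c\<bar>) *\<^sub>R h z \<partial>plane)"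
    unfolding distr_linear_plane[OF D] by (subst integral_density) simp_all
  finally show ?thesis by simp
qed

text \<open>
  The substitution \<open>y = x s\<close> describes the plane by abscissa and slope.  It plays the part of polar coordinates: on a line of
  fixed slope, both \<open>x / (x\<^sup>2 + y\<^sup>2)\<close> and \<open>x\<^sup>2 + y\<^sup>2\<close> are monomials in \<open>x\<close>.
\<close>
lemma nn_integral_slope:
  fixes H :: "real \<times> real \<Rightarrow> ennreal"
  assumes [measurable]: "H \<in> borel_measurable plane"
  shows "(\<integral>\<^sup>+z. H z \<partial>plane) = (\<integral>\<^sup>+s. \<integral>\<^sup>+u. ennreal \<bar>u\<bar> * H (u, u * s) \<partial>lborel \<partial>lborel)"
proof -
  have "(\<integral>\<^sup>+z. H z \<partial>plane) = (\<integral>\<^sup>+u. \<integral>\<^sup>+y. H (u, y) \<partial>lborel \<partial>lborel)"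
    by (simp add: lborel.nn_integral_fst)
  also have "\<dots> = (\<integral>\<^sup>+u. ennreal \<bar>u\<bar> * (\<integral>\<^sup>+s. H (u, u * s) \<partial>lborel) \<partial>lborel)"
  proof (rule nn_integral_cong_AE)
    show "AE u in lborel. (\<integral>\<^sup>+y. H (u, y) \<partial>lborel) = ennreal \<bar>u\<bar> * (\<integral>\<^sup>+s. H (u, u * s) \<partial>lborel)"
      using AE_lborel_singleton[of 0]
    proof eventually_elim
      case (elim u)
      then show ?case
        using nn_integral_real_affine[of "\<lambda>y. H (u, y)" u 0] by simp
    qed
  qed
  also have "\<dots> = (\<integral>\<^sup>+u. \<integral>\<^sup>+s. ennreal \<bar>u\<bar> * H (u, u * s) \<partial>lborel \<partial>lborel)"
    by (simp add: nn_integral_cmult)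
  also have "\<dots> = (\<integral>\<^sup>+s. \<integral>\<^sup>+u. ennreal \<bar>u\<bar> * H (u, u * s) \<partial>lborel \<partial>lborel)"
    by (rule lborel_pair.Fubini'[symmetric]) measurable
  finally show ?thesis .
qed

lemma nn_integral_reflect:
  fixes F :: "real \<Rightarrow> ennreal"
  assumes [measurable]: "F \<in> borel_measurable borel"
  shows "(\<integral>\<^sup>+x. F (- x) \<partial>lborel) = (\<integral>\<^sup>+x. F x \<partial>lborel)"
  using nn_integral_real_affine[of F "-1" 0] by simp

lemma nn_integral_indicator_incseq:
  fixes G :: "real \<Rightarrow> ennreal"
  assumes [measurable]: "G \<in> borel_measurable borel" "\<And>n. A n \<in> sets borel" and mono: "incseq A"
  shows "(\<integral>\<^sup>+u. G u * indicator (\<Union>n. A n) u \<partial>lborel) = (SUP n. \<integral>\<^sup>+u. G u * indicator (A n) u \<partial>lborel)"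
proof -
  have "range A \<subseteq> sets (density lborel G)"
    using assms(2) by auto
  from SUP_emeasure_incseq[OF this mono] show ?thesis
    by (simp add: emeasure_density)
qed

text \<open>
  The map \<open>u \<mapsto> - c / u\<close> is increasing and smooth on the compact intervals \<open>A n\<close>, where the substitution rule applies; a reflection
  removes the sign, and monotone convergence exhausts the half-line.
\<close>
lemma nn_integral_inversion_pos:
  fixes F :: "real \<Rightarrow> ennreal"
  assumes [measurable]: "F \<in> borel_measurable borel" and c: "c > 0"
  shows "(\<integral>\<^sup>+u. F u * indicator {0<..} u \<partial>lborel) =
    (\<integral>\<^sup>+u. F (c / u) * ennreal (c / u\<^sup>2) * indicator {0<..} u \<partial>lborel)"
proof -
  define A where "A n = {1 / (real n + 2) .. real n + 2}" for n
  define B where "B n = {- c / (1 / (real n + 2)) .. - c / (real n + 2)}" for n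
  have mono: "incseq A"
    unfolding A_def by (rule monoI) (auto simp: frac_le)
  have mono': "incseq B"
    unfolding B_def
  proof (rule monoI)
    fix m n :: nat assume "m \<le> n"
    then have "c * (real m + 2) \<le> c * (real n + 2)" "c / (real n + 2) \<le> c / (real m + 2)"
      using c by (auto intro!: divide_left_mono mult_pos_pos)
    then show "{- c / (1 / (real m + 2)) .. - c / (real m + 2)} \<subseteq> {- c / (1 / (real n + 2)) .. - c / (real n + 2)}"
      by auto
  qed
  have cover: "\<exists>n. u \<in> A n" if u: "u > 0" for u
  proof -
    obtain n where n: "max u (1 / u) \<le> real n"
      using real_arch_simple by blast
    then have "u \<le> real n + 2" "1 / u \<le> real n + 2" by auto
    then have "u \<in> A n" using u by (auto simp: A_def field_simps)
    then show ?thesis ..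
  qed
  have UA: "(\<Union>n. A n) = {0<..}"
  proof (intro equalityI subsetI)
    fix u assume "u \<in> (\<Union>n. A n)"
    then obtain n where "1 / (real n + 2) \<le> u" by (auto simp: A_def)
    moreover have "0 < 1 / (real n + 2)" by simp
    ultimately have "0 < u" by (rule less_le_trans[rotated])
    then show "u \<in> {0<..}" by simp
  qed (use cover in auto)
  have UB: "(\<Union>n. B n) = {..<0}"
  proof (intro equalityI subsetI)
    fix y assume "y \<in> (\<Union>n. B n)"
    then obtain n where "y \<le> - c / (real n + 2)" by (auto simp: B_def)
    moreover have "- c / (real n + 2) < 0" using c by simp
    ultimately have "y < 0" by (rule le_less_trans)
    then show "y \<in> {..<0}" by simp
  next
    fix y :: real assume "y \<in> {..<0}"
    then have "0 < - c / y" using c by (simp add: divide_pos_neg)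
    then obtain n where "- c / y \<in> A n" using cover by blast
    then have "y \<in> B n"
      using c \<open>y \<in> {..<0}\<close> by (auto simp: A_def B_def field_simps)
    then show "y \<in> (\<Union>n. B n)" by blast
  qed
  have step: "(\<integral>\<^sup>+y. F (- y) * indicator (B n) y \<partial>lborel)
      = (\<integral>\<^sup>+u. F (c / u) * ennreal (c / u\<^sup>2) * indicator (A n) u \<partial>lborel)" for n
  proof -
    have "(\<integral>\<^sup>+y. F (- y) * indicator {(- c / (1 / (real n + 2))) .. (- c / (real n + 2))} y \<partial>lborel)
      = (\<integral>\<^sup>+u. F (- (- c / u)) * ennreal (c / u\<^sup>2) * indicator {1 / (real n + 2) .. real n + 2} u \<partial>lborel)"
    proof (rule nn_integral_substitution_aux[where g = "\<lambda>u. - c / u" and g' = "\<lambda>u. c / u\<^sup>2"])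
      have pos: "u > 0" if "u \<in> {1 / (real n + 2) .. real n + 2}" for u
      proof -
        have "0 < 1 / (real n + 2)" by simp
        also have "1 / (real n + 2) \<le> u" using that by simp
        finally show ?thesis .
      qed
      show "1 / (real n + 2) < real n + 2" by (rule le_less_trans[of _ 1]) simp_all
      show "((\<lambda>u. - c / u) has_real_derivative c / u\<^sup>2) (at u)"
        if "u \<in> {1 / (real n + 2) .. real n + 2}" for u
        using pos[OF that] by (auto intro!: derivative_eq_intros simp: power2_eq_square)
      show "continuous_on {1 / (real n + 2) .. real n + 2} (\<lambda>u. c / u\<^sup>2)"
        by (intro continuous_intros) (auto dest: pos)
    qed (use c in auto)
    then show ?thesis by (simp add: A_def B_def)
  qed
  have "(\<integral>\<^sup>+u. F u * indicator {0<..} u \<partial>lborel) = (\<integral>\<^sup>+y. F (- y) * indicator {0<..} (- y) \<partial>lborel)"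
    by (rule nn_integral_reflect[symmetric]) measurable
  also have "\<dots> = (\<integral>\<^sup>+y. F (- y) * indicator (\<Union>n. B n) y \<partial>lborel)"
    unfolding UB by (intro nn_integral_cong) (auto simp: indicator_def)
  also have "\<dots> = (SUP n. \<integral>\<^sup>+y. F (- y) * indicator (B n) y \<partial>lborel)"
    by (rule nn_integral_indicator_incseq[OF _ _ mono']) (auto simp: B_def)
  also have "\<dots> = (\<integral>\<^sup>+u. F (c / u) * ennreal (c / u\<^sup>2) * indicator (\<Union>n. A n) u \<partial>lborel)"
    unfolding step by (rule nn_integral_indicator_incseq[OF _ _ mono, symmetric]) (auto simp: A_def)
  finally show ?thesis unfolding UA .
qed

lemma nn_integral_inversion:
  fixes F :: "real \<Rightarrow> ennreal"
  assumes [measurable]: "F \<in> borel_measurable borel" and c: "c > 0"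
  shows "(\<integral>\<^sup>+u. F u \<partial>lborel) = (\<integral>\<^sup>+u. F (c / u) * ennreal (c / u\<^sup>2) \<partial>lborel)"
proof -
  have split: "(\<integral>\<^sup>+u. G u \<partial>lborel) =
      (\<integral>\<^sup>+u. G u * indicator {0<..} u \<partial>lborel) + (\<integral>\<^sup>+u. G (- u) * indicator {0<..} u \<partial>lborel)"
    if [measurable]: "G \<in> borel_measurable borel" for G :: "real \<Rightarrow> ennreal"
  proof -
    have "(\<integral>\<^sup>+u. G u \<partial>lborel) = (\<integral>\<^sup>+u. G u * indicator {0<..} u + G u * indicator {..<0} u \<partial>lborel)"
    proof (rule nn_integral_cong_AE)
      show "AE u in lborel. G u = G u * indicator {0<..} u + G u * indicator {..<0} u"
        using AE_lborel_singleton[of "0::real"]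
        by eventually_elim (auto simp: indicator_def)
    qed
    also have "\<dots> = (\<integral>\<^sup>+u. G u * indicator {0<..} u \<partial>lborel) + (\<integral>\<^sup>+u. G u * indicator {..<0} u \<partial>lborel)"
      by (rule nn_integral_add) measurable
    also have "(\<integral>\<^sup>+u. G u * indicator {..<0} u \<partial>lborel) = (\<integral>\<^sup>+u. G (- u) * indicator {..<0} (- u) \<partial>lborel)"
      by (rule nn_integral_reflect[symmetric]) measurable
    also have "\<dots> = (\<integral>\<^sup>+u. G (- u) * indicator {0<..} u \<partial>lborel)"
      by (intro nn_integral_cong) (auto simp: indicator_def)
    finally show ?thesis .
  qed
  show ?thesis
    unfolding split[OF assms(1)]
    by (subst split, measurable)
       (use nn_integral_inversion_pos[OF assms] nn_integral_inversion_pos[of "\<lambda>u. F (- u)", OF _ c] in simp)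
qed

lemma nn_integral_even:
  fixes F :: "real \<Rightarrow> ennreal"
  assumes [measurable]: "F \<in> borel_measurable borel" and even: "\<And>u. F (- u) = F u"
  shows "(\<integral>\<^sup>+u. F u \<partial>lborel) = 2 * (\<integral>\<^sup>+u. F u * indicator {0..} u \<partial>lborel)"
proof -
  have "(\<integral>\<^sup>+u. F u \<partial>lborel) = (\<integral>\<^sup>+u. F u * indicator {0..} u + F u * indicator {..0} u \<partial>lborel)"
  proof (rule nn_integral_cong_AE)
    show "AE u in lborel. F u = F u * indicator {0..} u + F u * indicator {..0} u"
      using AE_lborel_singleton[of "0::real"]
      by eventually_elim (auto simp: indicator_def)
  qed
  also have "\<dots> = (\<integral>\<^sup>+u. F u * indicator {0..} u \<partial>lborel) + (\<integral>\<^sup>+u. F u * indicator {..0} u \<partial>lborel)"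
    by (rule nn_integral_add) measurable
  also have "(\<integral>\<^sup>+u. F u * indicator {..0} u \<partial>lborel) = (\<integral>\<^sup>+u. F (- u) * indicator {..0} (- u) \<partial>lborel)"
    by (rule nn_integral_reflect[symmetric]) measurable
  also have "\<dots> = (\<integral>\<^sup>+u. F u * indicator {0..} u \<partial>lborel)"
    by (intro nn_integral_cong) (auto simp: indicator_def even)
  finally show ?thesis by (simp add: mult_2)
qed

lemma nn_integral_inverse_1_plus_square:
  "(\<integral>\<^sup>+s. ennreal (1 / (1 + s\<^sup>2)) \<partial>lborel) = ennreal pi"
proof -
  have "(\<integral>\<^sup>+s. ennreal (1 / (1 + s\<^sup>2)) * indicator {0..} s \<partial>lborel) = ennreal (pi / 2 - arctan 0)"
  proof (rule nn_integral_FTC_atLeast)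
    show "(arctan has_real_derivative 1 / (1 + s\<^sup>2)) (at s)" for s
      using DERIV_arctan[of s] by (simp add: divide_inverse)
  qed (simp_all add: tendsto_arctan_at_top)
  moreover have "2 * ennreal (pi / 2) = ennreal pi"
    by (simp add: ennreal_mult'[symmetric] flip: ennreal_numeral)
  ultimately show ?thesis
    by (subst nn_integral_even) simp_all
qed

text \<open>
  Polar coordinates by way of slopes: on the line of slope \<open>s\<close> the radius is \<open>|u| sqrt (1 + s\<^sup>2)\<close>, and rescaling \<open>u\<close> leaves the
  factor \<open>1 / (1 + s\<^sup>2)\<close>, whose integral \<open>\<pi>\<close> is half of the full angle because each line carries two rays.
\<close>
lemma nn_integral_disc_radial:
  fixes H :: "real \<Rightarrow> ennreal"
  assumes [measurable]: "H \<in> borel_measurable borel"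
  shows "(\<integral>\<^sup>+z. indicator unit_disc z * H (sqrt ((fst z)\<^sup>2 + (snd z)\<^sup>2)) \<partial>plane)
    = (\<integral>\<^sup>+r. ennreal (2 * pi * r) * indicator {0..1} r * H r \<partial>lborel)"
proof -
  define P where "P r = ennreal \<bar>r\<bar> * indicator {-1..1} r * H \<bar>r\<bar>" for r :: real
  have [measurable]: "P \<in> borel_measurable borel"
    unfolding P_def by measurable
  have slope: "(\<integral>\<^sup>+u. ennreal \<bar>u\<bar> * (indicator unit_disc (u, u * s)
      * H (sqrt (u\<^sup>2 + (u * s)\<^sup>2))) \<partial>lborel) = ennreal (1 / (1 + s\<^sup>2)) * (\<integral>\<^sup>+r. P r \<partial>lborel)" for s :: real
  proof -
    define q where "q = sqrt (1 + s\<^sup>2)"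
    have q: "q > 0" "q\<^sup>2 = 1 + s\<^sup>2"
      by (simp_all add: q_def add_pos_nonneg)
    have uq: "u\<^sup>2 + (u * s)\<^sup>2 = (q * u)\<^sup>2" for u
      using q(2) by (simp add: power_mult_distrib algebra_simps)
    have "ennreal \<bar>u\<bar> * (indicator unit_disc (u, u * s) * H (sqrt (u\<^sup>2 + (u * s)\<^sup>2)))
       = ennreal (1 / q) * P (q * u)" for u
    proof -
      have "(q * u)\<^sup>2 \<le> 1 \<longleftrightarrow> q * u \<in> {-1..1}"
        unfolding abs_square_le_1 by auto
      then have "indicator unit_disc (u, u * s) = (indicator {-1..1} (q * u) :: ennreal)"
        by (simp add: indicator_def uq)
      moreover have "ennreal \<bar>u\<bar> = ennreal (1 / q) * ennreal \<bar>q * u\<bar>"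
        using q(1) by (simp add: ennreal_mult''[symmetric] abs_mult)
      ultimately show ?thesis
        unfolding P_def uq by (simp add: mult.assoc)
    qed
    then have "(\<integral>\<^sup>+u. ennreal \<bar>u\<bar> * (indicator unit_disc (u, u * s)
        * H (sqrt (u\<^sup>2 + (u * s)\<^sup>2))) \<partial>lborel) = ennreal (1 / q) * (\<integral>\<^sup>+u. P (q * u) \<partial>lborel)"
      by (simp add: nn_integral_cmult)
    also have "\<dots> = ennreal (1 / q\<^sup>2) * (\<integral>\<^sup>+r. P r \<partial>lborel)"
      using q(1) by (subst nn_integral_real_affine[of P q 0])
        (simp_all add: mult.assoc[symmetric] ennreal_mult''[symmetric] power2_eq_square)
    finally show ?thesis unfolding q(2) .
  qed
  have "(\<integral>\<^sup>+z. indicator unit_disc z * H (sqrt ((fst z)\<^sup>2 + (snd z)\<^sup>2)) \<partial>plane)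
    = (\<integral>\<^sup>+s. ennreal (1 / (1 + s\<^sup>2)) * (\<integral>\<^sup>+r. P r \<partial>lborel) \<partial>lborel)"
    by (subst nn_integral_slope) (simp_all add: slope)
  also have "\<dots> = ennreal pi * (\<integral>\<^sup>+r. P r \<partial>lborel)"
    by (simp add: nn_integral_multc nn_integral_inverse_1_plus_square)
  also have "(\<integral>\<^sup>+r. P r \<partial>lborel) = 2 * (\<integral>\<^sup>+r. P r * indicator {0..} r \<partial>lborel)"
    by (rule nn_integral_even) (auto simp: P_def indicator_def)
  also have "ennreal pi * (2 * (\<integral>\<^sup>+r. P r * indicator {0..} r \<partial>lborel))
     = (\<integral>\<^sup>+r. ennreal (2 * pi) * (P r * indicator {0..} r) \<partial>lborel)"
    by (subst nn_integral_cmult) (simp_all add: ennreal_mult'' mult_ac)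
  also have "\<dots> = (\<integral>\<^sup>+r. ennreal (2 * pi * r) * indicator {0..1} r * H r \<partial>lborel)"
    by (intro nn_integral_cong) (auto simp: P_def indicator_def ennreal_mult'' mult.assoc)
  finally show ?thesis .
qed

section \<open>The distribution of the real part of the inverse on the unit disc\<close>

definition inv_tail :: "real \<Rightarrow> real" where
  "inv_tail B = (if B \<le> 1 then pi / 2 else pi / 2 - sqrt (B - 1) / B - arctan (sqrt (B - 1)))"

lemma nn_integral_inverse_square_tail:
  "(\<integral>\<^sup>+s. ennreal (1 / (1 + s\<^sup>2)\<^sup>2) * indicator {s. B \<le> 1 + s\<^sup>2} s \<partial>lborel) = ennreal (inv_tail B)"
proof -
  define a where "a = (if B \<le> 1 then 0 else sqrt (B - 1))"
  have a0: "a \<ge> 0" by (simp add: a_def)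
  have aiff: "B \<le> 1 + s\<^sup>2 \<longleftrightarrow> a \<le> s" if "s \<ge> 0" for s
  proof (cases "B \<le> 1")
    case True
    have "B \<le> 1 + s\<^sup>2" using True by (rule order_trans) simp
    then show ?thesis using True that by (simp add: a_def)
  next
    case False
    have "a \<le> s \<longleftrightarrow> B - 1 \<le> s\<^sup>2"
      using False that by (auto simp: a_def intro: real_le_lsqrt dest: sqrt_le_D)
    then show ?thesis by auto
  qed
  define F where "F s = (s / (1 + s\<^sup>2) + arctan s) / 2" for s :: real
  have pos: "1 + s\<^sup>2 > 0" for s :: real by (simp add: add_pos_nonneg)
  have "(\<integral>\<^sup>+s. ennreal (1 / (1 + s\<^sup>2)\<^sup>2) * indicator {a..} s \<partial>lborel) = ennreal (pi / 4 - F a)"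
  proof (rule nn_integral_FTC_atLeast)
    show "(F has_real_derivative 1 / (1 + s\<^sup>2)\<^sup>2) (at s)" for s
    proof -
      have "(F has_real_derivative (((1 + s\<^sup>2) - s * (2 * s)) / ((1 + s\<^sup>2) * (1 + s\<^sup>2)) + inverse (1 + s\<^sup>2)) / 2) (at s)"
        unfolding F_def using pos[of s] by (auto intro!: derivative_eq_intros)
      moreover have "(((1 + s\<^sup>2) - s * (2 * s)) / ((1 + s\<^sup>2) * (1 + s\<^sup>2)) + inverse (1 + s\<^sup>2)) / 2 = 1 / (1 + s\<^sup>2)\<^sup>2"
        using pos[of s] by (simp add: divide_simps power2_eq_square)
      ultimately show ?thesis by simp
    qed
    have "((\<lambda>s::real. s / (1 + s\<^sup>2)) \<longlongrightarrow> 0) at_top"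
      by real_asymp
    then have "(F \<longlongrightarrow> (0 + pi / 2) / 2) at_top"
      unfolding F_def by (intro tendsto_intros tendsto_arctan_at_top) auto
    then show "(F \<longlongrightarrow> pi / 4) at_top" by simp
  qed auto
  also have "(\<lambda>s. ennreal (1 / (1 + s\<^sup>2)\<^sup>2) * indicator {a..} s) =
      (\<lambda>s. (ennreal (1 / (1 + s\<^sup>2)\<^sup>2) * indicator {s. B \<le> 1 + s\<^sup>2} s) * indicator {0..} s)"
    using a0 aiff by (auto simp: indicator_def fun_eq_iff)
  finally have "(\<integral>\<^sup>+s. ennreal (1 / (1 + s\<^sup>2)\<^sup>2) * indicator {s. B \<le> 1 + s\<^sup>2} s \<partial>lborel)
      = 2 * ennreal (pi / 4 - F a)"
    by (subst nn_integral_even) (auto simp: indicator_def)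
  also have "\<dots> = ennreal (2 * (pi / 4 - F a))"
    by (subst ennreal_mult') simp_all
  also have "2 * (pi / 4 - F a) = inv_tail B"
    by (simp add: F_def inv_tail_def a_def field_simps)
  finally show ?thesis .
qed

text \<open>
  The density at \<open>u\<close> of the image of Lebesgue measure on the unit disc under \<open>z \<mapsto> Re (1 / z)\<close>:
  inverting the disc, it is the integral of \<open>(u\<^sup>2 + v\<^sup>2)\<^sup>-\<^sup>2\<close> over the \<open>v\<close> with \<open>u\<^sup>2 + v\<^sup>2 \<ge> 1\<close>.
\<close>
definition disc_kernel :: "real \<Rightarrow> real" where
  "disc_kernel u =
     (if u = 0 then 2 / 3
      else if \<bar>u\<bar> \<le> 1 then (arcsin \<bar>u\<bar> - \<bar>u\<bar> * sqrt (1 - u\<^sup>2)) / \<bar>u\<bar> ^ 3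
      else pi / (2 * \<bar>u\<bar> ^ 3))"

lemma disc_kernel_eq_inv_tail:
  assumes "u \<noteq> 0"
  shows "disc_kernel u = inv_tail (1 / u\<^sup>2) / \<bar>u\<bar> ^ 3"
proof (cases "\<bar>u\<bar> < 1")
  case False
  then have "1 / u\<^sup>2 \<le> 1"
    using assms by (simp add: divide_le_eq_1 abs_square_less_1[symmetric] not_less)
  moreover
  have "arcsin \<bar>u\<bar> - \<bar>u\<bar> * sqrt (1 - u\<^sup>2) = pi / 2" if "\<bar>u\<bar> \<le> 1"
  proof -
    have 1: "\<bar>u\<bar> = 1" using False that by simp
    then have "u\<^sup>2 = 1" by (metis one_power2 power2_abs)
    with 1 show ?thesis by simp
  qed
  then have "disc_kernel u = pi / 2 / \<bar>u\<bar> ^ 3"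
    using assms by (cases "\<bar>u\<bar> \<le> 1") (simp_all add: disc_kernel_def del: divide_divide_eq_left)
  ultimately show ?thesis
    by (simp add: inv_tail_def)
next
  case True
  define v where "v = \<bar>u\<bar>"
  have v: "0 < v" "v < 1" "u\<^sup>2 = v\<^sup>2" using assms True by (simp_all add: v_def)
  have v2: "v\<^sup>2 < 1" using v by (simp add: abs_square_less_1)
  have B: "1 / u\<^sup>2 > 1" using v v2 by simp
  have "sqrt (1 / u\<^sup>2 - 1) = sqrt ((1 - v\<^sup>2) / v\<^sup>2)"
    using v by (simp add: field_simps)
  also have "\<dots> = sqrt (1 - v\<^sup>2) / v"
    using v by (simp add: real_sqrt_divide)
  finally have s: "sqrt (1 / u\<^sup>2 - 1) = sqrt (1 - v\<^sup>2) / v" .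
  have w: "v / sqrt (1 - v\<^sup>2) > 0" using v v2 by simp
  have "arctan (sqrt (1 - v\<^sup>2) / v) = arctan (1 / (v / sqrt (1 - v\<^sup>2)))"
    by simp
  also have "\<dots> = pi / 2 - arctan (v / sqrt (1 - v\<^sup>2))"
    using arctan_inverse[of "v / sqrt (1 - v\<^sup>2)"] w by simp
  also have "arctan (v / sqrt (1 - v\<^sup>2)) = arcsin v"
    using arcsin_arctan[of v] v by simp
  finally have "inv_tail (1 / u\<^sup>2) = arcsin v - v * sqrt (1 - v\<^sup>2)"
    using B v unfolding inv_tail_def s by (simp add: power2_eq_square)
  moreover have "disc_kernel u = (arcsin v - v * sqrt (1 - v\<^sup>2)) / v ^ 3"
    using True assms by (simp add: disc_kernel_def v_def)
  ultimately show ?thesis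
    by (simp only: v_def)
qed

abbreviation inv_re :: "real \<times> real \<Rightarrow> real" where
  "inv_re z \<equiv> fst z / ((fst z)\<^sup>2 + (snd z)\<^sup>2)"

lemma disc_kernel_measurable [measurable]: "disc_kernel \<in> borel_measurable borel"
proof -
  have [measurable]: "(arctan :: real \<Rightarrow> real) \<in> borel_measurable borel"
    by (intro borel_measurable_continuous_onI continuous_at_imp_continuous_on ballI isCont_arctan)
  have "(\<lambda>u. if u = 0 then 2 / 3 else inv_tail (1 / u\<^sup>2) / \<bar>u\<bar> ^ 3) \<in> borel_measurable borel"
    unfolding inv_tail_def by measurable
  also have "(\<lambda>u. if u = 0 then 2 / 3 else inv_tail (1 / u\<^sup>2) / \<bar>u\<bar> ^ 3) = disc_kernel"
    using disc_kernel_eq_inv_tail by (auto simp: fun_eq_iff disc_kernel_def[of 0])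
  finally show ?thesis .
qed

text \<open>
  The indicator \<open>i\<close> and the value \<open>h\<close> of the integrand are carried along while the Jacobians are multiplied out.
\<close>
lemma product_regroup:
  fixes a b c d h i :: ennreal
  assumes "a * b = c * d"
  shows "a * (i * h) * b = h * c * (d * i)"
proof -
  have "a * (i * h) * b = (a * b) * (i * h)" by (simp only: mult_ac)
  also have "\<dots> = h * c * (d * i)" unfolding assms by (simp only: mult_ac)
  finally show ?thesis .
qed

text \<open>
  On the line of slope \<open>s\<close> the function \<open>X Re (1 / z)\<close> is \<open>t = X / ((1 + s\<^sup>2) u)\<close>, so the inversion \<open>u \<mapsto> t\<close> straightens it; in terms of \<open>t\<close>
  the disc is the set of slopes with \<open>X\<^sup>2 / t\<^sup>2 \<le> 1 + s\<^sup>2\<close>.  Integrating over \<open>s\<close> gives the tail \<open>inv_tail\<close>, hence the kernel.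
\<close>
lemma nn_integral_disc_inv_re:
  fixes H :: "real \<Rightarrow> ennreal"
  assumes [measurable]: "H \<in> borel_measurable borel" and X: "X > 0"
  shows "(\<integral>\<^sup>+z. indicator unit_disc z * H (X * inv_re z) \<partial>plane) =
    (\<integral>\<^sup>+t. ennreal (disc_kernel (t / X) / X) * H t \<partial>lborel)"
proof -
  define F where "F s u = ennreal \<bar>u\<bar> * (indicator unit_disc (u, u * s) * H (X * (u / (u\<^sup>2 + (u * s)\<^sup>2))))"
    for s u :: real
  have [measurable]: "case_prod F \<in> borel_measurable plane"
    unfolding F_def split_beta' by measurable
  have [measurable]: "F s \<in> borel_measurable borel" for s
    unfolding F_def by measurable
  define E where "E s t = H t * ennreal (X\<^sup>2 / \<bar>t\<bar> ^ 3) *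
    (ennreal (1 / (1 + s\<^sup>2)\<^sup>2) * indicator {s. X\<^sup>2 / t\<^sup>2 \<le> 1 + s\<^sup>2} s)" for s t :: real
  have key: "F s ((X / (1 + s\<^sup>2)) / t) * ennreal ((X / (1 + s\<^sup>2)) / t\<^sup>2) = E s t" for s t :: real
  proof (cases "t = 0")
    case False
    define q where "q = 1 + s\<^sup>2"
    have q: "q > 0" by (simp add: q_def add_pos_nonneg)
    define u where "u = X / q / t"
    have uq: "u\<^sup>2 + (u * s)\<^sup>2 = u\<^sup>2 * q"
      by (simp add: q_def power_mult_distrib algebra_simps)
    have u2: "u\<^sup>2 * q = X\<^sup>2 / t\<^sup>2 / q"
      using q False by (simp add: u_def power_divide power2_eq_square)
    have "u\<^sup>2 * q \<le> 1 \<longleftrightarrow> X\<^sup>2 / t\<^sup>2 \<le> q"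
      unfolding u2 using q by (simp only: pos_divide_le_eq mult_1)
    then have ind: "indicator unit_disc (u, u * s) = (indicator {s. X\<^sup>2 / t\<^sup>2 \<le> 1 + s\<^sup>2} s :: ennreal)"
      by (simp add: indicator_def uq q_def)
    have arg: "X * (u / (u\<^sup>2 * q)) = t"
      using X q False by (simp add: u_def power2_eq_square)
    have "\<bar>u\<bar> * (X / q / t\<^sup>2) = (X\<^sup>2 / \<bar>t\<bar> ^ 3) * (1 / q\<^sup>2)"
      using X q False by (simp add: u_def abs_divide abs_mult power2_eq_square power3_eq_cube)
    then have "ennreal \<bar>u\<bar> * ennreal (X / q / t\<^sup>2) = ennreal (X\<^sup>2 / \<bar>t\<bar> ^ 3) * ennreal (1 / q\<^sup>2)"
      using X q by (simp flip: ennreal_mult'')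
    then show ?thesis
      unfolding F_def E_def q_def[symmetric] u_def[symmetric] uq arg
      unfolding ind q_def[symmetric]
      by (rule product_regroup)
  qed (simp add: F_def E_def)
  have "(\<integral>\<^sup>+z. indicator unit_disc z * H (X * inv_re z) \<partial>plane) = (\<integral>\<^sup>+s. \<integral>\<^sup>+u. F s u \<partial>lborel \<partial>lborel)"
    by (subst nn_integral_slope) (simp_all add: F_def[abs_def])
  also have "\<dots> = (\<integral>\<^sup>+s. \<integral>\<^sup>+t. E s t \<partial>lborel \<partial>lborel)"
  proof (rule nn_integral_cong)
    fix s :: real
    have "X / (1 + s\<^sup>2) > 0" using X by (simp add: add_pos_nonneg)
    from nn_integral_inversion[OF _ this, of "F s"]
    show "(\<integral>\<^sup>+u. F s u \<partial>lborel) = (\<integral>\<^sup>+t. E s t \<partial>lborel)"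
      by (simp only: key) simp
  qed
  also have "\<dots> = (\<integral>\<^sup>+t. \<integral>\<^sup>+s. E s t \<partial>lborel \<partial>lborel)"
    by (rule lborel_pair.Fubini') (unfold E_def split_beta', measurable)
  also have "\<dots> = (\<integral>\<^sup>+t. H t * ennreal (X\<^sup>2 / \<bar>t\<bar> ^ 3) * ennreal (inv_tail (X\<^sup>2 / t\<^sup>2)) \<partial>lborel)"
    unfolding E_def by (intro nn_integral_cong) (simp add: nn_integral_cmult nn_integral_inverse_square_tail)
  also have "\<dots> = (\<integral>\<^sup>+t. ennreal (disc_kernel (t / X) / X) * H t \<partial>lborel)"
  proof (rule nn_integral_cong_AE)
    show "AE t in lborel. H t * ennreal (X\<^sup>2 / \<bar>t\<bar> ^ 3) * ennreal (inv_tail (X\<^sup>2 / t\<^sup>2)) =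
        ennreal (disc_kernel (t / X) / X) * H t"
      using AE_lborel_singleton[of "0::real"]
    proof eventually_elim
      case (elim t)
      have "disc_kernel (t / X) / X = X\<^sup>2 / \<bar>t\<bar> ^ 3 * inv_tail (X\<^sup>2 / t\<^sup>2)"
        using elim X by (simp add: disc_kernel_eq_inv_tail abs_divide power_divide power2_eq_square power3_eq_cube mult_ac)
      moreover have "0 \<le> X\<^sup>2 / \<bar>t\<bar> ^ 3" by simp
      then have "ennreal (X\<^sup>2 / \<bar>t\<bar> ^ 3 * inv_tail (X\<^sup>2 / t\<^sup>2)) =
          ennreal (X\<^sup>2 / \<bar>t\<bar> ^ 3) * ennreal (inv_tail (X\<^sup>2 / t\<^sup>2))"
        by (rule ennreal_mult')
      ultimately show ?case
        by (simp only: mult_ac)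
    qed
  qed
  finally show ?thesis .
qed

text \<open>
  Near zero, \<open>q v = arcsin v - v sqrt (1 - v\<^sup>2)\<close> has derivative \<open>2 v\<^sup>2 / sqrt (1 - v\<^sup>2)\<close>, which lies between \<open>2 v\<^sup>2\<close> and \<open>2 v\<^sup>2 + 2 v\<^sup>3\<close> for
  \<open>v \<le> 1/2\<close>.  For \<open>|u| > 1/2\<close> the kernel is at most \<open>(\<pi>/2) / (1/8) \<le> 13\<close>, and the Lipschitz bound at zero holds trivially
  with the constant \<open>26\<close> because \<open>26 |u| > 13\<close>.
\<close>
lemma disc_kernel_bounds: "0 \<le> disc_kernel u" "\<bar>disc_kernel u - 2 / 3\<bar> \<le> 26 * \<bar>u\<bar>" "disc_kernel u \<le> 13"
proof -
  define q where "q v = arcsin v - v * sqrt (1 - v\<^sup>2)" for v :: real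
  have deriv: "(q has_real_derivative 2 * v\<^sup>2 / sqrt (1 - v\<^sup>2)) (at v)" if "\<bar>v\<bar> < 1" for v
  proof -
    have v2: "1 - v\<^sup>2 > 0" using that by (simp add: abs_square_less_1)
    have "(q has_real_derivative inverse (sqrt (1 - v\<^sup>2)) -
       (sqrt (1 - v\<^sup>2) + v * (- (2 * v) * (inverse (sqrt (1 - v\<^sup>2)) / 2)))) (at v)"
      unfolding q_def using that v2
      by (auto intro!: derivative_eq_intros simp: abs_less_iff)
    moreover have "inverse (sqrt (1 - v\<^sup>2)) -
       (sqrt (1 - v\<^sup>2) + v * (- (2 * v) * (inverse (sqrt (1 - v\<^sup>2)) / 2))) = 2 * v\<^sup>2 / sqrt (1 - v\<^sup>2)"
      using v2 by (simp add: field_simps power2_eq_square)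
    ultimately show ?thesis by simp
  qed
  have small: "2 * v ^ 3 / 3 \<le> q v \<and> q v \<le> 2 * v ^ 3 / 3 + v ^ 4 / 2" if v: "0 \<le> v" "v \<le> 1 / 2" for v
  proof -
    have sqrt_le: "sqrt (1 - x\<^sup>2) \<le> 1" "1 \<le> (1 + x) * sqrt (1 - x\<^sup>2)" "sqrt (1 - x\<^sup>2) > 0" if x: "0 \<le> x" "x \<le> 1 / 2" for x
    proof -
      have x2: "x\<^sup>2 < 1" using x by (simp add: abs_square_less_1)
      show "sqrt (1 - x\<^sup>2) \<le> 1" by simp
      show "sqrt (1 - x\<^sup>2) > 0" using x2 by simp
      have "x * x \<le> 1 / 2 * x" using x by (intro mult_right_mono) auto
      then have "x * (x * x) \<le> 1 / 2 * (1 / 2 * x)"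
        using x by (intro mult_mono) (auto intro: order_trans)
      moreover have "x * (x * (x * x)) \<le> 1 * (1 / 2 * (1 / 2 * x))"
        using x \<open>x * (x * x) \<le> _\<close> by (intro mult_mono) auto
      ultimately have "1 \<le> ((1 + x) * (1 + x)) * (1 - x * x)"
        using x by (simp add: algebra_simps)
      also have "\<dots> = ((1 + x) * sqrt (1 - x\<^sup>2))\<^sup>2"
        using x2 by (simp add: power_mult_distrib power2_eq_square)
      finally show "1 \<le> (1 + x) * sqrt (1 - x\<^sup>2)"
        using x x2 by (intro power2_le_imp_le[of 1]) auto
    qed
    have "q 0 - 2 * 0 ^ 3 / 3 \<le> q v - 2 * v ^ 3 / 3"
    proof (rule DERIV_nonneg_imp_nondecreasing[OF v(1)])
      fix x assume x: "0 \<le> x" "x \<le> v"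
      have "((\<lambda>v. q v - 2 * v ^ 3 / 3) has_real_derivative 2 * x\<^sup>2 / sqrt (1 - x\<^sup>2) - 2 * x\<^sup>2) (at x)"
        using x v by (auto intro!: derivative_eq_intros deriv simp: power2_eq_square)
      moreover have "0 \<le> 2 * x\<^sup>2 / sqrt (1 - x\<^sup>2) - 2 * x\<^sup>2"
      proof -
        have "2 * x\<^sup>2 * sqrt (1 - x\<^sup>2) \<le> 2 * x\<^sup>2 * 1"
          using sqrt_le[of x] x v by (intro mult_left_mono) auto
        then show ?thesis using sqrt_le(3)[of x] x v by (simp add: pos_le_divide_eq)
      qed
      ultimately show "\<exists>y. ((\<lambda>v. q v - 2 * v ^ 3 / 3) has_real_derivative y) (at x) \<and> 0 \<le> y" by blast
    qed
    moreover have "2 * 0 ^ 3 / 3 + 0 ^ 4 / 2 - q 0 \<le> 2 * v ^ 3 / 3 + v ^ 4 / 2 - q v"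
    proof (rule DERIV_nonneg_imp_nondecreasing[OF v(1)])
      fix x assume x: "0 \<le> x" "x \<le> v"
      have "((\<lambda>v. 2 * v ^ 3 / 3 + v ^ 4 / 2 - q v) has_real_derivative 2 * x\<^sup>2 + 2 * x ^ 3 - 2 * x\<^sup>2 / sqrt (1 - x\<^sup>2)) (at x)"
        using x v by (auto intro!: derivative_eq_intros deriv simp: power2_eq_square power3_eq_cube)
      moreover have "0 \<le> 2 * x\<^sup>2 + 2 * x ^ 3 - 2 * x\<^sup>2 / sqrt (1 - x\<^sup>2)"
      proof -
        have "2 * x\<^sup>2 * 1 \<le> 2 * x\<^sup>2 * ((1 + x) * sqrt (1 - x\<^sup>2))"
          using sqrt_le(2)[of x] x v by (intro mult_left_mono) auto
        then have "2 * x\<^sup>2 / sqrt (1 - x\<^sup>2) \<le> 2 * x\<^sup>2 * (1 + x)"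
          using sqrt_le(3)[of x] x v by (simp add: pos_divide_le_eq mult_ac)
        then show ?thesis by (simp add: power2_eq_square power3_eq_cube algebra_simps)
      qed
      ultimately show "\<exists>y. ((\<lambda>v. 2 * v ^ 3 / 3 + v ^ 4 / 2 - q v) has_real_derivative y) (at x) \<and> 0 \<le> y" by blast
    qed
    moreover have "q 0 = 0" by (simp add: q_def)
    ultimately show ?thesis by simp
  qed
  have pi4: "4 * pi \<le> 13" using pi_less_4 pi_approx by simp
  define v where "v = \<bar>u\<bar>"
  have v0: "v \<ge> 0" "u\<^sup>2 = v\<^sup>2" "\<bar>u\<bar> = v" by (simp_all add: v_def)
  have "0 \<le> disc_kernel u \<and> \<bar>disc_kernel u - 2 / 3\<bar> \<le> 26 * \<bar>u\<bar> \<and> disc_kernel u \<le> 13"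
  proof (cases "v \<le> 1 / 2")
    case True
    show ?thesis
    proof (cases "v = 0")
      case True
      then show ?thesis by (simp add: disc_kernel_def v_def)
    next
      case False
      have k: "disc_kernel u = q v / v ^ 3"
        using False True by (simp add: disc_kernel_def q_def v0) (simp add: v_def)
      have v3: "v ^ 3 > 0" using False v0 by simp
      have "2 / 3 \<le> disc_kernel u"
        using small[OF v0(1) True] v3 unfolding k by (simp add: pos_le_divide_eq)
      moreover have "disc_kernel u \<le> 2 / 3 + v / 2"
        using small[OF v0(1) True] v3 unfolding k
        by (simp add: pos_divide_le_eq algebra_simps power_Suc numeral_eq_Suc)
      ultimately show ?thesis using True v0 by (simp add: v0(3))
    qed
  next
    case False
    have v3: "1 / 8 \<le> v ^ 3"
      using power_mono[of "1 / 2" v 3] False by (simp add: power_divide)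
    have "0 \<le> disc_kernel u \<and> disc_kernel u \<le> (pi / 2) / (1 / 8)"
    proof (cases "v \<le> 1")
      case True
      have k: "disc_kernel u = q v / v ^ 3"
        using False True by (simp add: disc_kernel_def q_def v0) (simp add: v_def)
      have "sqrt (1 - v\<^sup>2) \<le> 1" "0 \<le> sqrt (1 - v\<^sup>2)"
        using True v0(1) by (simp_all add: abs_square_le_1)
      then have "0 \<le> v * sqrt (1 - v\<^sup>2)" "v * sqrt (1 - v\<^sup>2) \<le> v"
        using v0(1) by (simp_all add: mult_left_le)
      moreover have "arcsin v \<le> pi / 2" "0 \<le> arcsin v"
        using True v0(1) arcsin_bounded[of v] by (simp_all add: arcsin_nonneg)
      moreover have "v \<le> arcsin v"
        using sin_x_le_x[OF \<open>0 \<le> arcsin v\<close>] True v0(1) by simp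
      ultimately have "0 \<le> q v" "q v \<le> pi / 2"
        by (simp_all add: q_def)
      then show ?thesis
        unfolding k using v3 v0(1) by (intro conjI frac_le) auto
    next
      case False
      then have "disc_kernel u = (pi / 2) / v ^ 3"
        unfolding disc_kernel_def v0(3) using v_def by auto
      moreover have "(pi / 2) / v ^ 3 \<le> (pi / 2) / (1 / 8)"
        using v3 \<open>\<not> v \<le> 1 / 2\<close> by (intro divide_left_mono mult_pos_pos) auto
      ultimately show ?thesis
        using v0(1) by simp
    qed
    then have "0 \<le> disc_kernel u" "disc_kernel u \<le> 4 * pi" by simp_all
    then show ?thesis using False pi4 by (simp add: v0(3))
  qed
  then show "0 \<le> disc_kernel u" "\<bar>disc_kernel u - 2 / 3\<bar> \<le> 26 * \<bar>u\<bar>" "disc_kernel u \<le> 13"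
    by auto
qed

lemma integral_disc_radial:
  fixes h :: "real \<Rightarrow> real"
  assumes [measurable]: "h \<in> borel_measurable borel"
  shows "(\<integral>z. indicator unit_disc z * h (sqrt ((fst z)\<^sup>2 + (snd z)\<^sup>2)) \<partial>plane)
    = (\<integral>r. indicator {0..1} r * (2 * pi * r) * h r \<partial>lborel)"
proof -
  let ?D = "density plane (\<lambda>z. ennreal (indicator unit_disc z))"
  let ?N = "\<lambda>z::real\<times>real. sqrt ((fst z)\<^sup>2 + (snd z)\<^sup>2)"
  let ?w = "\<lambda>r::real. indicator {0..1} r * (2 * pi * r)"
  have "distr ?D borel ?N = density lborel (\<lambda>r. ennreal (?w r))"
  proof (rule measure_eqI)
    fix A assume "A \<in> sets (distr ?D borel ?N)"
    then have [measurable]: "A \<in> sets borel" by simp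
    have "emeasure (distr ?D borel ?N) A = (\<integral>\<^sup>+z. indicator A (?N z) \<partial>?D)"
      by (subst nn_integral_indicator[symmetric]) (auto simp: nn_integral_distr simp del: nn_integral_indicator)
    also have "\<dots> = (\<integral>\<^sup>+z. indicator unit_disc z * indicator A (?N z) \<partial>plane)"
      by (subst nn_integral_density) (simp_all add: ennreal_indicator)
    also have "\<dots> = (\<integral>\<^sup>+r. ennreal (2 * pi * r) * indicator {0..1} r * indicator A r \<partial>lborel)"
      by (rule nn_integral_disc_radial) measurable
    also have "\<dots> = emeasure (density lborel (\<lambda>r. ennreal (?w r))) A"
      by (subst emeasure_density) (auto intro!: nn_integral_cong simp: indicator_def)
    finally show "emeasure (distr ?D borel ?N) A = emeasure (density lborel (\<lambda>r. ennreal (?w r))) A" .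
  qed simp
  then have "(\<integral>r. h r \<partial>distr ?D borel ?N) = (\<integral>r. h r \<partial>density lborel (\<lambda>r. ennreal (?w r)))"
    by simp
  moreover have "(\<integral>r. h r \<partial>distr ?D borel ?N) = (\<integral>z. indicator unit_disc z * h (?N z) \<partial>plane)"
    by (subst integral_distr, measurable) (subst integral_density, simp_all)
  moreover have "(\<integral>r. h r \<partial>density lborel (\<lambda>r. ennreal (?w r))) = (\<integral>r. ?w r * h r \<partial>lborel)"
    by (subst integral_density) (auto simp: indicator_def)
  ultimately show ?thesis by simp
qed

text \<open>
  This integral is not divided by the area \<open>\<pi>\<close> of the disc.
\<close>
definition disc_avg :: "(real \<Rightarrow> real) \<Rightarrow> real \<Rightarrow> real" where
  "disc_avg f X = (\<integral>z. indicator unit_disc z * f (X * inv_re z) \<partial>plane)"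

text \<open>
  The nonnegative case says that two measures on the line agree; integrating \<open>f\<close> against both gives the signed case.
\<close>
lemma disc_avg_eq_kernel:
  fixes f :: "real \<Rightarrow> real"
  assumes [measurable]: "f \<in> borel_measurable borel" and X: "X > 0"
  shows "disc_avg f X = (\<integral>t. disc_kernel (t / X) / X * f t \<partial>lborel)"
proof -
  let ?D = "density plane (\<lambda>z. ennreal (indicator unit_disc z))"
  let ?N = "\<lambda>z::real\<times>real. X * inv_re z"
  let ?w = "\<lambda>t::real. disc_kernel (t / X) / X"
  have "distr ?D borel ?N = density lborel (\<lambda>r. ennreal (?w r))"
  proof (rule measure_eqI)
    fix A assume "A \<in> sets (distr ?D borel ?N)"
    then have [measurable]: "A \<in> sets borel" by simp
    have "emeasure (distr ?D borel ?N) A = (\<integral>\<^sup>+z. indicator A (?N z) \<partial>?D)"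
      by (subst nn_integral_indicator[symmetric]) (auto simp: nn_integral_distr simp del: nn_integral_indicator)
    also have "\<dots> = (\<integral>\<^sup>+z. indicator unit_disc z * indicator A (?N z) \<partial>plane)"
      by (subst nn_integral_density) (simp_all add: ennreal_indicator)
    also have "\<dots> = (\<integral>\<^sup>+t. ennreal (?w t) * indicator A t \<partial>lborel)"
      by (rule nn_integral_disc_inv_re[OF _ X]) measurable
    also have "\<dots> = emeasure (density lborel (\<lambda>r. ennreal (?w r))) A"
      by (subst emeasure_density) simp_all
    finally show "emeasure (distr ?D borel ?N) A = emeasure (density lborel (\<lambda>r. ennreal (?w r))) A" .
  qed simp
  then have "(\<integral>r. f r \<partial>distr ?D borel ?N) = (\<integral>r. f r \<partial>density lborel (\<lambda>r. ennreal (?w r)))"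
    by simp
  moreover have "(\<integral>r. f r \<partial>distr ?D borel ?N) = (\<integral>z. indicator unit_disc z * f (?N z) \<partial>plane)"
    by (subst integral_distr, measurable) (subst integral_density, simp_all)
  moreover have "(\<integral>r. f r \<partial>density lborel (\<lambda>r. ennreal (?w r))) = (\<integral>r. ?w r * f r \<partial>lborel)"
    using disc_kernel_bounds(1) X by (subst integral_density) auto
  ultimately show ?thesis by (simp add: disc_avg_def)
qed

lemma space_plane [simp]: "space plane = UNIV"
  by (simp add: space_pair_measure)

lemma unit_disc_measurable [measurable]: "unit_disc \<in> sets plane"
proof -
  have "{z \<in> space plane. (fst z)\<^sup>2 + (snd z)\<^sup>2 \<le> 1} \<in> sets plane" by measurable
  then show ?thesis by simp
qed

lemma nn_integral_disc_power:
  "(\<integral>\<^sup>+z. indicator unit_disc z \<partial>plane) = ennreal pi"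
  "(\<integral>\<^sup>+z. indicator unit_disc z * ennreal (1 / sqrt ((fst z)\<^sup>2 + (snd z)\<^sup>2)) \<partial>plane) = ennreal (2 * pi)"
proof -
  have "(\<integral>\<^sup>+z. indicator unit_disc z * (1::ennreal) \<partial>plane) =
      (\<integral>\<^sup>+r. ennreal (2 * pi * r) * indicator {0..1} r * 1 \<partial>lborel)"
    using nn_integral_disc_radial[of "\<lambda>_. 1"] by simp
  also have "\<dots> = ennreal (pi * 1\<^sup>2 - pi * 0\<^sup>2)"
    unfolding mult_1_right
    by (rule nn_integral_FTC_Icc) (auto intro!: derivative_eq_intros)
  finally show "(\<integral>\<^sup>+z. indicator unit_disc z \<partial>plane) = ennreal pi" by simp
  have "(\<integral>\<^sup>+z. indicator unit_disc z * ennreal (1 / sqrt ((fst z)\<^sup>2 + (snd z)\<^sup>2)) \<partial>plane) =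
      (\<integral>\<^sup>+r. ennreal (2 * pi * r) * indicator {0..1} r * ennreal (1 / r) \<partial>lborel)"
    by (rule nn_integral_disc_radial) measurable
  also have "\<dots> = (\<integral>\<^sup>+r. ennreal (2 * pi) * indicator {0..1::real} r \<partial>lborel)"
  proof (rule nn_integral_cong_AE)
    show "AE r::real in lborel. ennreal (2 * pi * r) * indicator {0..1} r * ennreal (1 / r) = ennreal (2 * pi) * indicator {0..1} r"
      using AE_lborel_singleton[of "0::real"]
      by eventually_elim (auto simp: indicator_def simp flip: ennreal_mult'')
  qed
  also have "\<dots> = ennreal (2 * pi)"
    by (simp add: nn_integral_cmult_indicator)
  finally show "(\<integral>\<^sup>+z. indicator unit_disc z * ennreal (1 / sqrt ((fst z)\<^sup>2 + (snd z)\<^sup>2)) \<partial>plane) = ennreal (2 * pi)" .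
qed

lemma integral_disc_const:
  "integrable plane (\<lambda>z. indicator unit_disc z * (c::real))"
  "(\<integral>z. indicator unit_disc z * c \<partial>plane) = pi * c"
proof -
  have "emeasure plane unit_disc = ennreal pi"
    using nn_integral_disc_power(1) by (simp add: nn_integral_indicator[OF unit_disc_measurable])
  then have "integrable plane (indicator unit_disc :: _ \<Rightarrow> real)" "measure plane unit_disc = pi"
    by (simp_all add: integrable_real_indicator[OF unit_disc_measurable] measure_def)
  then show "integrable plane (\<lambda>z. indicator unit_disc z * (c::real))"
    "(\<integral>z. indicator unit_disc z * c \<partial>plane) = pi * c"
    by simp_all
qed

lemma integrable_disc_bounded:
  fixes g :: "real \<times> real \<Rightarrow> real"
  assumes [measurable]: "g \<in> borel_measurable plane" and bound: "\<And>z. \<bar>g z\<bar> \<le> M"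
  shows "integrable plane (\<lambda>z. indicator unit_disc z * g z)"
proof (rule Bochner_Integration.integrable_bound[OF integral_disc_const(1)[of M]])
  show "AE z in plane. norm (indicator unit_disc z * g z) \<le> norm (indicator unit_disc z * M)"
    using order_trans[OF bound abs_ge_self] by (intro AE_I2) (simp add: indicator_def)
qed measurable

lemma disc_avg_zero: "disc_avg f 0 = pi * f 0"
  unfolding disc_avg_def mult_zero_left by (rule integral_disc_const(2))

lemma disc_avg_bounded:
  assumes [measurable]: "f \<in> borel_measurable borel" and bound: "\<And>t. \<bar>f t\<bar> \<le> M"
  shows "\<bar>disc_avg f X\<bar> \<le> pi * M"
proof -
  have "\<bar>disc_avg f X\<bar> \<le> (\<integral>z. \<bar>indicator unit_disc z * f (X * inv_re z)\<bar> \<partial>plane)"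
    unfolding disc_avg_def by (rule integral_abs_bound)
  also have "\<dots> \<le> (\<integral>z. indicator unit_disc z * M \<partial>plane)"
    using bound by (intro integral_mono integrable_abs integrable_disc_bounded[of _ M] integral_disc_const)
      (auto simp: indicator_def)
  finally show ?thesis unfolding integral_disc_const(2) .
qed

text \<open>
  The function \<open>Re (1/z)\<close> is bounded by \<open>1 / |z|\<close>, and the integral of \<open>1 / |z|\<close> over the unit disc is \<open>2 \<pi>\<close>.
\<close>
lemma disc_avg_lipschitz:
  assumes [measurable]: "f \<in> borel_measurable borel" and bound: "\<And>t. \<bar>f t\<bar> \<le> M"
    and lip: "\<And>s t. \<bar>f s - f t\<bar> \<le> L * \<bar>s - t\<bar>"
  shows "\<bar>disc_avg f X - disc_avg f Y\<bar> \<le> 2 * pi * L * \<bar>X - Y\<bar>"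
proof -
  have L: "0 \<le> L" using lip[of 1 0] by simp
  define w where "w z = indicator unit_disc z * (1 / sqrt ((fst z)\<^sup>2 + (snd z)\<^sup>2))" for z :: "real \<times> real"
  have w0: "0 \<le> w z" for z by (simp add: w_def)
  have [measurable]: "w \<in> borel_measurable plane" unfolding w_def by measurable
  have wn: "(\<integral>\<^sup>+z. ennreal (w z) \<partial>plane) = ennreal (2 * pi)"
  proof -
    have "ennreal (w z) = indicator unit_disc z * ennreal (1 / sqrt ((fst z)\<^sup>2 + (snd z)\<^sup>2))" for z
      by (simp add: w_def indicator_def)
    then show ?thesis using nn_integral_disc_power(2) by (simp only:)
  qed
  have wint: "integrable plane w"
    by (rule integrableI_nn_integral_finite[OF _ _ wn]) (use w0 in auto)
  have wval: "(\<integral>z. w z \<partial>plane) = 2 * pi"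
    by (rule integral_eq_nn_integral[THEN trans]) (use w0 wn in auto)
  have int: "integrable plane (\<lambda>z. indicator unit_disc z * f (X * inv_re z))" for X
    by (rule integrable_disc_bounded[of _ M]) (use bound in auto)
  have eq: "disc_avg f X - disc_avg f Y =
      (\<integral>z. indicator unit_disc z * f (X * inv_re z) - indicator unit_disc z * f (Y * inv_re z) \<partial>plane)"
    unfolding disc_avg_def by (rule Bochner_Integration.integral_diff[symmetric]) (rule int)+
  have "\<bar>disc_avg f X - disc_avg f Y\<bar> \<le> (\<integral>z. \<bar>indicator unit_disc z * f (X * inv_re z) - indicator unit_disc z * f (Y * inv_re z)\<bar> \<partial>plane)"
    unfolding eq by (rule integral_abs_bound)
  also have "\<dots> \<le> (\<integral>z. (L * \<bar>X - Y\<bar>) * w z \<partial>plane)"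
  proof (rule integral_mono)
    fix z :: "real \<times> real"
    define q where "q = sqrt ((fst z)\<^sup>2 + (snd z)\<^sup>2)"
    have q: "0 \<le> q" "(fst z)\<^sup>2 + (snd z)\<^sup>2 = q * q" "\<bar>fst z\<bar> \<le> q"
      by (simp_all add: q_def)
    define c where "c = inv_re z"
    have "\<bar>c\<bar> \<le> 1 / q"
    proof (cases "q = 0")
      case False
      then have "\<bar>fst z\<bar> / (q * q) \<le> q / (q * q)"
        using q by (intro divide_right_mono) auto
      then show ?thesis
        unfolding c_def q(2) using False by (simp add: abs_divide)
    qed (simp add: c_def q(2))
    then have "L * (\<bar>X - Y\<bar> * \<bar>c\<bar>) \<le> L * (\<bar>X - Y\<bar> * (1 / q))"
      using L by (intro mult_left_mono) auto
    moreover have "\<bar>f (X * c) - f (Y * c)\<bar> \<le> L * (\<bar>X - Y\<bar> * \<bar>c\<bar>)"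
      using lip[of "X * c" "Y * c"] by (simp only: left_diff_distrib[symmetric] abs_mult)
    ultimately have "\<bar>f (X * c) - f (Y * c)\<bar> \<le> L * \<bar>X - Y\<bar> * (1 / q)"
      by simp
    then show "\<bar>indicator unit_disc z * f (X * inv_re z) - indicator unit_disc z * f (Y * inv_re z)\<bar> \<le> L * \<bar>X - Y\<bar> * w z"
      unfolding w_def q_def[symmetric] c_def[symmetric] by (cases "z \<in> unit_disc") simp_all
  next
    show "integrable plane (\<lambda>z. \<bar>indicator unit_disc z * f (X * inv_re z) - indicator unit_disc z * f (Y * inv_re z)\<bar>)"
      by (intro integrable_abs Bochner_Integration.integrable_diff int)
    show "integrable plane (\<lambda>z. L * \<bar>X - Y\<bar> * w z)"
      by (intro integrable_mult_right wint)
  qed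
  also have "\<dots> = 2 * pi * L * \<bar>X - Y\<bar>"
    by (simp add: wval)
  finally show ?thesis .
qed

lemma integrable_indicator_Icc_const: "integrable lborel (\<lambda>t. indicator {a..b::real} t * (c::real))"
  by (intro integrable_mult_left integrable_real_indicator) (auto simp: emeasure_lborel_Icc_eq)

lemma integrable_bounded_support:
  fixes f :: "real \<Rightarrow> real"
  assumes [measurable]: "f \<in> borel_measurable borel" and bound: "\<And>t. \<bar>f t\<bar> \<le> M"
    and supp: "\<And>t. \<bar>t\<bar> > A \<Longrightarrow> f t = 0"
  shows "integrable lborel f"
proof (rule Bochner_Integration.integrable_bound[of _ "\<lambda>t. indicator {-A..A} t * M"])
  show "AE t in lborel. norm (f t) \<le> norm (indicator {-A..A} t * M)"
  proof (rule AE_I2)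
    fix t
    show "norm (f t) \<le> norm (indicator {-A..A} t * M)"
      using order_trans[OF bound abs_ge_self, of t] supp[of t] by (cases "\<bar>t\<bar> > A") (auto simp: abs_le_iff indicator_def)
  qed
  show "integrable lborel (\<lambda>t. indicator {-A..A} t * M)"
    by (rule integrable_indicator_Icc_const)
qed simp

text \<open>
  For \<open>X \<ge> 1\<close> the Lipschitz bound of the kernel at zero gives an error \<open>O(X\<^sup>-\<^sup>2)\<close>, for \<open>X \<le> 1\<close> boundedness gives \<open>O(X\<^sup>-\<^sup>1)\<close>.
  The exponent \<open>7/4\<close> covers both ranges and is less than two, so that the sum of \<open>|p|\<^bsup>-7/4\<^esup>\<close> over a disc grows like a power of the radius
  without a logarithm; it exceeds \<open>5/3\<close>, so that the relative error \<open>X\<^bsup>-3/4\<^esup>\<close> is smaller than the rate \<open>X\<^bsup>-2/3\<^esup>\<close> of the theorem.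
\<close>
lemma disc_avg_asymptotic:
  fixes f :: "real \<Rightarrow> real"
  assumes meas [measurable]: "f \<in> borel_measurable borel" and bound: "\<And>t. \<bar>f t\<bar> \<le> M"
    and supp: "\<And>t. \<bar>t\<bar> > A \<Longrightarrow> f t = 0" and A: "A > 0"
  obtains C where "C \<ge> 0"
    "\<And>X. X > 0 \<Longrightarrow> \<bar>disc_avg f X - 2 / (3 * X) * (\<integral>t. f t \<partial>lborel)\<bar> \<le> C * X powr (- (7 / 4))"
proof -
  have M: "M \<ge> 0" using bound[of 0] by linarith
  have intf: "integrable lborel f"
    using meas bound supp by (rule integrable_bounded_support)
  define C where "C = 52 * A\<^sup>2 * M + 26 * A * M"
  have "\<bar>disc_avg f X - 2 / (3 * X) * (\<integral>t. f t \<partial>lborel)\<bar> \<le> C * X powr (- (7 / 4))" if X: "X > 0" for X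
  proof -
    have intk: "integrable lborel (\<lambda>t. disc_kernel (t / X) / X * f t)"
    proof (rule integrable_bounded_support[of _ "13 / X * M" A])
      fix t
      show "\<bar>disc_kernel (t / X) / X * f t\<bar> \<le> 13 / X * M"
        unfolding abs_mult using disc_kernel_bounds[of "t / X"] X bound[of t]
        by (intro mult_mono) (auto intro: divide_right_mono)
    qed (use supp in auto)
    have eq: "disc_avg f X - 2 / (3 * X) * (\<integral>t. f t \<partial>lborel) = (\<integral>t. (disc_kernel (t / X) - 2 / 3) / X * f t \<partial>lborel)"
    proof -
      have "(\<integral>t. (disc_kernel (t / X) - 2 / 3) / X * f t \<partial>lborel) =
          (\<integral>t. disc_kernel (t / X) / X * f t - 2 / (3 * X) * f t \<partial>lborel)"
        by (intro Bochner_Integration.integral_cong) (simp_all add: diff_divide_distrib left_diff_distrib)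
      also have "\<dots> = (\<integral>t. disc_kernel (t / X) / X * f t \<partial>lborel) - (\<integral>t. 2 / (3 * X) * f t \<partial>lborel)"
        by (intro Bochner_Integration.integral_diff intk integrable_mult_right intf)
      finally show ?thesis
        by (simp add: disc_avg_eq_kernel[OF meas X])
    qed
    have key: "\<bar>disc_avg f X - 2 / (3 * X) * (\<integral>t. f t \<partial>lborel)\<bar> \<le> B / X * M * (2 * A)"
      if B: "\<And>t. \<bar>t\<bar> \<le> A \<Longrightarrow> \<bar>disc_kernel (t / X) - 2 / 3\<bar> \<le> B" for B
    proof -
      have "\<bar>disc_avg f X - 2 / (3 * X) * (\<integral>t. f t \<partial>lborel)\<bar> \<le> (\<integral>t. \<bar>(disc_kernel (t / X) - 2 / 3) / X * f t\<bar> \<partial>lborel)"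
        unfolding eq by (rule integral_abs_bound)
      also have "\<dots> \<le> (\<integral>t. indicator {-A..A} t * (B / X * M) \<partial>lborel)"
      proof (rule integral_mono)
        show "integrable lborel (\<lambda>t. \<bar>(disc_kernel (t / X) - 2 / 3) / X * f t\<bar>)"
        proof (rule integrable_abs, rule integrable_bounded_support[of _ "15 / X * M" A])
          fix t
          have "\<bar>disc_kernel (t / X) - 2 / 3\<bar> \<le> 15"
            using disc_kernel_bounds[of "t / X"] by (simp add: abs_le_iff)
          then show "\<bar>(disc_kernel (t / X) - 2 / 3) / X * f t\<bar> \<le> 15 / X * M"
            unfolding abs_mult abs_divide using X bound[of t]
            by (intro mult_mono) (auto intro: divide_right_mono)
        qed (use supp in auto)
        fix t
        show "\<bar>(disc_kernel (t / X) - 2 / 3) / X * f t\<bar> \<le> indicator {-A..A} t * (B / X * M)"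
        proof (cases "\<bar>t\<bar> \<le> A")
          case True
          then have "\<bar>(disc_kernel (t / X) - 2 / 3) / X * f t\<bar> \<le> B / X * M"
            unfolding abs_mult abs_divide using X bound[of t] order_trans[OF abs_ge_zero B[OF True]]
            by (intro mult_mono) (auto intro: divide_right_mono B)
          with True show ?thesis by (simp add: indicator_def abs_le_iff)
        next
          case False
          then show ?thesis using supp[of t] by (auto simp: indicator_def)
        qed
      next
        show "integrable lborel (\<lambda>t. indicator {-A..A} t * (B / X * M))"
          by (rule integrable_indicator_Icc_const)
      qed
      also have "\<dots> = B / X * M * (2 * A)"
        using A by simp
      finally show ?thesis .
    qed
    show ?thesis
    proof (cases "X \<ge> 1")
      case True
      have "\<bar>disc_avg f X - 2 / (3 * X) * (\<integral>t. f t \<partial>lborel)\<bar> \<le> (26 * A / X) / X * M * (2 * A)"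
      proof (rule key)
        fix t assume "\<bar>t\<bar> \<le> A"
        then have "26 * \<bar>t / X\<bar> \<le> 26 * A / X"
          using X by (simp add: abs_divide divide_right_mono)
        then show "\<bar>disc_kernel (t / X) - 2 / 3\<bar> \<le> 26 * A / X"
          using disc_kernel_bounds(2)[of "t / X"] by linarith
      qed
      also have "\<dots> = 52 * A\<^sup>2 * M * X powr (- 2)"
        using X by (simp add: powr_minus powr_numeral power2_eq_square field_simps)
      also have "\<dots> \<le> C * X powr (- (7 / 4))"
        unfolding C_def using A M True by (intro mult_mono powr_mono) auto
      finally show ?thesis .
    next
      case False
      have "\<bar>disc_avg f X - 2 / (3 * X) * (\<integral>t. f t \<partial>lborel)\<bar> \<le> 13 / X * M * (2 * A)"
        using disc_kernel_bounds by (intro key) (simp add: abs_le_iff, smt (verit))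
      also have "\<dots> = 26 * A * M * X powr (- 1)"
        using X by (simp add: powr_minus field_simps)
      also have "\<dots> \<le> C * X powr (- (7 / 4))"
        unfolding C_def using A M X False by (intro mult_mono powr_mono') auto
      finally show ?thesis .
    qed
  qed
  moreover have "C \<ge> 0" using A M by (simp add: C_def)
  ultimately show thesis using that by blast
qed

section \<open>Radial averages and the limit density\<close>

text \<open>
  The average of \<open>disc_kernel (a / r)\<close> over \<open>r\<close> in the unit interval.
\<close>
definition unit_rho :: "real \<Rightarrow> real" where
  "unit_rho a =
     (if a = 0 then 2 / 3
      else if \<bar>a\<bar> \<le> 1 then (arcsin \<bar>a\<bar> - \<bar>a\<bar> * (1 - 2 * a\<^sup>2) * sqrt (1 - a\<^sup>2)) / (4 * \<bar>a\<bar> ^ 3)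
      else pi / (8 * \<bar>a\<bar> ^ 3))"

text \<open>
  The integrand has the primitive \<open>F\<close>, which is built from \<open>P\<close> for \<open>r > v\<close> and is a quartic for \<open>r \<le> v\<close>, where the kernel is a cubic in \<open>r\<close>.
\<close>
lemma has_integral_disc_kernel_pos:
  assumes v: "v > 0"
  shows "((\<lambda>r. disc_kernel (v / r)) has_integral unit_rho v) {0..1}"
proof -
  define P where "P u = arcsin u - u * (1 - 2 * u\<^sup>2) * sqrt (1 - u\<^sup>2)" for u :: real
  have P': "(P has_real_derivative 8 * u\<^sup>2 * sqrt (1 - u\<^sup>2)) (at u)" if u: "\<bar>u\<bar> < 1" for u
  proof -
    have u2: "1 - u\<^sup>2 > 0" using u by (simp add: abs_square_less_1)
    define q where "q = sqrt (1 - u\<^sup>2)"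
    have q: "q > 0" "u\<^sup>2 = 1 - q * q" using u2 by (simp_all add: q_def)
    have "(P has_real_derivative inverse q -
       ((1 * (1 - 2 * u\<^sup>2) + u * (- (2 * (2 * u)))) * q + u * (1 - 2 * u\<^sup>2) * (- (2 * u) * (inverse q / 2)))) (at u)"
      unfolding P_def q_def using u u2
      by (auto intro!: derivative_eq_intros simp: abs_less_iff)
    also have "inverse q - ((1 * (1 - 2 * u\<^sup>2) + u * (- (2 * (2 * u)))) * q + u * (1 - 2 * u\<^sup>2) * (- (2 * u) * (inverse q / 2)))
      = inverse q - ((1 - 2 * u\<^sup>2) - 4 * u\<^sup>2) * q + u\<^sup>2 * (1 - 2 * u\<^sup>2) * inverse q"
      by (simp add: algebra_simps power2_eq_square)
    also have "\<dots> = 8 * u\<^sup>2 * q"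
      unfolding q(2) using q(1) by (simp add: field_simps)
    finally show ?thesis unfolding q_def .
  qed
  define F where "F r = (if r \<le> v then pi * r ^ 4 / (8 * v ^ 3) else r ^ 4 * P (v / r) / (4 * v ^ 3))" for r
  have "((\<lambda>r. disc_kernel (v / r)) has_integral (F 1 - F 0)) {0..1}"
  proof (rule fundamental_theorem_of_calculus_interior_strong[of "{v}"])
    have "continuous_on ({0..1} \<inter> {..v} \<union> {0..1} \<inter> {v..}) F"
      unfolding F_def
    proof (rule continuous_on_If)
      show "continuous_on ({0..1} \<inter> {..v}) (\<lambda>r. pi * r ^ 4 / (8 * v ^ 3))"
        using v by (intro continuous_intros) auto
      have "v / r \<in> {-1..1}" if "r \<in> {0..1} \<inter> {v..}" for r
      proof -
        have "r > 0" "v \<le> r" using that v by auto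
        then have "0 \<le> v / r" "v / r \<le> 1" using v by (auto simp: divide_le_eq_1)
        then show ?thesis by simp
      qed
      then show "continuous_on ({0..1} \<inter> {v..}) (\<lambda>r. r ^ 4 * P (v / r) / (4 * v ^ 3))"
        unfolding P_def using v by (intro continuous_intros) auto
      fix r assume "r \<in> {0..1} \<inter> {v..}" "r \<le> v"
      then have "r = v" by auto
      then show "pi * r ^ 4 / (8 * v ^ 3) = r ^ 4 * P (v / r) / (4 * v ^ 3)"
        using v by (simp add: P_def)
    next
      fix r assume "r \<in> {0..1} \<inter> {..v}" "\<not> r \<le> v"
      then show "pi * r ^ 4 / (8 * v ^ 3) = r ^ 4 * P (v / r) / (4 * v ^ 3)" by auto
    qed auto
    also have "{0..1} \<inter> {..v} \<union> {0..1} \<inter> {v..} = {0..1}" by auto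
    finally show "continuous_on {0..1} F" .
    fix r assume r: "r \<in> {0<..<1} - {v}"
    show "(F has_vector_derivative disc_kernel (v / r)) (at r)"
    proof (cases "r < v")
      case True
      have "((\<lambda>r. pi * r ^ 4 / (8 * v ^ 3)) has_real_derivative pi * (4 * r ^ 3) / (8 * v ^ 3)) (at r)"
        by (rule DERIV_cdivide) (auto intro!: derivative_eq_intros)
      moreover have "pi * (4 * r ^ 3) / (8 * v ^ 3) = disc_kernel (v / r)"
      proof -
        have "\<not> v / r \<le> 1" using True r by (simp add: divide_le_eq_1)
        then show ?thesis
          using v r by (simp add: disc_kernel_def power_divide)
      qed
      ultimately have "((\<lambda>r. pi * r ^ 4 / (8 * v ^ 3)) has_real_derivative disc_kernel (v / r)) (at r)" by simp
      then have "(F has_real_derivative disc_kernel (v / r)) (at r)"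
        by (rule has_field_derivative_transform_within_open[of _ _ _ "{..<v}"]) (use True in \<open>auto simp: F_def\<close>)
      then show ?thesis by (simp add: has_real_derivative_iff_has_vector_derivative)
    next
      case False
      define u where "u = v / r"
      have rv: "r > v" "r > 0" using False r by auto
      have u: "0 < u" "u < 1" using rv v by (simp_all add: u_def)
      define q where "q = sqrt (1 - u\<^sup>2)"
      have du: "((\<lambda>r. v / r) has_real_derivative - v / r\<^sup>2) (at r)"
        using rv by (auto intro!: derivative_eq_intros simp: power2_eq_square)
      have "((\<lambda>r. P (v / r)) has_real_derivative (8 * u\<^sup>2 * q) * (- v / r\<^sup>2)) (at r)"
        unfolding u_def q_def by (rule DERIV_chain2[OF P' du]) (use u in \<open>simp add: u_def\<close>)
      moreover have "((\<lambda>r. r ^ 4) has_real_derivative 4 * r ^ 3) (at r)"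
        by (auto intro!: derivative_eq_intros)
      ultimately have "((\<lambda>r. r ^ 4 * P (v / r)) has_real_derivative
         4 * r ^ 3 * P u + (8 * u\<^sup>2 * q) * (- v / r\<^sup>2) * r ^ 4) (at r)"
        unfolding u_def by (rule DERIV_mult[rotated])
      then have "((\<lambda>r. r ^ 4 * P (v / r) / (4 * v ^ 3)) has_real_derivative
         (4 * r ^ 3 * P u + r ^ 4 * ((8 * u\<^sup>2 * q) * (- v / r\<^sup>2))) / (4 * v ^ 3)) (at r)"
        unfolding mult.commute[of "r ^ 4" "8 * u\<^sup>2 * q * (- v / r\<^sup>2)"] by (rule DERIV_cdivide)
      moreover have "(4 * r ^ 3 * P u + r ^ 4 * ((8 * u\<^sup>2 * q) * (- v / r\<^sup>2))) / (4 * v ^ 3) = disc_kernel u"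
      proof -
        have vr: "v = u * r" using rv by (simp add: u_def)
        have "(4 * r ^ 3 * P u + r ^ 4 * ((8 * u\<^sup>2 * q) * (- v / r\<^sup>2))) / (4 * v ^ 3)
          = (P u - 2 * u ^ 3 * q) / u ^ 3"
          unfolding vr using rv u by (simp add: field_simps power_mult_distrib numeral_eq_Suc)
        also have "P u - 2 * u ^ 3 * q = arcsin u - u * sqrt (1 - u\<^sup>2) + 2 * u ^ 3 * q - 2 * u ^ 3 * q"
          by (simp add: P_def q_def algebra_simps power2_eq_square power3_eq_cube)
        finally show ?thesis using u by (simp add: disc_kernel_def)
      qed
      ultimately have "((\<lambda>r. r ^ 4 * P (v / r) / (4 * v ^ 3)) has_real_derivative disc_kernel (v / r)) (at r)"
        by (simp add: u_def)
      then have "(F has_real_derivative disc_kernel (v / r)) (at r)"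
        by (rule has_field_derivative_transform_within_open[of _ _ _ "{v<..}"]) (use rv in \<open>auto simp: F_def\<close>)
      then show ?thesis by (simp add: has_real_derivative_iff_has_vector_derivative)
    qed
  qed auto
  moreover have "F 1 - F 0 = unit_rho v"
  proof (cases "v \<le> 1")
    case True
    then show ?thesis using v by (cases "v = 1") (auto simp: F_def unit_rho_def P_def)
  next
    case False
    then show ?thesis using v by (simp add: F_def unit_rho_def)
  qed
  ultimately show ?thesis by simp
qed

lemma disc_kernel_abs: "disc_kernel \<bar>u\<bar> = disc_kernel u"
  by (simp add: disc_kernel_def)

lemma integral_disc_kernel:
  "(\<integral>r. indicator {0..1} r * disc_kernel (a / r) \<partial>lborel) = unit_rho a"
proof -
  have "((\<lambda>r. disc_kernel (a / r)) has_integral unit_rho a) {0..1}"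
  proof (cases "a = 0")
    case True
    then show ?thesis
      using has_integral_const_real[of "2 / 3" 0 1] by (simp add: disc_kernel_def unit_rho_def)
  next
    case False
    have "((\<lambda>r. disc_kernel (\<bar>a\<bar> / r)) has_integral unit_rho \<bar>a\<bar>) {0..1}"
      using False by (intro has_integral_disc_kernel_pos) simp
    moreover have "disc_kernel (\<bar>a\<bar> / r) = disc_kernel (a / r)" for r
      using disc_kernel_abs[of "\<bar>a\<bar> / r"] disc_kernel_abs[of "a / r"] by (simp add: abs_divide)
    moreover have "unit_rho \<bar>a\<bar> = unit_rho a" by (simp add: unit_rho_def)
    ultimately show ?thesis by simp
  qed
  moreover have "set_integrable lborel {0..1} (\<lambda>r. disc_kernel (a / r))"
    unfolding set_integrable_def
  proof (rule integrable_bounded_support[of _ 13 1])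
    show "\<bar>indicator {0..1} r *\<^sub>R disc_kernel (a / r)\<bar> \<le> 13" for r
      using disc_kernel_bounds[of "a / r"] by (simp add: indicator_def)
  qed (auto simp: indicator_def)
  ultimately show ?thesis
    using set_borel_integral_eq_integral(2)[of "{0..1}" "\<lambda>r. disc_kernel (a / r)"]
    by (simp add: set_lebesgue_integral_def integral_unique)
qed

lemma unit_rho_measurable [measurable]: "unit_rho \<in> borel_measurable borel"
  unfolding integral_disc_kernel[symmetric, abs_def] by measurable

lemma unit_rho_bounds: "0 \<le> unit_rho a" "unit_rho a \<le> 13"
proof -
  show "0 \<le> unit_rho a"
    unfolding integral_disc_kernel[symmetric] using disc_kernel_bounds(1)
    by (intro Bochner_Integration.integral_nonneg) simp
  have "(\<integral>r. indicator {0..1} r * disc_kernel (a / r) \<partial>lborel) \<le> (\<integral>r. indicator {0..1::real} r * 13 \<partial>lborel)"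
  proof (rule integral_mono)
    show "integrable lborel (\<lambda>r. indicator {0..1} r * disc_kernel (a / r))"
      using disc_kernel_bounds by (intro integrable_bounded_support[of _ 13 1]) (auto simp: indicator_def)
    show "integrable lborel (\<lambda>r. indicator {0..1::real} r * (13::real))"
      by (rule integrable_indicator_Icc_const)
  qed (use disc_kernel_bounds(3) in \<open>auto simp: indicator_def\<close>)
  then show "unit_rho a \<le> 13"
    unfolding integral_disc_kernel by simp
qed

lemma disc_avg_measurable:
  assumes [measurable]: "f \<in> borel_measurable borel"
  shows "disc_avg f \<in> borel_measurable borel"
proof -
  interpret plane: sigma_finite_measure plane
    by (rule lborel_pair.sigma_finite_measure_axioms)
  show ?thesis
    unfolding disc_avg_def[abs_def] by measurable
qed

text \<open>
  In polar coordinates the weight \<open>2 \<pi> r\<close> cancels the factor \<open>1 / (2 l r)\<close> of the kernel formula up to \<open>\<pi> / l\<close>; after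
  exchanging the integrals, the inner one is the radial average of the kernel.
\<close>
lemma integral_disc_avg_radial:
  fixes f :: "real \<Rightarrow> real"
  assumes meas [measurable]: "f \<in> borel_measurable borel" and bound: "\<And>t. \<bar>f t\<bar> \<le> M"
    and supp: "\<And>t. \<bar>t\<bar> > A \<Longrightarrow> f t = 0" and l: "l > 0"
  shows "(\<integral>z. indicator unit_disc z * disc_avg f (2 * l * sqrt ((fst z)\<^sup>2 + (snd z)\<^sup>2)) \<partial>plane) =
    pi / l * (\<integral>t. unit_rho (t / (2 * l)) * f t \<partial>lborel)"
proof -
  note [measurable] = disc_avg_measurable[OF meas]
  have M: "M \<ge> 0" using bound[of 0] by linarith
  define h where "h r t = indicator {0..1} r * disc_kernel (t / (2 * l) / r) * f t" for r t :: real
  have [measurable]: "case_prod h \<in> borel_measurable plane"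
    unfolding h_def split_beta' by measurable
  have "(\<integral>z. indicator unit_disc z * disc_avg f (2 * l * sqrt ((fst z)\<^sup>2 + (snd z)\<^sup>2)) \<partial>plane)
      = (\<integral>r. indicator {0..1} r * (2 * pi * r) * disc_avg f (2 * l * r) \<partial>lborel)"
    by (rule integral_disc_radial) measurable
  also have "\<dots> = (\<integral>r. pi / l * (\<integral>t. h r t \<partial>lborel) \<partial>lborel)"
  proof (rule integral_cong_AE)
    show "AE r in lborel. indicator {0..1} r * (2 * pi * r) * disc_avg f (2 * l * r) = pi / l * (\<integral>t. h r t \<partial>lborel)"
      using AE_lborel_singleton[of "0::real"]
    proof eventually_elim
      case (elim r)
      show ?case
      proof (cases "r \<in> {0..1}")
        case True
        then have r: "2 * l * r > 0" using elim l by auto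
        have "disc_avg f (2 * l * r) = (\<integral>t. (1 / (2 * l * r)) * (disc_kernel (t / (2 * l) / r) * f t) \<partial>lborel)"
          unfolding disc_avg_eq_kernel[OF meas r] by (intro Bochner_Integration.integral_cong) simp_all
        then have "disc_avg f (2 * l * r) = (1 / (2 * l * r)) * (\<integral>t. disc_kernel (t / (2 * l) / r) * f t \<partial>lborel)"
          by simp
        then show ?thesis
          using True r l elim by (simp add: h_def)
      next
        case False
        then show ?thesis by (simp add: h_def)
      qed
    qed
  qed measurable
  also have "\<dots> = pi / l * (\<integral>r. \<integral>t. h r t \<partial>lborel \<partial>lborel)"
    by simp
  also have "(\<integral>r. \<integral>t. h r t \<partial>lborel \<partial>lborel) = (\<integral>t. \<integral>r. h r t \<partial>lborel \<partial>lborel)"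
  proof (rule lborel_pair.Fubini_integral[symmetric])
    show "integrable plane (case_prod h)"
    proof (rule Bochner_Integration.integrable_bound)
      have "emeasure plane ({0..1} \<times> {-A..A}) = emeasure lborel {0..1::real} * emeasure lborel {-A..A}"
        by (rule lborel.emeasure_pair_measure_Times) auto
      then have fin: "emeasure plane ({0..1} \<times> {-A..A}) < \<infinity>"
        by (simp add: emeasure_lborel_Icc_eq)
      show "integrable plane (\<lambda>z. indicator ({0..1} \<times> {-A..A}) z * (13 * M))"
        using fin by (intro integrable_mult_left integrable_real_indicator) auto
      show "AE z in plane. norm (case_prod h z) \<le> norm (indicator ({0..1} \<times> {-A..A}) z * (13 * M))"
      proof (rule AE_I2)
        fix z :: "real \<times> real"
        obtain r t where z: "z = (r, t)" by (cases z)
        have "\<bar>h r t\<bar> \<le> indicator ({0..1} \<times> {-A..A}) z * (13 * M)"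
        proof (cases "r \<in> {0..1} \<and> \<bar>t\<bar> \<le> A")
          case True
          have "\<bar>disc_kernel (t / (2 * l) / r) * f t\<bar> \<le> 13 * M"
            unfolding abs_mult using disc_kernel_bounds[of "t / (2 * l) / r"] bound[of t]
            by (intro mult_mono) auto
          with True show ?thesis by (auto simp: h_def z indicator_def abs_mult)
        next
          case False
          then show ?thesis using supp[of t] by (auto simp: h_def z indicator_def)
        qed
        then show "norm (case_prod h z) \<le> norm (indicator ({0..1} \<times> {-A..A}) z * (13 * M))"
          using M by (simp add: z)
      qed
    qed measurable
  qed
  also have "\<dots> = (\<integral>t. unit_rho (t / (2 * l)) * f t \<partial>lborel)"
    unfolding h_def by (simp add: integral_disc_kernel del: divide_divide_eq_left)
  finally show ?thesis .
qed

lemma disc_avg_radial_lipschitz: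
  assumes meas: "f \<in> borel_measurable borel" and bound: "\<And>t. \<bar>f t\<bar> \<le> M"
    and lip: "\<And>s t. \<bar>f s - f t\<bar> \<le> L * \<bar>s - t\<bar>"
  shows "\<bar>(\<integral>z. indicator unit_disc z * disc_avg f (k * sqrt ((fst z)\<^sup>2 + (snd z)\<^sup>2)) \<partial>plane) -
     (\<integral>z. indicator unit_disc z * disc_avg f (l * sqrt ((fst z)\<^sup>2 + (snd z)\<^sup>2)) \<partial>plane)\<bar> \<le> 2 * pi\<^sup>2 * L * \<bar>k - l\<bar>"
proof -
  note [measurable] = disc_avg_measurable[OF meas]
  have L: "0 \<le> L" using lip[of 1 0] by simp
  define h where "h k z = indicator unit_disc z * disc_avg f (k * sqrt ((fst z)\<^sup>2 + (snd z)\<^sup>2))" for k and z :: "real \<times> real"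
  have int: "integrable plane (h k)" for k
    unfolding h_def
    by (rule integrable_disc_bounded[of _ "pi * M"]) (auto intro: disc_avg_bounded[OF meas bound])
  have eq: "(\<integral>z. h k z \<partial>plane) - (\<integral>z. h l z \<partial>plane) = (\<integral>z. h k z - h l z \<partial>plane)"
    by (rule Bochner_Integration.integral_diff[symmetric]) (rule int)+
  have "\<bar>(\<integral>z. h k z \<partial>plane) - (\<integral>z. h l z \<partial>plane)\<bar> \<le> (\<integral>z. \<bar>h k z - h l z\<bar> \<partial>plane)"
    unfolding eq by (rule integral_abs_bound)
  also have "\<dots> \<le> (\<integral>z. indicator unit_disc z * (2 * pi * L * \<bar>k - l\<bar>) \<partial>plane)"
  proof (rule integral_mono)
    show "integrable plane (\<lambda>z. \<bar>h k z - h l z\<bar>)"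
      by (intro integrable_abs Bochner_Integration.integrable_diff int)
    show "integrable plane (\<lambda>z. indicator unit_disc z * (2 * pi * L * \<bar>k - l\<bar>))"
      by (rule integral_disc_const)
    fix z :: "real \<times> real"
    define r where "r = sqrt ((fst z)\<^sup>2 + (snd z)\<^sup>2)"
    show "\<bar>h k z - h l z\<bar> \<le> indicator unit_disc z * (2 * pi * L * \<bar>k - l\<bar>)"
    proof (cases "z \<in> unit_disc")
      case True
      then have r: "0 \<le> r" "r \<le> 1" by (simp_all add: r_def)
      have "\<bar>disc_avg f (k * r) - disc_avg f (l * r)\<bar> \<le> 2 * pi * L * \<bar>k * r - l * r\<bar>"
        using meas bound lip by (rule disc_avg_lipschitz)
      also have "\<bar>k * r - l * r\<bar> = \<bar>k - l\<bar> * r"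
        using r by (simp add: abs_mult flip: left_diff_distrib)
      also have "2 * pi * L * (\<bar>k - l\<bar> * r) \<le> 2 * pi * L * (\<bar>k - l\<bar> * 1)"
        using L r by (intro mult_left_mono) auto
      finally show ?thesis
        using True by (simp add: h_def r_def)
    qed (simp add: h_def)
  qed
  also have "\<dots> = pi * (2 * pi * L * \<bar>k - l\<bar>)"
    by (rule integral_disc_const)
  finally show ?thesis
    by (simp add: h_def power2_eq_square mult_ac)
qed

lemma rho_eq_unit_rho:
  assumes l: "l > 0"
  shows "rho K l t = 4 * pi / \<bar>real_of_int (disc K)\<bar> * unit_rho (t / (2 * l))"
proof (cases "t = 0")
  case True
  then show ?thesis by (simp add: rho_def unit_rho_def)
next
  case False
  define a where "a = \<bar>t\<bar> / (2 * l)"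
  have a: "a > 0" "\<bar>t\<bar> = 2 * l * a" "\<bar>t / (2 * l)\<bar> = a" "(t / (2 * l))\<^sup>2 = a\<^sup>2"
    using False l by (simp_all add: a_def power_divide)
  have le: "\<bar>t\<bar> \<le> 2 * l \<longleftrightarrow> a \<le> 1"
    using l by (simp add: a_def)
  have sq: "\<bar>t\<bar>\<^sup>2 / (2 * l\<^sup>2) = 2 * a\<^sup>2" "\<bar>t\<bar>\<^sup>2 / (4 * l\<^sup>2) = a\<^sup>2"
    unfolding a(2) using l by (simp_all add: power_mult_distrib)
  have cube: "l ^ 3 / \<bar>t\<bar> ^ 3 = 1 / (8 * a ^ 3)"
    unfolding a(2) using l a(1) by (simp add: power_mult_distrib)
  define D where "D = \<bar>real_of_int (disc K)\<bar>"
  have "rho K l t = (if a \<le> 1 then 8 * pi / D * (l ^ 3 / \<bar>t\<bar> ^ 3) * (arcsin a - a * (1 - 2 * a\<^sup>2) * sqrt (1 - a\<^sup>2))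
      else 4 * pi\<^sup>2 / D * (l ^ 3 / \<bar>t\<bar> ^ 3))"
    unfolding rho_def Let_def le sq D_def[symmetric] a_def[symmetric] using False by simp
  also have "\<dots> = 4 * pi / D * unit_rho (t / (2 * l))"
    unfolding cube unit_rho_def a(3) a(4) using False l by (simp add: power2_eq_square)
  finally show ?thesis unfolding D_def .
qed

section \<open>Lattice points and areas\<close>

definition lat :: "complex \<Rightarrow> complex set" where
  "lat \<tau> = (\<lambda>(m, n). of_int m + of_int n * \<tau>) ` (UNIV :: (int \<times> int) set)"

text \<open>
  The plane is parametrized by the coordinates with respect to \<open>1\<close> and \<open>\<tau>\<close>.  In these coordinates the cells of the lattice are unit
  squares, so that each lattice point carries measure one.
\<close>
definition lat_point :: "complex \<Rightarrow> real \<times> real \<Rightarrow> complex" where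
  "lat_point \<tau> z = of_real (fst z) + of_real (snd z) * \<tau>"

text \<open>
  The lattice point to whose cell a point belongs.
\<close>
definition lat_floor :: "complex \<Rightarrow> real \<times> real \<Rightarrow> complex" where
  "lat_floor \<tau> z = of_int \<lfloor>fst z\<rfloor> + of_int \<lfloor>snd z\<rfloor> * \<tau>"

lemma lat_point_measurable [measurable]: "lat_point \<tau> \<in> borel_measurable plane"
  unfolding lat_point_def by measurable

locale lattice =
  fixes \<tau> :: complex
  assumes Im_pos: "Im \<tau> > 0"
    and norm_ge_1: "\<And>w. w \<in> lat \<tau> \<Longrightarrow> w \<noteq> 0 \<Longrightarrow> 1 \<le> cmod w"
begin

text \<open>
  An upper bound for the diameter of a cell.
\<close>
definition diam :: real where "diam = 1 + cmod \<tau>"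

lemma diam_ge_1: "diam \<ge> 1"
  by (simp add: diam_def)

lemma lat_floor_in_lat: "lat_floor \<tau> z \<in> lat \<tau>"
  unfolding lat_floor_def lat_def by (rule image_eqI[of _ _ "(\<lfloor>fst z\<rfloor>, \<lfloor>snd z\<rfloor>)"]) auto

lemma dist_lat_floor: "cmod (lat_point \<tau> z - lat_floor \<tau> z) \<le> diam"
proof -
  have "lat_point \<tau> z - lat_floor \<tau> z = of_real (fst z - of_int \<lfloor>fst z\<rfloor>) + of_real (snd z - of_int \<lfloor>snd z\<rfloor>) * \<tau>"
    by (simp add: lat_point_def lat_floor_def algebra_simps)
  also have "cmod \<dots> \<le> \<bar>fst z - of_int \<lfloor>fst z\<rfloor>\<bar> + \<bar>snd z - of_int \<lfloor>snd z\<rfloor>\<bar> * cmod \<tau>"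
    by (rule order_trans[OF norm_triangle_ineq]) (simp add: norm_mult del: of_real_diff)
  also have "\<dots> \<le> 1 + 1 * cmod \<tau>"
    by (intro add_mono mult_right_mono) (auto simp: abs_le_iff, linarith+)
  finally show ?thesis by (simp add: diam_def)
qed

lemma norm_lat_floor_bounds:
  "cmod (lat_floor \<tau> z) \<le> cmod (lat_point \<tau> z) + diam"
  "cmod (lat_point \<tau> z) \<le> cmod (lat_floor \<tau> z) + diam"
  using dist_lat_floor[of z] norm_triangle_sub[of "lat_point \<tau> z" "lat_floor \<tau> z"]
    norm_triangle_sub[of "lat_floor \<tau> z" "lat_point \<tau> z"]
  by (simp_all add: norm_minus_commute)

lemma coordinate_bounds:
  fixes m n :: int
  defines "\<kappa> \<equiv> 1 + (1 + cmod \<tau>) / Im \<tau>"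
  shows "\<bar>of_int m\<bar> \<le> \<kappa> * cmod (of_int m + of_int n * \<tau>)" "\<bar>of_int n\<bar> \<le> \<kappa> * cmod (of_int m + of_int n * \<tau>)"
proof -
  define w where "w = of_int m + of_int n * \<tau>"
  have "\<bar>of_int n\<bar> * Im \<tau> = \<bar>Im w\<bar>"
    using Im_pos by (simp add: w_def abs_mult)
  also have "\<dots> \<le> cmod w" by (rule abs_Im_le_cmod)
  finally have n: "\<bar>of_int n\<bar> \<le> cmod w / Im \<tau>"
    using Im_pos by (simp add: pos_le_divide_eq)
  have "\<bar>of_int m\<bar> = cmod (w - of_int n * \<tau>)"
    by (simp add: w_def)
  also have "\<dots> \<le> cmod w + \<bar>of_int n\<bar> * cmod \<tau>"
    by (rule order_trans[OF norm_triangle_ineq4]) (simp add: norm_mult)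
  also have "\<dots> \<le> cmod w + cmod w / Im \<tau> * cmod \<tau>"
    using n by (intro add_left_mono mult_right_mono) auto
  also have "\<dots> \<le> \<kappa> * cmod w"
    using Im_pos by (simp add: \<kappa>_def field_simps)
  finally show "\<bar>of_int m\<bar> \<le> \<kappa> * cmod (of_int m + of_int n * \<tau>)" unfolding w_def .
  have "cmod w / Im \<tau> \<le> \<kappa> * cmod w"
    using Im_pos by (simp add: \<kappa>_def field_simps)
  with n show "\<bar>of_int n\<bar> \<le> \<kappa> * cmod (of_int m + of_int n * \<tau>)" unfolding w_def by linarith
qed

lemma finite_int_abs_le: "finite {k::int. \<bar>of_int k\<bar> \<le> (x::real)}"
  by (rule finite_subset[of _ "{- \<lfloor>x\<rfloor>..\<lfloor>x\<rfloor>}"]) (auto simp: abs_le_iff le_floor_iff floor_le_iff minus_le_iff)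

lemma finite_lat_ball: "finite {w \<in> lat \<tau>. cmod w \<le> R}"
proof -
  define \<kappa> where "\<kappa> = 1 + (1 + cmod \<tau>) / Im \<tau>"
  have \<kappa>: "\<kappa> \<ge> 0" using Im_pos by (simp add: \<kappa>_def)
  define S where "S = {k::int. \<bar>of_int k\<bar> \<le> \<kappa> * R}"
  have "{w \<in> lat \<tau>. cmod w \<le> R} \<subseteq> (\<lambda>(m, n). of_int m + of_int n * \<tau>) ` (S \<times> S)"
  proof
    fix w assume w: "w \<in> {w \<in> lat \<tau>. cmod w \<le> R}"
    then obtain m n :: int where mn: "w = of_int m + of_int n * \<tau>"
      by (auto simp: lat_def)
    have "\<kappa> * cmod w \<le> \<kappa> * R" using w \<kappa> by (intro mult_left_mono) auto
    then have "m \<in> S" "n \<in> S"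
      using coordinate_bounds(1)[of m n] coordinate_bounds(2)[where m = m and n = n]
      unfolding S_def mn \<kappa>_def by auto
    then show "w \<in> (\<lambda>(m, n). of_int m + of_int n * \<tau>) ` (S \<times> S)"
      unfolding mn by (intro image_eqI[of _ _ "(m, n)"]) auto
  qed
  moreover have "finite S" unfolding S_def by (rule finite_int_abs_le)
  ultimately show ?thesis by (auto intro: finite_subset)
qed

lemma lat_cell_eq:
  fixes m n :: int
  shows "{z. lat_floor \<tau> z = of_int m + of_int n * \<tau>} = {of_int m..<of_int m + 1} \<times> {of_int n..<of_int n + 1}"
proof (intro set_eqI)
  fix z :: "real \<times> real"
  have "lat_floor \<tau> z = of_int m + of_int n * \<tau> \<longleftrightarrow> \<lfloor>fst z\<rfloor> = m \<and> \<lfloor>snd z\<rfloor> = n"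
    using Im_pos unfolding lat_floor_def by (auto simp: complex_eq_iff)
  also have "\<dots> \<longleftrightarrow> z \<in> {of_int m..<of_int m + 1} \<times> {of_int n..<of_int n + 1}"
    by (cases z) (auto simp: floor_eq_iff)
  finally show "z \<in> {z. lat_floor \<tau> z = of_int m + of_int n * \<tau>} \<longleftrightarrow> z \<in> {of_int m..<of_int m + 1} \<times> {of_int n..<of_int n + 1}"
    by simp
qed

lemma lat_cell:
  assumes "w \<in> lat \<tau>"
  shows "{z. lat_floor \<tau> z = w} \<in> sets plane" "emeasure plane {z. lat_floor \<tau> z = w} = 1"
    "integrable plane (\<lambda>z. indicator {z. lat_floor \<tau> z = w} z * (c::real))"
    "(\<integral>z. indicator {z. lat_floor \<tau> z = w} z * c \<partial>plane) = c"
proof -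
  obtain m n :: int where mn: "w = of_int m + of_int n * \<tau>"
    using assms by (auto simp: lat_def)
  show s: "{z. lat_floor \<tau> z = w} \<in> sets plane"
    unfolding mn lat_cell_eq by (rule pair_measureI) auto
  have "emeasure plane ({of_int m..<of_int m + 1} \<times> {of_int n..<of_int n + 1}) =
     emeasure lborel {real_of_int m..<of_int m + 1} * emeasure lborel {real_of_int n..<of_int n + 1}"
    by (rule lborel.emeasure_pair_measure_Times) auto
  then show e: "emeasure plane {z. lat_floor \<tau> z = w} = 1"
    unfolding mn lat_cell_eq by simp
  have i: "integrable plane (indicator {z. lat_floor \<tau> z = w} :: _ \<Rightarrow> real)"
    by (rule integrable_real_indicator[OF s]) (simp add: e)
  then show "integrable plane (\<lambda>z. indicator {z. lat_floor \<tau> z = w} z * (c::real))"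
    by (rule integrable_mult_left)
  show "(\<integral>z. indicator {z. lat_floor \<tau> z = w} z * c \<partial>plane) = c"
    using s e by (simp add: measure_def)
qed

text \<open>
  A lattice sum is compared with the integral cell by cell: the cell of a lattice point has measure one,
  so the error is at most the sum of the oscillations of \<open>h\<close> over the cells.
\<close>
lemma sum_lattice_integral_compare:
  fixes h :: "complex \<Rightarrow> real"
  assumes meas: "(\<lambda>z. h (lat_point \<tau> z)) \<in> borel_measurable plane"
    and W: "finite W" "W \<subseteq> lat \<tau>"
    and close: "\<And>z. lat_floor \<tau> z \<in> W \<Longrightarrow> \<bar>h (lat_floor \<tau> z) - h (lat_point \<tau> z)\<bar> \<le> e (lat_floor \<tau> z)"
    and zero: "\<And>z. lat_floor \<tau> z \<notin> W \<Longrightarrow> h (lat_point \<tau> z) = 0"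
  shows "\<bar>(\<Sum>w\<in>W. h w) - (\<integral>z. h (lat_point \<tau> z) \<partial>plane)\<bar> \<le> (\<Sum>w\<in>W. e w)"
proof -
  note [measurable] = meas
  let ?I = "\<lambda>w z. indicator {z. lat_floor \<tau> z = w} z :: real"
  have int: "integrable plane (\<lambda>z. ?I w z * h (lat_point \<tau> z))" if w: "w \<in> W" for w
  proof (rule Bochner_Integration.integrable_bound)
    show "integrable plane (\<lambda>z. ?I w z * (\<bar>h w\<bar> + e w))"
      using w W by (intro lat_cell) auto
    have [measurable]: "{z. lat_floor \<tau> z = w} \<in> sets plane"
      using w W by (intro lat_cell) auto
    show "(\<lambda>z. ?I w z * h (lat_point \<tau> z)) \<in> borel_measurable plane"
      by measurable
    show "AE z in plane. norm (?I w z * h (lat_point \<tau> z)) \<le> norm (?I w z * (\<bar>h w\<bar> + e w))"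
    proof (rule AE_I2)
      fix z :: "real \<times> real"
      show "norm (?I w z * h (lat_point \<tau> z)) \<le> norm (?I w z * (\<bar>h w\<bar> + e w))"
        using close[of z] w by (cases "lat_floor \<tau> z = w") auto
    qed
  qed
  have "h (lat_point \<tau> z) = (\<Sum>w\<in>W. ?I w z * h (lat_point \<tau> z))" for z
  proof (cases "lat_floor \<tau> z \<in> W")
    case True
    have "(\<Sum>w\<in>W. ?I w z * h (lat_point \<tau> z)) = (\<Sum>w\<in>W. if w = lat_floor \<tau> z then h (lat_point \<tau> z) else 0)"
      by (intro sum.cong) (auto simp: indicator_def)
    then show ?thesis using True W(1) by simp
  next
    case False
    then have "(\<Sum>w\<in>W. ?I w z * h (lat_point \<tau> z)) = 0"
      using zero by (intro sum.neutral) auto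
    then show ?thesis using zero[OF False] by simp
  qed
  then have "(\<integral>z. h (lat_point \<tau> z) \<partial>plane) = (\<integral>z. (\<Sum>w\<in>W. ?I w z * h (lat_point \<tau> z)) \<partial>plane)"
    by presburger
  also have "\<dots> = (\<Sum>w\<in>W. \<integral>z. ?I w z * h (lat_point \<tau> z) \<partial>plane)"
    by (rule Bochner_Integration.integral_sum) (rule int)
  finally have "(\<Sum>w\<in>W. h w) - (\<integral>z. h (lat_point \<tau> z) \<partial>plane) =
      (\<Sum>w\<in>W. h w - (\<integral>z. ?I w z * h (lat_point \<tau> z) \<partial>plane))"
    by (simp add: sum_subtractf)
  also have "\<bar>\<dots>\<bar> \<le> (\<Sum>w\<in>W. \<bar>h w - (\<integral>z. ?I w z * h (lat_point \<tau> z) \<partial>plane)\<bar>)"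
    by (rule sum_abs)
  also have "\<dots> \<le> (\<Sum>w\<in>W. e w)"
  proof (rule sum_mono)
    fix w assume w: "w \<in> W"
    then have wl: "w \<in> lat \<tau>" using W by auto
    have "h w - (\<integral>z. ?I w z * h (lat_point \<tau> z) \<partial>plane) = (\<integral>z. ?I w z * h w \<partial>plane) - (\<integral>z. ?I w z * h (lat_point \<tau> z) \<partial>plane)"
      by (simp only: lat_cell(4)[OF wl])
    also have "\<dots> = (\<integral>z. ?I w z * h w - ?I w z * h (lat_point \<tau> z) \<partial>plane)"
      by (intro Bochner_Integration.integral_diff[symmetric] int[OF w] lat_cell(3)[OF wl])
    finally have eq: "h w - (\<integral>z. ?I w z * h (lat_point \<tau> z) \<partial>plane) = (\<integral>z. ?I w z * h w - ?I w z * h (lat_point \<tau> z) \<partial>plane)" .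
    have "\<bar>h w - (\<integral>z. ?I w z * h (lat_point \<tau> z) \<partial>plane)\<bar> \<le> (\<integral>z. \<bar>?I w z * h w - ?I w z * h (lat_point \<tau> z)\<bar> \<partial>plane)"
      unfolding eq by (rule integral_abs_bound)
    also have "\<dots> \<le> (\<integral>z. ?I w z * e w \<partial>plane)"
    proof (rule integral_mono)
      show "integrable plane (\<lambda>z. \<bar>?I w z * h w - ?I w z * h (lat_point \<tau> z)\<bar>)"
        by (intro integrable_abs Bochner_Integration.integrable_diff int[OF w] lat_cell(3)[OF wl])
      show "integrable plane (\<lambda>z. ?I w z * e w)"
        by (rule lat_cell(3)[OF wl])
      fix z :: "real \<times> real"
      show "\<bar>?I w z * h w - ?I w z * h (lat_point \<tau> z)\<bar> \<le> ?I w z * e w"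
        using close[of z] w by (cases "lat_floor \<tau> z = w") auto
    qed
    also have "\<dots> = e w" by (rule lat_cell(4)[OF wl])
    finally show "\<bar>h w - (\<integral>z. ?I w z * h (lat_point \<tau> z) \<partial>plane)\<bar> \<le> e w" .
  qed
  finally show ?thesis .
qed

lemma card_le_area:
  assumes W: "finite W" "W \<subseteq> lat \<tau>" and S: "S \<in> sets plane" "emeasure plane S = ennreal s" "s \<ge> 0"
    and sub: "\<And>z. lat_floor \<tau> z \<in> W \<Longrightarrow> z \<in> S"
  shows "real (card W) \<le> s"
proof -
  have "ennreal (real (card W)) = (\<Sum>w\<in>W. emeasure plane {z. lat_floor \<tau> z = w})"
    using W lat_cell(2) by (subst sum.cong[OF refl, of W _ "\<lambda>_. 1"]) (auto simp: ennreal_of_nat_eq_real_of_nat)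
  also have "\<dots> = emeasure plane (\<Union>w\<in>W. {z. lat_floor \<tau> z = w})"
    using W lat_cell(1) by (intro sum_emeasure) (auto simp: disjoint_family_on_def)
  also have "\<dots> \<le> emeasure plane S"
    using sub by (intro emeasure_mono S) auto
  finally show ?thesis
    using S by simp
qed

lemma area_ball:
  assumes r: "r > 0"
  shows "{z. cmod (lat_point \<tau> z) \<le> r} \<in> sets plane"
    "emeasure plane {z. cmod (lat_point \<tau> z) \<le> r} = ennreal (pi * r\<^sup>2 / Im \<tau>)"
proof -
  have "{z \<in> space plane. cmod (lat_point \<tau> z) \<le> r} \<in> sets plane"
    by measurable
  then show [measurable]: "{z. cmod (lat_point \<tau> z) \<le> r} \<in> sets plane" by simp
  show "emeasure plane {z. cmod (lat_point \<tau> z) \<le> r} = ennreal (pi * r\<^sup>2 / Im \<tau>)"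
  proof -
    have det: "1 / r * (Im \<tau> / r) - Re \<tau> / r * 0 = Im \<tau> / r\<^sup>2"
      by (simp add: power2_eq_square)
    have "ennreal pi = (\<integral>\<^sup>+z. indicator unit_disc z \<partial>plane)"
      by (rule nn_integral_disc_power(1)[symmetric])
    also have "\<dots> = ennreal \<bar>1 / r * (Im \<tau> / r) - Re \<tau> / r * 0\<bar> *
        (\<integral>\<^sup>+z. indicator unit_disc (1 / r * fst z + Re \<tau> / r * snd z, 0 * fst z + Im \<tau> / r * snd z) \<partial>plane)"
      by (rule nn_integral_linear_plane) (use r Im_pos in \<open>auto simp: det\<close>)
    also have "(\<integral>\<^sup>+z. indicator unit_disc (1 / r * fst z + Re \<tau> / r * snd z, 0 * fst z + Im \<tau> / r * snd z) \<partial>plane)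
      = (\<integral>\<^sup>+z. indicator {z. cmod (lat_point \<tau> z) \<le> r} z \<partial>plane)"
    proof (rule nn_integral_cong)
      fix z :: "real \<times> real"
      have "(1 / r * fst z + Re \<tau> / r * snd z)\<^sup>2 + (0 * fst z + Im \<tau> / r * snd z)\<^sup>2 = (cmod (lat_point \<tau> z))\<^sup>2 / r\<^sup>2"
        using r by (simp add: lat_point_def cmod_power2 power_divide field_simps)
      moreover have "(cmod (lat_point \<tau> z))\<^sup>2 / r\<^sup>2 \<le> 1 \<longleftrightarrow> cmod (lat_point \<tau> z) \<le> r"
        using r by (simp add: divide_le_eq_1 power2_le_iff_abs_le abs_le_square_iff[symmetric])
      ultimately show "indicator unit_disc (1 / r * fst z + Re \<tau> / r * snd z, 0 * fst z + Im \<tau> / r * snd z) =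
         (indicator {z. cmod (lat_point \<tau> z) \<le> r} z :: ennreal)"
        by (simp add: indicator_def)
    qed
    also have "(\<integral>\<^sup>+z. indicator {z. cmod (lat_point \<tau> z) \<le> r} z \<partial>plane) = emeasure plane {z. cmod (lat_point \<tau> z) \<le> r}"
      by (rule nn_integral_indicator) measurable
    also have "\<bar>1 / r * (Im \<tau> / r) - Re \<tau> / r * 0\<bar> = Im \<tau> / r\<^sup>2"
      unfolding det using Im_pos by simp
    finally have "ennreal pi = ennreal (Im \<tau> / r\<^sup>2) * emeasure plane {z. cmod (lat_point \<tau> z) \<le> r}" .
    then have "ennreal (r\<^sup>2 / Im \<tau>) * ennreal pi = ennreal (r\<^sup>2 / Im \<tau> * (Im \<tau> / r\<^sup>2)) * emeasure plane {z. cmod (lat_point \<tau> z) \<le> r}"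
      using Im_pos r by (subst ennreal_mult') (simp_all add: mult.assoc)
    then show ?thesis
      using Im_pos r by (simp add: ennreal_mult''[symmetric] mult.commute)
  qed
qed

text \<open>
  Relative to \<open>b (b - a + 1)\<close> and the covolume, a bound for the area of the annulus from \<open>a\<close> to \<open>b\<close> enlarged by \<open>diam\<close> on both sides.
\<close>
definition ann_const :: real where
  "ann_const = pi * (1 + 2 * diam)\<^sup>2 / Im \<tau>"

lemma ann_const_pos: "ann_const > 0"
  using Im_pos diam_ge_1 by (simp add: ann_const_def)

text \<open>
  The cells of the lattice points in the annulus are disjoint and lie in the annulus enlarged by \<open>diam\<close>, whose area is computed.
  If \<open>a \<le> diam\<close>, the enlarged region is a full disc.
\<close>
lemma card_annulus:
  assumes ab: "0 \<le> a" "a \<le> b" "1 \<le> b"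
  shows "real (card {w \<in> lat \<tau>. a < cmod w \<and> cmod w \<le> b}) \<le> ann_const * (b * (b - a + 1))"
proof -
  define W where "W = {w \<in> lat \<tau>. a < cmod w \<and> cmod w \<le> b}"
  have W: "finite W" "W \<subseteq> lat \<tau>"
    using finite_lat_ball[of b] by (auto simp: W_def elim: finite_subset[rotated])
  define d where "d = diam"
  have d: "d \<ge> 1" using diam_ge_1 by (simp add: d_def)
  have outer: "cmod (lat_point \<tau> z) \<le> b + d" if "lat_floor \<tau> z \<in> W" for z
    using norm_lat_floor_bounds(2)[of z] that by (auto simp: W_def d_def)
  have inner: "a - d < cmod (lat_point \<tau> z)" if "lat_floor \<tau> z \<in> W" for z
    using norm_lat_floor_bounds(1)[of z] that by (auto simp: W_def d_def)
  have "real (card W) \<le> pi / Im \<tau> * ((1 + 2 * d)\<^sup>2 * (b * (b - a + 1)))"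
  proof (cases "a \<le> d")
    case True
    have "real (card W) \<le> pi * (b + d)\<^sup>2 / Im \<tau>"
      using Im_pos ab d outer by (intro card_le_area[OF W area_ball]) auto
    also have "\<dots> = pi / Im \<tau> * (b + d)\<^sup>2" by simp
    also have "\<dots> \<le> pi / Im \<tau> * ((1 + 2 * d)\<^sup>2 * (b * (b - a + 1)))"
    proof (rule mult_left_mono)
      have "b + d \<le> (1 + 2 * d) * b" using mult_mono[of 1 d 1 b] d ab by (simp add: algebra_simps)
      moreover have "b + d \<le> (1 + 2 * d) * (b - a + 1)"
      proof -
        have "a * d \<le> b * d" using d ab by (intro mult_right_mono) auto
        moreover have "(1 + 2 * d) * (b - a + 1) = b - a + 1 + 2 * (b * d) - 2 * (a * d) + 2 * d"
          by (simp add: algebra_simps)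
        ultimately show ?thesis using d ab True by linarith
      qed
      ultimately have "(b + d) * (b + d) \<le> ((1 + 2 * d) * b) * ((1 + 2 * d) * (b - a + 1))"
        using ab d by (intro mult_mono) auto
      then show "(b + d)\<^sup>2 \<le> (1 + 2 * d)\<^sup>2 * (b * (b - a + 1))"
        by (simp add: power2_eq_square mult_ac)
    qed (use Im_pos in simp)
    finally show ?thesis .
  next
    case False
    let ?B = "\<lambda>r. {z. cmod (lat_point \<tau> z) \<le> r}"
    have "emeasure plane (?B (b + d) - ?B (a - d)) = emeasure plane (?B (b + d)) - emeasure plane (?B (a - d))"
      using ab d False by (intro emeasure_Diff area_ball) (auto simp: area_ball)
    also have "\<dots> = ennreal (pi * (b + d)\<^sup>2 / Im \<tau> - pi * (a - d)\<^sup>2 / Im \<tau>)"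
      using ab d False Im_pos by (simp add: area_ball ennreal_minus)
    finally have em: "emeasure plane (?B (b + d) - ?B (a - d)) = ennreal (pi * (b + d)\<^sup>2 / Im \<tau> - pi * (a - d)\<^sup>2 / Im \<tau>)" .
    have eq: "pi * (b + d)\<^sup>2 / Im \<tau> - pi * (a - d)\<^sup>2 / Im \<tau> = pi / Im \<tau> * ((b + a) * (b - a + 2 * d))"
      by (simp add: power2_eq_square algebra_simps diff_divide_distrib add_divide_distrib)
    have "real (card W) \<le> pi * (b + d)\<^sup>2 / Im \<tau> - pi * (a - d)\<^sup>2 / Im \<tau>"
    proof (rule card_le_area[OF W _ em])
      show "?B (b + d) - ?B (a - d) \<in> sets plane"
        using ab d False by (intro sets.Diff area_ball) auto
      show "0 \<le> pi * (b + d)\<^sup>2 / Im \<tau> - pi * (a - d)\<^sup>2 / Im \<tau>"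
        unfolding eq using ab d Im_pos by simp
      show "z \<in> ?B (b + d) - ?B (a - d)" if "lat_floor \<tau> z \<in> W" for z
        using outer[OF that] inner[OF that] by auto
    qed
    also have "\<dots> \<le> pi / Im \<tau> * ((1 + 2 * d)\<^sup>2 * (b * (b - a + 1)))"
      unfolding eq
    proof (rule mult_left_mono)
      have "a * d \<le> b * d" using d ab by (intro mult_right_mono) auto
      moreover have "(1 + 2 * d) * (b - a + 1) = b - a + 1 + 2 * (b * d) - 2 * (a * d) + 2 * d"
        by (simp add: algebra_simps)
      ultimately have "b - a + 2 * d \<le> (1 + 2 * d) * (b - a + 1)"
        using d ab by linarith
      moreover have "b + a \<le> (1 + 2 * d) * b"
        using mult_mono[of 1 d a b] d ab by (simp add: algebra_simps)
      ultimately have "(b + a) * (b - a + 2 * d) \<le> ((1 + 2 * d) * b) * ((1 + 2 * d) * (b - a + 1))"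
        using ab d by (intro mult_mono) auto
      then show "(b + a) * (b - a + 2 * d) \<le> (1 + 2 * d)\<^sup>2 * (b * (b - a + 1))"
        by (simp add: power2_eq_square mult_ac)
    qed (use Im_pos in simp)
    finally show ?thesis .
  qed
  then show ?thesis by (simp add: W_def d_def ann_const_def)
qed

lemma card_punctured_ball:
  assumes "R \<ge> 1"
  shows "real (card {w \<in> lat \<tau>. 0 < cmod w \<and> cmod w \<le> R}) \<le> 2 * ann_const * R\<^sup>2"
proof -
  have "real (card {w \<in> lat \<tau>. 0 < cmod w \<and> cmod w \<le> R}) \<le> ann_const * (R * (R - 0 + 1))"
    using assms by (intro card_annulus) auto
  also have "\<dots> \<le> ann_const * (R * (2 * R))"
    using assms ann_const_pos by (intro mult_left_mono) auto
  finally show ?thesis by (simp add: power2_eq_square mult_ac)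
qed

text \<open>
  The points \<open>m + n \<tau>\<close> with \<open>1 \<le> m, n \<le> R / diam\<close> lie in the disc.
\<close>
lemma card_punctured_ball_lower:
  assumes R: "R \<ge> diam"
  shows "R\<^sup>2 / (4 * diam\<^sup>2) \<le> real (card {w \<in> lat \<tau>. 0 < cmod w \<and> cmod w \<le> R})"
proof -
  define M where "M = nat \<lfloor>R / diam\<rfloor>"
  define g where "g = (\<lambda>(m::nat, n::nat). of_nat m + of_nat n * \<tau>)"
  have q: "1 \<le> R / diam" using R diam_ge_1 by (simp add: pos_le_divide_eq)
  then have M: "real M \<le> R / diam" "R / diam < real M + 1" by (simp_all add: M_def)
  define x where "x = R / diam"
  have "1 \<le> M" unfolding M_def using q by (intro le_nat_floor) simp
  then have "x / 2 \<le> real M" using M unfolding x_def[symmetric] by linarith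
  then have "R / (2 * diam) \<le> real M" by (simp add: x_def)
  then have "(R / (2 * diam))\<^sup>2 \<le> (real M)\<^sup>2"
    using R diam_ge_1 by (intro power_mono) auto
  then have 1: "R\<^sup>2 / (4 * diam\<^sup>2) \<le> real (M * M)"
    by (simp add: power_divide power_mult_distrib power2_eq_square)
  have "inj_on g ({1..M} \<times> {1..M})"
  proof (rule inj_onI)
    fix a b assume "g a = g b"
    then have eq: "of_nat (fst a) + of_nat (snd a) * \<tau> = of_nat (fst b) + of_nat (snd b) * \<tau>"
      by (simp add: g_def case_prod_unfold)
    have "real (snd a) * Im \<tau> = real (snd b) * Im \<tau>" "real (fst a) + real (snd a) * Re \<tau> = real (fst b) + real (snd b) * Re \<tau>"
      using arg_cong[OF eq, of Im] arg_cong[OF eq, of Re] by simp_all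
    then show "a = b" using Im_pos by (simp add: prod_eq_iff)
  qed
  then have "M * M = card (g ` ({1..M} \<times> {1..M}))"
    by (simp add: card_image)
  also have "\<dots> \<le> card {w \<in> lat \<tau>. 0 < cmod w \<and> cmod w \<le> R}"
  proof (rule card_mono)
    show "finite {w \<in> lat \<tau>. 0 < cmod w \<and> cmod w \<le> R}"
      by (rule finite_subset[OF _ finite_lat_ball[of R]]) auto
    show "g ` ({1..M} \<times> {1..M}) \<subseteq> {w \<in> lat \<tau>. 0 < cmod w \<and> cmod w \<le> R}"
    proof safe
      fix m n assume mn: "m \<in> {1..M}" "n \<in> {1..M}"
      show "g (m, n) \<in> lat \<tau>"
        unfolding g_def lat_def by (intro image_eqI[of _ _ "(int m, int n)"]) auto
      have "Im (g (m, n)) \<noteq> 0" using mn Im_pos by (simp add: g_def)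
      then show "0 < cmod (g (m, n))" by (metis zero_complex.simps(2) zero_less_norm_iff)
      have "cmod (g (m, n)) \<le> real m + real n * cmod \<tau>"
        unfolding g_def by (simp add: norm_triangle_le norm_mult)
      also have "\<dots> \<le> real M + real M * cmod \<tau>"
        using mn by (intro add_mono mult_right_mono) auto
      also have "\<dots> = real M * diam" by (simp add: diam_def algebra_simps)
      also have "\<dots> \<le> R" using M(1) diam_ge_1 by (simp add: pos_le_divide_eq)
      finally show "cmod (g (m, n)) \<le> R" .
    qed
  qed
  finally show ?thesis using 1 by linarith
qed

text \<open>
  The annulus \<open>k - 1 < |w| \<le> k\<close> contains \<open>O(k)\<close> lattice points, and \<open>|w| \<ge> k / 2\<close> on it, also for \<open>k = 1\<close> because nonzero lattice
  points have absolute value at least one.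
\<close>
lemma sum_inverse_powr_le:
  assumes R: "R \<ge> 1" and s: "s > 0"
  shows "(\<Sum>w | w \<in> lat \<tau> \<and> 0 < cmod w \<and> cmod w \<le> R. cmod w powr (- s))
     \<le> 2 * ann_const * 2 powr s * (\<Sum>k=1..nat \<lceil>R\<rceil>. real k powr (1 - s))"
proof -
  define W where "W = {w \<in> lat \<tau>. 0 < cmod w \<and> cmod w \<le> R}"
  define c where "c w = nat \<lceil>cmod w\<rceil>" for w :: complex
  have finW: "finite W"
    unfolding W_def by (rule finite_subset[OF _ finite_lat_ball[of R]]) auto
  have cW: "c ` W \<subseteq> {1..nat \<lceil>R\<rceil>}"
  proof
    fix k assume "k \<in> c ` W"
    then obtain w where w: "w \<in> W" "k = nat \<lceil>cmod w\<rceil>" by (auto simp: c_def)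
    then have "\<lceil>cmod w\<rceil> \<le> \<lceil>R\<rceil>" "\<lceil>cmod w\<rceil> > 0"
      by (auto simp: W_def intro: ceiling_mono)
    then have "1 \<le> nat \<lceil>cmod w\<rceil>" "nat \<lceil>cmod w\<rceil> \<le> nat \<lceil>R\<rceil>"
      by (linarith, intro nat_mono)
    then show "k \<in> {1..nat \<lceil>R\<rceil>}" unfolding w(2) by (simp only: atLeastAtMost_iff)
  qed
  have "(\<Sum>w\<in>W. cmod w powr (- s)) = (\<Sum>k=1..nat \<lceil>R\<rceil>. \<Sum>w | w \<in> W \<and> c w = k. cmod w powr (- s))"
    by (rule sum.group[symmetric]) (use finW cW in auto)
  also have "\<dots> \<le> (\<Sum>k=1..nat \<lceil>R\<rceil>. 2 * ann_const * 2 powr s * real k powr (1 - s))"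
  proof (rule sum_mono)
    fix k assume k: "k \<in> {1..nat \<lceil>R\<rceil>}"
    define V where "V = {w \<in> lat \<tau>. real k - 1 < cmod w \<and> cmod w \<le> real k}"
    have finV: "finite V"
      unfolding V_def by (rule finite_subset[OF _ finite_lat_ball[of "real k"]]) auto
    have sub: "{w. w \<in> W \<and> c w = k} \<subseteq> V"
    proof
      fix w assume w: "w \<in> {w. w \<in> W \<and> c w = k}"
      then have "nat \<lceil>cmod w\<rceil> = k" by (simp add: c_def)
      then have "\<lceil>cmod w\<rceil> = int k" using k unfolding nat_eq_iff by (auto split: if_splits)
      then have "of_int (int k) - 1 < cmod w \<and> cmod w \<le> of_int (int k)"
        by (simp only: ceiling_eq_iff)
      then show "w \<in> V" using w by (auto simp: V_def W_def)
    qed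
    have "(\<Sum>w | w \<in> W \<and> c w = k. cmod w powr (- s)) \<le> (\<Sum>w | w \<in> W \<and> c w = k. (real k / 2) powr (- s))"
    proof (rule sum_mono)
      fix w assume w: "w \<in> {w. w \<in> W \<and> c w = k}"
      then have "w \<in> V" "1 \<le> cmod w" using sub norm_ge_1 by (auto simp: W_def)
      then have "real k / 2 \<le> cmod w" by (auto simp: V_def)
      then show "cmod w powr (- s) \<le> (real k / 2) powr (- s)"
        using k s by (intro powr_mono2') auto
    qed
    also have "\<dots> = real (card {w. w \<in> W \<and> c w = k}) * (real k / 2) powr (- s)" by simp
    also have "\<dots> \<le> (ann_const * (real k * (real k - (real k - 1) + 1))) * (real k / 2) powr (- s)"
    proof (rule mult_right_mono)
      have "real (card {w. w \<in> W \<and> c w = k}) \<le> real (card V)"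
        using card_mono[OF finV sub] by simp
      also have "\<dots> \<le> ann_const * (real k * (real k - (real k - 1) + 1))"
        unfolding V_def using k by (intro card_annulus) auto
      finally show "real (card {w. w \<in> W \<and> c w = k}) \<le> ann_const * (real k * (real k - (real k - 1) + 1))" .
    qed simp
    also have "\<dots> = 2 * ann_const * 2 powr s * real k powr (1 - s)"
      using k by (simp add: powr_divide powr_minus powr_diff field_simps)
    finally show "(\<Sum>w | w \<in> W \<and> c w = k. cmod w powr (- s)) \<le> 2 * ann_const * 2 powr s * real k powr (1 - s)" .
  qed
  finally show ?thesis
    by (simp add: W_def sum_distrib_left)
qed

lemma sum_powr_minus_one_le: "n \<ge> 1 \<Longrightarrow> (\<Sum>k=1..n. real k powr (- 1)) \<le> 1 + ln (real n)"
proof (induction n rule: dec_induct)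
  case (step n)
  have "ln (real n / real (Suc n)) \<le> real n / real (Suc n) - 1"
    using step.hyps by (intro ln_le_minus_one) auto
  moreover have "real n / real (Suc n) - 1 = - (1 / real (Suc n))"
    by (simp add: field_simps)
  moreover have "ln (real n / real (Suc n)) = ln (real n) - ln (real (Suc n))"
    using step.hyps by (simp add: ln_div)
  moreover have "real (Suc n) powr (- 1) = 1 / real (Suc n)"
    by (simp add: powr_minus_divide)
  ultimately show ?case
    using step.IH by (simp del: of_nat_Suc)
qed simp

lemma sum_powr_minus_three_quarters_le: "(\<Sum>k=1..n. real k powr (- (3 / 4))) \<le> 4 * real n powr (1 / 4)"
proof (induction n)
  case (Suc n)
  define a b where "a = real (Suc n) powr (1 / 4)" and "b = real n powr (1 / 4)"
  have ab: "0 \<le> b" "b \<le> a" "a > 0"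
    by (auto simp: a_def b_def intro: powr_mono2)
  have a4: "a ^ 4 = real (Suc n)" "b ^ 4 = real n"
    by (simp_all add: a_def b_def powr_powr flip: powr_numeral)
  have a3: "real (Suc n) powr (- (3 / 4)) = 1 / a ^ 3"
  proof -
    have "a ^ 3 = a powr 3" using ab by simp
    also have "\<dots> = real (Suc n) powr (3 / 4)"
      unfolding a_def powr_powr by simp
    finally show ?thesis by (simp add: powr_minus_divide)
  qed
  \<comment> \<open>The term is compared with the increment of \<open>4 n\<^bsup>1/4\<^esup>\<close> by factoring a difference of fourth powers.\<close>
  have "1 = a ^ 4 - b ^ 4" by (simp add: a4)
  also have "\<dots> = (a - b) * (a ^ 3 + a\<^sup>2 * b + a * b\<^sup>2 + b ^ 3)"
    by (simp add: algebra_simps power2_eq_square power3_eq_cube power4_eq_xxxx)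
  also have "\<dots> \<le> (a - b) * (4 * a ^ 3)"
  proof (rule mult_left_mono)
    have "a\<^sup>2 * b \<le> a\<^sup>2 * a" "a * b\<^sup>2 \<le> a * a\<^sup>2" "b ^ 3 \<le> a ^ 3"
      using ab by (auto intro!: mult_left_mono power_mono)
    then show "a ^ 3 + a\<^sup>2 * b + a * b\<^sup>2 + b ^ 3 \<le> 4 * a ^ 3"
      by (simp add: power2_eq_square power3_eq_cube)
  qed (use ab in simp)
  also have "\<dots> = 4 * (a - b) * a ^ 3" by simp
  finally have "1 / a ^ 3 \<le> 4 * (a - b)"
    using ab by (subst pos_divide_le_eq) auto
  then show ?case
    using Suc.IH unfolding a_def[symmetric] b_def[symmetric] by (simp add: a3 del: of_nat_Suc)
qed simp

text \<open>
  The points equidistant from \<open>0\<close> and \<open>p\<close> satisfy a nontrivial linear equation in their lattice coordinates, so one coordinate determines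
  the other, and each coordinate takes \<open>O(N)\<close> values.
\<close>
lemma card_bisector:
  assumes p: "p \<noteq> 0" and N: "N \<ge> 1"
  shows "real (card {w \<in> lat \<tau>. cmod w \<le> N \<and> cmod w = cmod (w - p)}) \<le> (3 + 2 * (1 + cmod \<tau>) / Im \<tau>) * N"
proof -
  define \<kappa> where "\<kappa> = 1 + (1 + cmod \<tau>) / Im \<tau>"
  have \<kappa>: "\<kappa> \<ge> 1" using Im_pos by (simp add: \<kappa>_def)
  define W where "W = {w \<in> lat \<tau>. cmod w \<le> N \<and> cmod w = cmod (w - p)}"
  have finW: "finite W"
    unfolding W_def by (rule finite_subset[OF _ finite_lat_ball[of N]]) auto
  define S where "S = {k::int. \<bar>of_int k\<bar> \<le> \<kappa> * N}"
  define P where "P = {(m::int, n::int). of_int m + of_int n * \<tau> \<in> W}"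
  have WP: "W = (\<lambda>(m, n). of_int m + of_int n * \<tau>) ` P"
    by (auto simp: P_def W_def lat_def)
  have PS: "m \<in> S \<and> n \<in> S" if "(m, n) \<in> P" for m n
  proof -
    have "cmod (of_int m + of_int n * \<tau>) \<le> N" using that by (auto simp: P_def W_def)
    then have "\<kappa> * cmod (of_int m + of_int n * \<tau>) \<le> \<kappa> * N" using \<kappa> by (intro mult_left_mono) auto
    then show ?thesis
      using coordinate_bounds(1)[of m n] coordinate_bounds(2)[where m = m and n = n]
      unfolding S_def \<kappa>_def by auto
  qed
  have finS: "finite S" unfolding S_def by (rule finite_int_abs_le)
  have eqn: "of_int m * Re p + of_int n * (Re \<tau> * Re p + Im \<tau> * Im p) = (cmod p)\<^sup>2 / 2" if "(m, n) \<in> P" for m n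
  proof -
    define w where "w = of_int m + of_int n * \<tau>"
    have "(cmod w)\<^sup>2 = (cmod (w - p))\<^sup>2" using that by (auto simp: P_def W_def w_def)
    then have "Re w * Re p + Im w * Im p = (cmod p)\<^sup>2 / 2"
      unfolding cmod_power2 by (simp add: power2_eq_square algebra_simps)
    then show ?thesis by (simp add: w_def algebra_simps)
  qed
  have "card P \<le> card S"
  proof (cases "Re p = 0")
    case False
    have "inj_on snd P"
    proof (rule inj_onI)
      fix a b assume ab: "a \<in> P" "b \<in> P" "snd a = snd b"
      then obtain m m' n where mn: "a = (m, n)" "b = (m', n)" by (metis prod.collapse)
      have "of_int m * Re p = of_int m' * Re p"
        using eqn[of m n] eqn[of m' n] ab unfolding mn by linarith
      then show "a = b" using False by (simp add: mn)
    qed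
    moreover have "snd ` P \<subseteq> S" using PS by auto
    ultimately show ?thesis using finS by (metis card_image card_mono)
  next
    case True
    then have "Im p \<noteq> 0" using p by (auto simp: complex_eq_iff)
    then have c: "Re \<tau> * Re p + Im \<tau> * Im p \<noteq> 0" using True Im_pos by simp
    have "inj_on fst P"
    proof (rule inj_onI)
      fix a b assume ab: "a \<in> P" "b \<in> P" "fst a = fst b"
      then obtain m n n' where mn: "a = (m, n)" "b = (m, n')" by (metis prod.collapse)
      have "of_int n * (Re \<tau> * Re p + Im \<tau> * Im p) = of_int n' * (Re \<tau> * Re p + Im \<tau> * Im p)"
        using eqn[of m n] eqn[of m n'] ab unfolding mn by linarith
      then show "a = b" using c by (simp add: mn)
    qed
    moreover have "fst ` P \<subseteq> S" using PS by auto
    ultimately show ?thesis using finS by (metis card_image card_mono)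
  qed
  moreover have "card W \<le> card P"
  proof -
    have "P \<subseteq> S \<times> S" using PS by auto
    then have "finite P" using finS by (auto intro: finite_subset)
    then show ?thesis unfolding WP by (rule card_image_le)
  qed
  moreover have "real (card S) \<le> 2 * (\<kappa> * N) + 1"
  proof -
    have "S \<subseteq> {- \<lfloor>\<kappa> * N\<rfloor>..\<lfloor>\<kappa> * N\<rfloor>}"
      by (auto simp: S_def abs_le_iff le_floor_iff floor_le_iff minus_le_iff)
    then have "card S \<le> card {- \<lfloor>\<kappa> * N\<rfloor>..\<lfloor>\<kappa> * N\<rfloor>}" by (intro card_mono) auto
    also have "\<dots> = nat (2 * \<lfloor>\<kappa> * N\<rfloor> + 1)" by simp
    finally have "card S \<le> nat (2 * \<lfloor>\<kappa> * N\<rfloor> + 1)" .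
    moreover have "0 \<le> \<lfloor>\<kappa> * N\<rfloor>" using \<kappa> N by simp
    ultimately have "int (card S) \<le> 2 * \<lfloor>\<kappa> * N\<rfloor> + 1" by linarith
    then have "real_of_int (int (card S)) \<le> real_of_int (2 * \<lfloor>\<kappa> * N\<rfloor> + 1)"
      by (simp only: of_int_le_iff)
    then have "real (card S) \<le> 2 * of_int \<lfloor>\<kappa> * N\<rfloor> + 1" by simp
    then show ?thesis using of_int_floor_le[of "\<kappa> * N"] by linarith
  qed
  ultimately have "real (card W) \<le> 2 * (\<kappa> * N) + 1" by linarith
  also have "\<dots> \<le> (3 + 2 * (1 + cmod \<tau>) / Im \<tau>) * N"
    using N by (simp add: \<kappa>_def algebra_simps)
  finally show ?thesis by (simp add: W_def)
qed

end

section \<open>Sums over lattice points with a given shift\<close>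

context lattice
begin

lemma nat_ceiling_le:
  assumes "R \<ge> 1"
  shows "real (nat \<lceil>R\<rceil>) \<le> 2 * R" "1 \<le> nat \<lceil>R\<rceil>"
proof -
  have "of_int \<lceil>R\<rceil> < R + 1" "1 \<le> \<lceil>R\<rceil>"
    using assms by linarith+
  then show "1 \<le> nat \<lceil>R\<rceil>" by linarith
  have "real (nat \<lceil>R\<rceil>) = of_int \<lceil>R\<rceil>" using \<open>1 \<le> \<lceil>R\<rceil>\<close> by simp
  then show "real (nat \<lceil>R\<rceil>) \<le> 2 * R"
    using assms \<open>of_int \<lceil>R\<rceil> < R + 1\<close> by linarith
qed

lemma sum_inverse_square_le:
  assumes R: "R \<ge> 1"
  shows "(\<Sum>w | w \<in> lat \<tau> \<and> 0 < cmod w \<and> cmod w \<le> R. 1 / (cmod w)\<^sup>2) \<le> 16 * ann_const * (1 + ln R)"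
proof -
  have "(\<Sum>w | w \<in> lat \<tau> \<and> 0 < cmod w \<and> cmod w \<le> R. 1 / (cmod w)\<^sup>2)
      = (\<Sum>w | w \<in> lat \<tau> \<and> 0 < cmod w \<and> cmod w \<le> R. cmod w powr (- 2))"
    by (intro sum.cong) (auto simp: powr_minus_divide)
  also have "\<dots> \<le> 2 * ann_const * 2 powr 2 * (\<Sum>k=1..nat \<lceil>R\<rceil>. real k powr (1 - 2))"
    by (rule sum_inverse_powr_le) (use R in auto)
  also have "\<dots> = 8 * ann_const * (\<Sum>k=1..nat \<lceil>R\<rceil>. real k powr (- 1))"
    by simp
  also have "\<dots> \<le> 8 * ann_const * (2 * (1 + ln R))"
  proof (rule mult_left_mono)
    have "(\<Sum>k=1..nat \<lceil>R\<rceil>. real k powr (- 1)) \<le> 1 + ln (real (nat \<lceil>R\<rceil>))"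
      using nat_ceiling_le[OF R] by (intro sum_powr_minus_one_le) auto
    also have "\<dots> \<le> 1 + ln (2 * R)"
      using nat_ceiling_le[OF R] R by (intro add_left_mono) (simp add: ln_mono)
    also have "1 + ln (2 * R) = 1 + (ln 2 + ln R)"
      using R by (simp add: ln_mult)
    also have "\<dots> \<le> 1 + (1 + (ln R + ln R))"
      using R ln_le_minus_one[of "2::real"] by (intro add_mono) auto
    also have "\<dots> = 2 * (1 + ln R)" by simp
    finally show "(\<Sum>k=1..nat \<lceil>R\<rceil>. real k powr (- 1)) \<le> 2 * (1 + ln R)" .
  qed (use ann_const_pos in simp)
  also have "\<dots> = 16 * ann_const * (1 + ln R)" by simp
  finally show ?thesis .
qed

lemma sum_inverse_seven_quarters_le:
  assumes R: "R \<ge> 1"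
  shows "(\<Sum>w | w \<in> lat \<tau> \<and> 0 < cmod w \<and> cmod w \<le> R. cmod w powr (- (7 / 4)))
    \<le> 8 * ann_const * 2 powr (7 / 4) * 2 powr (1 / 4) * R powr (1 / 4)"
proof -
  have "(\<Sum>w | w \<in> lat \<tau> \<and> 0 < cmod w \<and> cmod w \<le> R. cmod w powr (- (7 / 4)))
     \<le> 2 * ann_const * 2 powr (7 / 4) * (\<Sum>k=1..nat \<lceil>R\<rceil>. real k powr (1 - 7 / 4))"
    by (rule sum_inverse_powr_le) (use R in auto)
  also have "\<dots> \<le> 2 * ann_const * 2 powr (7 / 4) * (4 * (2 * R) powr (1 / 4))"
  proof (rule mult_left_mono)
    have "(\<Sum>k=1..nat \<lceil>R\<rceil>. real k powr (- (3 / 4))) \<le> 4 * real (nat \<lceil>R\<rceil>) powr (1 / 4)"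
      by (rule sum_powr_minus_three_quarters_le)
    also have "\<dots> \<le> 4 * (2 * R) powr (1 / 4)"
      using nat_ceiling_le[OF R] by (intro mult_left_mono powr_mono2) auto
    finally show "(\<Sum>k=1..nat \<lceil>R\<rceil>. real k powr (1 - 7 / 4)) \<le> 4 * (2 * R) powr (1 / 4)" by simp
  qed (use ann_const_pos in simp)
  finally show ?thesis using R by (simp add: powr_mult)
qed

text \<open>
  Relative to \<open>R\<close>, a bound for the number of lattice points at distance less than \<open>2 diam\<close> from the origin or at most \<open>diam\<close> from the
  circle of radius \<open>R\<close>.
\<close>
definition edge_const :: real where
  "edge_const = 1 + 8 * ann_const * diam\<^sup>2 + ann_const * (1 + diam) * (2 * diam + 1)"

lemma edge_const_nonneg: "edge_const \<ge> 0"
  using ann_const_pos diam_ge_1 by (simp add: edge_const_def)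

lemma card_ball:
  assumes "R \<ge> 1"
  shows "real (card {w \<in> lat \<tau>. cmod w \<le> R}) \<le> 1 + 2 * ann_const * R\<^sup>2"
proof -
  have "{w \<in> lat \<tau>. cmod w \<le> R} \<subseteq> insert 0 {w \<in> lat \<tau>. 0 < cmod w \<and> cmod w \<le> R}" by auto
  moreover have fin: "finite {w \<in> lat \<tau>. 0 < cmod w \<and> cmod w \<le> R}"
    by (rule finite_subset[OF _ finite_lat_ball[of R]]) auto
  ultimately have "card {w \<in> lat \<tau>. cmod w \<le> R} \<le> card (insert 0 {w \<in> lat \<tau>. 0 < cmod w \<and> cmod w \<le> R})"
    by (intro card_mono) auto
  also have "\<dots> \<le> Suc (card {w \<in> lat \<tau>. 0 < cmod w \<and> cmod w \<le> R})"
    by (rule card_insert_le_m1) auto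
  finally show ?thesis
    using card_punctured_ball[OF assms] by linarith
qed

text \<open>
  On the cells near the origin and along the boundary circle the integrand may jump, and only its bound \<open>M\<close> is used there; there are
  \<open>O(R)\<close> such cells.  The other cells contribute their oscillation.
\<close>
lemma sum_ball_integral_compare:
  fixes h :: "complex \<Rightarrow> real"
  assumes meas: "h \<in> borel_measurable borel" and bound: "\<And>w. \<bar>h w\<bar> \<le> M" and R: "R \<ge> 1"
    and close: "\<And>w x. w \<in> lat \<tau> \<Longrightarrow> 2 * diam \<le> cmod w \<Longrightarrow> cmod w \<le> R \<Longrightarrow> cmod (x - w) \<le> diam \<Longrightarrow> \<bar>h w - h x\<bar> \<le> e w"
    and e: "\<And>w. 0 \<le> e w"
  shows "\<bar>(\<Sum>w | w \<in> lat \<tau> \<and> cmod w \<le> R. h w) - (\<integral>z. (if cmod (lat_point \<tau> z) \<le> R then h (lat_point \<tau> z) else 0) \<partial>plane)\<bar>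
    \<le> (\<Sum>w | w \<in> lat \<tau> \<and> 0 < cmod w \<and> cmod w \<le> R. e w) + 2 * M * edge_const * R"
proof -
  note [measurable] = meas
  define d where "d = diam"
  have d: "d \<ge> 1" using diam_ge_1 by (simp add: d_def)
  have M: "0 \<le> M" using bound[of 0] by linarith
  define g where "g w = (if cmod w \<le> R then h w else 0)" for w
  have g: "\<bar>g w\<bar> \<le> M" for w using bound[of w] M by (simp add: g_def)
  define W where "W = {w \<in> lat \<tau>. cmod w \<le> R + d}"
  have W: "finite W" "W \<subseteq> lat \<tau>" using finite_lat_ball by (auto simp: W_def)
  define e' where "e' w = (if 2 * d \<le> cmod w \<and> cmod w \<le> R - d then e w else 2 * M)" for w
  have cmp: "\<bar>(\<Sum>w\<in>W. g w) - (\<integral>z. g (lat_point \<tau> z) \<partial>plane)\<bar> \<le> (\<Sum>w\<in>W. e' w)"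
  proof (rule sum_lattice_integral_compare[OF _ W])
    show "(\<lambda>z. g (lat_point \<tau> z)) \<in> borel_measurable plane"
      unfolding g_def by measurable
    show "g (lat_point \<tau> z) = 0" if "lat_floor \<tau> z \<notin> W" for z
      using that norm_lat_floor_bounds(1)[of z] lat_floor_in_lat[of z] by (auto simp: g_def W_def d_def)
    show "\<bar>g (lat_floor \<tau> z) - g (lat_point \<tau> z)\<bar> \<le> e' (lat_floor \<tau> z)" if "lat_floor \<tau> z \<in> W" for z
    proof (cases "2 * d \<le> cmod (lat_floor \<tau> z) \<and> cmod (lat_floor \<tau> z) \<le> R - d")
      case True
      then have "cmod (lat_floor \<tau> z) \<le> R" "cmod (lat_point \<tau> z) \<le> R"
        using norm_lat_floor_bounds(2)[of z] d by (auto simp: d_def)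
      then show ?thesis
        using True close[OF lat_floor_in_lat, of z "lat_point \<tau> z"] dist_lat_floor[of z]
        by (simp add: g_def e'_def d_def)
    next
      case False
      then have "e' (lat_floor \<tau> z) = 2 * M" by (auto simp: e'_def)
      then show ?thesis
        using g[of "lat_floor \<tau> z"] g[of "lat_point \<tau> z"] by linarith
    qed
  qed
  have "(\<Sum>w\<in>W. g w) = (\<Sum>w | w \<in> lat \<tau> \<and> cmod w \<le> R. h w)"
    using d by (intro sum.mono_neutral_cong_right W) (auto simp: W_def g_def)
  moreover have "(\<integral>z. g (lat_point \<tau> z) \<partial>plane) = (\<integral>z. (if cmod (lat_point \<tau> z) \<le> R then h (lat_point \<tau> z) else 0) \<partial>plane)"
    by (simp add: g_def)
  moreover have "(\<Sum>w\<in>W. e' w) \<le> (\<Sum>w | w \<in> lat \<tau> \<and> 0 < cmod w \<and> cmod w \<le> R. e w) + 2 * M * edge_const * R"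
  proof -
    define V where "V = {w \<in> lat \<tau>. 2 * d \<le> cmod w \<and> cmod w \<le> R - d}"
    have VW: "V \<subseteq> W" using d by (auto simp: V_def W_def)
    have "(\<Sum>w\<in>W. e' w) = (\<Sum>w\<in>V. e' w) + (\<Sum>w\<in>W - V. e' w)"
      by (rule sum.subset_diff[OF VW W(1), THEN trans]) simp
    also have "(\<Sum>w\<in>V. e' w) = (\<Sum>w\<in>V. e w)"
      by (intro sum.cong) (auto simp: V_def e'_def)
    also have "(\<Sum>w\<in>W - V. e' w) = (\<Sum>w\<in>W - V. 2 * M)"
      by (intro sum.cong) (auto simp: V_def W_def e'_def)
    also have "(\<Sum>w\<in>V. e w) \<le> (\<Sum>w | w \<in> lat \<tau> \<and> 0 < cmod w \<and> cmod w \<le> R. e w)"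
      using d e by (intro sum_mono2 finite_subset[OF _ finite_lat_ball[of R]]) (auto simp: V_def)
    also have "(\<Sum>w\<in>W - V. 2 * M) \<le> 2 * M * edge_const * R"
    proof -
      define a where "a = max 0 (R - d)"
      let ?A = "{w \<in> lat \<tau>. cmod w \<le> 2 * d}" and ?B = "{w \<in> lat \<tau>. a < cmod w \<and> cmod w \<le> R + d}"
      have "W - V \<subseteq> ?A \<union> ?B"
        using d by (auto simp: W_def V_def a_def)
      moreover have "finite (?A \<union> ?B)"
        by (rule finite_subset[OF _ finite_lat_ball[of "max (2 * d) (R + d)"]]) auto
      ultimately have "card (W - V) \<le> card (?A \<union> ?B)" by (rule card_mono[rotated])
      also have "\<dots> \<le> card ?A + card ?B" by (rule card_Un_le)
      finally have "real (card (W - V)) \<le> real (card ?A) + real (card ?B)" by linarith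
      also have "real (card ?A) \<le> 1 + 2 * ann_const * (2 * d)\<^sup>2"
        using d by (intro card_ball) auto
      also have "real (card ?B) \<le> ann_const * ((R + d) * (R + d - a + 1))"
        using d R by (intro card_annulus) (auto simp: a_def)
      also have "\<dots> \<le> ann_const * (((1 + d) * R) * (2 * d + 1))"
      proof (intro mult_left_mono mult_mono)
        show "R + d \<le> (1 + d) * R" using mult_mono[of 1 R d d] d R by (simp add: algebra_simps)
      qed (use d R ann_const_pos in \<open>auto simp: a_def\<close>)
      also have "1 + 2 * ann_const * (2 * d)\<^sup>2 + ann_const * (((1 + d) * R) * (2 * d + 1))
         \<le> (1 + 2 * ann_const * (2 * d)\<^sup>2) * R + ann_const * (((1 + d) * R) * (2 * d + 1))"
        using R ann_const_pos mult_left_mono[of 1 R "1 + 2 * ann_const * (2 * d)\<^sup>2"] by simp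
      also have "\<dots> = edge_const * R"
        by (simp add: edge_const_def d_def algebra_simps power2_eq_square)
      finally have "real (card (W - V)) \<le> edge_const * R" by simp
      then have "2 * M * real (card (W - V)) \<le> 2 * M * (edge_const * R)"
        using M by (intro mult_left_mono) auto
      then show ?thesis by (simp add: mult_ac)
    qed
    finally show ?thesis by simp
  qed
  ultimately show ?thesis using cmp by linarith
qed

lemma integral_lat_point_mult:
  fixes g :: "real \<times> real \<Rightarrow> real"
  assumes [measurable]: "g \<in> borel_measurable plane" and s: "s \<noteq> 0"
  shows "(\<integral>z. g (Re (lat_point \<tau> z * s), Im (lat_point \<tau> z * s)) \<partial>plane) = (\<integral>z. g z \<partial>plane) / ((cmod s)\<^sup>2 * Im \<tau>)"
proof -
  define a b c d where "a = Re s" and "b = Re (\<tau> * s)" and "c = Im s" and "d = Im (\<tau> * s)"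
  have det: "a * d - b * c = (cmod s)\<^sup>2 * Im \<tau>"
    unfolding cmod_power2 by (simp add: a_def b_def c_def d_def power2_eq_square algebra_simps)
  have det0: "a * d - b * c \<noteq> 0" unfolding det using s Im_pos by simp
  have "(\<integral>z. g (Re (lat_point \<tau> z * s), Im (lat_point \<tau> z * s)) \<partial>plane) =
      (\<integral>z. g (a * fst z + b * snd z, c * fst z + d * snd z) \<partial>plane)"
    by (intro Bochner_Integration.integral_cong refl arg_cong[of _ _ g])
       (simp add: lat_point_def a_def b_def c_def d_def algebra_simps)
  also have "\<dots> = (\<integral>z. g z \<partial>plane) / \<bar>a * d - b * c\<bar>"
    by (rule integral_linear_plane[OF _ det0]) measurable
  finally show ?thesis unfolding det using Im_pos by simp
qed

text \<open>
  Multiplication by \<open>cnj p / (|p| N)\<close> turns the disc of radius \<open>N\<close> into the unit disc and \<open>p\<close> into a positive real number.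
\<close>
lemma integral_ball_inv_re:
  fixes f :: "real \<Rightarrow> real"
  assumes [measurable]: "f \<in> borel_measurable borel" and p: "p \<noteq> 0" and N: "N > 0"
  shows "(\<integral>z. (if cmod (lat_point \<tau> z) \<le> N then f (2 * \<phi> * Re (p / lat_point \<tau> z)) else 0) \<partial>plane)
     = N\<^sup>2 / Im \<tau> * disc_avg f (2 * \<phi> * cmod p / N)"
proof -
  define s where "s = cnj p / (of_real (cmod p) * of_real N)"
  have cs: "cmod s = 1 / N" using p N by (simp add: s_def norm_divide norm_mult)
  have s0: "s \<noteq> 0" using p N by (simp add: s_def)
  define X where "X = 2 * \<phi> * cmod p / N"
  have "(\<integral>z. (if cmod (lat_point \<tau> z) \<le> N then f (2 * \<phi> * Re (p / lat_point \<tau> z)) else 0) \<partial>plane)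
     = (\<integral>z. indicator unit_disc (Re (lat_point \<tau> z * s), Im (lat_point \<tau> z * s)) *
           f (X * inv_re (Re (lat_point \<tau> z * s), Im (lat_point \<tau> z * s))) \<partial>plane)"
  proof (rule Bochner_Integration.integral_cong[OF refl])
    fix z
    define \<zeta> where "\<zeta> = lat_point \<tau> z"
    define u v where "u = Re (\<zeta> * s)" and "v = Im (\<zeta> * s)"
    have n: "u\<^sup>2 + v\<^sup>2 = (cmod \<zeta> / N)\<^sup>2"
      unfolding u_def v_def by (simp only: cmod_power2[symmetric] norm_mult cs) simp
    have disc: "(cmod \<zeta> / N)\<^sup>2 \<le> 1 \<longleftrightarrow> cmod \<zeta> \<le> N"
      using N by (simp add: abs_square_le_1)
    have "X * (u / (cmod \<zeta> / N)\<^sup>2) = 2 * \<phi> * Re (p / \<zeta>)"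
    proof (cases "\<zeta> = 0")
      case False
      have "u = Re (\<zeta> * cnj p) / (cmod p * N)"
        unfolding u_def s_def by (metis Re_divide_of_real of_real_mult times_divide_eq_right)
      moreover have "Re (p / \<zeta>) = Re (\<zeta> * cnj p) / (cmod \<zeta>)\<^sup>2"
        by (simp add: Re_divide' cmod_power2 mult_ac)
      ultimately show ?thesis
        using p N False by (simp add: X_def power_divide power2_eq_square)
    qed (simp add: u_def)
    then show "(if cmod (lat_point \<tau> z) \<le> N then f (2 * \<phi> * Re (p / lat_point \<tau> z)) else 0) =
        indicator unit_disc (Re (lat_point \<tau> z * s), Im (lat_point \<tau> z * s)) *
           f (X * inv_re (Re (lat_point \<tau> z * s), Im (lat_point \<tau> z * s)))"
      unfolding \<zeta>_def[symmetric] u_def[symmetric] v_def[symmetric] by (simp add: n disc indicator_def)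
  qed
  also have "\<dots> = (\<integral>z. indicator unit_disc z * f (X * inv_re z) \<partial>plane) / ((cmod s)\<^sup>2 * Im \<tau>)"
    by (rule integral_lat_point_mult[OF _ s0]) measurable
  also have "\<dots> = N\<^sup>2 / Im \<tau> * disc_avg f X"
    using N by (simp add: disc_avg_def cs power_divide)
  finally show ?thesis unfolding X_def .
qed

lemma integral_ball_radial:
  fixes H :: "real \<Rightarrow> real"
  assumes [measurable]: "H \<in> borel_measurable borel" and N: "N > 0"
  shows "(\<integral>z. (if cmod (lat_point \<tau> z) \<le> N then H (cmod (lat_point \<tau> z)) else 0) \<partial>plane)
     = N\<^sup>2 / Im \<tau> * (\<integral>z. indicator unit_disc z * H (N * sqrt ((fst z)\<^sup>2 + (snd z)\<^sup>2)) \<partial>plane)"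
proof -
  define s :: complex where "s = of_real (1 / N)"
  have cs: "cmod s = 1 / N" using N by (simp add: s_def norm_divide)
  have s0: "s \<noteq> 0" using N by (simp add: s_def)
  have "(\<integral>z. (if cmod (lat_point \<tau> z) \<le> N then H (cmod (lat_point \<tau> z)) else 0) \<partial>plane)
     = (\<integral>z. (\<lambda>z. indicator unit_disc z * H (N * sqrt ((fst z)\<^sup>2 + (snd z)\<^sup>2))) (Re (lat_point \<tau> z * s), Im (lat_point \<tau> z * s)) \<partial>plane)"
  proof (rule Bochner_Integration.integral_cong[OF refl])
    fix z
    define \<zeta> where "\<zeta> = lat_point \<tau> z"
    define u v where "u = Re (\<zeta> * s)" and "v = Im (\<zeta> * s)"
    have n: "u\<^sup>2 + v\<^sup>2 = (cmod \<zeta> / N)\<^sup>2"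
      unfolding u_def v_def by (simp only: cmod_power2[symmetric] norm_mult cs) simp
    have disc: "(cmod \<zeta> / N)\<^sup>2 \<le> 1 \<longleftrightarrow> cmod \<zeta> \<le> N"
      using N by (simp add: abs_square_le_1)
    have sq: "sqrt ((cmod \<zeta> / N)\<^sup>2) = cmod \<zeta> / N" using N by (simp only: real_sqrt_abs) simp
    show "(if cmod (lat_point \<tau> z) \<le> N then H (cmod (lat_point \<tau> z)) else 0) =
        (\<lambda>z. indicator unit_disc z * H (N * sqrt ((fst z)\<^sup>2 + (snd z)\<^sup>2))) (Re (lat_point \<tau> z * s), Im (lat_point \<tau> z * s))"
      unfolding \<zeta>_def[symmetric] u_def[symmetric] v_def[symmetric] fst_conv snd_conv n sq using N by (simp add: n disc indicator_def)
  qed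
  also have "\<dots> = (\<integral>z. indicator unit_disc z * H (N * sqrt ((fst z)\<^sup>2 + (snd z)\<^sup>2)) \<partial>plane) / ((cmod s)\<^sup>2 * Im \<tau>)"
    by (rule integral_lat_point_mult[OF _ s0]) measurable
  also have "\<dots> = N\<^sup>2 / Im \<tau> * (\<integral>z. indicator unit_disc z * H (N * sqrt ((fst z)\<^sup>2 + (snd z)\<^sup>2)) \<partial>plane)"
    using N by (simp add: cs power_divide)
  finally show ?thesis .
qed

text \<open>
  The function \<open>w \<mapsto> f (2 \<phi> Re (p / w))\<close> varies by \<open>O(\<phi> |p| / |w|\<^sup>2)\<close> over the cell of \<open>w\<close>, and
  \<open>|w|\<^sup>-\<^sup>2\<close> is only logarithmically divergent over the lattice.
\<close>
lemma sum_inv_re_compare: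
  fixes f :: "real \<Rightarrow> real"
  assumes meas: "f \<in> borel_measurable borel" and bound: "\<And>t. \<bar>f t\<bar> \<le> M"
    and lip: "\<And>s t. \<bar>f s - f t\<bar> \<le> L * \<bar>s - t\<bar>"
    and p: "p \<noteq> 0" and N: "N \<ge> 1" and \<phi>: "\<phi> \<ge> 0"
  shows "\<bar>(\<Sum>w | w \<in> lat \<tau> \<and> cmod w \<le> N. f (2 * \<phi> * Re (p / w))) - N\<^sup>2 / Im \<tau> * disc_avg f (2 * \<phi> * cmod p / N)\<bar>
    \<le> 64 * L * diam * ann_const * \<phi> * cmod p * (1 + ln N) + 2 * M * edge_const * N"
proof -
  note [measurable] = meas
  have L: "0 \<le> L" using lip[of 1 0] by simp
  define e where "e w = 4 * L * diam * \<phi> * cmod p * (1 / (cmod w)\<^sup>2)" for w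
  have "\<bar>(\<Sum>w | w \<in> lat \<tau> \<and> cmod w \<le> N. f (2 * \<phi> * Re (p / w)))
       - (\<integral>z. (if cmod (lat_point \<tau> z) \<le> N then f (2 * \<phi> * Re (p / lat_point \<tau> z)) else 0) \<partial>plane)\<bar>
     \<le> (\<Sum>w | w \<in> lat \<tau> \<and> 0 < cmod w \<and> cmod w \<le> N. e w) + 2 * M * edge_const * N"
  proof (rule sum_ball_integral_compare[OF _ bound N])
    show "(\<lambda>w. f (2 * \<phi> * Re (p / w))) \<in> borel_measurable borel" by measurable
    show "0 \<le> e w" for w using L \<phi> diam_ge_1 by (simp add: e_def)
    fix w x assume w: "2 * diam \<le> cmod w" and x: "cmod (x - w) \<le> diam"
    have wpos: "cmod w > 0" using w diam_ge_1 by linarith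
    have "cmod w \<le> cmod x + cmod (x - w)"
      using norm_triangle_sub[of w x] by (simp add: norm_minus_commute)
    then have x2: "cmod w / 2 \<le> cmod x" using w x by linarith
    then have xpos: "cmod x > 0" using wpos by linarith
    have "\<bar>Re (p / w) - Re (p / x)\<bar> = \<bar>Re (p / w - p / x)\<bar>" by simp
    also have "\<dots> \<le> cmod (p / w - p / x)" by (rule abs_Re_le_cmod)
    also have "p / w - p / x = p * (x - w) / (w * x)"
      using wpos xpos by (simp add: field_simps)
    also have "cmod \<dots> = cmod p * cmod (x - w) / (cmod w * cmod x)"
      by (simp add: norm_mult norm_divide)
    also have "\<dots> \<le> cmod p * diam / (cmod w * (cmod w / 2))"
      using x x2 wpos diam_ge_1 by (intro frac_le mult_left_mono mult_pos_pos mult_nonneg_nonneg) auto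
    finally have re: "\<bar>Re (p / w) - Re (p / x)\<bar> \<le> 2 * (cmod p * diam / (cmod w)\<^sup>2)"
      by (simp add: power2_eq_square mult_ac)
    have "\<bar>f (2 * \<phi> * Re (p / w)) - f (2 * \<phi> * Re (p / x))\<bar> \<le> L * \<bar>2 * \<phi> * Re (p / w) - 2 * \<phi> * Re (p / x)\<bar>"
      by (rule lip)
    also have "\<bar>2 * \<phi> * Re (p / w) - 2 * \<phi> * Re (p / x)\<bar> = 2 * \<phi> * \<bar>Re (p / w) - Re (p / x)\<bar>"
      using \<phi> by (simp add: abs_mult flip: right_diff_distrib)
    also have "L * (2 * \<phi> * \<bar>Re (p / w) - Re (p / x)\<bar>) \<le> L * (2 * \<phi> * (2 * (cmod p * diam / (cmod w)\<^sup>2)))"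
      using re L \<phi> by (intro mult_left_mono) auto
    also have "\<dots> = e w" by (simp add: e_def)
    finally show "\<bar>f (2 * \<phi> * Re (p / w)) - f (2 * \<phi> * Re (p / x))\<bar> \<le> e w" .
  qed
  also have "(\<Sum>w | w \<in> lat \<tau> \<and> 0 < cmod w \<and> cmod w \<le> N. e w) =
      4 * L * diam * \<phi> * cmod p * (\<Sum>w | w \<in> lat \<tau> \<and> 0 < cmod w \<and> cmod w \<le> N. 1 / (cmod w)\<^sup>2)"
    by (simp add: e_def sum_distrib_left)
  also have "\<dots> \<le> 4 * L * diam * \<phi> * cmod p * (16 * ann_const * (1 + ln N))"
    using L \<phi> diam_ge_1 by (intro mult_left_mono sum_inverse_square_le N) auto
  finally show ?thesis
    unfolding integral_ball_inv_re[OF meas p less_le_trans[OF zero_less_one N]]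
    by (simp add: mult_ac)
qed

text \<open>
  The left-hand side is twice the real part of \<open>Ln (1 - p/w)\<close> with its linear term removed.
\<close>
lemma ln_norm_diff_approx:
  assumes w: "2 * cmod p \<le> cmod w" and p: "p \<noteq> 0"
  shows "\<bar>ln ((cmod w)\<^sup>2) - ln ((cmod (w - p))\<^sup>2) - 2 * Re (p / w)\<bar> \<le> 4 * (cmod p)\<^sup>2 / (cmod w)\<^sup>2"
proof -
  define \<zeta> where "\<zeta> = p / w"
  have wpos: "cmod w > 0" using w p by (smt (verit) zero_less_norm_iff)
  have \<zeta>: "cmod \<zeta> \<le> 1 / 2" using w wpos by (simp add: \<zeta>_def norm_divide)
  have eq: "w - p = w * (1 - \<zeta>)" using wpos by (simp add: \<zeta>_def field_simps)
  have ne: "1 - \<zeta> \<noteq> 0" using \<zeta> by auto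
  have "ln ((cmod (w - p))\<^sup>2) = ln ((cmod w)\<^sup>2) + 2 * ln (cmod (1 - \<zeta>))"
    unfolding eq norm_mult using wpos ne by (simp add: ln_mult ln_realpow)
  moreover have "ln (cmod (1 - \<zeta>)) = Re (Ln (1 - \<zeta>))"
    using ne by simp
  ultimately have "\<bar>ln ((cmod w)\<^sup>2) - ln ((cmod (w - p))\<^sup>2) - 2 * Re (p / w)\<bar> = 2 * \<bar>Re (Ln (1 + - \<zeta>) - - \<zeta>)\<bar>"
    by (simp add: \<zeta>_def abs_real_def)
  also have "\<dots> \<le> 2 * cmod (Ln (1 + - \<zeta>) - - \<zeta>)"
    by (intro mult_left_mono abs_Re_le_cmod) auto
  also have "cmod (Ln (1 + - \<zeta>) - - \<zeta>) \<le> (cmod (- \<zeta>))\<^sup>2 / (1 - cmod (- \<zeta>))"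
    using \<zeta> by (intro Ln_approx_linear) auto
  also have "\<dots> \<le> (cmod \<zeta>)\<^sup>2 / (1 / 2)"
    using \<zeta> by (intro frac_le) auto
  finally show ?thesis
    by (simp add: \<zeta>_def norm_divide power_divide)
qed

text \<open>
  The points \<open>w\<close> for which \<open>(w, w - p)\<close> is one of the counted pairs.
\<close>
definition shift_set :: "real \<Rightarrow> complex \<Rightarrow> complex set" where
  "shift_set N p = {w \<in> lat \<tau>. 0 < cmod w \<and> cmod w \<le> N \<and> 0 < cmod (w - p) \<and> cmod (w - p) \<le> N \<and> cmod w \<noteq> cmod (w - p)}"

text \<open>
  The logarithm may be linearized unless \<open>|w| \<le> 2 |p|\<close> (\<open>V1\<close>).  The two index sets differ at most where \<open>w - p\<close> may leave the disc, that is, in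
  the annulus \<open>N - |p| < |w| \<le> N\<close> (\<open>V2\<close>), on the bisector (\<open>V3\<close>), which is excluded by the condition \<open>a \<noteq> b\<close>, and at points already in \<open>V1\<close>.
  All exceptional sets together have \<open>O(N |p|)\<close> elements.
\<close>
lemma sum_log_compare:
  fixes f :: "real \<Rightarrow> real"
  assumes bound: "\<And>t. \<bar>f t\<bar> \<le> M" and lip: "\<And>s t. \<bar>f s - f t\<bar> \<le> L * \<bar>s - t\<bar>"
    and p: "1 \<le> cmod p" "cmod p \<le> N" and \<phi>: "\<phi> \<ge> 0"
  shows "\<bar>(\<Sum>w\<in>shift_set N p. f (\<phi> * (ln ((cmod w)\<^sup>2) - ln ((cmod (w - p))\<^sup>2))))
      - (\<Sum>w | w \<in> lat \<tau> \<and> cmod w \<le> N. f (2 * \<phi> * Re (p / w)))\<bar>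
    \<le> 64 * L * ann_const * \<phi> * (cmod p)\<^sup>2 * (1 + ln N)
      + 2 * M * (4 + 10 * ann_const + 2 * (1 + cmod \<tau>) / Im \<tau>) * (N * cmod p)"
proof -
  have L: "0 \<le> L" using lip[of 1 0] by simp
  have M: "0 \<le> M" using bound[of 0] by linarith
  have N: "N \<ge> 1" using p by linarith
  have p0: "p \<noteq> 0" using p by auto
  define B where "B = {w \<in> lat \<tau>. cmod w \<le> N}"
  have finB: "finite B" unfolding B_def by (rule finite_lat_ball)
  define a where "a = N - cmod p"
  have a: "0 \<le> a" using p by (simp add: a_def)
  define V1 where "V1 = {w \<in> lat \<tau>. cmod w \<le> 2 * cmod p}"
  define V2 where "V2 = {w \<in> lat \<tau>. a < cmod w \<and> cmod w \<le> N}"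
  define V3 where "V3 = {w \<in> lat \<tau>. cmod w \<le> N \<and> cmod w = cmod (w - p)}"
  define V where "V = B \<inter> (V1 \<union> V2 \<union> V3)"
  define F where "F w = (if w \<in> shift_set N p then f (\<phi> * (ln ((cmod w)\<^sup>2) - ln ((cmod (w - p))\<^sup>2))) else 0)" for w
  define h where "h w = f (2 * \<phi> * Re (p / w))" for w
  define e where "e w = 4 * L * \<phi> * (cmod p)\<^sup>2 * (1 / (cmod w)\<^sup>2)" for w
  have e0: "0 \<le> e w" for w using L \<phi> by (simp add: e_def)
  have "(\<Sum>w\<in>shift_set N p. f (\<phi> * (ln ((cmod w)\<^sup>2) - ln ((cmod (w - p))\<^sup>2)))) = (\<Sum>w\<in>B. F w)"
    by (intro sum.mono_neutral_cong_left finB) (auto simp: F_def B_def shift_set_def)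
  then have "(\<Sum>w\<in>shift_set N p. f (\<phi> * (ln ((cmod w)\<^sup>2) - ln ((cmod (w - p))\<^sup>2)))) - (\<Sum>w\<in>B. h w) = (\<Sum>w\<in>B. F w - h w)"
    by (simp add: sum_subtractf)
  also have "\<dots> = (\<Sum>w\<in>B - V. F w - h w) + (\<Sum>w\<in>V. F w - h w)"
    by (rule sum.subset_diff) (auto simp: V_def finB)
  finally have i1: "\<bar>(\<Sum>w\<in>shift_set N p. f (\<phi> * (ln ((cmod w)\<^sup>2) - ln ((cmod (w - p))\<^sup>2)))) - (\<Sum>w\<in>B. h w)\<bar>
     \<le> \<bar>\<Sum>w\<in>B - V. F w - h w\<bar> + \<bar>\<Sum>w\<in>V. F w - h w\<bar>"
    by (simp add: abs_triangle_ineq)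
  have "\<bar>\<Sum>w\<in>B - V. F w - h w\<bar> \<le> (\<Sum>w\<in>B - V. e w)"
  proof (rule order_trans[OF sum_abs sum_mono])
    fix w assume w: "w \<in> B - V"
    then have w1: "2 * cmod p \<le> cmod w" "cmod w \<le> a" "cmod w \<noteq> cmod (w - p)" "w \<in> lat \<tau>" "cmod w \<le> N"
      by (auto simp: B_def V_def V1_def V2_def V3_def not_le)
    have "cmod w \<le> cmod (w - p) + cmod p" "cmod (w - p) \<le> cmod w + cmod p"
      using norm_triangle_ineq[of "w - p" p] norm_triangle_ineq4[of w p] by simp_all
    then have "w \<in> shift_set N p"
      using w1 p unfolding shift_set_def a_def by auto
    then have "\<bar>F w - h w\<bar> \<le> L * \<bar>\<phi> * (ln ((cmod w)\<^sup>2) - ln ((cmod (w - p))\<^sup>2)) - 2 * \<phi> * Re (p / w)\<bar>"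
      unfolding F_def h_def by (simp add: lip)
    also have "\<phi> * (ln ((cmod w)\<^sup>2) - ln ((cmod (w - p))\<^sup>2)) - 2 * \<phi> * Re (p / w)
       = \<phi> * (ln ((cmod w)\<^sup>2) - ln ((cmod (w - p))\<^sup>2) - 2 * Re (p / w))"
      by (simp add: algebra_simps)
    also have "L * \<bar>\<phi> * (ln ((cmod w)\<^sup>2) - ln ((cmod (w - p))\<^sup>2) - 2 * Re (p / w))\<bar> \<le> L * (\<phi> * (4 * (cmod p)\<^sup>2 / (cmod w)\<^sup>2))"
      unfolding abs_mult abs_of_nonneg[OF \<phi>] using \<phi> L ln_norm_diff_approx[OF w1(1) p0] by (intro mult_left_mono)
    also have "\<dots> = e w" by (simp add: e_def)
    finally show "\<bar>F w - h w\<bar> \<le> e w" .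
  qed
  also have "(\<Sum>w\<in>B - V. e w) \<le> (\<Sum>w | w \<in> lat \<tau> \<and> 0 < cmod w \<and> cmod w \<le> N. e w)"
    by (rule sum_mono2[OF finite_subset[OF _ finB]]) (auto simp: B_def V_def V1_def e0)
  also have "\<dots> = 4 * L * \<phi> * (cmod p)\<^sup>2 * (\<Sum>w | w \<in> lat \<tau> \<and> 0 < cmod w \<and> cmod w \<le> N. 1 / (cmod w)\<^sup>2)"
    by (simp add: e_def sum_distrib_left)
  also have "\<dots> \<le> 4 * L * \<phi> * (cmod p)\<^sup>2 * (16 * ann_const * (1 + ln N))"
    using L \<phi> by (intro mult_left_mono sum_inverse_square_le N) auto
  also have "\<dots> = 64 * L * ann_const * \<phi> * (cmod p)\<^sup>2 * (1 + ln N)"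
    by simp
  finally have i2: "\<bar>\<Sum>w\<in>B - V. F w - h w\<bar> \<le> 64 * L * ann_const * \<phi> * (cmod p)\<^sup>2 * (1 + ln N)" .
  have "\<bar>\<Sum>w\<in>V. F w - h w\<bar> \<le> (\<Sum>w\<in>V. 2 * M)"
  proof (rule order_trans[OF sum_abs sum_mono])
    fix w
    have "\<bar>F w\<bar> \<le> M" "\<bar>h w\<bar> \<le> M" using bound M by (auto simp: F_def h_def)
    then show "\<bar>F w - h w\<bar> \<le> 2 * M" by linarith
  qed
  also have "(\<Sum>w\<in>V. 2 * M) = 2 * M * real (card V)" by simp
  also have "\<dots> \<le> 2 * M * ((4 + 10 * ann_const + 2 * (1 + cmod \<tau>) / Im \<tau>) * (N * cmod p))"
  proof (rule mult_left_mono)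
    have "card V \<le> card (V1 \<union> V2 \<union> V3)"
      by (rule card_mono[OF finite_subset[OF _ finite_lat_ball[of "max (2 * cmod p) N"]]]) (auto simp: V_def V1_def V2_def V3_def)
    also have "\<dots> \<le> card V1 + card V2 + card V3"
      by (meson card_Un_le add_le_mono order_trans le_refl)
    finally have "real (card V) \<le> real (card V1) + real (card V2) + real (card V3)" by linarith
    moreover have "real (card V1) \<le> (1 + 8 * ann_const) * (N * cmod p)"
    proof -
      have "real (card V1) \<le> 1 + 2 * ann_const * (2 * cmod p)\<^sup>2"
        unfolding V1_def using p by (intro card_ball) auto
      also have "\<dots> = 1 + 8 * ann_const * (cmod p * cmod p)" by (simp add: power2_eq_square)
      also have "\<dots> \<le> 1 * (N * cmod p) + 8 * ann_const * (N * cmod p)"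
        using p N ann_const_pos mult_mono[of 1 N 1 "cmod p"] by (intro add_mono mult_left_mono mult_right_mono) auto
      finally show ?thesis by (simp add: algebra_simps)
    qed
    moreover have "real (card V2) \<le> 2 * ann_const * (N * cmod p)"
    proof -
      have "real (card V2) \<le> ann_const * (N * (N - a + 1))"
        unfolding V2_def using p N a by (intro card_annulus) (auto simp: a_def)
      also have "\<dots> \<le> ann_const * (N * (2 * cmod p))"
        using p N ann_const_pos by (intro mult_left_mono) (auto simp: a_def)
      finally show ?thesis by simp
    qed
    moreover have "real (card V3) \<le> (3 + 2 * (1 + cmod \<tau>) / Im \<tau>) * (N * cmod p)"
    proof -
      have "real (card V3) \<le> (3 + 2 * (1 + cmod \<tau>) / Im \<tau>) * N"
        unfolding V3_def by (rule card_bisector[OF p0 N])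
      also have "\<dots> \<le> (3 + 2 * (1 + cmod \<tau>) / Im \<tau>) * (N * cmod p)"
        using p N Im_pos by (intro mult_left_mono) auto
      finally show ?thesis .
    qed
    ultimately show "real (card V) \<le> (4 + 10 * ann_const + 2 * (1 + cmod \<tau>) / Im \<tau>) * (N * cmod p)"
      by (simp add: algebra_simps)
  qed (use M in simp)
  also have "\<dots> = 2 * M * (4 + 10 * ann_const + 2 * (1 + cmod \<tau>) / Im \<tau>) * (N * cmod p)"
    by (rule mult.assoc[symmetric])
  finally have i3: "\<bar>\<Sum>w\<in>V. F w - h w\<bar> \<le> 2 * M * (4 + 10 * ann_const + 2 * (1 + cmod \<tau>) / Im \<tau>) * (N * cmod p)" .
  show ?thesis
    using order_trans[OF i1 add_mono[OF i2 i3]] unfolding h_def B_def by simp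
qed

lemma finite_punctured_ball: "finite {p \<in> lat \<tau>. 0 < cmod p \<and> cmod p \<le> R}"
  by (rule finite_subset[OF _ finite_lat_ball[of R]]) auto

text \<open>
  There are \<open>O(R\<^sup>2)\<close> shifts \<open>p\<close>, each with an error \<open>O(\<phi> R\<^sup>2 (1 + ln N) + N R)\<close>.
\<close>
lemma sum_shifts_compare:
  fixes f :: "real \<Rightarrow> real"
  assumes meas: "f \<in> borel_measurable borel" and bound: "\<And>t. \<bar>f t\<bar> \<le> M"
    and lip: "\<And>s t. \<bar>f s - f t\<bar> \<le> L * \<bar>s - t\<bar>"
  obtains C where "C \<ge> 0" "\<And>N R \<phi>. 1 \<le> R \<Longrightarrow> R \<le> N \<Longrightarrow> 0 \<le> \<phi> \<Longrightarrow>
    \<bar>(\<Sum>p | p \<in> lat \<tau> \<and> 0 < cmod p \<and> cmod p \<le> R. \<Sum>w\<in>shift_set N p. f (\<phi> * (ln ((cmod w)\<^sup>2) - ln ((cmod (w - p))\<^sup>2))))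
      - N\<^sup>2 / Im \<tau> * (\<Sum>p | p \<in> lat \<tau> \<and> 0 < cmod p \<and> cmod p \<le> R. disc_avg f (2 * \<phi> * cmod p / N))\<bar>
    \<le> C * (\<phi> * R ^ 4 * (1 + ln N) + N * R ^ 3)"
proof -
  have L: "0 \<le> L" using lip[of 1 0] by simp
  have M: "0 \<le> M" using bound[of 0] by linarith
  note K = ann_const_pos and d = diam_ge_1
  define c3 where "c3 = 4 + 10 * ann_const + 2 * (1 + cmod \<tau>) / Im \<tau>"
  have c3: "c3 \<ge> 0" using K Im_pos by (simp add: c3_def)
  define a1 where "a1 = 64 * L * diam * ann_const"
  define a2 where "a2 = 64 * L * ann_const"
  define b1 where "b1 = 2 * M * edge_const"
  define b2 where "b2 = 2 * M * c3"
  have nn: "0 \<le> a1" "0 \<le> a2" "0 \<le> b1" "0 \<le> b2"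
    using L M K d edge_const_nonneg c3 by (simp_all add: a1_def a2_def b1_def b2_def)
  define C1 where "C1 = a1 + a2 + b1 + b2"
  have C1: "C1 \<ge> 0" using nn by (simp add: C1_def)
  show thesis
  proof (rule that[of "2 * ann_const * C1"])
    show "0 \<le> 2 * ann_const * C1" using K C1 by simp
    fix N R \<phi> :: real
    assume R: "1 \<le> R" and RN: "R \<le> N" and \<phi>: "0 \<le> \<phi>"
    have N: "1 \<le> N" using R RN by linarith
    have ln0: "0 \<le> 1 + ln N" using N by simp
    define P where "P = {p \<in> lat \<tau>. 0 < cmod p \<and> cmod p \<le> R}"
    define A where "A p = (\<Sum>w\<in>shift_set N p. f (\<phi> * (ln ((cmod w)\<^sup>2) - ln ((cmod (w - p))\<^sup>2))))" for p
    define G where "G p = N\<^sup>2 / Im \<tau> * disc_avg f (2 * \<phi> * cmod p / N)" for p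
    define E where "E = \<phi> * R\<^sup>2 * (1 + ln N) + N * R"
    have per: "\<bar>A p - G p\<bar> \<le> C1 * E" if "p \<in> P" for p
    proof -
      have p: "p \<in> lat \<tau>" "p \<noteq> 0" "cmod p \<le> R" using that by (auto simp: P_def)
      then have p1: "1 \<le> cmod p" by (intro norm_ge_1)
      define H where "H = (\<Sum>w | w \<in> lat \<tau> \<and> cmod w \<le> N. f (2 * \<phi> * Re (p / w)))"
      have pp: "cmod p \<le> R\<^sup>2" "(cmod p)\<^sup>2 \<le> R\<^sup>2"
        using p p1 R power_increasing[of 1 2 R] by (auto intro: power_mono)
      have l1: "\<phi> * cmod p * (1 + ln N) \<le> \<phi> * R\<^sup>2 * (1 + ln N)" "\<phi> * (cmod p)\<^sup>2 * (1 + ln N) \<le> \<phi> * R\<^sup>2 * (1 + ln N)"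
        using pp \<phi> ln0 by (auto intro!: mult_right_mono mult_left_mono)
      have l2: "N \<le> N * R" "N * cmod p \<le> N * R"
        using N R p by (auto intro: mult_left_mono)
      have E0: "0 \<le> \<phi> * R\<^sup>2 * (1 + ln N)" "0 \<le> N * R"
        using \<phi> ln0 N R by auto
      have "\<bar>H - G p\<bar> \<le> a1 * (\<phi> * cmod p * (1 + ln N)) + b1 * N"
        using sum_inv_re_compare[OF meas bound lip p(2) N \<phi>] by (simp add: H_def G_def a1_def b1_def mult_ac)
      also have "\<dots> \<le> a1 * E + b1 * E"
        using l1 l2 E0 nn by (intro add_mono mult_left_mono) (auto simp: E_def)
      finally have 1: "\<bar>H - G p\<bar> \<le> a1 * E + b1 * E" .
      have "\<bar>A p - H\<bar> \<le> a2 * (\<phi> * (cmod p)\<^sup>2 * (1 + ln N)) + b2 * (N * cmod p)"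
        using sum_log_compare[OF bound lip p1 order_trans[OF p(3) RN] \<phi>]
        by (simp add: H_def A_def a2_def b2_def c3_def mult_ac)
      also have "\<dots> \<le> a2 * E + b2 * E"
        using l1 l2 E0 nn by (intro add_mono mult_left_mono) (auto simp: E_def)
      finally have 2: "\<bar>A p - H\<bar> \<le> a2 * E + b2 * E" .
      show ?thesis using 1 2 by (simp add: C1_def algebra_simps)
    qed
    have "\<bar>(\<Sum>p\<in>P. A p) - (\<Sum>p\<in>P. G p)\<bar> \<le> (\<Sum>p\<in>P. \<bar>A p - G p\<bar>)"
      unfolding sum_subtractf[symmetric] by (rule sum_abs)
    also have "\<dots> \<le> (\<Sum>p\<in>P. C1 * E)"
      by (rule sum_mono) (rule per)
    also have "\<dots> = real (card P) * (C1 * E)" by simp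
    also have "\<dots> \<le> (2 * ann_const * R\<^sup>2) * (C1 * E)"
      using card_punctured_ball[OF R] C1 \<phi> ln0 N R by (intro mult_right_mono) (auto simp: P_def E_def)
    also have "\<dots> = 2 * ann_const * C1 * (\<phi> * R ^ 4 * (1 + ln N) + N * R ^ 3)"
      by (simp add: E_def algebra_simps power2_eq_square power3_eq_cube power4_eq_xxxx)
    finally show "\<bar>(\<Sum>p | p \<in> lat \<tau> \<and> 0 < cmod p \<and> cmod p \<le> R. \<Sum>w\<in>shift_set N p. f (\<phi> * (ln ((cmod w)\<^sup>2) - ln ((cmod (w - p))\<^sup>2))))
      - N\<^sup>2 / Im \<tau> * (\<Sum>p | p \<in> lat \<tau> \<and> 0 < cmod p \<and> cmod p \<le> R. disc_avg f (2 * \<phi> * cmod p / N))\<bar>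
      \<le> 2 * ann_const * C1 * (\<phi> * R ^ 4 * (1 + ln N) + N * R ^ 3)"
      unfolding sum_distrib_left by (simp add: A_def G_def P_def)
  qed
qed

text \<open>
  The sum of the main terms \<open>2 / (3 X)\<close> is exact; the errors \<open>O(X\<^bsup>-7/4\<^esup>)\<close> sum to \<open>(N / \<phi>)\<^bsup>7/4\<^esup> R\<^bsup>1/4\<^esup>\<close>.
\<close>
lemma sum_disc_avg_asymptotic:
  fixes f :: "real \<Rightarrow> real"
  assumes meas: "f \<in> borel_measurable borel" and bound: "\<And>t. \<bar>f t\<bar> \<le> M"
    and supp: "\<And>t. \<bar>t\<bar> > A \<Longrightarrow> f t = 0" and A: "A > 0"
  obtains C where "C \<ge> 0" "\<And>N R \<phi>. 1 \<le> R \<Longrightarrow> 0 < N \<Longrightarrow> 0 < \<phi> \<Longrightarrow>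
    \<bar>(\<Sum>p | p \<in> lat \<tau> \<and> 0 < cmod p \<and> cmod p \<le> R. disc_avg f (2 * \<phi> * cmod p / N))
      - N / (3 * \<phi>) * (\<integral>t. f t \<partial>lborel) * (\<Sum>p | p \<in> lat \<tau> \<and> 0 < cmod p \<and> cmod p \<le> R. 1 / cmod p)\<bar>
    \<le> C * ((N / \<phi>) powr (7 / 4) * R powr (1 / 4))"
proof -
  obtain C where C: "C \<ge> 0"
    "\<And>X. X > 0 \<Longrightarrow> \<bar>disc_avg f X - 2 / (3 * X) * (\<integral>t. f t \<partial>lborel)\<bar> \<le> C * X powr (- (7 / 4))"
    using disc_avg_asymptotic[OF meas bound supp A] by blast
  define k where "k = 8 * ann_const * 2 powr (7 / 4) * 2 powr (1 / 4)"
  have k: "0 \<le> k" using ann_const_pos by (simp add: k_def)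
  show thesis
  proof (rule that[of "C * 2 powr (- (7 / 4)) * k"])
    show "0 \<le> C * 2 powr (- (7 / 4)) * k" using C k by simp
    fix N R \<phi> :: real
    assume R: "1 \<le> R" and N: "0 < N" and \<phi>: "0 < \<phi>"
    define P where "P = {p \<in> lat \<tau>. 0 < cmod p \<and> cmod p \<le> R}"
    define I where "I = (\<integral>t. f t \<partial>lborel)"
    have eq: "(\<Sum>p\<in>P. disc_avg f (2 * \<phi> * cmod p / N)) - N / (3 * \<phi>) * I * (\<Sum>p\<in>P. 1 / cmod p)
       = (\<Sum>p\<in>P. disc_avg f (2 * \<phi> * cmod p / N) - 2 / (3 * (2 * \<phi> * cmod p / N)) * I)"
      unfolding sum_subtractf sum_distrib_left using N \<phi> by (intro arg_cong2[of _ _ _ _ minus] sum.cong refl) (simp add: field_simps)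
    have "\<bar>(\<Sum>p\<in>P. disc_avg f (2 * \<phi> * cmod p / N)) - N / (3 * \<phi>) * I * (\<Sum>p\<in>P. 1 / cmod p)\<bar>
      \<le> (\<Sum>p\<in>P. C * (2 * \<phi> * cmod p / N) powr (- (7 / 4)))"
      unfolding eq
    proof (rule order_trans[OF sum_abs sum_mono])
      fix p assume "p \<in> P"
      then show "\<bar>disc_avg f (2 * \<phi> * cmod p / N) - 2 / (3 * (2 * \<phi> * cmod p / N)) * I\<bar> \<le> C * (2 * \<phi> * cmod p / N) powr (- (7 / 4))"
        unfolding I_def using N \<phi> by (intro C) (auto simp: P_def)
    qed
    also have "\<dots> = (\<Sum>p\<in>P. C * 2 powr (- (7 / 4)) * (N / \<phi>) powr (7 / 4) * cmod p powr (- (7 / 4)))"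
    proof (rule sum.cong[OF refl])
      fix p assume "p \<in> P"
      then have p: "0 < cmod p" by (simp add: P_def)
      have x: "0 < N / \<phi>" using N \<phi> by simp
      have "2 * \<phi> * cmod p / N = 2 * cmod p / (N / \<phi>)" by simp
      then have "(2 * \<phi> * cmod p / N) powr (- (7 / 4)) =
          2 powr (- (7 / 4)) * cmod p powr (- (7 / 4)) / (N / \<phi>) powr (- (7 / 4))"
        using p x by (simp only: powr_divide powr_mult mult_nonneg_nonneg less_imp_le zero_le_numeral)
      also have "\<dots> = 2 powr (- (7 / 4)) * cmod p powr (- (7 / 4)) * (N / \<phi>) powr (7 / 4)"
        unfolding powr_minus_divide[of "N / \<phi>"] by simp
      finally show "C * (2 * \<phi> * cmod p / N) powr (- (7 / 4)) =
          C * 2 powr (- (7 / 4)) * (N / \<phi>) powr (7 / 4) * cmod p powr (- (7 / 4))"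
        by (simp only: mult_ac)
    qed
    also have "\<dots> = C * 2 powr (- (7 / 4)) * (N / \<phi>) powr (7 / 4) * (\<Sum>p\<in>P. cmod p powr (- (7 / 4)))"
      by (simp add: sum_distrib_left)
    also have "\<dots> \<le> C * 2 powr (- (7 / 4)) * (N / \<phi>) powr (7 / 4) * (k * R powr (1 / 4))"
      unfolding P_def k_def using C by (intro mult_left_mono sum_inverse_seven_quarters_le R) auto
    finally show "\<bar>(\<Sum>p | p \<in> lat \<tau> \<and> 0 < cmod p \<and> cmod p \<le> R. disc_avg f (2 * \<phi> * cmod p / N))
      - N / (3 * \<phi>) * (\<integral>t. f t \<partial>lborel) * (\<Sum>p | p \<in> lat \<tau> \<and> 0 < cmod p \<and> cmod p \<le> R. 1 / cmod p)\<bar>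
      \<le> C * 2 powr (- (7 / 4)) * k * ((N / \<phi>) powr (7 / 4) * R powr (1 / 4))"
      unfolding P_def I_def by (simp only: mult_ac)
  qed
qed

text \<open>
  If \<open>\<phi> / N\<close> is of the order of \<open>1 / R\<close>, the summand hardly varies over a cell and the sum over \<open>p\<close> is a Riemann sum.
  Adding the term at \<open>p = 0\<close> completes the disc at the cost of a bounded error.
\<close>
lemma sum_disc_avg_riemann:
  fixes f :: "real \<Rightarrow> real"
  assumes meas: "f \<in> borel_measurable borel" and bound: "\<And>t. \<bar>f t\<bar> \<le> M"
    and lip: "\<And>s t. \<bar>f s - f t\<bar> \<le> L * \<bar>s - t\<bar>"
  obtains C where "C \<ge> 0" "\<And>N R \<phi>. 1 \<le> R \<Longrightarrow> 0 < N \<Longrightarrow> 0 \<le> \<phi> \<Longrightarrow>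
    \<bar>(\<Sum>p | p \<in> lat \<tau> \<and> 0 < cmod p \<and> cmod p \<le> R. disc_avg f (2 * \<phi> * cmod p / N))
      - R\<^sup>2 / Im \<tau> * (\<integral>z. indicator unit_disc z * disc_avg f (2 * \<phi> * R / N * sqrt ((fst z)\<^sup>2 + (snd z)\<^sup>2)) \<partial>plane)\<bar>
    \<le> C * (\<phi> * R\<^sup>2 / N + R)"
proof -
  note [measurable] = disc_avg_measurable[OF meas]
  have L: "0 \<le> L" using lip[of 1 0] by simp
  have M: "0 \<le> M" using bound[of 0] by linarith
  define a where "a = 2 * ann_const * (4 * pi * L * diam)"
  define b where "b = 2 * (pi * M) * edge_const + pi * M"
  have ab: "0 \<le> a" "0 \<le> b"
    using L M ann_const_pos diam_ge_1 edge_const_nonneg by (simp_all add: a_def b_def)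
  show thesis
  proof (rule that[of "a + b"])
    show "0 \<le> a + b" using ab by simp
    fix N R \<phi> :: real
    assume R: "1 \<le> R" and N: "0 < N" and \<phi>: "0 \<le> \<phi>"
    define P where "P = {p \<in> lat \<tau>. 0 < cmod p \<and> cmod p \<le> R}"
    define h where "h w = disc_avg f (2 * \<phi> / N * cmod w)" for w :: complex
    define Z where "Z = (\<integral>z. (if cmod (lat_point \<tau> z) \<le> R then h (lat_point \<tau> z) else 0) \<partial>plane)"
    define e where "e w = 4 * pi * L * diam * (\<phi> / N)" for w :: complex
    have 1: "\<bar>(\<Sum>w | w \<in> lat \<tau> \<and> cmod w \<le> R. h w) - Z\<bar>
      \<le> (\<Sum>w | w \<in> lat \<tau> \<and> 0 < cmod w \<and> cmod w \<le> R. e w) + 2 * (pi * M) * edge_const * R"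
      unfolding Z_def
    proof (rule sum_ball_integral_compare[OF _ _ R])
      show "h \<in> borel_measurable borel" unfolding h_def by measurable
      show "\<bar>h w\<bar> \<le> pi * M" for w unfolding h_def by (rule disc_avg_bounded[OF meas bound])
      show "0 \<le> e w" for w using L \<phi> N diam_ge_1 by (simp add: e_def)
      fix w x assume x: "cmod (x - w) \<le> diam"
      have "\<bar>h w - h x\<bar> \<le> 2 * pi * L * \<bar>2 * \<phi> / N * cmod w - 2 * \<phi> / N * cmod x\<bar>"
        unfolding h_def by (rule disc_avg_lipschitz[OF meas bound lip])
      also have "\<bar>2 * \<phi> / N * cmod w - 2 * \<phi> / N * cmod x\<bar> = 2 * \<phi> / N * \<bar>cmod w - cmod x\<bar>"
        unfolding right_diff_distrib[symmetric] abs_mult using \<phi> N by simp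
      also have "2 * pi * L * (2 * \<phi> / N * \<bar>cmod w - cmod x\<bar>) \<le> 2 * pi * L * (2 * \<phi> / N * diam)"
      proof (intro mult_left_mono)
        show "\<bar>cmod w - cmod x\<bar> \<le> diam"
          using norm_triangle_ineq3[of w x] x by (simp add: norm_minus_commute)
      qed (use L \<phi> N in auto)
      also have "\<dots> = e w" by (simp add: e_def)
      finally show "\<bar>h w - h x\<bar> \<le> e w" .
    qed
    have "(\<Sum>w | w \<in> lat \<tau> \<and> 0 < cmod w \<and> cmod w \<le> R. e w) = real (card P) * (4 * pi * L * diam * (\<phi> / N))"
      by (simp add: e_def P_def)
    also have "\<dots> \<le> (2 * ann_const * R\<^sup>2) * (4 * pi * L * diam * (\<phi> / N))"
      unfolding P_def using L \<phi> N diam_ge_1 by (intro mult_right_mono card_punctured_ball R) auto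
    also have "\<dots> = a * (\<phi> * R\<^sup>2 / N)" by (simp add: a_def)
    finally have 2: "(\<Sum>w | w \<in> lat \<tau> \<and> 0 < cmod w \<and> cmod w \<le> R. e w) \<le> a * (\<phi> * R\<^sup>2 / N)" .
    have "{w \<in> lat \<tau>. cmod w \<le> R} = insert 0 P"
    proof -
      have "0 \<in> lat \<tau>" unfolding lat_def by (intro image_eqI[of _ _ "(0, 0)"]) auto
      then show ?thesis using R by (auto simp: P_def)
    qed
    then have 3: "(\<Sum>w | w \<in> lat \<tau> \<and> cmod w \<le> R. h w) = h 0 + (\<Sum>p\<in>P. h p)"
      using finite_punctured_ball[of R] by (simp add: P_def)
    have 4: "\<bar>h 0\<bar> \<le> pi * M" unfolding h_def by (rule disc_avg_bounded[OF meas bound])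
    have Z: "Z = R\<^sup>2 / Im \<tau> * (\<integral>z. indicator unit_disc z * disc_avg f (2 * \<phi> * R / N * sqrt ((fst z)\<^sup>2 + (snd z)\<^sup>2)) \<partial>plane)"
      unfolding Z_def h_def using R by (subst integral_ball_radial) (simp_all add: mult_ac)
    have "\<bar>(\<Sum>p\<in>P. h p) - Z\<bar> \<le> a * (\<phi> * R\<^sup>2 / N) + 2 * (pi * M) * edge_const * R + pi * M * 1"
      using 1 2 3 4 by linarith
    also have "\<dots> \<le> a * (\<phi> * R\<^sup>2 / N) + 2 * (pi * M) * edge_const * R + pi * M * R"
      using R M by (intro add_left_mono mult_left_mono) auto
    also have "\<dots> = a * (\<phi> * R\<^sup>2 / N) + b * R" by (simp add: b_def algebra_simps)
    also have "\<dots> \<le> (a + b) * (\<phi> * R\<^sup>2 / N) + (a + b) * R"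
      using ab R \<phi> N by (intro add_mono mult_right_mono) auto
    finally show "\<bar>(\<Sum>p | p \<in> lat \<tau> \<and> 0 < cmod p \<and> cmod p \<le> R. disc_avg f (2 * \<phi> * cmod p / N))
      - R\<^sup>2 / Im \<tau> * (\<integral>z. indicator unit_disc z * disc_avg f (2 * \<phi> * R / N * sqrt ((fst z)\<^sup>2 + (snd z)\<^sup>2)) \<partial>plane)\<bar>
      \<le> (a + b) * (\<phi> * R\<^sup>2 / N + R)"
      unfolding Z[symmetric] by (simp add: h_def P_def distrib_left)
  qed
qed

end

section \<open>Limit measures, test functions and admissible errors\<close>

lemma scale_measure_eq_density: "scale_measure r M = density M (\<lambda>_. r)"
  by (rule measure_eqI) (simp_all add: emeasure_density nn_integral_cmult_indicator)

lemma integral_limit_measure: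
  assumes [measurable]: "f \<in> borel_measurable borel"
  shows "l = 0 \<Longrightarrow> (\<integral>t. f t \<partial>limit_measure K l) = 4 * pi\<^sup>2 / \<bar>real_of_int (disc K)\<bar> * f 0"
    and "l = \<infinity> \<Longrightarrow> (\<integral>t. f t \<partial>limit_measure K l) = 8 * pi / (3 * \<bar>real_of_int (disc K)\<bar>) * (\<integral>t. f t \<partial>lborel)"
    and "l = ereal r \<Longrightarrow> r > 0 \<Longrightarrow> (\<integral>t. f t \<partial>limit_measure K l) =
      4 * pi / \<bar>real_of_int (disc K)\<bar> * (\<integral>t. unit_rho (t / (2 * r)) * f t \<partial>lborel)"
proof -
  show "(\<integral>t. f t \<partial>limit_measure K l) = 4 * pi\<^sup>2 / \<bar>real_of_int (disc K)\<bar> * f 0" if "l = 0"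
    unfolding limit_measure_def scale_measure_eq_density using that
    by (simp add: integral_density integral_return)
  show "(\<integral>t. f t \<partial>limit_measure K l) = 8 * pi / (3 * \<bar>real_of_int (disc K)\<bar>) * (\<integral>t. f t \<partial>lborel)" if "l = \<infinity>"
    unfolding limit_measure_def scale_measure_eq_density using that
    by (simp add: integral_density)
  show "(\<integral>t. f t \<partial>limit_measure K l) =
      4 * pi / \<bar>real_of_int (disc K)\<bar> * (\<integral>t. unit_rho (t / (2 * r)) * f t \<partial>lborel)" if l: "l = ereal r" "r > 0"
  proof -
    have "(\<integral>t. f t \<partial>limit_measure K l) =
        (\<integral>t. f t \<partial>density lborel (\<lambda>t. ennreal (4 * pi / \<bar>real_of_int (disc K)\<bar> * unit_rho (t / (2 * r)))))"
      using l by (simp add: limit_measure_def rho_eq_unit_rho)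
    also have "\<dots> = (\<integral>t. 4 * pi / \<bar>real_of_int (disc K)\<bar> * (unit_rho (t / (2 * r)) * f t) \<partial>lborel)"
      using unit_rho_bounds(1) by (subst integral_density) (auto simp: mult.assoc)
    finally show ?thesis by simp
  qed
qed

text \<open>
  The norms of a nonzero test function and of its derivative are positive: were the derivative zero, \<open>f\<close> would be constant,
  hence zero by its compact support.  This positivity lets constants depending on \<open>f\<close> be absorbed later.
\<close>
lemma bounded_lipschitz_of_C1_compact_support:
  fixes f :: "real \<Rightarrow> real"
  assumes C1: "f C1_differentiable_on UNIV" and supp: "closure {t. f t \<noteq> 0} \<subseteq> {-A..A}"
  shows "f \<in> borel_measurable borel" "\<And>t. \<bar>t\<bar> > A \<Longrightarrow> f t = 0"
    and "\<exists>M. \<forall>t. \<bar>f t\<bar> \<le> M" "\<exists>L. \<forall>s t. \<bar>f s - f t\<bar> \<le> L * \<bar>s - t\<bar>"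
    and "f t0 \<noteq> 0 \<Longrightarrow> 0 < sup_norm f" "f t0 \<noteq> 0 \<Longrightarrow> 0 < sup_norm (deriv f)"
proof -
  obtain D where D: "\<And>x. (f has_vector_derivative D x) (at x)" and contD: "continuous_on UNIV D"
    using C1 unfolding C1_differentiable_on_def by auto
  have contf: "continuous_on UNIV f"
    by (intro continuous_at_imp_continuous_on ballI) (rule has_vector_derivative_continuous[OF D])
  show "f \<in> borel_measurable borel"
    by (rule borel_measurable_continuous_onI[OF contf])
  show zero: "f t = 0" if "\<bar>t\<bar> > A" for t
  proof (rule ccontr)
    assume "f t \<noteq> 0"
    then have "t \<in> closure {t. f t \<noteq> 0}" using closure_subset by fastforce
    then have "t \<in> {-A..A}" using supp by blast
    then have "\<bar>t\<bar> \<le> A" by (simp add: abs_le_iff)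
    then show False using that by simp
  qed
  have Dzero: "D t = 0" if t: "\<bar>t\<bar> > A" for t
  proof -
    have "open {t::real. \<bar>t\<bar> > A}"
      by (intro open_Collect_less continuous_intros)
    then have "((\<lambda>_. 0) has_vector_derivative D t) (at t)"
      using has_vector_derivative_transform_within_open[OF D, of "{t. \<bar>t\<bar> > A}" t "\<lambda>_. 0"] t zero by auto
    then show ?thesis
      using vector_derivative_unique_at has_vector_derivative_const by blast
  qed
  have bnd: "\<exists>B. \<forall>t. \<bar>g t\<bar> \<le> B" if cont: "continuous_on UNIV g" and z: "\<And>t. \<bar>t\<bar> > A \<Longrightarrow> g t = 0" for g :: "real \<Rightarrow> real"
  proof -
    have "compact (g ` {-A..A})"
      by (intro compact_continuous_image continuous_on_subset[OF cont]) auto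
    from compact_imp_bounded[OF this] obtain B where "\<forall>x\<in>g ` {-A..A}. norm x \<le> B"
      unfolding bounded_iff ..
    then have B: "\<bar>g t\<bar> \<le> B" if "t \<in> {-A..A}" for t
      using that by simp
    have "\<bar>g t\<bar> \<le> max B 0" for t
    proof (cases "\<bar>t\<bar> > A")
      case False
      then have "t \<in> {-A..A}" by auto
      then show ?thesis using B[of t] by linarith
    qed (simp add: z)
    then show ?thesis by blast
  qed
  show bf: "\<exists>M. \<forall>t. \<bar>f t\<bar> \<le> M" by (rule bnd[OF contf zero])
  have bD: "\<exists>M. \<forall>t. \<bar>D t\<bar> \<le> M" by (rule bnd[OF contD Dzero])
  then obtain L where L: "\<And>t. \<bar>D t\<bar> \<le> L" by blast
  have "\<bar>f s - f t\<bar> \<le> L * \<bar>s - t\<bar>" for s t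
  proof -
    have "norm (f s - f t) \<le> L * norm (s - t)"
    proof (rule differentiable_bound[of UNIV f "\<lambda>x h. h * D x"])
      show "(f has_derivative (\<lambda>h. h * D x)) (at x within UNIV)" for x
        using D[of x] by (simp add: has_vector_derivative_def)
      show "onorm (\<lambda>h. h * D x) \<le> L" for x
      proof (rule onorm_le)
        fix h
        have "\<bar>h\<bar> * \<bar>D x\<bar> \<le> \<bar>h\<bar> * L" by (intro mult_left_mono L) auto
        then show "norm (h * D x) \<le> L * norm h" by (simp add: abs_mult mult.commute)
      qed
    qed auto
    then show ?thesis by simp
  qed
  then show lip: "\<exists>L. \<forall>s t. \<bar>f s - f t\<bar> \<le> L * \<bar>s - t\<bar>" by blast
  have sup_pos: "0 < sup_norm g" if b: "\<exists>B. \<forall>t. \<bar>g t\<bar> \<le> B" and nz: "g x \<noteq> 0" for g and x :: real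
  proof -
    have "\<bar>g x\<bar> \<le> sup_norm g"
      unfolding sup_norm_def using b by (intro cSUP_upper) (auto simp: bdd_above_def)
    then show ?thesis using nz by linarith
  qed
  show "0 < sup_norm f" if "f t0 \<noteq> 0" by (rule sup_pos[OF bf that])
  have deriv: "deriv f = D"
  proof
    show "deriv f x = D x" for x
      using D[of x] by (intro DERIV_imp_deriv) (simp add: has_real_derivative_iff_has_vector_derivative)
  qed
  show "0 < sup_norm (deriv f)" if nz: "f t0 \<noteq> 0"
  proof -
    have "\<exists>x. D x \<noteq> 0"
    proof (rule ccontr)
      assume "\<not> (\<exists>x. D x \<noteq> 0)"
      then have "(f has_real_derivative 0) (at x)" for x
        using D[of x] by (simp add: has_real_derivative_iff_has_vector_derivative)
      then have "f t0 = f (\<bar>A\<bar> + 1)"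
        by (intro DERIV_isconst_all) auto
      then show False using zero[of "\<bar>A\<bar> + 1"] nz by auto
    qed
    then show ?thesis unfolding deriv using sup_pos[OF bD] by blast
  qed
qed

text \<open>
  A one-sided condition: only an upper bound for \<open>e\<close> is of interest, and both functions are eventually nonnegative in all uses.
\<close>
definition little_o :: "(nat \<Rightarrow> real) \<Rightarrow> (nat \<Rightarrow> real) \<Rightarrow> bool" where
  "little_o e m \<longleftrightarrow> (\<forall>c>0. \<forall>\<^sub>F N in sequentially. e N \<le> c * m N)"

text \<open>
  The threshold for \<open>N\<close> may depend on \<open>A\<close> and \<open>f\<close>.  Hence an error \<open>C\<^sub>f e N\<close> with a factor \<open>C\<^sub>f\<close> depending on \<open>f\<close> is
  admissible as soon as \<open>e\<close> is negligible with respect to the prescribed rate \<open>m\<close>; the constant in front of the prescribed error may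
  then be taken to be one.
\<close>
lemma converges_with_error_if_little_o:
  assumes small: "little_o e m"
    and est: "\<And>A f M L. 0 < A \<Longrightarrow> f \<in> borel_measurable borel \<Longrightarrow> (\<And>t. \<bar>t\<bar> > A \<Longrightarrow> f t = 0) \<Longrightarrow>
        (\<And>t. \<bar>f t\<bar> \<le> M) \<Longrightarrow> (\<And>s t. \<bar>f s - f t\<bar> \<le> L * \<bar>s - t\<bar>) \<Longrightarrow>
        \<exists>C\<ge>0. \<forall>\<^sub>F N in sequentially. \<bar>(\<integral>t. f t \<partial>R N) - (\<integral>t. f t \<partial>\<mu>)\<bar> \<le> C * e N"
    and e_nonneg: "\<forall>\<^sub>F N in sequentially. 0 \<le> e N"
    and low: "\<And>A x y. 1 \<le> A \<Longrightarrow> 0 < x \<Longrightarrow> 0 < y \<Longrightarrow> \<forall>\<^sub>F N in sequentially. min x y * m N \<le> err N A x y"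
    and zero: "\<And>N A. err N A 0 0 \<ge> 0"
  shows "converges_with_error R \<mu> err"
  unfolding converges_with_error_def
proof (intro exI[of _ 1] conjI allI impI)
  fix A :: real and f :: "real \<Rightarrow> real"
  assume A: "1 \<le> A" and f: "f C1_differentiable_on UNIV" "closure {t. f t \<noteq> 0} \<subseteq> {-A..A}"
  note props = bounded_lipschitz_of_C1_compact_support[OF f]
  show "\<forall>\<^sub>F N in sequentially. \<bar>(\<integral>t. f t \<partial>R N) - (\<integral>t. f t \<partial>\<mu>)\<bar> \<le> 1 * err N A (sup_norm f) (sup_norm (deriv f))"
  proof (cases "\<exists>t. f t \<noteq> 0")
    case False
    then have "f = (\<lambda>_. 0)" by auto
    then show ?thesis using zero by (simp add: sup_norm_def)
  next
    case True
    then obtain t0 where t0: "f t0 \<noteq> 0" by blast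
    obtain M L where bl: "\<And>t. \<bar>f t\<bar> \<le> M" "\<And>s t. \<bar>f s - f t\<bar> \<le> L * \<bar>s - t\<bar>"
      using props(3,4) by blast
    obtain C where C: "C \<ge> 0" "\<forall>\<^sub>F N in sequentially. \<bar>(\<integral>t. f t \<partial>R N) - (\<integral>t. f t \<partial>\<mu>)\<bar> \<le> C * e N"
      using est[of A f M L] A props(1,2) bl by fastforce
    define k where "k = min (sup_norm f) (sup_norm (deriv f))"
    have k: "k > 0" using props(5,6)[OF t0] by (simp add: k_def)
    have "0 < k / (C + 1)" using k C(1) by simp
    then have "\<forall>\<^sub>F N in sequentially. e N \<le> k / (C + 1) * m N"
      using small unfolding little_o_def by blast
    moreover have "\<forall>\<^sub>F N in sequentially. k * m N \<le> err N A (sup_norm f) (sup_norm (deriv f))"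
      unfolding k_def using props(5,6)[OF t0] A by (intro low) auto
    ultimately show ?thesis using C(2) e_nonneg
    proof eventually_elim
      case (elim N)
      have "C * e N \<le> (C + 1) * e N" using elim(4) by (simp add: algebra_simps)
      also have "\<dots> \<le> (C + 1) * (k / (C + 1) * m N)"
        using elim(1) C(1) by (intro mult_left_mono) auto
      also have "\<dots> = k * m N" using C(1) by simp
      finally have "C * e N \<le> k * m N" .
      then show ?case using elim by linarith
    qed
  qed
qed simp

section \<open>Grouping the pairs by their difference\<close>

lemma qnorm_eq: "qnorm z = (cmod z)\<^sup>2"
  by (simp add: qnorm_def complex_mult_cnj cmod_power2)

context
  fixes K :: "complex set"
  assumes K: "imaginary_quadratic_field K"
begin

lemma ring_of_integers_eq_lat: "ring_of_integers K = lat (omega K)"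
  unfolding lat_def by (rule ring_of_integers_omega[OF K])

lemma norm_square_nat:
  assumes "w \<in> ring_of_integers K"
  shows "(cmod w)\<^sup>2 = real (nat \<lfloor>(cmod w)\<^sup>2\<rfloor>)"
proof -
  obtain b :: int where b: "(cmod w)\<^sup>2 = of_int b"
    using assms ring_of_integers_iff[OF K] by blast
  moreover have "0 \<le> b" using b by (metis of_int_0_le_iff zero_le_power2)
  ultimately show ?thesis by simp
qed

lemma lattice_omega: "lattice (omega K)"
proof
  show "0 < Im (omega K)" by (rule ring_of_integers_omega[OF K])
  fix w assume w: "w \<in> lat (omega K)" "w \<noteq> 0"
  then have "(cmod w)\<^sup>2 = real (nat \<lfloor>(cmod w)\<^sup>2\<rfloor>)"
    by (intro norm_square_nat) (simp add: ring_of_integers_eq_lat)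
  moreover have "(cmod w)\<^sup>2 \<noteq> 0" using w by simp
  ultimately have "1 \<le> (cmod w)\<^sup>2" by (metis of_nat_0 of_nat_1 of_nat_le_iff less_one not_le)
  then show "1 \<le> cmod w" by (metis abs_norm_cancel abs_square_le_1 one_le_power power2_le_iff_abs_le linorder_le_cases norm_ge_zero power_le_one order_antisym one_power2 power2_eq_imp_eq zero_le_one)
qed

text \<open>
  The pair \<open>(a, b)\<close> of norms is a function of \<open>(w, z)\<close>, so summing \<open>r_count\<close> over \<open>(a, b)\<close> is summing over the pairs
  \<open>(w, z)\<close> themselves, which are then indexed by \<open>p = w - z\<close> and \<open>w\<close>.
\<close>
lemma sum_r_count_eq:
  fixes f :: "real \<Rightarrow> real"
  assumes N: "N \<ge> 1"
  shows "(\<Sum>(a, b)\<in>index_pairs N. real (r_count K \<alpha> a b N) * f (\<phi> * (ln (real a) - ln (real b)))) =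
    (\<Sum>p | p \<in> lat (omega K) \<and> 0 < cmod p \<and> cmod p \<le> real N powr \<alpha>.
       \<Sum>w\<in>lattice.shift_set (omega K) (real N) p. f (\<phi> * (ln ((cmod w)\<^sup>2) - ln ((cmod (w - p))\<^sup>2))))"
proof -
  interpret lattice "omega K" by (rule lattice_omega)
  define Ok where "Ok = ring_of_integers K"
  have OL: "Ok = lat (omega K)" by (simp add: Ok_def ring_of_integers_eq_lat)
  define R where "R = real N powr \<alpha>"
  have R2: "real N powr (2 * \<alpha>) = R\<^sup>2"
    by (simp add: R_def power2_eq_square flip: powr_add)
  have R0: "0 \<le> R" by (simp add: R_def)
  have Rle: "qnorm x \<le> real N powr (2 * \<alpha>) \<longleftrightarrow> cmod x \<le> R" for x
    unfolding qnorm_eq R2 using R0 by (simp add: power2_le_iff_abs_le)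
  define Q where "Q = {(w, z). w \<in> Ok \<and> z \<in> Ok \<and> 0 < cmod w \<and> cmod w \<le> real N \<and> 0 < cmod z \<and> cmod z \<le> real N
     \<and> cmod w \<noteq> cmod z \<and> cmod (z - w) \<le> R}"
  define nn where "nn w = nat \<lfloor>(cmod w)\<^sup>2\<rfloor>" for w
  have nn: "(cmod w)\<^sup>2 = real (nn w)" if "w \<in> Ok" for w
    unfolding nn_def using that norm_square_nat Ok_def by blast
  define key where "key = (\<lambda>(w, z). (nn w, nn z))"
  have le_N: "cmod w \<le> real N \<longleftrightarrow> nn w \<le> N\<^sup>2" if "w \<in> Ok" for w
  proof -
    have "cmod w \<le> real N \<longleftrightarrow> (cmod w)\<^sup>2 \<le> (real N)\<^sup>2"
      by (simp add: power2_le_iff_abs_le)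
    also have "\<dots> \<longleftrightarrow> nn w \<le> N\<^sup>2"
      unfolding nn[OF that] by (metis of_nat_le_iff of_nat_power)
    finally show ?thesis .
  qed
  have pos: "0 < cmod w \<longleftrightarrow> 0 < nn w" if "w \<in> Ok" for w
    using nn[OF that] by (metis less_numeral_extra(3) of_nat_0_less_iff zero_less_norm_iff zero_less_power2 norm_eq_zero)
  have eq_norm: "cmod w = cmod z \<longleftrightarrow> nn w = nn z" if "w \<in> Ok" "z \<in> Ok" for w z
    using nn[OF that(1)] nn[OF that(2)] by (metis norm_ge_zero of_nat_eq_iff power2_eq_imp_eq)
  have finQ: "finite Q"
    by (rule finite_subset[of _ "{w \<in> lat (omega K). cmod w \<le> real N} \<times> {w \<in> lat (omega K). cmod w \<le> real N}"])
       (auto simp: Q_def OL intro: finite_lat_ball)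
  have keyQ: "key ` Q \<subseteq> index_pairs N"
    using le_N pos eq_norm by (auto simp: Q_def key_def index_pairs_def)
  have fin_ind: "finite (index_pairs N)"
    by (rule finite_subset[of _ "{..N\<^sup>2} \<times> {..N\<^sup>2}"]) (auto simp: index_pairs_def)
  have rc: "r_count K \<alpha> a b N = card {q \<in> Q. key q = (a, b)}" if ab: "(a, b) \<in> index_pairs N" for a b
  proof -
    have "{(w, z). w \<in> Ok \<and> z \<in> Ok \<and> qnorm w = real a \<and> qnorm z = real b \<and> qnorm (z - w) \<le> real N powr (2 * \<alpha>)}
       = {q \<in> Q. key q = (a, b)}"
    proof (intro set_eqI iffI)
      fix q assume q: "q \<in> {(w, z). w \<in> Ok \<and> z \<in> Ok \<and> qnorm w = real a \<and> qnorm z = real b \<and> qnorm (z - w) \<le> real N powr (2 * \<alpha>)}"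
      then obtain w z where wz: "q = (w, z)" "w \<in> Ok" "z \<in> Ok" "qnorm w = real a" "qnorm z = real b" "cmod (z - w) \<le> R"
        unfolding Rle by auto
      then have "nn w = a" "nn z = b" using nn by (auto simp: qnorm_eq)
      then show "q \<in> {q \<in> Q. key q = (a, b)}"
        using wz ab le_N pos eq_norm by (auto simp: Q_def key_def index_pairs_def)
    next
      fix q assume "q \<in> {q \<in> Q. key q = (a, b)}"
      then show "q \<in> {(w, z). w \<in> Ok \<and> z \<in> Ok \<and> qnorm w = real a \<and> qnorm z = real b \<and> qnorm (z - w) \<le> real N powr (2 * \<alpha>)}"
        unfolding Rle using nn by (auto simp: Q_def key_def qnorm_eq)
    qed
    then show ?thesis by (simp add: r_count_def Ok_def)
  qed
  define F where "F = (\<lambda>(a, b). f (\<phi> * (ln (real a) - ln (real b))))"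
  have "(\<Sum>(a, b)\<in>index_pairs N. real (r_count K \<alpha> a b N) * f (\<phi> * (ln (real a) - ln (real b)))) =
      (\<Sum>ab\<in>index_pairs N. \<Sum>q | q \<in> Q \<and> key q = ab. F (key q))"
    using rc by (intro sum.cong) (auto simp: F_def)
  also have "\<dots> = (\<Sum>q\<in>Q. F (key q))"
    by (rule sum.group[OF finQ fin_ind keyQ])
  also have "\<dots> = (\<Sum>(w, z)\<in>Q. f (\<phi> * (ln ((cmod w)\<^sup>2) - ln ((cmod z)\<^sup>2))))"
    by (intro sum.cong) (auto simp: F_def key_def nn Q_def)
  also have "\<dots> = (\<Sum>(p, w)\<in>(SIGMA p:{p \<in> lat (omega K). 0 < cmod p \<and> cmod p \<le> R}. shift_set (real N) p).
       f (\<phi> * (ln ((cmod w)\<^sup>2) - ln ((cmod (w - p))\<^sup>2))))"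
  proof (rule sum.reindex_bij_witness[of _ "\<lambda>(p, w). (w, w - p)" "\<lambda>(w, z). (w - z, w)"])
    fix q assume "q \<in> Q"
    then obtain w z where wz: "q = (w, z)" "(w, z) \<in> Q" by (cases q) auto
    then have Okwz: "w \<in> Ok" "z \<in> Ok" by (auto simp: Q_def)
    have "w - z \<in> Ok"
      using ring_of_integers_diff[OF K] Okwz by (simp add: Ok_def)
    moreover have "w - z \<noteq> 0" using wz by (auto simp: Q_def)
    ultimately show "(case q of (w, z) \<Rightarrow> (w - z, w)) \<in> (SIGMA p:{p \<in> lat (omega K). 0 < cmod p \<and> cmod p \<le> R}. shift_set (real N) p)"
      using wz by (auto simp: Q_def shift_set_def OL norm_minus_commute)
  next
    fix q assume q: "q \<in> (SIGMA p:{p \<in> lat (omega K). 0 < cmod p \<and> cmod p \<le> R}. shift_set (real N) p)"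
    then obtain p w where pw: "q = (p, w)" "p \<in> Ok" "w \<in> Ok" "cmod p \<le> R" "w \<in> shift_set (real N) p"
      by (auto simp: OL shift_set_def)
    have "w - p \<in> Ok"
      using ring_of_integers_diff[OF K] pw by (simp add: Ok_def)
    then show "(case q of (p, w) \<Rightarrow> (w, w - p)) \<in> Q"
      using pw by (auto simp: Q_def shift_set_def)
  qed auto
  also have "\<dots> = (\<Sum>p\<in>{p \<in> lat (omega K). 0 < cmod p \<and> cmod p \<le> R}. \<Sum>w\<in>shift_set (real N) p. f (\<phi> * (ln ((cmod w)\<^sup>2) - ln ((cmod (w - p))\<^sup>2))))"
  proof (rule sum.Sigma[symmetric])
    show "finite {p \<in> lat (omega K). 0 < cmod p \<and> cmod p \<le> R}" by (rule finite_punctured_ball)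
    show "\<forall>p\<in>{p \<in> lat (omega K). 0 < cmod p \<and> cmod p \<le> R}. finite (shift_set (real N) p)"
      by (intro ballI finite_subset[OF _ finite_lat_ball[of "real N"]]) (auto simp: shift_set_def)
  qed
  finally show ?thesis by (simp add: R_def)
qed

end

section \<open>The three limits with explicit errors\<close>

lemma abs_divide_diff_le:
  fixes T B E \<psi> \<psi>0 :: real
  assumes "\<bar>T - B\<bar> \<le> E" "0 < \<psi>0" "\<psi>0 \<le> \<psi>"
  shows "\<bar>1 / \<psi> * T - B / \<psi>\<bar> \<le> E / \<psi>0"
proof -
  have "1 / \<psi> * T - B / \<psi> = (T - B) / \<psi>" by (simp add: diff_divide_distrib)
  then have "\<bar>1 / \<psi> * T - B / \<psi>\<bar> = \<bar>T - B\<bar> / \<psi>" using assms by (simp add: abs_divide)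
  also have "\<dots> \<le> E / \<psi>0" using assms by (intro frac_le) auto
  finally show ?thesis .
qed

lemma eventually_radius:
  assumes "0 < \<alpha>" "\<alpha> < 1"
  shows "\<forall>\<^sub>F N in sequentially. 1 \<le> N \<and> d \<le> real N powr \<alpha> \<and> 1 \<le> real N powr \<alpha> \<and> real N powr \<alpha> \<le> real N"
proof -
  have "filterlim (\<lambda>N. real N powr \<alpha>) at_top sequentially"
    using assms by real_asymp
  then have "\<forall>\<^sub>F N in sequentially. d \<le> real N powr \<alpha>"
    by (simp add: filterlim_at_top)
  moreover have "\<forall>\<^sub>F N in sequentially. 1 \<le> (N::nat)"
    by (rule eventually_ge_at_top)
  ultimately show ?thesis
  proof eventually_elim
    case (elim N)
    have "real N powr \<alpha> \<le> real N powr 1" using elim assms by (intro powr_mono) auto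
    moreover have "1 \<le> real N powr \<alpha>" using elim assms by (intro ge_one_powr_ge_zero) auto
    ultimately show ?case using elim by simp
  qed
qed

context
  fixes K :: "complex set" and \<alpha> :: real and \<phi> :: "nat \<Rightarrow> real"
  assumes K: "imaginary_quadratic_field K" and \<alpha>: "0 < \<alpha>" "\<alpha> < 1"
    and \<phi>_pos: "\<And>N. 1 \<le> N \<Longrightarrow> 0 < \<phi> N"
begin

interpretation lattice "omega K"
  by (rule lattice_omega[OF K])

abbreviation (input) rad :: "nat \<Rightarrow> real" where
  "rad N \<equiv> real N powr \<alpha>"

definition disc_points :: "nat \<Rightarrow> complex set" where
  "disc_points N = {p \<in> lat (omega K). 0 < cmod p \<and> cmod p \<le> rad N}"

lemma abs_disc: "\<bar>real_of_int (disc K)\<bar> = 4 * (Im (omega K))\<^sup>2"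
  by (rule ring_of_integers_omega[OF K])

lemma S_sum_0: "S_sum K \<alpha> 0 N = Im (omega K) / (2 * pi) * (\<Sum>p\<in>disc_points N. 1 / cmod p)"
  unfolding S_sum_eq_power_sum[OF K] disc_points_def ring_of_integers_eq_lat[OF K] by simp

lemma S_sum_1: "S_sum K \<alpha> 1 N = Im (omega K) / pi * real (card (disc_points N))"
proof -
  have "(\<Sum>p | p \<in> lat (omega K) \<and> 0 < cmod p \<and> cmod p \<le> rad N. cmod p ^ 1 / cmod p) = (\<Sum>p\<in>disc_points N. 1)"
    by (intro sum.cong) (auto simp: disc_points_def)
  then show ?thesis
    unfolding S_sum_eq_power_sum[OF K] ring_of_integers_eq_lat[OF K] by simp
qed

lemma card_disc_points:
  assumes "diam \<le> rad N"
  shows "(rad N)\<^sup>2 / (4 * diam\<^sup>2) \<le> real (card (disc_points N))"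
  unfolding disc_points_def by (rule card_punctured_ball_lower[OF assms])

text \<open>
  Each summand is at least \<open>1 / R\<close>, and there are at least \<open>R\<^sup>2 / (4 diam\<^sup>2)\<close> of them.
\<close>
lemma sum_inverse_disc_points:
  assumes "diam \<le> rad N"
  shows "rad N / (4 * diam\<^sup>2) \<le> (\<Sum>p\<in>disc_points N. 1 / cmod p)"
proof -
  have r: "0 < rad N" using assms diam_ge_1 by linarith
  have "rad N / (4 * diam\<^sup>2) = (rad N)\<^sup>2 / (4 * diam\<^sup>2) / rad N"
    using r by (simp add: power2_eq_square)
  also have "\<dots> \<le> real (card (disc_points N)) / rad N"
    using r card_disc_points[OF assms] by (intro divide_right_mono) auto
  also have "\<dots> = (\<Sum>p\<in>disc_points N. 1 / rad N)" by simp
  also have "\<dots> \<le> (\<Sum>p\<in>disc_points N. 1 / cmod p)"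
    by (intro sum_mono frac_le) (auto simp: disc_points_def)
  finally show ?thesis .
qed

context
  fixes f :: "real \<Rightarrow> real" and A M L :: real
  assumes A: "0 < A" and meas: "f \<in> borel_measurable borel" and supp: "\<And>t. \<bar>t\<bar> > A \<Longrightarrow> f t = 0"
    and bound: "\<And>t. \<bar>f t\<bar> \<le> M" and lip: "\<And>s t. \<bar>f s - f t\<bar> \<le> L * \<bar>s - t\<bar>"
begin

definition pair_sum :: "nat \<Rightarrow> real" where
  "pair_sum N = (\<Sum>p\<in>disc_points N. \<Sum>w\<in>shift_set (real N) p. f (\<phi> N * (ln ((cmod w)\<^sup>2) - ln ((cmod (w - p))\<^sup>2))))"

definition avg_sum :: "nat \<Rightarrow> real" where
  "avg_sum N = (\<Sum>p\<in>disc_points N. disc_avg f (2 * \<phi> N * cmod p / real N))"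

lemma integral_R_meas_eq:
  assumes "0 \<le> \<psi> N" "1 \<le> N"
  shows "(\<integral>t. f t \<partial>R_meas K \<alpha> \<phi> \<psi> N) = 1 / \<psi> N * pair_sum N"
  unfolding integral_R_meas[where f = f and \<psi> = \<psi> and N = N, OF meas assms(1)] sum_r_count_eq[OF K assms(2)] pair_sum_def disc_points_def ..

lemma pair_sum_compare:
  obtains C where "C \<ge> 0" "\<And>N. 1 \<le> N \<Longrightarrow> 1 \<le> rad N \<Longrightarrow> rad N \<le> real N \<Longrightarrow>
    \<bar>pair_sum N - (real N)\<^sup>2 / Im (omega K) * avg_sum N\<bar> \<le> C * (\<phi> N * rad N ^ 4 * (1 + ln (real N)) + real N * rad N ^ 3)"
proof -
  obtain C where C: "C \<ge> 0" "\<And>N R \<phi>. 1 \<le> R \<Longrightarrow> R \<le> N \<Longrightarrow> 0 \<le> \<phi> \<Longrightarrow>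
    \<bar>(\<Sum>p | p \<in> lat (omega K) \<and> 0 < cmod p \<and> cmod p \<le> R. \<Sum>w\<in>shift_set N p. f (\<phi> * (ln ((cmod w)\<^sup>2) - ln ((cmod (w - p))\<^sup>2))))
      - N\<^sup>2 / Im (omega K) * (\<Sum>p | p \<in> lat (omega K) \<and> 0 < cmod p \<and> cmod p \<le> R. disc_avg f (2 * \<phi> * cmod p / N))\<bar>
    \<le> C * (\<phi> * R ^ 4 * (1 + ln N) + N * R ^ 3)"
    using sum_shifts_compare[OF meas bound lip] by blast
  show thesis
  proof (rule that[OF C(1)])
    fix N :: nat assume "1 \<le> N" "1 \<le> rad N" "rad N \<le> real N"
    then show "\<bar>pair_sum N - (real N)\<^sup>2 / Im (omega K) * avg_sum N\<bar> \<le> C * (\<phi> N * rad N ^ 4 * (1 + ln (real N)) + real N * rad N ^ 3)"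
      unfolding pair_sum_def avg_sum_def disc_points_def
      using \<phi>_pos[of N] by (intro C(2)) auto
  qed
qed

text \<open>
  After division by \<open>\<psi>\<close>, which is of the order of \<open>N\<^sup>2 R\<^sup>2\<close>, the first two terms come from the comparison of sums with integrals and the last
  one from replacing \<open>disc_avg f X\<close> by its value at zero.
\<close>
lemma estimate_zero:
  "\<exists>C\<ge>0. \<forall>\<^sub>F N in sequentially.
     \<bar>(\<integral>t. f t \<partial>R_meas K \<alpha> \<phi> (\<lambda>N. real N ^ 2 * S_sum K \<alpha> 1 N) N) - (\<integral>t. f t \<partial>limit_measure K 0)\<bar>
     \<le> C * (\<phi> N * rad N ^ 2 * (1 + ln (real N)) / real N ^ 2 + rad N / real N + \<phi> N * rad N / real N)"
proof -
  define I where "I = Im (omega K)"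
  have I: "I > 0" using Im_pos by (simp add: I_def)
  have L: "0 \<le> L" using lip[of 1 0] by simp
  obtain C where C: "C \<ge> 0" "\<And>N. 1 \<le> N \<Longrightarrow> 1 \<le> rad N \<Longrightarrow> rad N \<le> real N \<Longrightarrow>
    \<bar>pair_sum N - (real N)\<^sup>2 / I * avg_sum N\<bar> \<le> C * (\<phi> N * rad N ^ 4 * (1 + ln (real N)) + real N * rad N ^ 3)"
    using pair_sum_compare unfolding I_def by blast
  \<comment> \<open>Chosen such that \<open>n\<^sup>2 r\<^sup>2 / k \<le> \<psi>\<close>, by the lower bound for the number of lattice points.\<close>
  define k where "k = 4 * diam\<^sup>2 * pi / I"
  have k: "0 \<le> k" using I by (simp add: k_def)
  define C' where "C' = C * k + 4 * pi\<^sup>2 * L / I\<^sup>2"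
  have C': "0 \<le> C * k" "0 \<le> 4 * pi\<^sup>2 * L / I\<^sup>2" using C(1) k L I by auto
  have "\<forall>\<^sub>F N in sequentially. \<bar>(\<integral>t. f t \<partial>R_meas K \<alpha> \<phi> (\<lambda>N. real N ^ 2 * S_sum K \<alpha> 1 N) N) - (\<integral>t. f t \<partial>limit_measure K 0)\<bar>
     \<le> C' * (\<phi> N * rad N ^ 2 * (1 + ln (real N)) / real N ^ 2 + rad N / real N + \<phi> N * rad N / real N)"
    using eventually_radius[OF \<alpha>, of diam]
  proof eventually_elim
    case (elim N)
    define n r F c where "n = real N" and "r = rad N" and "F = \<phi> N" and "c = real (card (disc_points N))"
    have nr: "1 \<le> n" "1 \<le> r" "r \<le> n" "diam \<le> r" "0 < F" "0 \<le> 1 + ln n"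
      using elim \<phi>_pos[of N] by (auto simp: n_def r_def F_def)
    have c: "r\<^sup>2 / (4 * diam\<^sup>2) \<le> c" "0 < c"
    proof -
      show "r\<^sup>2 / (4 * diam\<^sup>2) \<le> c" using card_disc_points nr by (simp add: r_def c_def)
      moreover have "0 < r\<^sup>2 / (4 * diam\<^sup>2)" using nr diam_ge_1 by simp
      ultimately show "0 < c" by linarith
    qed
    define \<psi> where "\<psi> = n\<^sup>2 * (I / pi * c)"
    have psi: "real N ^ 2 * S_sum K \<alpha> 1 N = \<psi>"
      unfolding \<psi>_def S_sum_1 by (simp add: n_def I_def c_def)
    have psi_pos: "0 < \<psi>" using nr I c by (simp add: \<psi>_def)
    have psi_low: "n\<^sup>2 * r\<^sup>2 / k \<le> \<psi>"
    proof -
      have "n\<^sup>2 * r\<^sup>2 / k = n\<^sup>2 * (I / pi * (r\<^sup>2 / (4 * diam\<^sup>2)))"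
        using I diam_ge_1 by (simp add: k_def mult_ac)
      also have "\<dots> \<le> \<psi>" unfolding \<psi>_def using I c by (intro mult_left_mono) auto
      finally show ?thesis .
    qed
    define e1 where "e1 = F * r ^ 4 * (1 + ln n) + n * r ^ 3"
    have avg: "\<bar>avg_sum N - c * (pi * f 0)\<bar> \<le> c * (4 * pi * L * (F * r / n))"
    proof -
      have "avg_sum N - c * (pi * f 0) = (\<Sum>p\<in>disc_points N. disc_avg f (2 * F * cmod p / n) - pi * f 0)"
        by (simp add: avg_sum_def sum_subtractf c_def F_def n_def)
      then have "\<bar>avg_sum N - c * (pi * f 0)\<bar> \<le> (\<Sum>p\<in>disc_points N. \<bar>disc_avg f (2 * F * cmod p / n) - pi * f 0\<bar>)"
        by (simp add: sum_abs)
      also have "\<dots> \<le> (\<Sum>p\<in>disc_points N. 4 * pi * L * (F * r / n))"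
      proof (rule sum_mono)
        fix p assume p: "p \<in> disc_points N"
        have "\<bar>disc_avg f (2 * F * cmod p / n) - disc_avg f 0\<bar> \<le> 2 * pi * L * \<bar>2 * F * cmod p / n - 0\<bar>"
          by (rule disc_avg_lipschitz[OF meas bound lip])
        also have "\<dots> = 2 * pi * L * (2 * F * cmod p / n)" using nr by simp
        also have "\<dots> \<le> 2 * pi * L * (2 * F * r / n)"
          using nr L p by (intro mult_left_mono divide_right_mono) (auto simp: disc_points_def r_def)
        finally show "\<bar>disc_avg f (2 * F * cmod p / n) - pi * f 0\<bar> \<le> 4 * pi * L * (F * r / n)"
          by (simp add: disc_avg_zero)
      qed
      finally show ?thesis by (simp add: c_def)
    qed
    have 1: "\<bar>1 / \<psi> * pair_sum N - (n\<^sup>2 / I * avg_sum N) / \<psi>\<bar> \<le> C * e1 / (n\<^sup>2 * r\<^sup>2 / k)"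
    proof (rule abs_divide_diff_le[OF _ _ psi_low])
      show "\<bar>pair_sum N - n\<^sup>2 / I * avg_sum N\<bar> \<le> C * e1"
        using C(2)[of N] elim by (simp add: n_def r_def F_def e1_def)
      show "0 < n\<^sup>2 * r\<^sup>2 / k" using nr I diam_ge_1 by (simp add: k_def)
    qed
    have 2: "\<bar>1 / \<psi> * (n\<^sup>2 / I * avg_sum N) - (n\<^sup>2 / I * (c * (pi * f 0))) / \<psi>\<bar> \<le> n\<^sup>2 / I * (c * (4 * pi * L * (F * r / n))) / \<psi>"
    proof (rule abs_divide_diff_le[OF _ psi_pos order_refl])
      have "\<bar>n\<^sup>2 / I * avg_sum N - n\<^sup>2 / I * (c * (pi * f 0))\<bar> = n\<^sup>2 / I * \<bar>avg_sum N - c * (pi * f 0)\<bar>"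
        unfolding right_diff_distrib[symmetric] abs_mult using I by simp
      also have "\<dots> \<le> n\<^sup>2 / I * (c * (4 * pi * L * (F * r / n)))"
        using I by (intro mult_left_mono avg) simp
      finally show "\<bar>n\<^sup>2 / I * avg_sum N - n\<^sup>2 / I * (c * (pi * f 0))\<bar> \<le> n\<^sup>2 / I * (c * (4 * pi * L * (F * r / n)))" .
    qed
    have 3: "(n\<^sup>2 / I * (c * (pi * f 0))) / \<psi> = (\<integral>t. f t \<partial>limit_measure K 0)"
      unfolding integral_limit_measure(1)[OF meas refl] abs_disc I_def[symmetric] \<psi>_def
      using nr I c by (simp add: power2_eq_square)
    have 4: "n\<^sup>2 / I * (c * (4 * pi * L * (F * r / n))) / \<psi> = 4 * pi\<^sup>2 * L / I\<^sup>2 * (F * r / n)"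
      unfolding \<psi>_def using nr I c by (simp add: power2_eq_square mult_ac)
    have 5: "C * e1 / (n\<^sup>2 * r\<^sup>2 / k) = C * k * (F * r\<^sup>2 * (1 + ln n) / n\<^sup>2 + r / n)"
    proof -
      have "e1 / (n\<^sup>2 * r\<^sup>2) = F * r\<^sup>2 * (1 + ln n) / n\<^sup>2 + r / n"
        unfolding e1_def using nr by (simp add: field_simps power2_eq_square power3_eq_cube power4_eq_xxxx)
      moreover have "C * e1 / (n\<^sup>2 * r\<^sup>2 / k) = C * k * (e1 / (n\<^sup>2 * r\<^sup>2))" by simp
      ultimately show ?thesis by simp
    qed
    have int: "(\<integral>t. f t \<partial>R_meas K \<alpha> \<phi> (\<lambda>N. real N ^ 2 * S_sum K \<alpha> 1 N) N) = 1 / \<psi> * pair_sum N"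
      unfolding psi[symmetric] by (rule integral_R_meas_eq) (use psi psi_pos elim in auto)
    have nn: "0 \<le> F * r\<^sup>2 * (1 + ln n) / n\<^sup>2" "0 \<le> r / n" "0 \<le> F * r / n"
      using nr by auto
    have "\<bar>1 / \<psi> * pair_sum N - (\<integral>t. f t \<partial>limit_measure K 0)\<bar>
       \<le> C * k * (F * r\<^sup>2 * (1 + ln n) / n\<^sup>2 + r / n) + 4 * pi\<^sup>2 * L / I\<^sup>2 * (F * r / n)"
    proof -
      have "1 / \<psi> * (n\<^sup>2 / I * avg_sum N) = (n\<^sup>2 / I * avg_sum N) / \<psi>" by simp
      then show ?thesis using 1 2 unfolding 3 4 5 by linarith
    qed
    also have "\<dots> \<le> C * k * (F * r\<^sup>2 * (1 + ln n) / n\<^sup>2 + r / n + F * r / n)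
        + 4 * pi\<^sup>2 * L / I\<^sup>2 * (F * r\<^sup>2 * (1 + ln n) / n\<^sup>2 + r / n + F * r / n)"
      by (rule add_mono; rule mult_left_mono) (use nn C' in linarith)+
    also have "\<dots> = C' * (F * r\<^sup>2 * (1 + ln n) / n\<^sup>2 + r / n + F * r / n)"
      by (simp add: C'_def distrib_right)
    finally show ?case
      unfolding int n_def r_def F_def .
  qed
  moreover have "0 \<le> C'" using C' by (simp add: C'_def)
  ultimately show ?thesis by blast
qed

text \<open>
  Here \<open>\<psi>\<close> is of the order of \<open>N\<^sup>3 R / \<phi>\<close>.  The last term is the relative error of the asymptotic expansion of \<open>disc_avg\<close>
  at \<open>X = \<phi> R / N\<close>.
\<close>
lemma estimate_infinity:
  "\<exists>C\<ge>0. \<forall>\<^sub>F N in sequentially.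
     \<bar>(\<integral>t. f t \<partial>R_meas K \<alpha> \<phi> (\<lambda>N. real N ^ 3 * S_sum K \<alpha> 0 N / \<phi> N) N) - (\<integral>t. f t \<partial>limit_measure K \<infinity>)\<bar>
     \<le> C * (\<phi> N ^ 2 * rad N ^ 3 * (1 + ln (real N)) / real N ^ 3 + \<phi> N * rad N ^ 2 / real N ^ 2
          + (real N / (\<phi> N * rad N)) powr (3 / 4))"
proof -
  define I where "I = Im (omega K)"
  have I: "I > 0" using Im_pos by (simp add: I_def)
  obtain C where C: "C \<ge> 0" "\<And>N. 1 \<le> N \<Longrightarrow> 1 \<le> rad N \<Longrightarrow> rad N \<le> real N \<Longrightarrow>
    \<bar>pair_sum N - (real N)\<^sup>2 / I * avg_sum N\<bar> \<le> C * (\<phi> N * rad N ^ 4 * (1 + ln (real N)) + real N * rad N ^ 3)"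
    using pair_sum_compare unfolding I_def by blast
  define J where "J = (\<integral>t. f t \<partial>lborel)"
  obtain C2 where C2: "C2 \<ge> 0" "\<And>N R \<phi>. 1 \<le> R \<Longrightarrow> 0 < N \<Longrightarrow> 0 < \<phi> \<Longrightarrow>
    \<bar>(\<Sum>p | p \<in> lat (omega K) \<and> 0 < cmod p \<and> cmod p \<le> R. disc_avg f (2 * \<phi> * cmod p / N))
      - N / (3 * \<phi>) * J * (\<Sum>p | p \<in> lat (omega K) \<and> 0 < cmod p \<and> cmod p \<le> R. 1 / cmod p)\<bar>
    \<le> C2 * ((N / \<phi>) powr (7 / 4) * R powr (1 / 4))"
    using sum_disc_avg_asymptotic[OF meas bound supp A] unfolding J_def by blast
  define k where "k = 8 * diam\<^sup>2 * pi / I"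
  have k: "0 \<le> k" using I by (simp add: k_def)
  define C' where "C' = C * k + C2 * k / I"
  have C': "0 \<le> C * k" "0 \<le> C2 * k / I" using C(1) C2(1) k I by auto
  have "\<forall>\<^sub>F N in sequentially.
     \<bar>(\<integral>t. f t \<partial>R_meas K \<alpha> \<phi> (\<lambda>N. real N ^ 3 * S_sum K \<alpha> 0 N / \<phi> N) N) - (\<integral>t. f t \<partial>limit_measure K \<infinity>)\<bar>
     \<le> C' * (\<phi> N ^ 2 * rad N ^ 3 * (1 + ln (real N)) / real N ^ 3 + \<phi> N * rad N ^ 2 / real N ^ 2
          + (real N / (\<phi> N * rad N)) powr (3 / 4))"
    using eventually_radius[OF \<alpha>, of diam]
  proof eventually_elim
    case (elim N)
    define n r F c where "n = real N" and "r = rad N" and "F = \<phi> N" and "c = (\<Sum>p\<in>disc_points N. 1 / cmod p)"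
    have nr: "1 \<le> n" "1 \<le> r" "r \<le> n" "diam \<le> r" "0 < F" "0 \<le> 1 + ln n"
      using elim \<phi>_pos[of N] by (auto simp: n_def r_def F_def)
    have c: "r / (4 * diam\<^sup>2) \<le> c" "0 < c"
    proof -
      show "r / (4 * diam\<^sup>2) \<le> c" using sum_inverse_disc_points nr by (simp add: r_def c_def)
      moreover have "0 < r / (4 * diam\<^sup>2)" using nr diam_ge_1 by simp
      ultimately show "0 < c" by linarith
    qed
    define \<psi> where "\<psi> = n ^ 3 * (I / (2 * pi) * c) / F"
    have psi: "real N ^ 3 * S_sum K \<alpha> 0 N / \<phi> N = \<psi>"
      by (simp add: \<psi>_def S_sum_0 n_def I_def c_def F_def)
    have psi_pos: "0 < \<psi>" using nr I c by (simp add: \<psi>_def)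
    \<comment> \<open>The lower bound for \<open>\<psi>\<close> that results from \<open>\<Sum> 1/|p| \<ge> r / (4 diam\<^sup>2)\<close>.\<close>
    define \<psi>0 where "\<psi>0 = n ^ 3 * r / (k * F)"
    have psi0: "0 < \<psi>0" using nr I diam_ge_1 by (simp add: \<psi>0_def k_def)
    have psi_low: "\<psi>0 \<le> \<psi>"
    proof -
      have "\<psi>0 = n ^ 3 * (I / (2 * pi) * (r / (4 * diam\<^sup>2))) / F"
        using I diam_ge_1 by (simp add: k_def \<psi>0_def mult_ac)
      also have "\<dots> \<le> \<psi>" unfolding \<psi>_def using I c nr by (intro divide_right_mono mult_left_mono) auto
      finally show ?thesis .
    qed
    define e1 where "e1 = F * r ^ 4 * (1 + ln n) + n * r ^ 3"
    define e2 where "e2 = (n / F) powr (7 / 4) * r powr (1 / 4)"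
    have avg: "\<bar>avg_sum N - n / (3 * F) * J * c\<bar> \<le> C2 * e2"
      using C2(2)[of r n F] nr by (simp add: avg_sum_def disc_points_def c_def e2_def n_def r_def F_def)
    have B: "\<bar>pair_sum N - n\<^sup>2 / I * (n / (3 * F) * J * c)\<bar> \<le> C * e1 + n\<^sup>2 / I * (C2 * e2)"
    proof -
      have "\<bar>pair_sum N - n\<^sup>2 / I * avg_sum N\<bar> \<le> C * e1"
        using C(2)[of N] elim by (simp add: n_def r_def F_def e1_def)
      moreover have "\<bar>n\<^sup>2 / I * avg_sum N - n\<^sup>2 / I * (n / (3 * F) * J * c)\<bar> \<le> n\<^sup>2 / I * (C2 * e2)"
        unfolding right_diff_distrib[symmetric] abs_mult using avg I by (simp add: divide_right_mono mult_left_mono)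
      ultimately show ?thesis by linarith
    qed
    have 1: "\<bar>1 / \<psi> * pair_sum N - n\<^sup>2 / I * (n / (3 * F) * J * c) / \<psi>\<bar> \<le> (C * e1 + n\<^sup>2 / I * (C2 * e2)) / \<psi>0"
      by (rule abs_divide_diff_le[OF B psi0 psi_low])
    have 3: "n\<^sup>2 / I * (n / (3 * F) * J * c) / \<psi> = (\<integral>t. f t \<partial>limit_measure K \<infinity>)"
      unfolding integral_limit_measure(2)[OF meas refl] abs_disc I_def[symmetric] \<psi>_def J_def[symmetric]
      using nr I c by (simp add: power2_eq_square power3_eq_cube mult_ac)
    have 4: "e1 / \<psi>0 = k * (F\<^sup>2 * r ^ 3 * (1 + ln n) / n ^ 3 + F * r\<^sup>2 / n\<^sup>2)"
      unfolding e1_def \<psi>0_def using nr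
      by (simp add: field_simps power2_eq_square power3_eq_cube power4_eq_xxxx)
    have 5: "n\<^sup>2 * e2 / \<psi>0 = k * (n / (F * r)) powr (3 / 4)"
    proof -
      have "n\<^sup>2 * e2 / \<psi>0 = k * ((n / F) powr (7 / 4) / (n / F)) * (r powr (1 / 4) / r)"
        unfolding e2_def \<psi>0_def using nr by (simp add: power2_eq_square power3_eq_cube)
      also have "(n / F) powr (7 / 4) / (n / F) = (n / F) powr (3 / 4)"
        using nr powr_diff[of "n / F" "7 / 4" 1] by simp
      also have "r powr (1 / 4) / r = r powr (- (3 / 4))"
        using nr powr_diff[of r "1 / 4" 1] by simp
      also have "k * (n / F) powr (3 / 4) * r powr (- (3 / 4)) = k * ((n / F) / r) powr (3 / 4)"
        using nr by (subst powr_divide) (auto simp: powr_minus_divide)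
      finally show ?thesis by simp
    qed
    have 6: "(C * e1 + n\<^sup>2 / I * (C2 * e2)) / \<psi>0 = C * (e1 / \<psi>0) + C2 / I * (n\<^sup>2 * e2 / \<psi>0)"
      by (simp add: add_divide_distrib)
    have int: "(\<integral>t. f t \<partial>R_meas K \<alpha> \<phi> (\<lambda>N. real N ^ 3 * S_sum K \<alpha> 0 N / \<phi> N) N) = 1 / \<psi> * pair_sum N"
      unfolding psi[symmetric] by (rule integral_R_meas_eq) (use psi psi_pos elim in auto)
    define x y z where "x = F\<^sup>2 * r ^ 3 * (1 + ln n) / n ^ 3" and "y = F * r\<^sup>2 / n\<^sup>2" and "z = (n / (F * r)) powr (3 / 4)"
    have nn: "0 \<le> x" "0 \<le> y" "0 \<le> z" using nr by (auto simp: x_def y_def z_def)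
    have "\<bar>1 / \<psi> * pair_sum N - (\<integral>t. f t \<partial>limit_measure K \<infinity>)\<bar> \<le> C * (k * (x + y)) + C2 / I * (k * z)"
      using 1 unfolding 3 6 4 5 x_def y_def z_def .
    also have "\<dots> = C * k * (x + y) + C2 * k / I * z" by simp
    also have "\<dots> \<le> C * k * (x + y + z) + C2 * k / I * (x + y + z)"
    proof (rule add_mono[OF mult_left_mono[OF _ C'(1)] mult_left_mono[OF _ C'(2)]])
      show "x + y \<le> x + y + z" "z \<le> x + y + z" using nn by auto
    qed
    also have "\<dots> = C' * (x + y + z)"
      by (simp add: C'_def distrib_right)
    finally show ?case
      unfolding int x_def y_def z_def n_def r_def F_def .
  qed
  moreover have "0 \<le> C'" using C' by (simp add: C'_def)
  ultimately show ?thesis by blast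
qed

text \<open>
  The Riemann sum has the integral with parameter \<open>q = \<phi> R / N\<close> as its limit; the last term comes from replacing \<open>q\<close> by \<open>l\<close>, on which the
  integral depends in a Lipschitz way.
\<close>
lemma estimate_finite:
  assumes l: "l > 0" and lim: "(\<lambda>N. \<phi> N * rad N / real N) \<longlonglongrightarrow> l"
  shows "\<exists>C\<ge>0. \<forall>\<^sub>F N in sequentially.
     \<bar>(\<integral>t. f t \<partial>R_meas K \<alpha> \<phi> (\<lambda>N. real N powr (3 + \<alpha>) / \<phi> N) N) - (\<integral>t. f t \<partial>limit_measure K (ereal l))\<bar>
     \<le> C * (\<phi> N ^ 2 * rad N ^ 3 * (1 + ln (real N)) / real N ^ 3 + \<phi> N * rad N ^ 2 / real N ^ 2
          + 1 / rad N + \<bar>\<phi> N * rad N / real N - l\<bar>)"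
proof -
  define I where "I = Im (omega K)"
  have I: "I > 0" using Im_pos by (simp add: I_def)
  have L: "0 \<le> L" using lip[of 1 0] by simp
  obtain C where C: "C \<ge> 0" "\<And>N. 1 \<le> N \<Longrightarrow> 1 \<le> rad N \<Longrightarrow> rad N \<le> real N \<Longrightarrow>
    \<bar>pair_sum N - (real N)\<^sup>2 / I * avg_sum N\<bar> \<le> C * (\<phi> N * rad N ^ 4 * (1 + ln (real N)) + real N * rad N ^ 3)"
    using pair_sum_compare unfolding I_def by blast
  define \<Gamma> where "\<Gamma> k = (\<integral>z. indicator unit_disc z * disc_avg f (k * sqrt ((fst z)\<^sup>2 + (snd z)\<^sup>2)) \<partial>plane)" for k
  obtain C2 where C2: "C2 \<ge> 0" "\<And>N R \<phi>. 1 \<le> R \<Longrightarrow> 0 < N \<Longrightarrow> 0 \<le> \<phi> \<Longrightarrow>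
    \<bar>(\<Sum>p | p \<in> lat (omega K) \<and> 0 < cmod p \<and> cmod p \<le> R. disc_avg f (2 * \<phi> * cmod p / N))
      - R\<^sup>2 / I * \<Gamma> (2 * \<phi> * R / N)\<bar> \<le> C2 * (\<phi> * R\<^sup>2 / N + R)"
    using sum_disc_avg_riemann[OF meas bound lip] unfolding I_def \<Gamma>_def by blast
  have \<Gamma>_lip: "\<bar>\<Gamma> a - \<Gamma> b\<bar> \<le> 2 * pi\<^sup>2 * L * \<bar>a - b\<bar>" for a b
    unfolding \<Gamma>_def by (rule disc_avg_radial_lipschitz[OF meas bound lip])
  \<comment> \<open>As \<open>q\<close> tends to \<open>l\<close>, it is eventually less than \<open>b\<close>.\<close>
  define b where "b = l + 1"
  have b: "b > 1" using l by (simp add: b_def)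
  define c3 where "c3 = (b * (4 * pi\<^sup>2 * L) + \<bar>\<Gamma> (2 * l)\<bar>) / I\<^sup>2"
  have c3: "0 \<le> c3" using b L by (simp add: c3_def)
  define c2 where "c2 = C2 / I * (b\<^sup>2 + b)"
  have c2: "0 \<le> c2" using b C2(1) I by (simp add: c2_def)
  have ev_b: "\<forall>\<^sub>F N in sequentially. \<phi> N * rad N / real N < b"
    using lim by (rule order_tendstoD) (simp add: b_def)
  have "\<forall>\<^sub>F N in sequentially.
     \<bar>(\<integral>t. f t \<partial>R_meas K \<alpha> \<phi> (\<lambda>N. real N powr (3 + \<alpha>) / \<phi> N) N) - (\<integral>t. f t \<partial>limit_measure K (ereal l))\<bar>
     \<le> (C + c2 + c3) * (\<phi> N ^ 2 * rad N ^ 3 * (1 + ln (real N)) / real N ^ 3 + \<phi> N * rad N ^ 2 / real N ^ 2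
          + 1 / rad N + \<bar>\<phi> N * rad N / real N - l\<bar>)"
    using eventually_radius[OF \<alpha>, of diam] ev_b
  proof eventually_elim
    case (elim N)
    define n r F q where "n = real N" and "r = rad N" and "F = \<phi> N" and "q = \<phi> N * rad N / real N"
    have nr: "1 \<le> n" "1 \<le> r" "r \<le> n" "0 < F" "0 \<le> 1 + ln n"
      using elim \<phi>_pos[of N] by (auto simp: n_def r_def F_def)
    have q: "0 < q" "q < b" "F * r / n = q" "F = q * n / r"
      using elim nr by (auto simp: q_def n_def r_def F_def)
    define \<psi> where "\<psi> = n ^ 3 * r / F"
    have psi: "real N powr (3 + \<alpha>) / \<phi> N = \<psi>"
      using nr by (simp add: \<psi>_def n_def r_def F_def powr_add powr_numeral)
    have psi_pos: "0 < \<psi>" using nr by (simp add: \<psi>_def)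
    define e1 where "e1 = F * r ^ 4 * (1 + ln n) + n * r ^ 3"
    define e2 where "e2 = F * r\<^sup>2 / n + r"
    have avg: "\<bar>avg_sum N - r\<^sup>2 / I * \<Gamma> (2 * q)\<bar> \<le> C2 * e2"
    proof -
      have arg: "2 * F * r / n = 2 * q" using q(3) by simp
      show ?thesis
        using C2(2)[of r n F] nr unfolding arg by (simp add: avg_sum_def disc_points_def e2_def n_def r_def F_def)
    qed
    have B: "\<bar>pair_sum N - n\<^sup>2 / I * (r\<^sup>2 / I * \<Gamma> (2 * q))\<bar> \<le> C * e1 + n\<^sup>2 / I * (C2 * e2)"
    proof -
      have "\<bar>pair_sum N - n\<^sup>2 / I * avg_sum N\<bar> \<le> C * e1"
        using C(2)[of N] elim by (simp add: n_def r_def F_def e1_def)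
      moreover have "\<bar>n\<^sup>2 / I * avg_sum N - n\<^sup>2 / I * (r\<^sup>2 / I * \<Gamma> (2 * q))\<bar> \<le> n\<^sup>2 / I * (C2 * e2)"
        unfolding right_diff_distrib[symmetric] abs_mult using avg I by (simp add: divide_right_mono mult_left_mono)
      ultimately show ?thesis by linarith
    qed
    have 1: "\<bar>1 / \<psi> * pair_sum N - n\<^sup>2 / I * (r\<^sup>2 / I * \<Gamma> (2 * q)) / \<psi>\<bar> \<le> (C * e1 + n\<^sup>2 / I * (C2 * e2)) / \<psi>"
      by (rule abs_divide_diff_le[OF B psi_pos order_refl])
    have 3: "n\<^sup>2 / I * (r\<^sup>2 / I * \<Gamma> (2 * q)) / \<psi> = q * \<Gamma> (2 * q) / I\<^sup>2"
      unfolding \<psi>_def q(3)[symmetric] using nr I by (simp add: power2_eq_square power3_eq_cube mult_ac)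
    have 4: "e1 / \<psi> = F\<^sup>2 * r ^ 3 * (1 + ln n) / n ^ 3 + F * r\<^sup>2 / n\<^sup>2"
      unfolding e1_def \<psi>_def using nr
      by (simp add: field_simps power2_eq_square power3_eq_cube power4_eq_xxxx)
    have 5: "n\<^sup>2 * e2 / \<psi> = (q\<^sup>2 + q) / r"
      unfolding e2_def \<psi>_def q(4) using nr q(1)
      by (simp add: field_simps power2_eq_square power3_eq_cube)
    have 6: "(C * e1 + n\<^sup>2 / I * (C2 * e2)) / \<psi> = C * (e1 / \<psi>) + C2 / I * (n\<^sup>2 * e2 / \<psi>)"
      by (simp add: add_divide_distrib)
    have int: "(\<integral>t. f t \<partial>R_meas K \<alpha> \<phi> (\<lambda>N. real N powr (3 + \<alpha>) / \<phi> N) N) = 1 / \<psi> * pair_sum N"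
      unfolding psi[symmetric] by (rule integral_R_meas_eq) (use psi psi_pos elim in auto)
    define x y z v where "x = F\<^sup>2 * r ^ 3 * (1 + ln n) / n ^ 3" and "y = F * r\<^sup>2 / n\<^sup>2" and "z = 1 / r" and "v = \<bar>q - l\<bar>"
    have nn: "0 \<le> x" "0 \<le> y" "0 \<le> z" "0 \<le> v" using nr by (auto simp: x_def y_def z_def v_def)
    have 7: "C2 / I * ((q\<^sup>2 + q) / r) \<le> c2 * z"
    proof -
      have "q\<^sup>2 + q \<le> b\<^sup>2 + b" using q by (intro add_mono power_mono) auto
      then have "C2 / I * (q\<^sup>2 + q) * z \<le> C2 / I * (b\<^sup>2 + b) * z"
        using C2(1) I nn by (intro mult_right_mono mult_left_mono) auto
      then show ?thesis by (simp add: c2_def z_def)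
    qed
    have 8: "\<bar>q * \<Gamma> (2 * q) / I\<^sup>2 - l * \<Gamma> (2 * l) / I\<^sup>2\<bar> \<le> c3 * v"
    proof -
      have "q * \<Gamma> (2 * q) / I\<^sup>2 - l * \<Gamma> (2 * l) / I\<^sup>2 = (q * (\<Gamma> (2 * q) - \<Gamma> (2 * l)) + (q - l) * \<Gamma> (2 * l)) / I\<^sup>2"
        unfolding diff_divide_distrib[symmetric] by (simp add: algebra_simps)
      also have "\<bar>(q * (\<Gamma> (2 * q) - \<Gamma> (2 * l)) + (q - l) * \<Gamma> (2 * l)) / I\<^sup>2\<bar>
         \<le> (q * \<bar>\<Gamma> (2 * q) - \<Gamma> (2 * l)\<bar> + v * \<bar>\<Gamma> (2 * l)\<bar>) / I\<^sup>2"
      proof -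
        have "\<bar>q * (\<Gamma> (2 * q) - \<Gamma> (2 * l)) + (q - l) * \<Gamma> (2 * l)\<bar> \<le> q * \<bar>\<Gamma> (2 * q) - \<Gamma> (2 * l)\<bar> + v * \<bar>\<Gamma> (2 * l)\<bar>"
          using q(1) by (intro order_trans[OF abs_triangle_ineq]) (simp add: abs_mult v_def)
        then show ?thesis by (simp add: divide_right_mono)
      qed
      also have "\<dots> \<le> (b * (4 * pi\<^sup>2 * L * v) + v * \<bar>\<Gamma> (2 * l)\<bar>) / I\<^sup>2"
      proof -
        have "\<bar>\<Gamma> (2 * q) - \<Gamma> (2 * l)\<bar> \<le> 2 * pi\<^sup>2 * L * \<bar>2 * q - 2 * l\<bar>" by (rule \<Gamma>_lip)
        also have "\<bar>2 * q - 2 * l\<bar> = 2 * v" unfolding v_def right_diff_distrib[symmetric] abs_mult by simp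
        finally have "\<bar>\<Gamma> (2 * q) - \<Gamma> (2 * l)\<bar> \<le> 4 * pi\<^sup>2 * L * v" by simp
        then show ?thesis using q b L nn by (intro divide_right_mono add_right_mono mult_mono) auto
      qed
      also have "\<dots> = c3 * v" by (simp add: c3_def algebra_simps add_divide_distrib)
      finally show ?thesis .
    qed
    have 9: "l * \<Gamma> (2 * l) / I\<^sup>2 = (\<integral>t. f t \<partial>limit_measure K (ereal l))"
    proof -
      have "\<Gamma> (2 * l) = pi / l * (\<integral>t. unit_rho (t / (2 * l)) * f t \<partial>lborel)"
        unfolding \<Gamma>_def by (rule integral_disc_avg_radial[OF meas bound _ l]) (rule supp)
      then show ?thesis
        unfolding integral_limit_measure(3)[OF meas refl l] abs_disc I_def[symmetric]
        using l I by (simp add: power2_eq_square)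
    qed
    have "\<bar>1 / \<psi> * pair_sum N - (\<integral>t. f t \<partial>limit_measure K (ereal l))\<bar> \<le> C * (x + y) + c2 * z + c3 * v"
    proof -
      have "\<bar>s - u\<bar> \<le> e + g + h" if "\<bar>s - t\<bar> \<le> e + d" "d \<le> g" "\<bar>t - u\<bar> \<le> h" for s t u e d g h :: real
        using that by linarith
      from this[OF _ 7 8] show ?thesis using 1 unfolding 3 6 4 5 9 x_def y_def by blast
    qed
    also have "\<dots> \<le> C * (x + y + z + v) + c2 * (x + y + z + v) + c3 * (x + y + z + v)"
      by (intro add_mono[of _ _ "c3 * v"] add_mono[of "C * (x + y)" _ "c2 * z"] mult_left_mono) (use nn C(1) c2 c3 in linarith)+
    also have "\<dots> = (C + c2 + c3) * (x + y + z + v)"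
      by (simp add: distrib_right)
    finally show ?case
      unfolding int x_def y_def z_def v_def n_def r_def F_def q_def .
  qed
  moreover have "0 \<le> C + c2 + c3" using C(1) c2 c3 by simp
  ultimately show ?thesis by blast
qed

end

end

section \<open>Comparison of the rates\<close>

lemma little_o_add:
  assumes "little_o e1 m" "little_o e2 m"
  shows "little_o (\<lambda>N. e1 N + e2 N) m"
  unfolding little_o_def
proof (intro allI impI)
  fix c :: real assume "c > 0"
  then have "\<forall>\<^sub>F N in sequentially. e1 N \<le> c / 2 * m N" "\<forall>\<^sub>F N in sequentially. e2 N \<le> c / 2 * m N"
    using assms unfolding little_o_def by (meson half_gt_zero)+
  then show "\<forall>\<^sub>F N in sequentially. e1 N + e2 N \<le> c * m N"
    by eventually_elim auto
qed

lemma little_o_mono: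
  assumes "little_o e m" "B > 0" "\<forall>\<^sub>F N in sequentially. e' N \<le> B * e N" "\<forall>\<^sub>F N in sequentially. m N \<le> B' * m' N" "B' > 0"
  shows "little_o e' m'"
  unfolding little_o_def
proof (intro allI impI)
  fix c :: real assume c: "c > 0"
  then have "c / (B * B') > 0" using assms by simp
  then have "\<forall>\<^sub>F N in sequentially. e N \<le> c / (B * B') * m N"
    using assms(1) unfolding little_o_def by blast
  with assms(3,4) show "\<forall>\<^sub>F N in sequentially. e' N \<le> c * m' N"
  proof eventually_elim
    case (elim N)
    have "e' N \<le> B * e N" by fact
    also have "\<dots> \<le> B * (c / (B * B') * m N)" using elim assms by (intro mult_left_mono) auto
    also have "\<dots> \<le> B * (c / (B * B') * (B' * m' N))" using elim assms c by (intro mult_left_mono) auto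
    also have "\<dots> = c * m' N" using assms by simp
    finally show ?case .
  qed
qed

lemma little_o_mult:
  assumes "little_o e m" "\<forall>\<^sub>F N in sequentially. 0 \<le> g N"
  shows "little_o (\<lambda>N. g N * e N) (\<lambda>N. g N * m N)"
  unfolding little_o_def
proof (intro allI impI)
  fix c :: real assume "c > 0"
  then have "\<forall>\<^sub>F N in sequentially. e N \<le> c * m N" using assms(1) unfolding little_o_def by blast
  with assms(2) show "\<forall>\<^sub>F N in sequentially. g N * e N \<le> c * (g N * m N)"
  proof eventually_elim
    case (elim N)
    then have "g N * e N \<le> g N * (c * m N)" by (intro mult_left_mono)
    then show ?case by (simp add: mult_ac)
  qed
qed

lemma little_o_of_tendsto_0:
  assumes lim: "h \<longlonglongrightarrow> 0" and "\<forall>\<^sub>F N in sequentially. 0 \<le> m N" and "\<forall>\<^sub>F N in sequentially. e N \<le> h N * m N"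
  shows "little_o e m"
  unfolding little_o_def
proof (intro allI impI)
  fix c :: real assume "c > 0"
  with lim have "\<forall>\<^sub>F N in sequentially. h N < c" by (rule order_tendstoD)
  with assms(2,3) show "\<forall>\<^sub>F N in sequentially. e N \<le> c * m N"
  proof eventually_elim
    case (elim N)
    then have "h N * m N \<le> c * m N" by (intro mult_right_mono) auto
    with elim show ?case by linarith
  qed
qed

lemma eventually_ge_1_nat: "\<forall>\<^sub>F N in sequentially. 1 \<le> (N::nat)"
  by (rule eventually_ge_at_top)

lemma little_o_powr_ln:
  assumes "a < b"
  shows "little_o (\<lambda>N. real N powr a * (1 + ln (real N))) (\<lambda>N. real N powr b)"
proof (rule little_o_of_tendsto_0)
  define d where "d = b - a"
  have "d > 0" using assms by (simp add: d_def)
  then show "(\<lambda>N. real N powr (- d) * (1 + ln (real N))) \<longlonglongrightarrow> 0"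
    by real_asymp
  show "\<forall>\<^sub>F N in sequentially. real N powr a * (1 + ln (real N)) \<le> real N powr (- d) * (1 + ln (real N)) * real N powr b"
    using eventually_ge_1_nat
  proof eventually_elim
    case (elim N)
    have "real N powr a = real N powr (- d) * real N powr b"
      by (simp add: d_def flip: powr_add)
    then show ?case by (simp add: mult_ac)
  qed
qed simp

lemma little_o_powr:
  assumes "a < b"
  shows "little_o (\<lambda>N. real N powr a) (\<lambda>N. real N powr b)"
proof (rule little_o_mono[OF little_o_powr_ln[OF assms], of 1 _ 1])
  show "\<forall>\<^sub>F N in sequentially. real N powr a \<le> 1 * (real N powr a * (1 + ln (real N)))"
    using eventually_ge_1_nat
  proof eventually_elim
    case (elim N)
    then have "real N powr a * 1 \<le> real N powr a * (1 + ln (real N))" by (intro mult_left_mono) auto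
    then show ?case by simp
  qed
qed auto

context
  fixes \<alpha> :: real and \<phi> :: "nat \<Rightarrow> real"
  assumes \<phi>_pos: "\<And>N. 1 \<le> N \<Longrightarrow> 0 < \<phi> N"
begin

text \<open>
  The terms of the three estimates, written with powers of \<open>N\<close> and the ratio \<open>\<phi> / N\<^bsup>1-\<alpha>\<^esup>\<close> of the theorem.
\<close>
lemma error_terms_as_powers:
  assumes "1 \<le> N"
  shows "\<phi> N * real N powr \<alpha> / real N = \<phi> N / real N powr (1 - \<alpha>)"
    "\<phi> N * (real N powr \<alpha>)\<^sup>2 * (1 + ln (real N)) / (real N)\<^sup>2 =
       \<phi> N / real N powr (1 - \<alpha>) * (real N powr (\<alpha> - 1) * (1 + ln (real N)))"
    "real N powr \<alpha> / real N = real N powr (\<alpha> - 1)"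
    "\<phi> N ^ 2 * (real N powr \<alpha>) ^ 3 * (1 + ln (real N)) / real N ^ 3 = \<phi> N ^ 2 * (real N powr (3 * \<alpha> - 3) * (1 + ln (real N)))"
    "\<phi> N * (real N powr \<alpha>)\<^sup>2 / (real N)\<^sup>2 = \<phi> N * real N powr (2 * \<alpha> - 2)"
    "real N / (\<phi> N * real N powr \<alpha>) = real N powr (1 - \<alpha>) / \<phi> N"
proof -
  define n where "n = real N"
  have n: "n > 0" using assms by (simp add: n_def)
  have p2: "(n powr \<alpha>)\<^sup>2 = n powr (2 * \<alpha>)" and p3: "(n powr \<alpha>) ^ 3 = n powr (3 * \<alpha>)"
    using n by (simp_all add: powr_powr mult.commute flip: powr_numeral)
  have d1: "n powr \<alpha> / n = n powr (\<alpha> - 1)" using n by (simp add: powr_diff)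
  have d1': "n powr (1 - \<alpha>) = n / n powr \<alpha>" using n by (simp add: powr_diff)
  have d2: "n powr (2 * \<alpha>) / n\<^sup>2 = n powr (2 * \<alpha> - 2)" using n by (simp add: powr_diff)
  have d3: "n powr (3 * \<alpha>) / n ^ 3 = n powr (3 * \<alpha> - 3)" using n by (simp add: powr_diff)
  have a0: "n powr \<alpha> > 0" using n by simp
  show "\<phi> N * real N powr \<alpha> / real N = \<phi> N / real N powr (1 - \<alpha>)"
    unfolding n_def[symmetric] d1' by simp
  show "real N powr \<alpha> / real N = real N powr (\<alpha> - 1)"
    unfolding n_def[symmetric] by (rule d1)
  show "\<phi> N * (real N powr \<alpha>)\<^sup>2 * (1 + ln (real N)) / (real N)\<^sup>2 =
       \<phi> N / real N powr (1 - \<alpha>) * (real N powr (\<alpha> - 1) * (1 + ln (real N)))"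
    unfolding n_def[symmetric] d1' d1[symmetric] using n by (simp add: power2_eq_square)
  show "\<phi> N ^ 2 * (real N powr \<alpha>) ^ 3 * (1 + ln (real N)) / real N ^ 3 = \<phi> N ^ 2 * (real N powr (3 * \<alpha> - 3) * (1 + ln (real N)))"
    unfolding n_def[symmetric] p3 d3[symmetric] by simp
  show "\<phi> N * (real N powr \<alpha>)\<^sup>2 / (real N)\<^sup>2 = \<phi> N * real N powr (2 * \<alpha> - 2)"
    unfolding n_def[symmetric] p2 d2[symmetric] by simp
  show "real N / (\<phi> N * real N powr \<alpha>) = real N powr (1 - \<alpha>) / \<phi> N"
    unfolding n_def[symmetric] d1' by simp
qed

lemma upper_bound_of_limit:
  assumes "(\<lambda>N. ereal (\<phi> N / real N powr b)) \<longlonglongrightarrow> l" "l < \<infinity>"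
  obtains B where "B > 0" "\<forall>\<^sub>F N in sequentially. \<phi> N \<le> B * real N powr b"
proof -
  obtain B0 where B0: "l < ereal B0" using assms(2) by (metis ereal_dense2)
  define B where "B = max B0 1"
  have "l < ereal B" using B0 by (rule less_le_trans) (simp add: B_def)
  with assms(1) have "\<forall>\<^sub>F N in sequentially. ereal (\<phi> N / real N powr b) < ereal B"
    by (rule order_tendstoD)
  then have "\<forall>\<^sub>F N in sequentially. \<phi> N \<le> B * real N powr b"
    using eventually_ge_1_nat by eventually_elim (simp add: pos_divide_less_eq)
  then show thesis by (intro that[of B]) (simp add: B_def)
qed

lemma lower_bound_of_limit:
  assumes "(\<lambda>N. ereal (\<phi> N / real N powr b)) \<longlonglongrightarrow> l" "0 < l"
  obtains B where "B > 0" "\<forall>\<^sub>F N in sequentially. B * real N powr b \<le> \<phi> N"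
proof -
  obtain B where B: "0 < ereal B" "ereal B < l" using assms(2) by (metis ereal_dense2)
  with assms(1) have "\<forall>\<^sub>F N in sequentially. ereal B < ereal (\<phi> N / real N powr b)"
    by (intro order_tendstoD)
  then have "\<forall>\<^sub>F N in sequentially. B * real N powr b \<le> \<phi> N"
    using eventually_ge_1_nat by eventually_elim (simp add: pos_less_divide_eq)
  then show thesis using B by (intro that[of B]) simp_all
qed

text \<open>
  With \<open>x = \<phi> / N\<^bsup>1-\<alpha>\<^esup>\<close> tending to zero, the last term is \<open>x\<close> and negligible against \<open>x\<^bsup>1/2\<^esup>\<close>.  The others are at most
  \<open>N\<^bsup>\<alpha>-1\<^esup>\<close> up to a logarithm and negligible against \<open>N\<^bsup>-2\<gamma>\<^esup>\<close>.
\<close>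
lemma rate_limit_zero:
  assumes \<gamma>: "2 * \<gamma> < 1 - \<alpha>" and lim: "(\<lambda>N. \<phi> N / real N powr (1 - \<alpha>)) \<longlonglongrightarrow> 0"
  shows "little_o (\<lambda>N. \<phi> N * (real N powr \<alpha>)\<^sup>2 * (1 + ln (real N)) / (real N)\<^sup>2 + real N powr \<alpha> / real N + \<phi> N * real N powr \<alpha> / real N)
    (\<lambda>N. (\<phi> N / real N powr (1 - \<alpha>)) powr (1 / 2) + real N powr (- (2 * \<gamma>)))"
proof (intro little_o_add)
  let ?m = "\<lambda>N. (\<phi> N / real N powr (1 - \<alpha>)) powr (1 / 2) + real N powr (- (2 * \<gamma>))"
  have m: "\<forall>\<^sub>F N in sequentially. real N powr (- (2 * \<gamma>)) \<le> 1 * ?m N" by simp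
  have ev1: "\<forall>\<^sub>F N in sequentially. \<phi> N / real N powr (1 - \<alpha>) < 1"
    using lim by (rule order_tendstoD) simp
  have lt: "\<alpha> - 1 < - (2 * \<gamma>)" using \<gamma> by simp
  show "little_o (\<lambda>N. \<phi> N * (real N powr \<alpha>)\<^sup>2 * (1 + ln (real N)) / (real N)\<^sup>2) ?m"
  proof (rule little_o_mono[OF little_o_powr_ln[OF lt] zero_less_one _ m zero_less_one])
    show "\<forall>\<^sub>F N in sequentially. \<phi> N * (real N powr \<alpha>)\<^sup>2 * (1 + ln (real N)) / (real N)\<^sup>2 \<le> 1 * (real N powr (\<alpha> - 1) * (1 + ln (real N)))"
      using ev1 eventually_ge_1_nat
    proof eventually_elim
      case (elim N)
      show ?case unfolding error_terms_as_powers(2)[OF elim(2)] using elim by (intro mult_right_mono) auto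
    qed
  qed
  show "little_o (\<lambda>N. real N powr \<alpha> / real N) ?m"
  proof (rule little_o_mono[OF little_o_powr[OF lt] zero_less_one _ m zero_less_one])
    show "\<forall>\<^sub>F N in sequentially. real N powr \<alpha> / real N \<le> 1 * real N powr (\<alpha> - 1)"
      using eventually_ge_1_nat by eventually_elim (simp add: error_terms_as_powers)
  qed
  show "little_o (\<lambda>N. \<phi> N * real N powr \<alpha> / real N) ?m"
  proof (rule little_o_of_tendsto_0)
    show "(\<lambda>N. (\<phi> N / real N powr (1 - \<alpha>)) powr (1 / 2)) \<longlonglongrightarrow> 0"
    proof (rule tendsto_zero_powrI[OF lim tendsto_const])
      show "\<forall>\<^sub>F N in sequentially. 0 \<le> \<phi> N / real N powr (1 - \<alpha>)"
        using eventually_ge_1_nat by eventually_elim (simp add: \<phi>_pos less_imp_le)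
    qed simp_all
    show "\<forall>\<^sub>F N in sequentially. \<phi> N * real N powr \<alpha> / real N \<le> (\<phi> N / real N powr (1 - \<alpha>)) powr (1 / 2) * ?m N"
      using eventually_ge_1_nat
    proof eventually_elim
      case (elim N)
      define x where "x = \<phi> N / real N powr (1 - \<alpha>)"
      have "0 < x" using elim \<phi>_pos[of N] by (simp add: x_def)
      then have "x = x powr (1 / 2) * x powr (1 / 2)" by (simp flip: powr_add)
      also have "\<dots> \<le> x powr (1 / 2) * (x powr (1 / 2) + real N powr (- (2 * \<gamma>)))"
        by (intro mult_left_mono) auto
      finally show ?case unfolding error_terms_as_powers(1)[OF elim] x_def .
    qed
  qed simp
qed

text \<open>
  As \<open>\<phi>\<close> is at most of the order of \<open>N\<^bsup>1-\<alpha>/2\<^esup>\<close>, the first two terms are of the orders \<open>N\<^bsup>2\<alpha>-1\<^esup> ln N\<close> and \<open>N\<^bsup>3\<alpha>/2-1\<^esup>\<close>, smaller than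
  \<open>N\<^bsup>(5\<alpha>-2)/4\<^esup>\<close> for \<open>\<alpha> < 2/5\<close>.  In the last one the exponent \<open>3/4\<close> exceeds \<open>2/3\<close>.
\<close>
lemma rate_infinity_below:
  assumes \<alpha>: "\<alpha> < 2 / 5" "0 < \<alpha>" and B: "B > 0" "\<forall>\<^sub>F N in sequentially. \<phi> N \<le> B * real N powr (1 - \<alpha> / 2)"
    and lim: "(\<lambda>N. real N powr (1 - \<alpha>) / \<phi> N) \<longlonglongrightarrow> 0"
  shows "little_o (\<lambda>N. \<phi> N ^ 2 * (real N powr \<alpha>) ^ 3 * (1 + ln (real N)) / real N ^ 3 + \<phi> N * (real N powr \<alpha>)\<^sup>2 / (real N)\<^sup>2
        + (real N / (\<phi> N * real N powr \<alpha>)) powr (3 / 4))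
    (\<lambda>N. real N powr ((5 * \<alpha> - 2) / 4) + (real N powr (1 - \<alpha>) / \<phi> N) powr (2 / 3))"
proof (intro little_o_add)
  let ?m = "\<lambda>N. real N powr ((5 * \<alpha> - 2) / 4) + (real N powr (1 - \<alpha>) / \<phi> N) powr (2 / 3)"
  have m: "\<forall>\<^sub>F N in sequentially. real N powr ((5 * \<alpha> - 2) / 4) \<le> 1 * ?m N" by simp
  show "little_o (\<lambda>N. \<phi> N ^ 2 * (real N powr \<alpha>) ^ 3 * (1 + ln (real N)) / real N ^ 3) ?m"
  proof (rule little_o_mono[OF little_o_powr_ln[of "2 * \<alpha> - 1"] _ _ m zero_less_one, where B = "B\<^sup>2"])
    show "2 * \<alpha> - 1 < (5 * \<alpha> - 2) / 4" using \<alpha> by simp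
    show "0 < B\<^sup>2" using B by simp
    show "\<forall>\<^sub>F N in sequentially. \<phi> N ^ 2 * (real N powr \<alpha>) ^ 3 * (1 + ln (real N)) / real N ^ 3 \<le> B\<^sup>2 * (real N powr (2 * \<alpha> - 1) * (1 + ln (real N)))"
      using B(2) eventually_ge_1_nat
    proof eventually_elim
      case (elim N)
      have "\<phi> N ^ 2 \<le> (B * real N powr (1 - \<alpha> / 2)) ^ 2"
        using elim \<phi>_pos[of N] by (intro power_mono) auto
      also have "\<dots> = B\<^sup>2 * real N powr (2 - \<alpha>)"
        using elim by (simp add: power_mult_distrib power2_eq_square flip: powr_add)
      finally have "\<phi> N ^ 2 * (real N powr (3 * \<alpha> - 3) * (1 + ln (real N)))
         \<le> B\<^sup>2 * real N powr (2 - \<alpha>) * (real N powr (3 * \<alpha> - 3) * (1 + ln (real N)))"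
        using elim by (intro mult_right_mono) auto
      also have "\<dots> = B\<^sup>2 * ((real N powr (2 - \<alpha>) * real N powr (3 * \<alpha> - 3)) * (1 + ln (real N)))" by simp
      also have "real N powr (2 - \<alpha>) * real N powr (3 * \<alpha> - 3) = real N powr (2 * \<alpha> - 1)"
        by (simp flip: powr_add)
      finally show ?case unfolding error_terms_as_powers(4)[OF elim(2)] .
    qed
  qed
  show "little_o (\<lambda>N. \<phi> N * (real N powr \<alpha>)\<^sup>2 / (real N)\<^sup>2) ?m"
  proof (rule little_o_mono[OF little_o_powr[of "3 * \<alpha> / 2 - 1"] B(1) _ m zero_less_one])
    show "3 * \<alpha> / 2 - 1 < (5 * \<alpha> - 2) / 4" using \<alpha> by simp
    show "\<forall>\<^sub>F N in sequentially. \<phi> N * (real N powr \<alpha>)\<^sup>2 / (real N)\<^sup>2 \<le> B * real N powr (3 * \<alpha> / 2 - 1)"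
      using B(2) eventually_ge_1_nat
    proof eventually_elim
      case (elim N)
      have "\<phi> N * real N powr (2 * \<alpha> - 2) \<le> B * real N powr (1 - \<alpha> / 2) * real N powr (2 * \<alpha> - 2)"
        using elim by (intro mult_right_mono) auto
      also have "\<dots> = B * real N powr (3 * \<alpha> / 2 - 1)"
        by (simp add: mult.assoc flip: powr_add)
      finally show ?case unfolding error_terms_as_powers(5)[OF elim(2)] .
    qed
  qed
  have y0: "\<forall>\<^sub>F N in sequentially. 0 \<le> real N powr (1 - \<alpha>) / \<phi> N"
    using eventually_ge_1_nat by eventually_elim (simp add: \<phi>_pos less_imp_le)
  show "little_o (\<lambda>N. (real N / (\<phi> N * real N powr \<alpha>)) powr (3 / 4)) ?m"
  proof (rule little_o_of_tendsto_0)
    show "(\<lambda>N. (real N powr (1 - \<alpha>) / \<phi> N) powr (1 / 12)) \<longlonglongrightarrow> 0"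
      by (rule tendsto_zero_powrI[OF lim tendsto_const]) (use y0 in simp_all)
    show "\<forall>\<^sub>F N in sequentially. (real N / (\<phi> N * real N powr \<alpha>)) powr (3 / 4) \<le> (real N powr (1 - \<alpha>) / \<phi> N) powr (1 / 12) * ?m N"
      using eventually_ge_1_nat
    proof eventually_elim
      case (elim N)
      define y where "y = real N powr (1 - \<alpha>) / \<phi> N"
      have "y powr (3 / 4) = y powr (1 / 12) * y powr (2 / 3)" by (simp flip: powr_add)
      also have "\<dots> \<le> y powr (1 / 12) * (real N powr ((5 * \<alpha> - 2) / 4) + y powr (2 / 3))"
        by (intro mult_left_mono) auto
      finally show ?case unfolding error_terms_as_powers(6)[OF elim] y_def .
    qed
  qed simp
qed

text \<open>
  Divided by the rate, the terms are at most of the orders \<open>N\<^bsup>4\<alpha>-1\<^esup> ln N\<close> and \<open>N\<^bsup>5\<alpha>/2-1\<^esup>\<close>.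
\<close>
lemma rate_upper_terms:
  assumes \<alpha>: "0 < \<alpha>" "\<alpha> \<le> 2 / 11" and up: "\<forall>\<^sub>F N in sequentially. \<phi> N \<le> B * real N powr (1 + \<alpha> / 2)" and B: "B > 0"
  shows "little_o (\<lambda>N. \<phi> N ^ 2 * (real N powr \<alpha>) ^ 3 * (1 + ln (real N)) / real N ^ 3) (\<lambda>N. \<phi> N / real N powr (1 + \<alpha> / 2))"
    and "little_o (\<lambda>N. \<phi> N * (real N powr \<alpha>)\<^sup>2 / (real N)\<^sup>2) (\<lambda>N. \<phi> N / real N powr (1 + \<alpha> / 2))"
proof -
  have g0: "\<forall>\<^sub>F N in sequentially. 0 \<le> \<phi> N / real N powr (1 + \<alpha> / 2)"
    using eventually_ge_1_nat by eventually_elim (simp add: \<phi>_pos less_imp_le)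
  have one: "\<forall>\<^sub>F N in sequentially. \<phi> N / real N powr (1 + \<alpha> / 2) * real N powr 0 \<le> 1 * (\<phi> N / real N powr (1 + \<alpha> / 2))"
    using eventually_ge_1_nat by eventually_elim simp
  show "little_o (\<lambda>N. \<phi> N ^ 2 * (real N powr \<alpha>) ^ 3 * (1 + ln (real N)) / real N ^ 3) (\<lambda>N. \<phi> N / real N powr (1 + \<alpha> / 2))"
  proof (rule little_o_mono[OF little_o_mult[OF little_o_powr_ln[of "4 * \<alpha> - 1" 0] g0] B _ one zero_less_one])
    show "4 * \<alpha> - 1 < 0" using \<alpha> by simp
    show "\<forall>\<^sub>F N in sequentially. \<phi> N ^ 2 * (real N powr \<alpha>) ^ 3 * (1 + ln (real N)) / real N ^ 3
       \<le> B * (\<phi> N / real N powr (1 + \<alpha> / 2) * (real N powr (4 * \<alpha> - 1) * (1 + ln (real N))))"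
      using up eventually_ge_1_nat
    proof eventually_elim
      case (elim N)
      define h where "h = real N powr (1 + \<alpha> / 2)"
      have h: "h > 0" using elim by (simp add: h_def)
      have hp: "real N powr (4 * \<alpha> - 1) = h * (h * real N powr (3 * \<alpha> - 3))"
        unfolding h_def by (simp flip: powr_add)
      have "\<phi> N * \<phi> N * (real N powr (3 * \<alpha> - 3) * (1 + ln (real N)))
          \<le> \<phi> N * (B * h) * (real N powr (3 * \<alpha> - 3) * (1 + ln (real N)))"
        using elim \<phi>_pos[of N] by (intro mult_right_mono mult_left_mono) (auto simp: h_def)
      also have "\<dots> = B * (\<phi> N / h * (real N powr (4 * \<alpha> - 1) * (1 + ln (real N))))"
        unfolding hp using h by simp
      finally show ?case unfolding error_terms_as_powers(4)[OF elim(2)] h_def by (simp only: power2_eq_square)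
    qed
  qed
  show "little_o (\<lambda>N. \<phi> N * (real N powr \<alpha>)\<^sup>2 / (real N)\<^sup>2) (\<lambda>N. \<phi> N / real N powr (1 + \<alpha> / 2))"
  proof (rule little_o_mono[OF little_o_mult[OF little_o_powr[of "5 * \<alpha> / 2 - 1" 0] g0] zero_less_one _ one zero_less_one])
    show "5 * \<alpha> / 2 - 1 < 0" using \<alpha> by simp
    show "\<forall>\<^sub>F N in sequentially. \<phi> N * (real N powr \<alpha>)\<^sup>2 / (real N)\<^sup>2
       \<le> 1 * (\<phi> N / real N powr (1 + \<alpha> / 2) * real N powr (5 * \<alpha> / 2 - 1))"
      using eventually_ge_1_nat
    proof eventually_elim
      case (elim N)
      have "real N powr (5 * \<alpha> / 2 - 1) = real N powr (1 + \<alpha> / 2) * real N powr (2 * \<alpha> - 2)"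
        by (simp flip: powr_add)
      then show ?case unfolding error_terms_as_powers(5)[OF elim] using elim by simp
    qed
  qed
qed

text \<open>
  For the last term, \<open>(N\<^bsup>1-\<alpha>\<^esup> / \<phi>)\<^bsup>3/4\<^esup> = \<phi>\<^bsup>1/4\<^esup> N\<^bsup>3(1-\<alpha>)/4\<^esup> / \<phi>\<close>, and \<open>\<phi> = O(N)\<close> bounds it by
  \<open>N\<^bsup>-\<alpha>/4\<^esup>\<close> times the rate \<open>N\<^bsup>1-\<alpha>/2\<^esup> / \<phi>\<close>.
\<close>
lemma rate_infinity_middle:
  assumes \<alpha>: "0 < \<alpha>" "\<alpha> \<le> 2 / 11" and up: "\<forall>\<^sub>F N in sequentially. \<phi> N \<le> B * real N powr 1" and B: "B > 0"
  shows "little_o (\<lambda>N. \<phi> N ^ 2 * (real N powr \<alpha>) ^ 3 * (1 + ln (real N)) / real N ^ 3 + \<phi> N * (real N powr \<alpha>)\<^sup>2 / (real N)\<^sup>2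
        + (real N / (\<phi> N * real N powr \<alpha>)) powr (3 / 4))
    (\<lambda>N. \<phi> N / real N powr (1 + \<alpha> / 2) + real N powr (1 - \<alpha> / 2) / \<phi> N)"
proof (intro little_o_add)
  let ?m = "\<lambda>N. \<phi> N / real N powr (1 + \<alpha> / 2) + real N powr (1 - \<alpha> / 2) / \<phi> N"
  have pos: "\<forall>\<^sub>F N in sequentially. 0 \<le> real N powr (1 - \<alpha> / 2) / \<phi> N" "\<forall>\<^sub>F N in sequentially. 0 \<le> \<phi> N / real N powr (1 + \<alpha> / 2)"
    by (use eventually_ge_1_nat in \<open>eventually_elim, simp add: \<phi>_pos less_imp_le\<close>)+
  then have m: "\<forall>\<^sub>F N in sequentially. \<phi> N / real N powr (1 + \<alpha> / 2) \<le> 1 * ?m N"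
    by eventually_elim simp
  have up': "\<forall>\<^sub>F N in sequentially. \<phi> N \<le> B * real N powr (1 + \<alpha> / 2)"
    using up eventually_ge_1_nat
  proof eventually_elim
    case (elim N)
    have "B * real N powr 1 \<le> B * real N powr (1 + \<alpha> / 2)"
      using elim \<alpha> B by (intro mult_left_mono powr_mono) auto
    with elim show ?case by linarith
  qed
  have refl1: "\<forall>\<^sub>F N in sequentially. e N \<le> 1 * e N" for e :: "nat \<Rightarrow> real" by simp
  show "little_o (\<lambda>N. \<phi> N ^ 2 * (real N powr \<alpha>) ^ 3 * (1 + ln (real N)) / real N ^ 3) ?m"
    by (rule little_o_mono[OF rate_upper_terms(1)[OF \<alpha> up' B] zero_less_one refl1 m zero_less_one])
  show "little_o (\<lambda>N. \<phi> N * (real N powr \<alpha>)\<^sup>2 / (real N)\<^sup>2) ?m"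
    by (rule little_o_mono[OF rate_upper_terms(2)[OF \<alpha> up' B] zero_less_one refl1 m zero_less_one])
  show "little_o (\<lambda>N. (real N / (\<phi> N * real N powr \<alpha>)) powr (3 / 4)) ?m"
  proof (rule little_o_of_tendsto_0)
    show "(\<lambda>N. B powr (1 / 4) * real N powr (- \<alpha> / 4)) \<longlonglongrightarrow> 0"
      using \<alpha> by real_asymp
    show "\<forall>\<^sub>F N in sequentially. 0 \<le> ?m N"
      using pos by eventually_elim simp
    show "\<forall>\<^sub>F N in sequentially. (real N / (\<phi> N * real N powr \<alpha>)) powr (3 / 4) \<le> B powr (1 / 4) * real N powr (- \<alpha> / 4) * ?m N"
      using up eventually_ge_1_nat pos
    proof eventually_elim
      case (elim N)
      have F: "\<phi> N > 0" and n: "real N > 0" using elim \<phi>_pos by auto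
      have "(real N powr (1 - \<alpha>) / \<phi> N) powr (3 / 4) = real N powr ((1 - \<alpha>) * (3 / 4)) / \<phi> N powr (3 / 4)"
        using F n by (simp add: powr_divide powr_powr)
      also have "\<phi> N powr (3 / 4) = \<phi> N / \<phi> N powr (1 / 4)"
        using F powr_diff[of "\<phi> N" 1 "1 / 4"] by simp
      also have "real N powr ((1 - \<alpha>) * (3 / 4)) / (\<phi> N / \<phi> N powr (1 / 4)) = \<phi> N powr (1 / 4) * (real N powr ((1 - \<alpha>) * (3 / 4)) / \<phi> N)"
        by simp
      also have "\<dots> \<le> (B * real N) powr (1 / 4) * (real N powr ((1 - \<alpha>) * (3 / 4)) / \<phi> N)"
        using F elim n by (intro mult_right_mono powr_mono2) auto
      also have "\<dots> = B powr (1 / 4) * (real N powr (1 / 4) * real N powr ((1 - \<alpha>) * (3 / 4))) / \<phi> N"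
        using B n by (simp add: powr_mult)
      also have "real N powr (1 / 4) * real N powr ((1 - \<alpha>) * (3 / 4)) = real N powr (- \<alpha> / 4) * real N powr (1 - \<alpha> / 2)"
        unfolding powr_add[symmetric] by (rule arg_cong[where f = "\<lambda>x. real N powr x"]) (simp add: field_simps)
      also have "B powr (1 / 4) * (real N powr (- \<alpha> / 4) * real N powr (1 - \<alpha> / 2)) / \<phi> N
          = B powr (1 / 4) * real N powr (- \<alpha> / 4) * (real N powr (1 - \<alpha> / 2) / \<phi> N)" by simp
      also have "\<dots> \<le> B powr (1 / 4) * real N powr (- \<alpha> / 4) * ?m N"
        using elim by (intro mult_left_mono) auto
      finally show ?case unfolding error_terms_as_powers(6)[OF elim(2)] .
    qed
  qed
qed

text \<open>
  As \<open>\<phi>\<close> is at least of the order of \<open>N\<close>, the last term is \<open>O(N\<^bsup>-3\<alpha>/4\<^esup>)\<close>, whereas the rate is at least of the order of \<open>N\<^bsup>-\<alpha>/2\<^esup>\<close>.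
\<close>
lemma rate_infinity_above:
  assumes \<alpha>: "0 < \<alpha>" "\<alpha> \<le> 2 / 11" and up: "\<forall>\<^sub>F N in sequentially. \<phi> N \<le> B * real N powr (1 + \<alpha> / 2)" and B: "B > 0"
    and low: "\<forall>\<^sub>F N in sequentially. b * real N powr 1 \<le> \<phi> N" and b: "b > 0"
  shows "little_o (\<lambda>N. \<phi> N ^ 2 * (real N powr \<alpha>) ^ 3 * (1 + ln (real N)) / real N ^ 3 + \<phi> N * (real N powr \<alpha>)\<^sup>2 / (real N)\<^sup>2
        + (real N / (\<phi> N * real N powr \<alpha>)) powr (3 / 4))
    (\<lambda>N. \<phi> N / real N powr (1 + \<alpha> / 2))"
proof (intro little_o_add rate_upper_terms[OF \<alpha> up B])
  show "little_o (\<lambda>N. (real N / (\<phi> N * real N powr \<alpha>)) powr (3 / 4)) (\<lambda>N. \<phi> N / real N powr (1 + \<alpha> / 2))"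
  proof (rule little_o_mono[OF little_o_powr[of "- (3 * \<alpha> / 4)" "- (\<alpha> / 2)"]])
    show "- (3 * \<alpha> / 4) < - (\<alpha> / 2)" using \<alpha> by simp
    show "0 < (1 / b) powr (3 / 4)" "0 < 1 / b" using b by simp_all
    show "\<forall>\<^sub>F N in sequentially. (real N / (\<phi> N * real N powr \<alpha>)) powr (3 / 4) \<le> (1 / b) powr (3 / 4) * real N powr (- (3 * \<alpha> / 4))"
      using low eventually_ge_1_nat
    proof eventually_elim
      case (elim N)
      have n: "real N > 0" using elim by simp
      have "real N powr (1 - \<alpha>) / \<phi> N \<le> real N powr (1 - \<alpha>) / (b * real N)"
        using elim n b by (intro divide_left_mono mult_pos_pos) (auto simp: \<phi>_pos)
      also have "\<dots> = 1 / b * real N powr (- \<alpha>)"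
        using n by (simp add: powr_diff powr_minus_divide)
      finally have "(real N powr (1 - \<alpha>) / \<phi> N) powr (3 / 4) \<le> (1 / b * real N powr (- \<alpha>)) powr (3 / 4)"
        using \<phi>_pos[OF elim(2)] by (intro powr_mono2) auto
      also have "\<dots> = (1 / b) powr (3 / 4) * real N powr (- (3 * \<alpha> / 4))"
        using b n by (subst powr_mult) (simp_all add: powr_powr mult.commute)
      finally show ?case unfolding error_terms_as_powers(6)[OF elim(2)] .
    qed
    show "\<forall>\<^sub>F N in sequentially. real N powr (- (\<alpha> / 2)) \<le> 1 / b * (\<phi> N / real N powr (1 + \<alpha> / 2))"
      using low eventually_ge_1_nat
    proof eventually_elim
      case (elim N)
      have n: "real N > 0" using elim by simp
      have "real N powr (- (\<alpha> / 2)) = 1 / b * (b * real N / real N powr (1 + \<alpha> / 2))"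
        using b n by (simp add: powr_add powr_minus_divide)
      also have "\<dots> \<le> 1 / b * (\<phi> N / real N powr (1 + \<alpha> / 2))"
        using elim n b by (intro mult_left_mono divide_right_mono) auto
      finally show ?case .
    qed
  qed
qed

text \<open>
  All terms but the last are at most of the order of \<open>N\<^bsup>-\<alpha>\<^esup>\<close> or \<open>N\<^bsup>\<alpha>-1\<^esup> ln N\<close>, negligible against \<open>N\<^bsup>-\<alpha>/4\<^esup>\<close>.  The last one is \<open>|q - l|\<close> with \<open>q = \<phi> / N\<^bsup>1-\<alpha>\<^esup>\<close>,
  which is of the order of \<open>\<delta> = |1/q - 1/l|\<close>, and \<open>\<delta>\<close> is negligible against \<open>\<delta>\<^bsup>1/2\<^esup> |ln \<delta>|\<close>.
\<close>
lemma rate_limit_finite: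
  assumes \<alpha>: "0 < \<alpha>" "\<alpha> < 1 / 2" and l: "l > 0" and lim: "(\<lambda>N. \<phi> N / real N powr (1 - \<alpha>)) \<longlonglongrightarrow> l"
  shows "little_o (\<lambda>N. \<phi> N ^ 2 * (real N powr \<alpha>) ^ 3 * (1 + ln (real N)) / real N ^ 3 + \<phi> N * (real N powr \<alpha>)\<^sup>2 / (real N)\<^sup>2
          + 1 / real N powr \<alpha> + \<bar>\<phi> N * real N powr \<alpha> / real N - l\<bar>)
    (\<lambda>N. real N powr (- (\<alpha> / 4)) + \<bar>real N powr (1 - \<alpha>) / \<phi> N - 1 / l\<bar> powr (1 / 2) * \<bar>ln \<bar>real N powr (1 - \<alpha>) / \<phi> N - 1 / l\<bar>\<bar>)"
proof (intro little_o_add)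
  define \<delta> where "\<delta> N = real N powr (1 - \<alpha>) / \<phi> N - 1 / l" for N
  let ?m = "\<lambda>N. real N powr (- (\<alpha> / 4)) + \<bar>real N powr (1 - \<alpha>) / \<phi> N - 1 / l\<bar> powr (1 / 2) * \<bar>ln \<bar>real N powr (1 - \<alpha>) / \<phi> N - 1 / l\<bar>\<bar>"
  have m: "\<forall>\<^sub>F N in sequentially. real N powr (- (\<alpha> / 4)) \<le> 1 * ?m N" by simp
  define b where "b = l + 1"
  have b: "b > 0" using l by (simp add: b_def)
  have ev: "\<forall>\<^sub>F N in sequentially. \<phi> N / real N powr (1 - \<alpha>) < b"
    using lim by (rule order_tendstoD) (simp add: b_def)
  show "little_o (\<lambda>N. \<phi> N ^ 2 * (real N powr \<alpha>) ^ 3 * (1 + ln (real N)) / real N ^ 3) ?m"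
  proof (rule little_o_mono[OF little_o_powr_ln[of "\<alpha> - 1"] _ _ m zero_less_one, where B = "b\<^sup>2"])
    show "\<alpha> - 1 < - (\<alpha> / 4)" using \<alpha> by simp
    show "0 < b\<^sup>2" using b by simp
    show "\<forall>\<^sub>F N in sequentially. \<phi> N ^ 2 * (real N powr \<alpha>) ^ 3 * (1 + ln (real N)) / real N ^ 3 \<le> b\<^sup>2 * (real N powr (\<alpha> - 1) * (1 + ln (real N)))"
      using ev eventually_ge_1_nat
    proof eventually_elim
      case (elim N)
      define q where "q = \<phi> N / real N powr (1 - \<alpha>)"
      have F: "\<phi> N = q * real N powr (1 - \<alpha>)" using elim by (simp add: q_def)
      have q: "0 < q" "q < b" using elim \<phi>_pos[of N] by (simp_all add: q_def)
      have "\<phi> N ^ 2 * (real N powr (3 * \<alpha> - 3) * (1 + ln (real N))) =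
          q\<^sup>2 * ((real N powr (1 - \<alpha>) * real N powr (1 - \<alpha>) * real N powr (3 * \<alpha> - 3)) * (1 + ln (real N)))"
        unfolding F by (simp add: power2_eq_square)
      also have "real N powr (1 - \<alpha>) * real N powr (1 - \<alpha>) * real N powr (3 * \<alpha> - 3) = real N powr (\<alpha> - 1)"
        by (simp flip: powr_add)
      also have "q\<^sup>2 * (real N powr (\<alpha> - 1) * (1 + ln (real N))) \<le> b\<^sup>2 * (real N powr (\<alpha> - 1) * (1 + ln (real N)))"
        using q elim by (intro mult_right_mono power_mono) auto
      finally show ?case unfolding error_terms_as_powers(4)[OF elim(2)] .
    qed
  qed
  show "little_o (\<lambda>N. \<phi> N * (real N powr \<alpha>)\<^sup>2 / (real N)\<^sup>2) ?m"
  proof (rule little_o_mono[OF little_o_powr[of "\<alpha> - 1"] b _ m zero_less_one])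
    show "\<alpha> - 1 < - (\<alpha> / 4)" using \<alpha> by simp
    show "\<forall>\<^sub>F N in sequentially. \<phi> N * (real N powr \<alpha>)\<^sup>2 / (real N)\<^sup>2 \<le> b * real N powr (\<alpha> - 1)"
      using ev eventually_ge_1_nat
    proof eventually_elim
      case (elim N)
      have "\<phi> N * real N powr (2 * \<alpha> - 2) = \<phi> N / real N powr (1 - \<alpha>) * (real N powr (1 - \<alpha>) * real N powr (2 * \<alpha> - 2))"
        using elim by simp
      also have "real N powr (1 - \<alpha>) * real N powr (2 * \<alpha> - 2) = real N powr (\<alpha> - 1)"
        by (simp flip: powr_add)
      also have "\<phi> N / real N powr (1 - \<alpha>) * real N powr (\<alpha> - 1) \<le> b * real N powr (\<alpha> - 1)"
        using elim by (intro mult_right_mono) auto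
      finally show ?case unfolding error_terms_as_powers(5)[OF elim(2)] .
    qed
  qed
  show "little_o (\<lambda>N. 1 / real N powr \<alpha>) ?m"
  proof (rule little_o_mono[OF little_o_powr[of "- \<alpha>"] zero_less_one _ m zero_less_one])
    show "- \<alpha> < - (\<alpha> / 4)" using \<alpha> by simp
  qed (simp add: powr_minus_divide)
  show "little_o (\<lambda>N. \<bar>\<phi> N * real N powr \<alpha> / real N - l\<bar>) ?m"
    unfolding little_o_def
  proof (intro allI impI)
    fix c :: real assume c: "c > 0"
    \<comment> \<open>For \<open>\<delta> \<le> exp (- 1)\<close> the logarithm is at least one in absolute value, and for \<open>\<delta> \<le> (c / (b l))\<^sup>2\<close> the missing
      square root makes up for the constants.\<close>
    define \<eta> where "\<eta> = min (exp (- 1)) ((c / (b * l))\<^sup>2)"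
    have \<eta>: "\<eta> > 0" using c b l by (simp add: \<eta>_def)
    have "(\<lambda>N. 1 / (\<phi> N / real N powr (1 - \<alpha>)) - 1 / l) \<longlonglongrightarrow> 1 / l - 1 / l"
      using l by (intro tendsto_intros lim) auto
    then have "(\<lambda>N. \<delta> N) \<longlonglongrightarrow> 0" by (simp add: \<delta>_def)
    then have "\<forall>\<^sub>F N in sequentially. \<bar>\<delta> N\<bar> < \<eta>"
      by (intro order_tendstoD(2)[OF tendsto_rabs_zero \<eta>])
    then show "\<forall>\<^sub>F N in sequentially. \<bar>\<phi> N * real N powr \<alpha> / real N - l\<bar> \<le> c * ?m N"
      using ev eventually_ge_1_nat
    proof eventually_elim
      case (elim N)
      define q where "q = \<phi> N / real N powr (1 - \<alpha>)"
      have q: "0 < q" "q < b" using elim \<phi>_pos[of N] by (simp_all add: q_def)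
      have d: "\<delta> N = 1 / q - 1 / l" by (simp add: \<delta>_def q_def)
      have "\<bar>q - l\<bar> = q * l * \<bar>\<delta> N\<bar>"
      proof -
        have "l - q = q * l * \<delta> N" unfolding d using q l by (simp add: field_simps)
        then have "\<bar>l - q\<bar> = \<bar>q * l * \<delta> N\<bar>" by simp
        then show ?thesis using q l by (simp add: abs_mult abs_minus_commute)
      qed
      also have "\<dots> \<le> b * l * \<bar>\<delta> N\<bar>" using q l by (intro mult_right_mono) auto
      also have "\<dots> \<le> c * (\<bar>\<delta> N\<bar> powr (1 / 2) * \<bar>ln \<bar>\<delta> N\<bar>\<bar>)"
      proof (cases "\<delta> N = 0")
        case False
        then have dp: "\<bar>\<delta> N\<bar> > 0" by simp
        have "ln \<bar>\<delta> N\<bar> \<le> ln (exp (- 1))"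
          using elim(1) dp by (subst ln_le_cancel_iff) (auto simp: \<eta>_def)
        then have ln1: "1 \<le> \<bar>ln \<bar>\<delta> N\<bar>\<bar>" by simp
        have "\<bar>\<delta> N\<bar> powr (1 / 2) \<le> ((c / (b * l))\<^sup>2) powr (1 / 2)"
          using elim(1) by (intro powr_mono2) (auto simp: \<eta>_def)
        also have "\<dots> = c / (b * l)" using c b l by (simp add: powr_half_sqrt)
        finally have "b * l * \<bar>\<delta> N\<bar> powr (1 / 2) \<le> c"
          using b l by (simp add: pos_le_divide_eq mult_ac)
        then have "(b * l * \<bar>\<delta> N\<bar> powr (1 / 2)) * \<bar>\<delta> N\<bar> powr (1 / 2) * 1 \<le> c * \<bar>\<delta> N\<bar> powr (1 / 2) * \<bar>ln \<bar>\<delta> N\<bar>\<bar>"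
          using ln1 c by (intro mult_mono) auto
        moreover have "\<bar>\<delta> N\<bar> powr (1 / 2) * \<bar>\<delta> N\<bar> powr (1 / 2) = \<bar>\<delta> N\<bar>"
          using dp by (simp flip: powr_add)
        ultimately show ?thesis by (simp add: mult.assoc)
      qed simp
      also have "\<dots> \<le> c * ?m N"
        unfolding \<delta>_def using c by (intro mult_left_mono) auto
      finally show ?case unfolding error_terms_as_powers(1)[OF elim(3)] q_def .
    qed
  qed
qed

end

section \<open>The five regimes\<close>

text \<open>
  The form in which a prescribed error with separate factors for \<open>\<parallel>f'\<parallel>\<close> and \<open>\<parallel>f\<parallel>\<close> dominates the smaller norm times a sum of rates.
\<close>
lemma min_weighted_sum_le:
  fixes x y u w M :: real
  assumes "0 \<le> u" "0 \<le> w" "w \<le> M" "0 \<le> x" "0 \<le> y"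
  shows "min x y * (u + w) \<le> u * y + M * x"
proof -
  have "min x y * u \<le> y * u" "min x y * w \<le> x * w" "x * w \<le> x * M"
    using assms by (auto intro!: mult_right_mono mult_left_mono)
  then show ?thesis unfolding distrib_left mult.commute[of u] mult.commute[of M] by linarith
qed

context
  fixes \<alpha> :: real and \<phi> :: "nat \<Rightarrow> real"
  assumes \<alpha>0: "0 < \<alpha>" and \<phi>_pos: "\<And>N. 1 \<le> N \<Longrightarrow> 0 < \<phi> N"
begin

text \<open>
  In the last two regimes \<open>\<lambda>\<^sub>\<phi> = \<infinity>\<close>, which selects the limit measure, is a consequence of the growth of \<open>\<phi>\<close>.
\<close>
lemma limit_infinite_of_lower_bound:
  assumes lam: "(\<lambda>N. ereal (\<phi> N / real N powr (1 - \<alpha>))) \<longlonglongrightarrow> lam"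
    and g: "filterlim g at_top sequentially"
    and le: "\<forall>\<^sub>F N in sequentially. g N \<le> \<phi> N / real N powr (1 - \<alpha>)"
  shows "lam = \<infinity>"
proof -
  have "filterlim (\<lambda>N. \<phi> N / real N powr (1 - \<alpha>)) at_top sequentially"
    by (rule filterlim_at_top_mono[OF g le])
  then have "(\<lambda>N. ereal (\<phi> N / real N powr (1 - \<alpha>))) \<longlonglongrightarrow> \<infinity>"
    by (simp add: tendsto_PInfty_eq_at_top)
  with lam show ?thesis by (rule LIMSEQ_unique)
qed

lemma limit_infinite_of_larger_exponent:
  assumes lam: "(\<lambda>N. ereal (\<phi> N / real N powr (1 - \<alpha>))) \<longlonglongrightarrow> lam"
    and lam': "(\<lambda>N. ereal (\<phi> N / real N powr (1 - \<alpha> / 2))) \<longlonglongrightarrow> \<infinity>"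
  shows "lam = \<infinity>"
proof (rule limit_infinite_of_lower_bound[OF lam])
  show "filterlim (\<lambda>N. \<phi> N / real N powr (1 - \<alpha> / 2)) at_top sequentially"
    using lam' by (simp add: tendsto_PInfty_eq_at_top)
  show "\<forall>\<^sub>F N in sequentially. \<phi> N / real N powr (1 - \<alpha> / 2) \<le> \<phi> N / real N powr (1 - \<alpha>)"
    using eventually_ge_1_nat
  proof eventually_elim
    case (elim N)
    then have "real N powr (1 - \<alpha>) \<le> real N powr (1 - \<alpha> / 2)"
      using \<alpha>0 by (intro powr_mono) auto
    then show ?case using \<phi>_pos[OF elim] elim by (intro divide_left_mono) auto
  qed
qed

lemma limit_infinite_of_linear_growth:
  assumes lam: "(\<lambda>N. ereal (\<phi> N / real N powr (1 - \<alpha>))) \<longlonglongrightarrow> lam"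
    and b: "b > 0" "\<forall>\<^sub>F N in sequentially. b * real N powr 1 \<le> \<phi> N"
  shows "lam = \<infinity>"
proof (rule limit_infinite_of_lower_bound[OF lam])
  show "filterlim (\<lambda>N. b * real N powr \<alpha>) at_top sequentially"
    using b(1) \<alpha>0 by real_asymp
  show "\<forall>\<^sub>F N in sequentially. b * real N powr \<alpha> \<le> \<phi> N / real N powr (1 - \<alpha>)"
    using b(2) eventually_ge_1_nat
  proof eventually_elim
    case (elim N)
    have "b * real N powr \<alpha> = b * real N powr 1 / real N powr (1 - \<alpha>)"
      using elim by (simp add: powr_diff)
    also have "\<dots> \<le> \<phi> N / real N powr (1 - \<alpha>)"
      using elim by (intro divide_right_mono) auto
    finally show ?case .
  qed
qed

lemma inverse_ratio_tendsto_0: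
  assumes "(\<lambda>N. ereal (\<phi> N / real N powr (1 - \<alpha>))) \<longlonglongrightarrow> \<infinity>"
  shows "(\<lambda>N. real N powr (1 - \<alpha>) / \<phi> N) \<longlonglongrightarrow> 0"
proof -
  have "filterlim (\<lambda>N. \<phi> N / real N powr (1 - \<alpha>)) at_top sequentially"
    using assms by (simp add: tendsto_PInfty_eq_at_top)
  from tendsto_inverse_0_at_top[OF this] show ?thesis by simp
qed

end

context
  fixes K :: "complex set" and \<alpha> :: real and \<phi> :: "nat \<Rightarrow> real"
  assumes K: "imaginary_quadratic_field K" and \<alpha>: "0 < \<alpha>" "\<alpha> < 1 / 2"
    and \<phi>_pos: "\<And>N. 1 \<le> N \<Longrightarrow> 0 < \<phi> N"
begin

lemma \<alpha>_less_1: "\<alpha> < 1"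
  using \<alpha> by simp

lemma convergence_infinity:
  assumes small: "little_o (\<lambda>N. \<phi> N ^ 2 * (real N powr \<alpha>) ^ 3 * (1 + ln (real N)) / real N ^ 3
        + \<phi> N * (real N powr \<alpha>)\<^sup>2 / (real N)\<^sup>2 + (real N / (\<phi> N * real N powr \<alpha>)) powr (3 / 4)) m"
    and low: "\<And>A x y. 1 \<le> A \<Longrightarrow> 0 < x \<Longrightarrow> 0 < y \<Longrightarrow> \<forall>\<^sub>F N in sequentially. min x y * m N \<le> err N A x y"
    and zero: "\<And>N A. err N A 0 0 \<ge> 0"
  shows "converges_with_error
    (R_meas K \<alpha> \<phi> (\<lambda>N. real N ^ 3 * S_sum K \<alpha> 0 N / \<phi> N)) (limit_measure K \<infinity>) err"
proof (rule converges_with_error_if_little_o[OF small _ _ low zero])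
  show "\<forall>\<^sub>F N in sequentially. 0 \<le> \<phi> N ^ 2 * (real N powr \<alpha>) ^ 3 * (1 + ln (real N)) / real N ^ 3
        + \<phi> N * (real N powr \<alpha>)\<^sup>2 / (real N)\<^sup>2 + (real N / (\<phi> N * real N powr \<alpha>)) powr (3 / 4)"
    using eventually_ge_1_nat by eventually_elim (auto simp: less_imp_le[OF \<phi>_pos] intro!: add_nonneg_nonneg)
qed (rule estimate_infinity[OF K \<alpha>(1) \<alpha>_less_1 \<phi>_pos])

lemma convergence_zero:
  assumes lim: "(\<lambda>N. ereal (\<phi> N / real N powr (1 - \<alpha>))) \<longlonglongrightarrow> 0" and \<gamma>: "\<gamma> < (1 - 2 * \<alpha>) / 2"
  shows "converges_with_error
     (R_meas K \<alpha> \<phi> (\<lambda>N. real N ^ 2 * S_sum K \<alpha> 1 N)) (limit_measure K 0)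
     (\<lambda>N A nf nf'. (\<phi> N / real N powr (1 - \<alpha>)) powr (1 / 2) * nf' +
             max (\<phi> N / real N powr (1 - \<alpha>)) (1 / real N powr (2 * \<gamma>)) * nf)"
proof (rule converges_with_error_if_little_o[OF rate_limit_zero[OF \<phi>_pos]])
  show "2 * \<gamma> < 1 - \<alpha>" using \<gamma> \<alpha> by simp
  show "(\<lambda>N. \<phi> N / real N powr (1 - \<alpha>)) \<longlonglongrightarrow> 0" using lim by (simp add: zero_ereal_def)
  show "\<forall>\<^sub>F N in sequentially. 0 \<le> \<phi> N * (real N powr \<alpha>)\<^sup>2 * (1 + ln (real N)) / (real N)\<^sup>2
      + real N powr \<alpha> / real N + \<phi> N * real N powr \<alpha> / real N"
    using eventually_ge_1_nat by eventually_elim (auto simp: less_imp_le[OF \<phi>_pos] intro!: add_nonneg_nonneg)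
  show "\<forall>\<^sub>F N in sequentially. min x y * ((\<phi> N / real N powr (1 - \<alpha>)) powr (1 / 2) + real N powr (- (2 * \<gamma>)))
      \<le> (\<phi> N / real N powr (1 - \<alpha>)) powr (1 / 2) * y + max (\<phi> N / real N powr (1 - \<alpha>)) (1 / real N powr (2 * \<gamma>)) * x"
    if "0 < x" "0 < y" for x y
    using that by (intro always_eventually allI min_weighted_sum_le) (auto simp: powr_minus_divide)
  show "0 \<le> (\<phi> N / real N powr (1 - \<alpha>)) powr (1 / 2) * 0 + max (\<phi> N / real N powr (1 - \<alpha>)) (1 / real N powr (2 * \<gamma>)) * 0" for N
    by simp
qed (assumption | rule estimate_zero[OF K \<alpha>(1) \<alpha>_less_1 \<phi>_pos])+

lemma convergence_finite:
  assumes lim: "(\<lambda>N. ereal (\<phi> N / real N powr (1 - \<alpha>))) \<longlonglongrightarrow> ereal l" and l: "l > 0"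
  shows "converges_with_error
     (R_meas K \<alpha> \<phi> (\<lambda>N. real N powr (3 + \<alpha>) / \<phi> N)) (limit_measure K (ereal l))
     (\<lambda>N A nf nf'. real N powr (- \<alpha>) * nf' +
             max (A / real N powr (\<alpha> / 4)) (1 / real N powr (2 * \<gamma>)) * nf +
             A * \<bar>real N powr (1 - \<alpha>) / \<phi> N - 1 / l\<bar> powr (1 / 2) *
               \<bar>ln \<bar>real N powr (1 - \<alpha>) / \<phi> N - 1 / l\<bar>\<bar> * nf)"
proof -
  have lim': "(\<lambda>N. \<phi> N / real N powr (1 - \<alpha>)) \<longlonglongrightarrow> l" using lim by simp
  have lim'': "(\<lambda>N. \<phi> N * real N powr \<alpha> / real N) \<longlonglongrightarrow> l"
  proof (rule Lim_transform_eventually[OF lim'])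
    show "\<forall>\<^sub>F N in sequentially. \<phi> N / real N powr (1 - \<alpha>) = \<phi> N * real N powr \<alpha> / real N"
      using eventually_ge_1_nat by eventually_elim (rule error_terms_as_powers(1)[OF \<phi>_pos, symmetric])
  qed
  show ?thesis
  proof (rule converges_with_error_if_little_o[OF rate_limit_finite[OF \<phi>_pos \<alpha> l lim']])
    show "\<forall>\<^sub>F N in sequentially. 0 \<le> \<phi> N ^ 2 * (real N powr \<alpha>) ^ 3 * (1 + ln (real N)) / real N ^ 3
        + \<phi> N * (real N powr \<alpha>)\<^sup>2 / (real N)\<^sup>2 + 1 / real N powr \<alpha> + \<bar>\<phi> N * real N powr \<alpha> / real N - l\<bar>"
      using eventually_ge_1_nat by eventually_elim (auto simp: less_imp_le[OF \<phi>_pos] intro!: add_nonneg_nonneg)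
    fix A x y :: real assume A: "1 \<le> A" and xy: "0 < x" "0 < y"
    show "\<forall>\<^sub>F N in sequentially. min x y * (real N powr (- (\<alpha> / 4)) + \<bar>real N powr (1 - \<alpha>) / \<phi> N - 1 / l\<bar> powr (1 / 2) * \<bar>ln \<bar>real N powr (1 - \<alpha>) / \<phi> N - 1 / l\<bar>\<bar>)
      \<le> real N powr (- \<alpha>) * y + max (A / real N powr (\<alpha> / 4)) (1 / real N powr (2 * \<gamma>)) * x +
             A * \<bar>real N powr (1 - \<alpha>) / \<phi> N - 1 / l\<bar> powr (1 / 2) *
               \<bar>ln \<bar>real N powr (1 - \<alpha>) / \<phi> N - 1 / l\<bar>\<bar> * x"
    proof (intro always_eventually allI)
      fix N
      define d u M where "d = \<bar>real N powr (1 - \<alpha>) / \<phi> N - 1 / l\<bar> powr (1 / 2) * \<bar>ln \<bar>real N powr (1 - \<alpha>) / \<phi> N - 1 / l\<bar>\<bar>"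
        and "u = real N powr (- (\<alpha> / 4))" and "M = max (A / real N powr (\<alpha> / 4)) (1 / real N powr (2 * \<gamma>))"
      have d: "0 \<le> d" by (simp add: d_def)
      have u: "0 \<le> u" "u \<le> M"
      proof -
        have "u * 1 \<le> u * A" using A by (intro mult_left_mono) (simp_all add: u_def)
        also have "u * A = A / real N powr (\<alpha> / 4)" by (simp add: u_def powr_minus_divide)
        also have "\<dots> \<le> M" by (simp add: M_def)
        finally show "u \<le> M" by simp
      qed (simp add: u_def)
      have "min x y * (u + d) \<le> x * (M + A * d)"
        using u d A xy mult_right_mono[of 1 A d] by (intro mult_mono add_mono) auto
      also have "\<dots> \<le> real N powr (- \<alpha>) * y + x * (M + A * d)" using xy by simp
      also have "\<dots> = real N powr (- \<alpha>) * y + M * x + A * d * x" by (simp add: algebra_simps)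
      finally show "min x y * (real N powr (- (\<alpha> / 4)) + \<bar>real N powr (1 - \<alpha>) / \<phi> N - 1 / l\<bar> powr (1 / 2) * \<bar>ln \<bar>real N powr (1 - \<alpha>) / \<phi> N - 1 / l\<bar>\<bar>)
      \<le> real N powr (- \<alpha>) * y + max (A / real N powr (\<alpha> / 4)) (1 / real N powr (2 * \<gamma>)) * x +
             A * \<bar>real N powr (1 - \<alpha>) / \<phi> N - 1 / l\<bar> powr (1 / 2) *
               \<bar>ln \<bar>real N powr (1 - \<alpha>) / \<phi> N - 1 / l\<bar>\<bar> * x"
        unfolding d_def u_def M_def by (simp only: mult.assoc)
    qed
  next
    show "0 \<le> real N powr (- \<alpha>) * 0 + max (A / real N powr (\<alpha> / 4)) (1 / real N powr (2 * \<gamma>)) * 0 +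
       A * \<bar>real N powr (1 - \<alpha>) / \<phi> N - 1 / l\<bar> powr (1 / 2) * \<bar>ln \<bar>real N powr (1 - \<alpha>) / \<phi> N - 1 / l\<bar>\<bar> * 0" for N A
      by simp
  qed (assumption | rule estimate_finite[OF K \<alpha>(1) \<alpha>_less_1 \<phi>_pos _ _ _ _ _ l lim''])+
qed

lemma convergence_infinity_below:
  assumes lim: "(\<lambda>N. ereal (\<phi> N / real N powr (1 - \<alpha>))) \<longlonglongrightarrow> \<infinity>"
    and lim': "(\<lambda>N. ereal (\<phi> N / real N powr (1 - \<alpha> / 2))) \<longlonglongrightarrow> lam'" "lam' < \<infinity>" and a: "\<alpha> < 2 / 5"
  shows "converges_with_error
    (R_meas K \<alpha> \<phi> (\<lambda>N. real N ^ 3 * S_sum K \<alpha> 0 N / \<phi> N)) (limit_measure K \<infinity>)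
    (\<lambda>N A nf nf'. real N powr ((5 * \<alpha> - 2) / 4) * nf' +
             max (A ^ 3 * (real N powr (1 - \<alpha>) / \<phi> N) powr (2 / 3)) (real N powr ((5 * \<alpha> - 2) / 4)) * nf)"
proof -
  obtain B where B: "B > 0" "\<forall>\<^sub>F N in sequentially. \<phi> N \<le> B * real N powr (1 - \<alpha> / 2)"
    using upper_bound_of_limit[OF \<phi>_pos lim'] by blast
  have lim0: "(\<lambda>N. real N powr (1 - \<alpha>) / \<phi> N) \<longlonglongrightarrow> 0"
    by (rule inverse_ratio_tendsto_0[OF \<alpha>(1) \<phi>_pos lim])
  show ?thesis
  proof (rule convergence_infinity[OF rate_infinity_below[OF \<phi>_pos a \<alpha>(1) B lim0]])
    fix A x y :: real assume A: "1 \<le> A" and xy: "0 < x" "0 < y"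
    show "\<forall>\<^sub>F N in sequentially. min x y * (real N powr ((5 * \<alpha> - 2) / 4) + (real N powr (1 - \<alpha>) / \<phi> N) powr (2 / 3))
       \<le> real N powr ((5 * \<alpha> - 2) / 4) * y +
             max (A ^ 3 * (real N powr (1 - \<alpha>) / \<phi> N) powr (2 / 3)) (real N powr ((5 * \<alpha> - 2) / 4)) * x"
    proof (intro always_eventually allI min_weighted_sum_le)
      fix N
      have "1 * (real N powr (1 - \<alpha>) / \<phi> N) powr (2 / 3) \<le> A ^ 3 * (real N powr (1 - \<alpha>) / \<phi> N) powr (2 / 3)"
        using A by (intro mult_right_mono one_le_power) auto
      then show "(real N powr (1 - \<alpha>) / \<phi> N) powr (2 / 3)
          \<le> max (A ^ 3 * (real N powr (1 - \<alpha>) / \<phi> N) powr (2 / 3)) (real N powr ((5 * \<alpha> - 2) / 4))"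
        by simp
    qed (use xy in auto)
  next
    show "0 \<le> real N powr ((5 * \<alpha> - 2) / 4) * 0 +
       max (A ^ 3 * (real N powr (1 - \<alpha>) / \<phi> N) powr (2 / 3)) (real N powr ((5 * \<alpha> - 2) / 4)) * 0" for N A
      by simp
  qed
qed

lemma convergence_infinity_middle:
  assumes lim: "(\<lambda>N. ereal (\<phi> N / real N)) \<longlonglongrightarrow> lam''" "lam'' < \<infinity>" and a: "\<alpha> \<le> 2 / 11"
  shows "converges_with_error
    (R_meas K \<alpha> \<phi> (\<lambda>N. real N ^ 3 * S_sum K \<alpha> 0 N / \<phi> N)) (limit_measure K \<infinity>)
    (\<lambda>N A nf nf'. \<phi> N / real N powr (1 + \<alpha> / 2) * nf' + real N powr (1 - \<alpha> / 2) / \<phi> N * nf)"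
proof -
  have "(\<lambda>N. ereal (\<phi> N / real N powr 1)) \<longlonglongrightarrow> lam''" using lim(1) by simp
  then obtain B where B: "B > 0" "\<forall>\<^sub>F N in sequentially. \<phi> N \<le> B * real N powr 1"
    using upper_bound_of_limit[where \<phi> = \<phi>, OF \<phi>_pos _ lim(2)] by blast
  show ?thesis
  proof (rule convergence_infinity[OF rate_infinity_middle[OF \<phi>_pos \<alpha>(1) a B(2,1)]])
    fix A x y :: real assume xy: "0 < x" "0 < y"
    show "\<forall>\<^sub>F N in sequentially. min x y * (\<phi> N / real N powr (1 + \<alpha> / 2) + real N powr (1 - \<alpha> / 2) / \<phi> N)
       \<le> \<phi> N / real N powr (1 + \<alpha> / 2) * y + real N powr (1 - \<alpha> / 2) / \<phi> N * x"
      using eventually_ge_1_nat by eventually_elim (rule min_weighted_sum_le; use xy in \<open>simp add: less_imp_le[OF \<phi>_pos]\<close>)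
  next
    show "0 \<le> \<phi> N / real N powr (1 + \<alpha> / 2) * 0 + real N powr (1 - \<alpha> / 2) / \<phi> N * 0" for N
      by simp
  qed
qed

lemma convergence_infinity_above:
  assumes lim: "(\<lambda>N. ereal (\<phi> N / real N powr (1 + \<alpha> / 2))) \<longlonglongrightarrow> lam'''" "lam''' < \<infinity>" and a: "\<alpha> \<le> 2 / 11"
    and low: "\<forall>\<^sub>F N in sequentially. b * real N powr 1 \<le> \<phi> N" and b: "b > 0"
  shows "converges_with_error
    (R_meas K \<alpha> \<phi> (\<lambda>N. real N ^ 3 * S_sum K \<alpha> 0 N / \<phi> N)) (limit_measure K \<infinity>)
    (\<lambda>N A nf nf'. \<phi> N / real N powr (1 + \<alpha> / 2) * (nf' + A ^ 3 * nf))"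
proof -
  obtain B where B: "B > 0" "\<forall>\<^sub>F N in sequentially. \<phi> N \<le> B * real N powr (1 + \<alpha> / 2)"
    using upper_bound_of_limit[OF \<phi>_pos lim] by blast
  show ?thesis
  proof (rule convergence_infinity[OF rate_infinity_above[OF \<phi>_pos \<alpha>(1) a B(2,1) low b]])
    fix A x y :: real assume A: "1 \<le> A" and xy: "0 < x" "0 < y"
    have "0 \<le> A ^ 3 * x" using A xy by simp
    then have le: "min x y \<le> y + A ^ 3 * x" by linarith
    show "\<forall>\<^sub>F N in sequentially. min x y * (\<phi> N / real N powr (1 + \<alpha> / 2))
       \<le> \<phi> N / real N powr (1 + \<alpha> / 2) * (y + A ^ 3 * x)"
      using eventually_ge_1_nat
    proof eventually_elim
      case (elim N)
      have "0 \<le> \<phi> N / real N powr (1 + \<alpha> / 2)" using \<phi>_pos[OF elim] by simp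
      from mult_left_mono[OF le this] show ?case by (simp only: mult.commute)
    qed
  next
    show "0 \<le> \<phi> N / real N powr (1 + \<alpha> / 2) * (0 + A ^ 3 * 0)" for N A
      by simp
  qed
qed

end

theorem theorem4p1:
  fixes K :: "complex set" and \<alpha> \<gamma> :: real and \<phi> :: "nat \<Rightarrow> real"
    and lam lam' lam'' lam''' :: ereal
  assumes K: "imaginary_quadratic_field K"
    and \<alpha>: "0 < \<alpha>" "\<alpha> < 1 / 2"
    and \<phi>_pos: "\<And>N. 1 \<le> N \<Longrightarrow> 0 < \<phi> N"
    and \<phi>_top: "filterlim \<phi> at_top sequentially"
    and lam: "(\<lambda>N. ereal (\<phi> N / real N powr (1 - \<alpha>))) \<longlonglongrightarrow> lam"
    and lam': "(\<lambda>N. ereal (\<phi> N / real N powr (1 - \<alpha> / 2))) \<longlonglongrightarrow> lam'"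
    and lam'': "(\<lambda>N. ereal (\<phi> N / real N)) \<longlonglongrightarrow> lam''"
    and lam''': "(\<lambda>N. ereal (\<phi> N / real N powr (1 + \<alpha> / 2))) \<longlonglongrightarrow> lam'''"
    and \<gamma>: "0 < \<gamma>" "\<gamma> < (1 - 2 * \<alpha>) / 2"
    and \<gamma>_lim: "(\<lambda>N. \<phi> N / real N powr (2 - 2 * \<alpha> - 2 * \<gamma>)) \<longlonglongrightarrow> 0"
  shows
    "(lam = 0 \<longrightarrow>
        converges_with_error
          (R_meas K \<alpha> \<phi> (\<lambda>N. real N ^ 2 * S_sum K \<alpha> 1 N)) (limit_measure K lam)
          (\<lambda>N A nf nf'.
             (\<phi> N / real N powr (1 - \<alpha>)) powr (1 / 2) * nf' +
             max (\<phi> N / real N powr (1 - \<alpha>)) (1 / real N powr (2 * \<gamma>)) * nf)) \<and>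
     (0 < lam \<and> lam < \<infinity> \<and> disc K mod 4 = 0 \<longrightarrow>
        converges_with_error
          (R_meas K \<alpha> \<phi> (\<lambda>N. real N powr (3 + \<alpha>) / \<phi> N)) (limit_measure K lam)
          (\<lambda>N A nf nf'.
             real N powr (- \<alpha>) * nf' +
             max (A / real N powr (\<alpha> / 4)) (1 / real N powr (2 * \<gamma>)) * nf +
             A * \<bar>real N powr (1 - \<alpha>) / \<phi> N - 1 / real_of_ereal lam\<bar> powr (1 / 2) *
               \<bar>ln \<bar>real N powr (1 - \<alpha>) / \<phi> N - 1 / real_of_ereal lam\<bar>\<bar> * nf)) \<and>
     (lam = \<infinity> \<and> lam' < \<infinity> \<and> \<alpha> < 2 / 5 \<longrightarrow>
        converges_with_error
          (R_meas K \<alpha> \<phi> (\<lambda>N. real N ^ 3 * S_sum K \<alpha> 0 N / \<phi> N)) (limit_measure K lam)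
          (\<lambda>N A nf nf'.
             real N powr ((5 * \<alpha> - 2) / 4) * nf' +
             max (A ^ 3 * (real N powr (1 - \<alpha>) / \<phi> N) powr (2 / 3))
                 (real N powr ((5 * \<alpha> - 2) / 4)) * nf)) \<and>
     (lam' = \<infinity> \<and> lam'' = 0 \<and> \<alpha> \<le> 2 / 11 \<longrightarrow>
        converges_with_error
          (R_meas K \<alpha> \<phi> (\<lambda>N. real N ^ 3 * S_sum K \<alpha> 0 N / \<phi> N)) (limit_measure K lam)
          (\<lambda>N A nf nf'.
             \<phi> N / real N powr (1 + \<alpha> / 2) * nf' + real N powr (1 - \<alpha> / 2) / \<phi> N * nf)) \<and>
     (0 < lam'' \<and> lam''' = 0 \<and> \<alpha> \<le> 2 / 11 \<longrightarrow>
        converges_with_error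
          (R_meas K \<alpha> \<phi> (\<lambda>N. real N ^ 3 * S_sum K \<alpha> 0 N / \<phi> N)) (limit_measure K lam)
          (\<lambda>N A nf nf'.
             \<phi> N / real N powr (1 + \<alpha> / 2) * (nf' + A ^ 3 * nf)))"
proof (intro conjI impI)
  assume "lam = 0"
  then show "converges_with_error
          (R_meas K \<alpha> \<phi> (\<lambda>N. real N ^ 2 * S_sum K \<alpha> 1 N)) (limit_measure K lam)
          (\<lambda>N A nf nf'.
             (\<phi> N / real N powr (1 - \<alpha>)) powr (1 / 2) * nf' +
             max (\<phi> N / real N powr (1 - \<alpha>)) (1 / real N powr (2 * \<gamma>)) * nf)"
    using convergence_zero[OF K \<alpha> \<phi>_pos _ \<gamma>(2)] lam by simp
next
  assume asm: "0 < lam \<and> lam < \<infinity> \<and> disc K mod 4 = 0"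
  then obtain l where l: "lam = ereal l" "l > 0" by (cases lam) auto
  show "converges_with_error
          (R_meas K \<alpha> \<phi> (\<lambda>N. real N powr (3 + \<alpha>) / \<phi> N)) (limit_measure K lam)
          (\<lambda>N A nf nf'.
             real N powr (- \<alpha>) * nf' +
             max (A / real N powr (\<alpha> / 4)) (1 / real N powr (2 * \<gamma>)) * nf +
             A * \<bar>real N powr (1 - \<alpha>) / \<phi> N - 1 / real_of_ereal lam\<bar> powr (1 / 2) *
               \<bar>ln \<bar>real N powr (1 - \<alpha>) / \<phi> N - 1 / real_of_ereal lam\<bar>\<bar> * nf)"
    using convergence_finite[OF K \<alpha> \<phi>_pos lam[unfolded l(1)] l(2)] unfolding l(1) real_of_ereal.simps .
next
  assume asm: "lam = \<infinity> \<and> lam' < \<infinity> \<and> \<alpha> < 2 / 5"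
  then have l: "lam = \<infinity>" "lam' < \<infinity>" "\<alpha> < 2 / 5" by auto
  show "converges_with_error
          (R_meas K \<alpha> \<phi> (\<lambda>N. real N ^ 3 * S_sum K \<alpha> 0 N / \<phi> N)) (limit_measure K lam)
          (\<lambda>N A nf nf'.
             real N powr ((5 * \<alpha> - 2) / 4) * nf' +
             max (A ^ 3 * (real N powr (1 - \<alpha>) / \<phi> N) powr (2 / 3))
                 (real N powr ((5 * \<alpha> - 2) / 4)) * nf)"
    using convergence_infinity_below[OF K \<alpha> \<phi>_pos lam[unfolded l(1)] lam' l(2,3)] unfolding l(1) .
next
  assume asm: "lam' = \<infinity> \<and> lam'' = 0 \<and> \<alpha> \<le> 2 / 11"
  then have l: "lam' = \<infinity>" "lam'' < \<infinity>" "\<alpha> \<le> 2 / 11" by auto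
  have inf: "lam = \<infinity>"
    by (rule limit_infinite_of_larger_exponent[OF \<alpha>(1) \<phi>_pos lam lam'[unfolded l(1)]])
  show "converges_with_error
          (R_meas K \<alpha> \<phi> (\<lambda>N. real N ^ 3 * S_sum K \<alpha> 0 N / \<phi> N)) (limit_measure K lam)
          (\<lambda>N A nf nf'.
             \<phi> N / real N powr (1 + \<alpha> / 2) * nf' + real N powr (1 - \<alpha> / 2) / \<phi> N * nf)"
    using convergence_infinity_middle[OF K \<alpha> \<phi>_pos lam'' l(2,3)] unfolding inf .
next
  assume asm: "0 < lam'' \<and> lam''' = 0 \<and> \<alpha> \<le> 2 / 11"
  then have l: "0 < lam''" "lam''' < \<infinity>" "\<alpha> \<le> 2 / 11" by auto
  have "(\<lambda>N. ereal (\<phi> N / real N powr 1)) \<longlonglongrightarrow> lam''" using lam'' by simp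
  from lower_bound_of_limit[OF \<phi>_pos this l(1)] obtain b
    where b: "b > 0" "\<forall>\<^sub>F N in sequentially. b * real N powr 1 \<le> \<phi> N" .
  have inf: "lam = \<infinity>"
    by (rule limit_infinite_of_linear_growth[OF \<alpha>(1) \<phi>_pos lam b])
  show "converges_with_error
          (R_meas K \<alpha> \<phi> (\<lambda>N. real N ^ 3 * S_sum K \<alpha> 0 N / \<phi> N)) (limit_measure K lam)
          (\<lambda>N A nf nf'.
             \<phi> N / real N powr (1 + \<alpha> / 2) * (nf' + A ^ 3 * nf))"
    using convergence_infinity_above[OF K \<alpha> \<phi>_pos lam''' l(2,3) b(2,1)] unfolding inf .
qed

end
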